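(* Let $N\ge 1$ be an integer and let $(a_n)$ and $(b_n)$ be $N$-periodically modulated Jacobi parameters, with associated $N$-periodic sequences $(\alpha_n)$ and $(\beta_n)$. Suppose that for every $i\in\{0,1,\ldots,N-1\}$, $$\Big(\frac{a_{kN+i-1}}{a_{kN+i}} : k\in\mathbb{N}\Big),\ \Big(\frac{b_{kN+i}}{a_{kN+i}} : k\in\mathbb{N}\Big),\ \Big(\frac{1}{a_{kN+i}} : k\in\mathbb{N}\Big) \in \mathcal{D}_1,$$ that the Carleman condition $\sum_{n=0}^\infty \frac{1}{a_n}=\infty$ is satisfied, and that $|\operatorname{tr}\mathfrak{X}_0(0)|<2$. Let $\omega$ be the equilibrium measure of $\{x\in\mathbb{R} : |\operatorname{tr}\mathfrak{X}_0(x)|\le 2\}$ and $\rho_n=\sum_{j=0}^n\frac{\alpha_j}{a_j}$. Then $$\lim_{n\to\infty}\frac{1}{\rho_n}K_n\Big(x+\frac{u}{\rho_n},x+\frac{v}{\rho_n}\Big)=\frac{\omega'(0)}{\mu'(x)}\operatorname{sinc}\big((u-v)\pi\omega'(0)\big)$$ locally uniformly with respect to $x,u,v\in\mathbb{R}$.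
   Context: $(a_n)_{n\ge 0}$ is a sequence of positive numbers and $(b_n)_{n\ge0}$ a sequence of real numbers (Jacobi parameters). The polynomials $(p_n)_{n\ge 0}$ are defined by $p_0(x)=1$, $p_1(x)=(x-b_0)/a_0$, and $x p_n(x) = a_n p_{n+1}(x)+b_n p_n(x)+a_{n-1}p_{n-1}(x)$ for $n\ge1$. The Christoffel–Darboux kernel is $K_n(x,y)=\sum_{j=0}^np_j(x)p_j(y)$. Under the Carleman condition there is a unique probability measure $\mu$ on $\mathbb{R}$ for which $(p_n)$ is orthonormal in $L^2(\mathbb{R},\mu)$. It is a known fact that, under the hypotheses of the claim, $\mu$ is purely absolutely continuous on $\mathbb{R}$ with continuous positive density; $\mu'$ denotes this density. The sequences $(a_n),(b_n)$ are $N$-periodically modulated if there are $N$-periodic sequences $(\alpha_n:n\in\mathbb{Z})$ of positive numbers and $(\beta_n:n\in\mathbb{Z})$ of real numbers such that $\lim_{n\to\infty} a_n=\infty$, $\lim_{n\to\infty}\big|\frac{a_{n-1}}{a_n}-\frac{\alpha_{n-1}}{\alpha_n}\big|=0$ and $\lim_{n\to\infty}\big|\frac{b_n}{a_n}-\frac{\beta_n}{\alpha_n}\big|=0$. Set $\mathfrak{B}_j(x)=\begin{pmatrix}0&1\\ -\frac{\alpha_{j-1}}{\alpha_j}&\frac{x-\beta_j}{\alpha_j}\end{pmatrix}$ and $\mathfrak{X}_n(x)=\mathfrak{B}_{n+N-1}(x)\cdots\mathfrak{B}_n(x)$. A real sequence $(x_n)$ belongs to $\mathcal{D}_1$ if it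 is bounded and $\sum_n|x_{n+1}-x_n|<\infty$. Equilibrium measure: for a compact set $F\subset\mathbb{R}$ with non-empty interior, its equilibrium measure is the unique probability measure minimizing $I(\nu)=-\iint\log|x-y|\,\nu(dx)\,\nu(dy)$ among probability measures $\nu$ supported on $F$. It is absolutely continuous with continuous density in the interior of $F$; $\omega'$ denotes the density of $\omega$. $\operatorname{sinc}(x)=\sin(x)/x$ for $x\ne0$ and $\operatorname{sinc}(0)=1$. *)

theory Defs
  imports "HOL-Probability.Probability"
begin

text \<open>The three-term recurrence
  \<open>x p\<^sub>n = a\<^sub>n p\<^sub>n\<^sub>+\<^sub>1 + b\<^sub>n p\<^sub>n + a\<^sub>n\<^sub>-\<^sub>1 p\<^sub>n\<^sub>-\<^sub>1\<close>, \<open>n \<ge> 1\<close>, solved for \<open>p\<^sub>n\<^sub>+\<^sub>1\<close>.\<close>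

fun orth_poly :: "(nat \<Rightarrow> real) \<Rightarrow> (nat \<Rightarrow> real) \<Rightarrow> nat \<Rightarrow> real \<Rightarrow> real" where
  "orth_poly a b 0 x = 1"
| "orth_poly a b (Suc 0) x = (x - b 0) / a 0"
| "orth_poly a b (Suc (Suc n)) x =
     ((x - b (Suc n)) * orth_poly a b (Suc n) x - a n * orth_poly a b n x) / a (Suc n)"

definition CD_kernel :: "(nat \<Rightarrow> real) \<Rightarrow> (nat \<Rightarrow> real) \<Rightarrow> nat \<Rightarrow> real \<Rightarrow> real \<Rightarrow> real" where
  "CD_kernel a b n x y = (\<Sum>j\<le>n. orth_poly a b j x * orth_poly a b j y)"

definition borel_prob_measure :: "real measure \<Rightarrow> bool" where
  "borel_prob_measure M \<longleftrightarrow> prob_space M \<and> sets M = sets borel"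

definition orthonormalizing_measure ::
    "(nat \<Rightarrow> real) \<Rightarrow> (nat \<Rightarrow> real) \<Rightarrow> real measure \<Rightarrow> bool" where
  "orthonormalizing_measure a b \<mu> \<longleftrightarrow>
     borel_prob_measure \<mu> \<and>
     (\<forall>m n. integrable \<mu> (\<lambda>x. orth_poly a b m x * orth_poly a b n x) \<and>
            (\<integral>x. orth_poly a b m x * orth_poly a b n x \<partial>\<mu>) = (if m = n then 1 else 0))"

definition periodic_seq :: "nat \<Rightarrow> (int \<Rightarrow> real) \<Rightarrow> bool" where
  "periodic_seq N f \<longleftrightarrow> (\<forall>n. f (n + int N) = f n)"

text \<open>Only limits as \<open>n \<rightarrow> \<infinity>\<close> are involved, so the truncated \<open>n - 1\<close> at \<open>n = 0\<close> is
  immaterial. The same holds for membership of \<open>a (k * N + i - 1) / a (k * N + i)\<close>, as a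
  sequence in \<open>k\<close>, in \<open>class_D1\<close> below: it does not depend on finitely many terms.\<close>

definition periodically_modulated ::
    "nat \<Rightarrow> (int \<Rightarrow> real) \<Rightarrow> (int \<Rightarrow> real) \<Rightarrow> (nat \<Rightarrow> real) \<Rightarrow> (nat \<Rightarrow> real) \<Rightarrow> bool" where
  "periodically_modulated N \<alpha> \<beta> a b \<longleftrightarrow>
     periodic_seq N \<alpha> \<and> (\<forall>n. \<alpha> n > 0) \<and> periodic_seq N \<beta> \<and>
     filterlim a at_top sequentially \<and>
     (\<lambda>n. \<bar>a (n - 1) / a n - \<alpha> (int n - 1) / \<alpha> (int n)\<bar>) \<longlonglongrightarrow> 0 \<and>
     (\<lambda>n. \<bar>b n / a n - \<beta> (int n) / \<alpha> (int n)\<bar>) \<longlonglongrightarrow> 0"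

definition transfer_matrix ::
    "(int \<Rightarrow> real) \<Rightarrow> (int \<Rightarrow> real) \<Rightarrow> int \<Rightarrow> real \<Rightarrow> real^2^2" where
  "transfer_matrix \<alpha> \<beta> j x =
     vector [vector [0, 1], vector [- (\<alpha> (j - 1) / \<alpha> j), (x - \<beta> j) / \<alpha> j]]"

text \<open>\<open>transfer_product \<alpha> \<beta> k n x\<close> is the ordered product of the transfer matrices with
  indices \<open>n + k - 1, \<dots>, n\<close>, the highest index being leftmost.\<close>

fun transfer_product ::
    "(int \<Rightarrow> real) \<Rightarrow> (int \<Rightarrow> real) \<Rightarrow> nat \<Rightarrow> int \<Rightarrow> real \<Rightarrow> real^2^2" where
  "transfer_product \<alpha> \<beta> 0 n x = mat 1"
| "transfer_product \<alpha> \<beta> (Suc k) n x =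
     transfer_matrix \<alpha> \<beta> (n + int k) x ** transfer_product \<alpha> \<beta> k n x"

definition monodromy ::
    "nat \<Rightarrow> (int \<Rightarrow> real) \<Rightarrow> (int \<Rightarrow> real) \<Rightarrow> int \<Rightarrow> real \<Rightarrow> real^2^2" where
  "monodromy N \<alpha> \<beta> n x = transfer_product \<alpha> \<beta> N n x"

definition class_D1 :: "(nat \<Rightarrow> real) set" where
  "class_D1 = {s. bounded (range s) \<and> summable (\<lambda>n. \<bar>s (Suc n) - s n\<bar>)}"

text \<open>The kernel \<open>- log \<bar>x - y\<bar>\<close> must be \<open>\<infinity>\<close> on the diagonal (whereas \<open>ln 0 = 0\<close> in HOL),
  so that measures with atoms have infinite energy.\<close>

definition log_kernel :: "real \<Rightarrow> real \<Rightarrow> ereal" where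
  "log_kernel x y = (if x = y then \<infinity> else ereal (- ln \<bar>x - y\<bar>))"

text \<open>The integral of the kernel as a difference of the integrals of its positive and negative
  parts (\<open>e2ennreal\<close> cuts off at 0), because the Bochner integral of a non-integrable function
  is 0. The negative part has finite integral for measures of bounded support, so the
  difference is then a well-defined element of \<open>(-\<infinity>, \<infinity>]\<close>.\<close>

definition log_energy :: "real measure \<Rightarrow> ereal" where
  "log_energy \<nu> =
     enn2ereal (\<integral>\<^sup>+x. (\<integral>\<^sup>+y. e2ennreal (log_kernel x y) \<partial>\<nu>) \<partial>\<nu>) -
     enn2ereal (\<integral>\<^sup>+x. (\<integral>\<^sup>+y. e2ennreal (- log_kernel x y) \<partial>\<nu>) \<partial>\<nu>)"

definition prob_measures_on :: "real set \<Rightarrow> real measure set" where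
  "prob_measures_on F = {\<nu>. borel_prob_measure \<nu> \<and> measure \<nu> F = 1}"

text \<open>Meant for compact \<open>F\<close> with non-empty interior, where the minimizer is unique.\<close>

definition equilibrium_measure :: "real set \<Rightarrow> real measure \<Rightarrow> bool" where
  "equilibrium_measure F \<omega> \<longleftrightarrow>
     \<omega> \<in> prob_measures_on F \<and> (\<forall>\<nu>\<in>prob_measures_on F. log_energy \<omega> \<le> log_energy \<nu>)"

definition is_cont_density_on :: "real set \<Rightarrow> real measure \<Rightarrow> (real \<Rightarrow> real) \<Rightarrow> bool" where
  "is_cont_density_on S M f \<longleftrightarrow>
     continuous_on S f \<and> (\<forall>x\<in>S. f x \<ge> 0) \<and>
     (\<forall>A\<in>sets borel. A \<subseteq> S \<longrightarrow> emeasure M A = (\<integral>\<^sup>+x\<in>A. ennreal (f x) \<partial>lborel))"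

text \<open>For open \<open>S\<close>, the values on \<open>S\<close> of a continuous density are uniquely determined by the
  measure; off \<open>S\<close> the chosen function is arbitrary.\<close>

definition cont_density_on :: "real set \<Rightarrow> real measure \<Rightarrow> real \<Rightarrow> real" where
  "cont_density_on S M = (SOME f. is_cont_density_on S M f)"

end

theory Submission
  imports Defs "HOL-Complex_Analysis.Complex_Analysis" "HOL-Real_Asymp.Real_Asymp"
    "HOL-Computational_Algebra.Fundamental_Theorem_Algebra"
begin

text \<open>Over one period the recurrence is a small perturbation of multiplication by the periodic
  monodromy matrix at \<open>0\<close>, which is elliptic; the \<open>class_D1\<close> conditions make the associated
  quadratic form converge along the solutions. Averaging shows that the polynomials at
  \<open>x + u / \<rho>\<^sub>n\<close> rotate, with respect to those at \<open>x\<close>, at constant speed in the variable \<open>\<rho>\<close>, and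
  this produces the sine kernel with constants expressed through the monodromy matrix and the limit
  \<open>\<tau>\<close> of the Weyl ratios. The two measures are then identified: Weyl's functions
  with a complex boundary condition have densities converging locally uniformly to \<open>- Im \<tau>\<close>, and
  their Poisson integrals converge to the one of \<open>\<mu>\<close>; and the pullback of the arcsine law
  under the trace polynomial has constant logarithmic potential, so that it is the equilibrium
  measure.\<close>

section \<open>Three-term recurrences and uniform asymptotics\<close>

text \<open>The kernel is summed term by term, without phase asymptotics of the polynomials.
  Variation of constants writes \<open>orthP\<close> at a shifted point as
  \<open>Re (cnj y * c)\<close>, with \<open>y\<close> a complex solution at \<open>x\<close> and
  \<open>c\<close> a slowly varying coefficient driven only by \<open>|y|^2\<close> and
  \<open>y^2\<close>. The mean of \<open>y^2\<close> vanishes because the eigenvalue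
  \<open>lam\<close> of the monodromy matrix is not real, and \<open>|y|^2\<close> has mean
  \<open>2 * hh x\<close> per unit of the clock; these two averages decide everything. The speed of
  \<open>c\<close> is proportional to \<open>Im (tau x) * hh x\<close>. The amplitude
  \<open>gp x\<close> enters the first factor as a denominator and the second as a numerator, so the
  argument of sinc is free of \<open>x\<close>. Two obstacles shape the second half. Truncations
  with real boundary conditions have discrete spectral measures; a non-real boundary value makes
  them absolutely continuous, and with the value \<open>zeta\<close> the density contains exactly
  the amplitude whose limit is known. And the equilibrium density must be continuous on the whole
  interior of the set, closed gaps included, where its formula degenerates to 0 / 0; otherwise
  \<open>cont_density_on\<close> would determine nothing.\<close>

fun rsol :: "(nat \<Rightarrow> 'a::comm_ring_1) \<Rightarrow> (nat \<Rightarrow> 'a) \<Rightarrow> 'a \<Rightarrow> 'a \<Rightarrow> nat \<Rightarrow> 'a" where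
  "rsol r t u0 u1 0 = u0"
| "rsol r t u0 u1 (Suc 0) = u1"
| "rsol r t u0 u1 (Suc (Suc n)) = t n * rsol r t u0 u1 (Suc n) - r n * rsol r t u0 u1 n"

lemma rsol_unique:
  assumes "\<And>n. n < K \<Longrightarrow> U (Suc (Suc n)) = t n * U (Suc n) - r n * U n" "n < Suc (Suc K)"
  shows "U n = rsol r t (U 0) (U 1) n"
  using assms(2)
proof (induction n rule: induct_nat_012)
  case (ge2 n)
  then show ?case using assms(1)[of n] by simp
qed simp_all

lemma rsol_linear:
  "rsol r t u0 u1 n = u0 * rsol r t 1 0 n + u1 * rsol r t 0 1 n"
  by (induction n rule: induct_nat_012) (simp_all add: algebra_simps)

lemma rsol_wronskian:
  "rsol r t 1 0 n * rsol r t 0 1 (Suc n) - rsol r t 1 0 (Suc n) * rsol r t 0 1 n = (\<Prod>j<n. r j)"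
proof (induction n)
  case (Suc n)
  have "rsol r t 1 0 (Suc n) * rsol r t 0 1 (Suc (Suc n)) - rsol r t 1 0 (Suc (Suc n)) * rsol r t 0 1 (Suc n)
     = r n * (rsol r t 1 0 n * rsol r t 0 1 (Suc n) - rsol r t 1 0 (Suc n) * rsol r t 0 1 n)"
    by (simp add: algebra_simps)
  then show ?case using Suc by (simp add: mult.commute)
qed simp

text \<open>Landau symbols, uniformly over \<open>C\<close>: \<open>e\<^sub>k(x) = o(w\<^sub>k)\<close> and \<open>e\<^sub>k(x) = O(w\<^sub>k)\<close>.\<close>

definition uo :: "'x set \<Rightarrow> (nat \<Rightarrow> real) \<Rightarrow> (nat \<Rightarrow> 'x \<Rightarrow> 'a::real_normed_vector) \<Rightarrow> bool" where
  "uo C w e \<longleftrightarrow> (\<forall>\<epsilon>>0. \<forall>\<^sub>F k in sequentially. \<forall>x\<in>C. norm (e k x) \<le> \<epsilon> * w k)"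

definition uO :: "'x set \<Rightarrow> (nat \<Rightarrow> real) \<Rightarrow> (nat \<Rightarrow> 'x \<Rightarrow> 'a::real_normed_vector) \<Rightarrow> bool" where
  "uO C w e \<longleftrightarrow> (\<exists>B. \<forall>\<^sub>F k in sequentially. \<forall>x\<in>C. norm (e k x) \<le> B * w k)"

lemma uoI: "(\<And>\<epsilon>. \<epsilon> > 0 \<Longrightarrow> \<forall>\<^sub>F k in sequentially. \<forall>x\<in>C. norm (e k x) \<le> \<epsilon> * w k) \<Longrightarrow> uo C w e"
  by (simp add: uo_def)

lemma uoD: "uo C w e \<Longrightarrow> \<epsilon> > 0 \<Longrightarrow> \<forall>\<^sub>F k in sequentially. \<forall>x\<in>C. norm (e k x) \<le> \<epsilon> * w k"
  by (simp add: uo_def)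

lemma uOI: "\<forall>\<^sub>F k in sequentially. \<forall>x\<in>C. norm (e k x) \<le> B * w k \<Longrightarrow> uO C w e"
  by (auto simp: uO_def)

lemma uOE:
  assumes "uO C w e" "\<And>k. w k \<ge> 0"
  obtains B where "B > 0" "\<forall>\<^sub>F k in sequentially. \<forall>x\<in>C. norm (e k x) \<le> B * w k"
proof -
  obtain B where B: "\<forall>\<^sub>F k in sequentially. \<forall>x\<in>C. norm (e k x) \<le> B * w k"
    using assms(1) by (auto simp: uO_def)
  have "\<forall>\<^sub>F k in sequentially. \<forall>x\<in>C. norm (e k x) \<le> (max B 1) * w k"
    using B by eventually_elim (use assms(2) in \<open>meson max.cobounded1 mult_right_mono order_trans\<close>)
  then show ?thesis using that[of "max B 1"] by auto
qed

lemma uo_imp_uO: "uo C w e \<Longrightarrow> uO C w e"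
  unfolding uo_def uO_def using zero_less_one by blast

lemma uo_add:
  assumes "uo C w e" "uo C w f"
  shows "uo C w (\<lambda>k x. e k x + f k x)"
proof (rule uoI)
  fix \<epsilon> :: real assume "\<epsilon> > 0"
  then have "\<epsilon>/2 > 0" by simp
  show "\<forall>\<^sub>F k in sequentially. \<forall>x\<in>C. norm (e k x + f k x) \<le> \<epsilon> * w k"
    using uoD[OF assms(1) \<open>\<epsilon>/2 > 0\<close>] uoD[OF assms(2) \<open>\<epsilon>/2 > 0\<close>]
  proof eventually_elim
    case (elim k)
    show ?case
    proof
      fix x assume "x \<in> C"
      then have "norm (e k x) \<le> \<epsilon>/2 * w k" "norm (f k x) \<le> \<epsilon>/2 * w k" using elim by auto
      then show "norm (e k x + f k x) \<le> \<epsilon> * w k" using norm_triangle_ineq[of "e k x" "f k x"] by (simp add: field_simps)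
    qed
  qed
qed

lemma uO_add:
  assumes "uO C w e" "uO C w f"
  shows "uO C w (\<lambda>k x. e k x + f k x)"
proof -
  obtain B D where B: "\<forall>\<^sub>F k in sequentially. \<forall>x\<in>C. norm (e k x) \<le> B * w k"
    "\<forall>\<^sub>F k in sequentially. \<forall>x\<in>C. norm (f k x) \<le> D * w k" using assms by (auto simp: uO_def)
  have "\<forall>\<^sub>F k in sequentially. \<forall>x\<in>C. norm (e k x + f k x) \<le> (B + D) * w k"
    using B
  proof eventually_elim
    case (elim k)
    then show ?case
      by (metis add_mono distrib_right norm_triangle_le)
  qed
  then show ?thesis by (rule uOI)
qed

lemma uo_minus: "uo C w e \<Longrightarrow> uo C w (\<lambda>k x. - e k x)" by (simp add: uo_def)
lemma uO_minus: "uO C w e \<Longrightarrow> uO C w (\<lambda>k x. - e k x)" by (simp add: uO_def)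

lemma uo_diff: "uo C w e \<Longrightarrow> uo C w f \<Longrightarrow> uo C w (\<lambda>k x. e k x - f k x)"
  using uo_add[of C w e "\<lambda>k x. - f k x"] uo_minus[of C w f] by simp

lemma uO_diff: "uO C w e \<Longrightarrow> uO C w f \<Longrightarrow> uO C w (\<lambda>k x. e k x - f k x)"
  using uO_add[of C w e "\<lambda>k x. - f k x"] uO_minus[of C w f] by simp

lemma uo_mult:
  fixes e f :: "nat \<Rightarrow> 'x \<Rightarrow> 'a::real_normed_algebra"
  assumes "uo C w e" "uO C v f" "\<And>k. w k \<ge> 0" "\<And>k. v k \<ge> 0"
  shows "uo C (\<lambda>k. w k * v k) (\<lambda>k x. e k x * f k x)"
    and "uo C (\<lambda>k. w k * v k) (\<lambda>k x. f k x * e k x)"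
proof -
  obtain B where B: "B > 0" "\<forall>\<^sub>F k in sequentially. \<forall>x\<in>C. norm (f k x) \<le> B * v k"
    using uOE[OF assms(2,4)] .
  have *: "\<forall>\<^sub>F k in sequentially. \<forall>x\<in>C. norm (e k x) * norm (f k x) \<le> \<epsilon> * (w k * v k)" if "\<epsilon> > 0" for \<epsilon>
  proof -
    have "\<epsilon>/B > 0" using that B by simp
    from uoD[OF assms(1) this] B(2) show ?thesis
    proof eventually_elim
      case (elim k)
      show ?case
      proof
        fix x assume x: "x \<in> C"
        have "norm (e k x) * norm (f k x) \<le> (\<epsilon>/B * w k) * (B * v k)"
          by (rule mult_mono) (use elim x assms B that in \<open>auto intro!: mult_nonneg_nonneg\<close>)
        then show "norm (e k x) * norm (f k x) \<le> \<epsilon> * (w k * v k)" using B by (simp add: field_simps)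
      qed
    qed
  qed
  show "uo C (\<lambda>k. w k * v k) (\<lambda>k x. e k x * f k x)"
  proof (rule uoI)
    fix \<epsilon> :: real assume "\<epsilon> > 0"
    from *[OF this] show "\<forall>\<^sub>F k in sequentially. \<forall>x\<in>C. norm (e k x * f k x) \<le> \<epsilon> * (w k * v k)"
      by eventually_elim (meson norm_mult_ineq order_trans)
  qed
  show "uo C (\<lambda>k. w k * v k) (\<lambda>k x. f k x * e k x)"
  proof (rule uoI)
    fix \<epsilon> :: real assume "\<epsilon> > 0"
    from *[OF this] show "\<forall>\<^sub>F k in sequentially. \<forall>x\<in>C. norm (f k x * e k x) \<le> \<epsilon> * (w k * v k)"
      by eventually_elim (metis mult.commute norm_mult_ineq order_trans)
  qed
qed

lemma uO_mult:
  fixes e f :: "nat \<Rightarrow> 'x \<Rightarrow> 'a::real_normed_algebra"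
  assumes "uO C w e" "uO C v f" "\<And>k. w k \<ge> 0" "\<And>k. v k \<ge> 0"
  shows "uO C (\<lambda>k. w k * v k) (\<lambda>k x. e k x * f k x)"
proof -
  obtain B where B: "B > 0" "\<forall>\<^sub>F k in sequentially. \<forall>x\<in>C. norm (f k x) \<le> B * v k"
    using uOE[OF assms(2,4)] .
  obtain D where D: "D > 0" "\<forall>\<^sub>F k in sequentially. \<forall>x\<in>C. norm (e k x) \<le> D * w k"
    using uOE[OF assms(1,3)] .
  have "\<forall>\<^sub>F k in sequentially. \<forall>x\<in>C. norm (e k x * f k x) \<le> (D*B) * (w k * v k)"
    using B(2) D(2)
  proof eventually_elim
    case (elim k)
    show ?case
    proof
      fix x assume x: "x \<in> C"
      have "norm (e k x * f k x) \<le> norm (e k x) * norm (f k x)" by (rule norm_mult_ineq)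
      also have "\<dots> \<le> (D * w k) * (B * v k)"
        by (rule mult_mono) (use elim x assms B D in \<open>auto intro!: mult_nonneg_nonneg\<close>)
      finally show "norm (e k x * f k x) \<le> (D*B) * (w k * v k)" by (simp add: field_simps)
    qed
  qed
  then show ?thesis by (rule uOI)
qed

lemma uo_norm_le:
  assumes "uo C w e" "\<forall>\<^sub>F k in sequentially. \<forall>x\<in>C. norm (f k x) \<le> norm (e k x)"
  shows "uo C w f"
proof (rule uoI)
  fix \<epsilon> :: real assume "\<epsilon> > 0"
  from uoD[OF assms(1) this] assms(2)
  show "\<forall>\<^sub>F k in sequentially. \<forall>x\<in>C. norm (f k x) \<le> \<epsilon> * w k"
    by eventually_elim (meson order_trans)
qed

lemma uo_of_real [simp]: "uo C w (\<lambda>k x. complex_of_real (e k x)) = uo C w e" by (simp add: uo_def)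
lemma uO_of_real [simp]: "uO C w (\<lambda>k x. complex_of_real (e k x)) = uO C w e" by (simp add: uO_def)
lemma uo_cnj [simp]: "uo C w (\<lambda>k x. cnj (e k x)) = uo C w e" by (simp add: uo_def)
lemma uO_cnj [simp]: "uO C w (\<lambda>k x. cnj (e k x)) = uO C w e" by (simp add: uO_def)

lemma uO_const_fun:
  assumes "\<And>x. x \<in> C \<Longrightarrow> norm (f x) \<le> B"
  shows "uO C (\<lambda>_. 1) (\<lambda>k x. f x)"
  by (rule uOI[where B=B]) (use assms in auto)

lemma uo_1_iff: "uo C (\<lambda>_. 1) (\<lambda>k x. f k x - l x) \<longleftrightarrow> uniform_limit C f l sequentially"
proof
  assume *: "uo C (\<lambda>_. 1) (\<lambda>k x. f k x - l x)"
  show "uniform_limit C f l sequentially"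
  proof (rule uniform_limitI)
    fix e :: real assume "e > 0"
    then have "e/2 > 0" by simp
    from uoD[OF * this] show "\<forall>\<^sub>F n in sequentially. \<forall>x\<in>C. dist (f n x) (l x) < e"
      by eventually_elim (use \<open>e > 0\<close> in \<open>auto simp: dist_norm intro: le_less_trans[of _ "e/2"]\<close>)
  qed
next
  assume *: "uniform_limit C f l sequentially"
  show "uo C (\<lambda>_. 1) (\<lambda>k x. f k x - l x)"
  proof (rule uoI)
    fix e :: real assume "e > 0"
    from uniform_limitD[OF * this] show "\<forall>\<^sub>F n in sequentially. \<forall>x\<in>C. norm (f n x - l x) \<le> e * 1"
      by eventually_elim (auto simp: dist_norm intro: less_imp_le)
  qed
qed

lemma uo_const: "(\<lambda>k. norm (c k)) \<longlonglongrightarrow> 0 \<Longrightarrow> uo C (\<lambda>_. 1) (\<lambda>k x. c k)"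
proof (rule uoI)
  fix e :: real assume "(\<lambda>k. norm (c k)) \<longlonglongrightarrow> 0" "e > 0"
  from order_tendstoD(2)[OF this] show "\<forall>\<^sub>F k in sequentially. \<forall>x\<in>C. norm (c k) \<le> e * 1"
    by eventually_elim auto
qed

text \<open>A Cesaro argument: the weights have a divergent sum, so the finitely many terms before
  the asymptotic regime are absorbed into half of \<open>\<epsilon>\<close>. Boundedness of each
  single term over \<open>C\<close> keeps this uniform.\<close>

lemma uo_sum:
  fixes e :: "nat \<Rightarrow> 'x \<Rightarrow> 'a::real_normed_vector"
  assumes e: "uo C w e" and w: "\<And>k. w k \<ge> 0" "filterlim (\<lambda>n. \<Sum>k<n. w k) at_top sequentially"
    and bdd: "\<And>k. \<exists>B. \<forall>x\<in>C. norm (e k x) \<le> B"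
  shows "uo C (\<lambda>n. \<Sum>k<n. w k) (\<lambda>n x. \<Sum>k<n. e k x)"
proof (rule uoI)
  fix \<epsilon> :: real assume "\<epsilon> > 0"
  then have "\<epsilon>/2 > 0" by simp
  from uoD[OF e this] obtain K where K: "\<And>k x. k \<ge> K \<Longrightarrow> x \<in> C \<Longrightarrow> norm (e k x) \<le> \<epsilon>/2 * w k"
    by (auto simp: eventually_sequentially)
  obtain B where B: "\<And>k x. x \<in> C \<Longrightarrow> norm (e k x) \<le> B k" using bdd by metis
  have "\<forall>\<^sub>F n in sequentially. (\<Sum>k<n. w k) \<ge> (\<Sum>k<K. B k) / (\<epsilon>/2)"
    using w(2) by (simp add: filterlim_at_top)
  then show "\<forall>\<^sub>F n in sequentially. \<forall>x\<in>C. norm (\<Sum>k<n. e k x) \<le> \<epsilon> * (\<Sum>k<n. w k)"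
    using eventually_ge_at_top[of K]
  proof eventually_elim
    case (elim n)
    show ?case
    proof
      fix x assume x: "x \<in> C"
      have "{..<n} = {..<K} \<union> {K..<n}" using elim by auto
      then have "norm (\<Sum>k<n. e k x) = norm ((\<Sum>k<K. e k x) + (\<Sum>k=K..<n. e k x))"
        by (metis atLeast0LessThan elim(2) sum.atLeastLessThan_concat zero_le)
      also have "\<dots> \<le> (\<Sum>k<K. norm (e k x)) + (\<Sum>k=K..<n. norm (e k x))"
        by (intro order_trans[OF norm_triangle_ineq] add_mono norm_sum)
      also have "\<dots> \<le> (\<Sum>k<K. B k) + (\<Sum>k=K..<n. \<epsilon>/2 * w k)"
        by (intro add_mono sum_mono) (use B K x in auto)
      also have "(\<Sum>k=K..<n. \<epsilon>/2 * w k) \<le> (\<Sum>k<n. \<epsilon>/2 * w k)"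
        by (rule sum_mono2) (use w \<open>\<epsilon> > 0\<close> in auto)
      also have "(\<Sum>k<K. B k) + (\<Sum>k<n. \<epsilon>/2 * w k) \<le> \<epsilon>/2 * (\<Sum>k<n. w k) + \<epsilon>/2 * (\<Sum>k<n. w k)"
        using elim(1) \<open>\<epsilon>/2 > 0\<close> unfolding sum_distrib_left[symmetric] pos_divide_le_eq[OF \<open>\<epsilon>/2 > 0\<close>] by (simp add: mult.commute)
      finally show "norm (\<Sum>k<n. e k x) \<le> \<epsilon> * (\<Sum>k<n. w k)" by (simp add: field_simps)
    qed
  qed
qed

text \<open>Bounded variation, uniformly over \<open>C\<close>.\<close>

definition ubv :: "'x set \<Rightarrow> (nat \<Rightarrow> 'x \<Rightarrow> real) \<Rightarrow> bool" where
  "ubv C f \<longleftrightarrow> (\<exists>B. \<forall>k. \<forall>x\<in>C. \<bar>f k x\<bar> \<le> B) \<and>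
     (\<exists>\<delta>. summable \<delta> \<and> (\<forall>k. \<delta> k \<ge> 0) \<and> (\<forall>k. \<forall>x\<in>C. \<bar>f (Suc k) x - f k x\<bar> \<le> \<delta> k))"

lemma ubv_const: "ubv C (\<lambda>k x. c)"
  unfolding ubv_def by (auto intro!: exI[of _ "\<lambda>_. 0"])

lemma ubv_fun: "(\<And>x. x \<in> C \<Longrightarrow> \<bar>f x\<bar> \<le> B) \<Longrightarrow> ubv C (\<lambda>k x. f x)"
  unfolding ubv_def by (auto intro!: exI[of _ "\<lambda>_. 0"])

lemma ubv_D1: "s \<in> class_D1 \<Longrightarrow> ubv C (\<lambda>k x. s k)"
  unfolding ubv_def class_D1_def bounded_iff by (auto intro!: exI[of _ "\<lambda>k. \<bar>s (Suc k) - s k\<bar>"])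

lemma ubv_add: "ubv C f \<Longrightarrow> ubv C g \<Longrightarrow> ubv C (\<lambda>k x. f k x + g k x)"
proof -
  assume "ubv C f" "ubv C g"
  then obtain B1 B2 d1 d2 where B: "\<And>k x. x \<in> C \<Longrightarrow> \<bar>f k x\<bar> \<le> B1" "\<And>k x. x \<in> C \<Longrightarrow> \<bar>g k x\<bar> \<le> B2"
    and d: "summable d1" "summable d2" "\<And>k. d1 k \<ge> 0" "\<And>k. d2 k \<ge> 0"
    "\<And>k x. x \<in> C \<Longrightarrow> \<bar>f (Suc k) x - f k x\<bar> \<le> d1 k" "\<And>k x. x \<in> C \<Longrightarrow> \<bar>g (Suc k) x - g k x\<bar> \<le> d2 k"
    unfolding ubv_def by metis
  show ?thesis unfolding ubv_def
  proof (intro conjI exI[of _ "B1+B2"] exI[of _ "\<lambda>k. d1 k + d2 k"] allI ballI)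
    fix k x assume "x \<in> C"
    then show "\<bar>f k x + g k x\<bar> \<le> B1 + B2" "\<bar>f (Suc k) x + g (Suc k) x - (f k x + g k x)\<bar> \<le> d1 k + d2 k"
      using B[of x k] d(5,6)[of x k] by linarith+
  qed (use d in \<open>auto intro: summable_add\<close>)
qed

lemma ubv_mult: "ubv C f \<Longrightarrow> ubv C g \<Longrightarrow> ubv C (\<lambda>k x. f k x * g k x)"
proof -
  assume "ubv C f" "ubv C g"
  then obtain B1 B2 d1 d2 where B: "\<And>k x. x \<in> C \<Longrightarrow> \<bar>f k x\<bar> \<le> B1" "\<And>k x. x \<in> C \<Longrightarrow> \<bar>g k x\<bar> \<le> B2"
    and d: "summable d1" "summable d2" "\<And>k. d1 k \<ge> 0" "\<And>k. d2 k \<ge> 0"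
    "\<And>k x. x \<in> C \<Longrightarrow> \<bar>f (Suc k) x - f k x\<bar> \<le> d1 k" "\<And>k x. x \<in> C \<Longrightarrow> \<bar>g (Suc k) x - g k x\<bar> \<le> d2 k"
    unfolding ubv_def by metis
  show ?thesis unfolding ubv_def
  proof (intro conjI exI[of _ "B1*B2"] exI[of _ "\<lambda>k. \<bar>B1\<bar> * d2 k + d1 k * \<bar>B2\<bar>"] allI ballI)
    fix k x assume x: "x \<in> C"
    show "\<bar>f k x * g k x\<bar> \<le> B1 * B2" unfolding abs_mult
      by (rule mult_mono) (use B[OF x, of k] in auto)
    have "f (Suc k) x * g (Suc k) x - f k x * g k x = f (Suc k) x * (g (Suc k) x - g k x) + (f (Suc k) x - f k x) * g k x"
      by (simp add: algebra_simps)
    also have "\<bar>\<dots>\<bar> \<le> \<bar>f (Suc k) x\<bar> * \<bar>g (Suc k) x - g k x\<bar> + \<bar>f (Suc k) x - f k x\<bar> * \<bar>g k x\<bar>"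
      by (metis abs_mult abs_triangle_ineq)
    also have "\<dots> \<le> \<bar>B1\<bar> * d2 k + d1 k * \<bar>B2\<bar>"
      by (intro add_mono mult_mono) (use B[OF x, of k] B[OF x, of "Suc k"] d(3-) x in \<open>auto\<close>)
    finally show "\<bar>f (Suc k) x * g (Suc k) x - f k x * g k x\<bar> \<le> \<bar>B1\<bar> * d2 k + d1 k * \<bar>B2\<bar>" .
  qed (use d in \<open>auto intro!: summable_add summable_mult summable_mult2\<close>)
qed

lemma ubv_minus: "ubv C f \<Longrightarrow> ubv C (\<lambda>k x. - f k x)"
  using ubv_mult[OF ubv_const[of C "-1"], of f] by simp

lemma ubv_diff: "ubv C f \<Longrightarrow> ubv C g \<Longrightarrow> ubv C (\<lambda>k x. f k x - g k x)"
  using ubv_add[of C f "\<lambda>k x. - g k x"] ubv_minus[of C g] by simp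

lemma ubv_shift: "ubv C f \<Longrightarrow> ubv C (\<lambda>k x. f (Suc k) x)"
  unfolding ubv_def by (metis summable_Suc_iff)

text \<open>The value at position \<open>n\<close> involves the coefficients up to
  \<open>n - 2\<close> only. For position \<open>Suc N\<close> these are the residues below
  \<open>N\<close>, exactly those whose variation the hypotheses of the theorem control.\<close>

lemma ubv_rsol:
  assumes "\<And>j. Suc j < n \<Longrightarrow> ubv C (\<lambda>k x. r k x j)" "\<And>j. Suc j < n \<Longrightarrow> ubv C (\<lambda>k x. t k x j)"
  shows "ubv C (\<lambda>k x. rsol (r k x) (t k x) c d n)"
  using assms
  by (induction n rule: induct_nat_012) (auto intro!: ubv_const ubv_diff ubv_mult)

lemma ulim_mult_uo:
  fixes f g :: "nat \<Rightarrow> 'x \<Rightarrow> real"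
  assumes "uniform_limit C f (\<lambda>_. a) sequentially" "uniform_limit C g (\<lambda>_. b) sequentially"
  shows "uniform_limit C (\<lambda>k x. f k x * g k x) (\<lambda>_. a * b) sequentially"
  by (rule uniform_lim_mult[OF assms]) (auto simp: image_constant_conv)

lemma ulim_rsol:
  fixes r t :: "nat \<Rightarrow> 'x \<Rightarrow> nat \<Rightarrow> real"
  assumes "\<And>j. Suc j < n \<Longrightarrow> uniform_limit C (\<lambda>k x. r k x j) (\<lambda>_. r' j) sequentially"
    "\<And>j. Suc j < n \<Longrightarrow> uniform_limit C (\<lambda>k x. t k x j) (\<lambda>_. t' j) sequentially"
  shows "uniform_limit C (\<lambda>k x. rsol (r k x) (t k x) c d n) (\<lambda>_. rsol r' t' c d n) sequentially"
  using assms
  by (induction n rule: induct_nat_012) (auto intro!: uniform_limit_minus uniform_limit_const ulim_mult_uo)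

text \<open>A relative perturbation bound \<open>\<bar>f\<^sub>k\<^sub>+\<^sub>1 - f\<^sub>k\<bar> \<le> \<delta>\<^sub>k \<bar>f\<^sub>k\<^sub>+\<^sub>1\<bar>\<close> with summable \<open>\<delta>\<close> forces
  uniform convergence to a limit that is bounded away from zero.\<close>

lemma relative_bv_converges:
  fixes f :: "nat \<Rightarrow> 'x \<Rightarrow> real"
  assumes \<delta>: "summable \<delta>" "\<And>k. \<delta> k \<ge> 0"
    and f: "\<And>k x. k \<ge> K \<Longrightarrow> x \<in> C \<Longrightarrow> \<bar>f (Suc k) x - f k x\<bar> \<le> \<delta> k * \<bar>f (Suc k) x\<bar>"
    and bnd: "\<And>k. \<exists>B. \<forall>x\<in>C. \<bar>f k x\<bar> \<le> B"
    and low: "\<And>k. \<exists>c>0. \<forall>x\<in>C. \<bar>f k x\<bar> \<ge> c"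
  obtains l c B where "uniform_limit C f l sequentially" "c > 0" "\<And>x. x \<in> C \<Longrightarrow> \<bar>l x\<bar> \<ge> c" "\<And>x. x \<in> C \<Longrightarrow> \<bar>l x\<bar> \<le> B"
proof -
  have "\<forall>\<^sub>F k in sequentially. \<delta> k < 1/2" using order_tendstoD(2)[OF summable_LIMSEQ_zero[OF \<delta>(1)], of "1/2"] by simp
  then obtain K2 where K2: "\<And>k. k \<ge> K2 \<Longrightarrow> \<delta> k < 1/2" by (auto simp: eventually_sequentially)
  define L where "L = max K K2"
  define s where "s = suminf \<delta>"
  have sum_le: "sum \<delta> {L..<k} \<le> s" for k unfolding s_def using \<delta> by (intro sum_le_suminf) auto
  obtain B where B: "\<And>x. x \<in> C \<Longrightarrow> \<bar>f L x\<bar> \<le> B" using bnd by blast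
  obtain c where c: "c > 0" "\<And>x. x \<in> C \<Longrightarrow> \<bar>f L x\<bar> \<ge> c" using low by blast
  \<comment> \<open>The hypothesis bounds the step by the later value. Beyond \<open>L\<close> one
    has \<open>\<delta> k < 1 / 2\<close>, so the inverse of \<open>1 - \<delta> k\<close> is at
    most \<open>1 + 2 * \<delta> k\<close>; this is the origin of the 2 in the exponent, which the
    opposite bound \<open>dn\<close> does without.\<close>
  have up: "\<bar>f k x\<bar> \<le> \<bar>f L x\<bar> * exp (2 * sum \<delta> {L..<k})" if "k \<ge> L" "x \<in> C" for k x
    using that(1)
  proof (induction k rule: dec_induct)
    case (step k)
    have d: "\<delta> k < 1/2" "\<delta> k \<ge> 0" using K2 step \<delta> by (auto simp: L_def)
    have "\<bar>f (Suc k) x - f k x\<bar> \<le> \<delta> k * \<bar>f (Suc k) x\<bar>" using f[of k x] step that by (auto simp: L_def)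
    then have 1: "(1 - \<delta> k) * \<bar>f (Suc k) x\<bar> \<le> \<bar>f k x\<bar>" by (simp add: algebra_simps)
    have "1 \<le> (1 + 2 * \<delta> k) * (1 - \<delta> k)"
    proof -
      have "\<delta> k * (1 - 2 * \<delta> k) \<ge> 0" using d by (intro mult_nonneg_nonneg) auto
      then show ?thesis by (simp add: algebra_simps)
    qed
    then have "\<bar>f (Suc k) x\<bar> \<le> ((1 + 2 * \<delta> k) * (1 - \<delta> k)) * \<bar>f (Suc k) x\<bar>"
      by (metis abs_ge_zero mult_1 mult_right_mono)
    also have "\<dots> \<le> (1 + 2 * \<delta> k) * \<bar>f k x\<bar>" using 1 d by (simp add: mult.assoc mult_left_mono)
    also have "\<dots> \<le> exp (2 * \<delta> k) * \<bar>f k x\<bar>" using exp_ge_add_one_self[of "2 * \<delta> k"] by (intro mult_right_mono) auto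
    also have "\<dots> \<le> exp (2 * \<delta> k) * (\<bar>f L x\<bar> * exp (2 * sum \<delta> {L..<k}))" using step by (intro mult_left_mono) auto
    also have "\<dots> = \<bar>f L x\<bar> * exp (2 * sum \<delta> {L..<Suc k})" using step by (simp add: distrib_left exp_add)
    finally show ?case .
  qed simp
  have dn: "\<bar>f L x\<bar> \<le> \<bar>f k x\<bar> * exp (sum \<delta> {L..<k})" if "k \<ge> L" "x \<in> C" for k x
    using that(1)
  proof (induction k rule: dec_induct)
    case (step k)
    have "\<bar>f (Suc k) x - f k x\<bar> \<le> \<delta> k * \<bar>f (Suc k) x\<bar>" using f[of k x] step that by (auto simp: L_def)
    then have "\<bar>f k x\<bar> \<le> (1 + \<delta> k) * \<bar>f (Suc k) x\<bar>" by (simp add: algebra_simps)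
    also have "\<dots> \<le> exp (\<delta> k) * \<bar>f (Suc k) x\<bar>" using exp_ge_add_one_self[of "\<delta> k"] by (intro mult_right_mono) auto
    finally have "\<bar>f k x\<bar> * exp (sum \<delta> {L..<k}) \<le> exp (\<delta> k) * \<bar>f (Suc k) x\<bar> * exp (sum \<delta> {L..<k})" by (intro mult_right_mono) auto
    then have "\<bar>f L x\<bar> \<le> exp (\<delta> k) * \<bar>f (Suc k) x\<bar> * exp (sum \<delta> {L..<k})" using step by linarith
    then show ?case using step by (simp add: exp_add mult_ac)
  qed simp
  define Bd where "Bd = \<bar>B\<bar> * exp (2 * s)"
  have up': "\<bar>f k x\<bar> \<le> Bd" if "k \<ge> L" "x \<in> C" for k x
  proof -
    have "\<bar>f k x\<bar> \<le> \<bar>f L x\<bar> * exp (2 * sum \<delta> {L..<k})" by (rule up[OF that])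
    also have "\<dots> \<le> \<bar>B\<bar> * exp (2 * s)" using B[OF that(2)] sum_le[of k] by (intro mult_mono) auto
    finally show ?thesis by (simp add: Bd_def)
  qed
  have dn': "c * exp (- s) \<le> \<bar>f k x\<bar>" if "k \<ge> L" "x \<in> C" for k x
  proof -
    have "c \<le> \<bar>f k x\<bar> * exp (sum \<delta> {L..<k})" using dn[OF that] c(2)[OF that(2)] by linarith
    also have "\<dots> \<le> \<bar>f k x\<bar> * exp s" using sum_le[of k] by (intro mult_left_mono) auto
    finally have "c * exp (-s) \<le> \<bar>f k x\<bar> * exp s * exp (-s)" by (intro mult_right_mono) auto
    then show ?thesis by (simp add: mult.assoc flip: exp_add)
  qed
  define g where "g = (\<lambda>j x. f (Suc (j + L)) x - f (j + L) x)"
  have "uniform_limit C (\<lambda>n x. \<Sum>j<n. g j x) (\<lambda>x. \<Sum>j. g j x) sequentially"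
  proof (rule Weierstrass_m_test)
    fix n x assume x: "x \<in> C"
    have "\<bar>g n x\<bar> \<le> \<delta> (n + L) * \<bar>f (Suc (n + L)) x\<bar>" unfolding g_def by (rule f) (use x in \<open>auto simp: L_def\<close>)
    also have "\<dots> \<le> \<delta> (n + L) * Bd" using up'[of "Suc (n+L)" x] x \<delta> by (intro mult_left_mono) auto
    finally show "norm (g n x) \<le> \<delta> (n + L) * Bd" by simp
  next
    show "summable (\<lambda>n. \<delta> (n + L) * Bd)" using \<delta>(1) by (intro summable_mult2) (simp add: summable_iff_shift)
  qed
  then have "uniform_limit C (\<lambda>n x. f L x + (\<Sum>j<n. g j x)) (\<lambda>x. f L x + (\<Sum>j. g j x)) sequentially"
    by (intro uniform_limit_add uniform_limit_const)
  moreover have "f L x + (\<Sum>j<n. g j x) = f (n + L) x" for n x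
    by (induction n) (auto simp: g_def)
  ultimately have ul: "uniform_limit C (\<lambda>n. f (n + L)) (\<lambda>x. f L x + (\<Sum>j. g j x)) sequentially" by simp
  define l where "l = (\<lambda>x. f L x + (\<Sum>j. g j x))"
  have ul2: "uniform_limit C f l sequentially"
    using ul unfolding uniform_limit_iff l_def
    by (subst eventually_sequentially_seg[symmetric, of _ L]) auto
  have lim: "(\<lambda>n. \<bar>f (n + L) x\<bar>) \<longlonglongrightarrow> \<bar>l x\<bar>" if "x \<in> C" for x
    using tendsto_uniform_limitI[OF ul that] unfolding l_def by (rule tendsto_rabs)
  have "c * exp (-s) \<le> \<bar>l x\<bar>" if "x \<in> C" for x
    by (rule LIMSEQ_le_const[OF lim[OF that]]) (use dn' that in auto)
  moreover have "\<bar>l x\<bar> \<le> Bd" if "x \<in> C" for x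
    by (rule LIMSEQ_le_const2[OF lim[OF that]]) (use up' that in auto)
  ultimately show ?thesis using that[OF ul2, of "c * exp (-s)" Bd] c(1) by simp
qed

section \<open>Orthogonal polynomials and the modulated setting\<close>

text \<open>Position \<open>j\<close> holds the solution of the periodic recurrence at index
  \<open>j - 1\<close>, so \<open>c\<close> and \<open>d\<close> are its values at -1 and 0. Hence
  the entries of the monodromy matrix are read off at positions \<open>N\<close> and
  \<open>Suc N\<close>.\<close>

definition per_sol :: "(int \<Rightarrow> real) \<Rightarrow> (int \<Rightarrow> real) \<Rightarrow> real \<Rightarrow> real \<Rightarrow> nat \<Rightarrow> real \<Rightarrow> real" where
  "per_sol \<alpha> \<beta> c d j x =
     rsol (\<lambda>j. \<alpha> (int j - 1) / \<alpha> (int j)) (\<lambda>j. (x - \<beta> (int j)) / \<alpha> (int j)) c d j"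

text \<open>The orthonormal polynomials over any real normed field: real arguments serve the kernel,
  complex ones the Weyl functions.\<close>

definition orthP :: "(nat \<Rightarrow> real) \<Rightarrow> (nat \<Rightarrow> real) \<Rightarrow> nat \<Rightarrow> 'a \<Rightarrow> 'a::real_normed_field" where
  "orthP a b n z = rsol (\<lambda>n. of_real (a n / a (Suc n))) (\<lambda>n. (z - of_real (b (Suc n))) / of_real (a (Suc n)))
     1 ((z - of_real (b 0)) / of_real (a 0)) n"

text \<open>Polynomials of the second kind. The initial values 0 and \<open>1 / a 0\<close>
  normalize \<open>a n\<close> times the Wronskian with \<open>orthP\<close> to 1.\<close>

definition orthQ :: "(nat \<Rightarrow> real) \<Rightarrow> (nat \<Rightarrow> real) \<Rightarrow> nat \<Rightarrow> 'a \<Rightarrow> 'a::real_normed_field" where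
  "orthQ a b n z = rsol (\<lambda>n. of_real (a n / a (Suc n))) (\<lambda>n. (z - of_real (b (Suc n))) / of_real (a (Suc n)))
     0 (1 / of_real (a 0)) n"

text \<open>The recurrence is required from index 1 on only. The two initial values remain free, so
  both polynomial families and all their combinations qualify.\<close>

definition jacobi_rec :: "(nat \<Rightarrow> real) \<Rightarrow> (nat \<Rightarrow> real) \<Rightarrow> 'a \<Rightarrow> (nat \<Rightarrow> 'a::real_normed_field) \<Rightarrow> bool" where
  "jacobi_rec a b z U \<longleftrightarrow> (\<forall>n. U (Suc (Suc n)) =
     (z - of_real (b (Suc n))) / of_real (a (Suc n)) * U (Suc n) - of_real (a n / a (Suc n)) * U n)"

lemma jacobi_rec_orthP: "jacobi_rec a b z (\<lambda>n. orthP a b n z)"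
  and jacobi_rec_orthQ: "jacobi_rec a b z (\<lambda>n. orthQ a b n z)"
  by (simp_all add: jacobi_rec_def orthP_def orthQ_def)

lemma jacobi_rec_comb: "jacobi_rec a b z U \<Longrightarrow> jacobi_rec a b z V \<Longrightarrow> jacobi_rec a b z (\<lambda>n. c * U n + d * V n)"
  unfolding jacobi_rec_def
proof
  fix n
  assume "\<forall>n. U (Suc (Suc n)) = (z - of_real (b (Suc n))) / of_real (a (Suc n)) * U (Suc n) - of_real (a n / a (Suc n)) * U n"
    "\<forall>n. V (Suc (Suc n)) = (z - of_real (b (Suc n))) / of_real (a (Suc n)) * V (Suc n) - of_real (a n / a (Suc n)) * V n"
  then have "U (Suc (Suc n)) = (z - of_real (b (Suc n))) / of_real (a (Suc n)) * U (Suc n) - of_real (a n / a (Suc n)) * U n"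
    "V (Suc (Suc n)) = (z - of_real (b (Suc n))) / of_real (a (Suc n)) * V (Suc n) - of_real (a n / a (Suc n)) * V n"
    by blast+
  then show "c * U (Suc (Suc n)) + d * V (Suc (Suc n)) = (z - of_real (b (Suc n))) / of_real (a (Suc n)) * (c * U (Suc n) + d * V (Suc n))
     - of_real (a n / a (Suc n)) * (c * U n + d * V n)"
    by (simp only:) (simp add: ring_distribs mult_ac add_divide_distrib)
qed

lemma orth_poly_eq_orthP: "orth_poly a b n x = orthP a b n x"
  unfolding orthP_def
  by (induction n rule: induct_nat_012) (simp_all add: diff_divide_distrib[of "_ * _"])

lemma orthP_of_real: "orthP a b n (of_real x) = of_real (orthP a b n x)"
  unfolding orthP_def by (induction n rule: induct_nat_012) simp_all

lemma orthQ_of_real: "orthQ a b n (of_real x) = of_real (orthQ a b n x)"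
  unfolding orthQ_def by (induction n rule: induct_nat_012) simp_all

lemma continuous_on_orth [continuous_intros]:
  "continuous_on C (\<lambda>x. orthP a b n x)" "continuous_on C (\<lambda>x. orthQ a b n x)"
  unfolding orthP_def orthQ_def divide_inverse
  by (induction n rule: induct_nat_012) (auto intro!: continuous_intros)

lemma prod_ratio_telescope:
  fixes a :: "nat \<Rightarrow> real"
  assumes "\<And>n. a n \<noteq> 0"
  shows "(\<Prod>j<n. a (m + j) / a (Suc (m + j))) = a m / a (m + n)"
  by (induction n) (use assms in \<open>auto simp: field_simps\<close>)

lemma orth_wronskian:
  assumes "\<And>n. a n > 0"
  shows "of_real (a n) * (orthP a b n z * orthQ a b (Suc n) z - orthP a b (Suc n) z * orthQ a b n z) = 1"
proof (induction n)
  case 0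
  then show ?case using assms[of 0] by (simp add: orthP_def orthQ_def)
next
  case (Suc n)
  have nz: "of_real (a (Suc n)) \<noteq> (0::'a)" using assms[of "Suc n"] by simp
  have r: "U (Suc (Suc n)) = (z - of_real (b (Suc n))) / of_real (a (Suc n)) * U (Suc n) - of_real (a n / a (Suc n)) * U n"
    if "jacobi_rec a b z U" for U using that by (simp add: jacobi_rec_def)
  have "of_real (a (Suc n)) * (orthP a b (Suc n) z * orthQ a b (Suc (Suc n)) z - orthP a b (Suc (Suc n)) z * orthQ a b (Suc n) z)
    = of_real (a n) * (orthP a b n z * orthQ a b (Suc n) z - orthP a b (Suc n) z * orthQ a b n z)"
    unfolding r[OF jacobi_rec_orthP] r[OF jacobi_rec_orthQ] using nz by (simp add: field_simps)
  then show ?case using Suc by simp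
qed

text \<open>Two consecutive zeros would, by Cramer's rule, annihilate \<open>c\<close> and
  \<open>d\<close> times the Wronskian, which is not 0.\<close>

lemma jacobi_comb_nonzero:
  fixes z :: "'a::real_normed_field"
  assumes "\<And>n. a n > 0" "(c, d) \<noteq> (0, 0)"
  shows "(c * orthP a b n z + d * orthQ a b n z, c * orthP a b (Suc n) z + d * orthQ a b (Suc n) z) \<noteq> (0, 0)"
proof
  assume *: "(c * orthP a b n z + d * orthQ a b n z, c * orthP a b (Suc n) z + d * orthQ a b (Suc n) z) = (0, 0)"
  have "c * (orthP a b n z * orthQ a b (Suc n) z - orthP a b (Suc n) z * orthQ a b n z)
      = orthQ a b (Suc n) z * (c * orthP a b n z + d * orthQ a b n z) - orthQ a b n z * (c * orthP a b (Suc n) z + d * orthQ a b (Suc n) z)"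
    by (simp add: algebra_simps)
  moreover have "d * (orthP a b n z * orthQ a b (Suc n) z - orthP a b (Suc n) z * orthQ a b n z)
      = orthP a b n z * (c * orthP a b (Suc n) z + d * orthQ a b (Suc n) z) - orthP a b (Suc n) z * (c * orthP a b n z + d * orthQ a b n z)"
    by (simp add: algebra_simps)
  ultimately show False using orth_wronskian[where a=a and b=b and n=n and z=z, OF assms(1)] assms(2) * by auto
qed

text \<open>The quadratic form is \<open>det (w, X w)\<close> for \<open>w = (u, v)\<close> and \<open>X = (p, q; r, s)\<close>; its discriminant is
  \<open>(tr X)\<^sup>2 - 4 det X\<close>.\<close>

lemma elliptic_form_lower:
  fixes p q r s u v :: real
  shows "- ((s - p)\<^sup>2 + 4 * q * r) / 4 * (u\<^sup>2 + v\<^sup>2) \<le> (\<bar>q\<bar> + \<bar>r\<bar>) * \<bar>r * u\<^sup>2 + (s - p) * u * v - q * v\<^sup>2\<bar>"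
proof -
  define f where "f = r * u\<^sup>2 + (s - p) * u * v - q * v\<^sup>2"
  define D where "D = - ((s - p)\<^sup>2 + 4 * q * r)"
  \<comment> \<open>Completing the square in either variable leaves the same factor
    \<open>D / 4\<close>, in front of the square of \<open>u\<close> here and of \<open>v\<close> in
    the next line.\<close>
  have 1: "- q * f = (q * v - (s - p) / 2 * u)\<^sup>2 + D / 4 * u\<^sup>2"
    unfolding f_def D_def by (simp add: power2_eq_square field_simps)
  have 2: "r * f = (r * u + (s - p) / 2 * v)\<^sup>2 + D / 4 * v\<^sup>2"
    unfolding f_def D_def by (simp add: power2_eq_square field_simps)
  have "D / 4 * u\<^sup>2 \<le> - q * f" unfolding 1 by simp
  also have "\<dots> \<le> \<bar>q\<bar> * \<bar>f\<bar>" by (metis abs_ge_self abs_minus_cancel abs_mult)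
  finally have 3: "D / 4 * u\<^sup>2 \<le> \<bar>q\<bar> * \<bar>f\<bar>" .
  have "D / 4 * v\<^sup>2 \<le> r * f" unfolding 2 by simp
  also have "\<dots> \<le> \<bar>r\<bar> * \<bar>f\<bar>" by (metis abs_ge_self abs_mult)
  finally show ?thesis using 3 unfolding f_def[symmetric] D_def[symmetric] by (simp add: algebra_simps)
qed

text \<open>\<open>M\<close> is the residue \<open>N - 1\<close> at which the blocks start;
  \<open>N = Suc M\<close> avoids subtraction. The last assumption is the trace condition at 0,
  written with the entries of the monodromy matrix.\<close>

locale modulated_jacobi =
  fixes M N :: nat and a b :: "nat \<Rightarrow> real" and \<alpha> \<beta> :: "int \<Rightarrow> real"
  assumes N_eq: "N = Suc M"
    and a_pos: "\<And>n. a n > 0"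
    and modulated: "periodically_modulated N \<alpha> \<beta> a b"
    and D1_a: "\<And>i. i < N \<Longrightarrow> (\<lambda>k. a (k * N + i - 1) / a (k * N + i)) \<in> class_D1"
    and D1_b: "\<And>i. i < N \<Longrightarrow> (\<lambda>k. b (k * N + i) / a (k * N + i)) \<in> class_D1"
    and D1_1: "\<And>i. i < N \<Longrightarrow> (\<lambda>k. 1 / a (k * N + i)) \<in> class_D1"
    and carleman: "\<not> summable (\<lambda>n. 1 / a n)"
    and ell: "\<bar>per_sol \<alpha> \<beta> 1 0 N 0 + per_sol \<alpha> \<beta> 0 1 (Suc N) 0\<bar> < 2"
begin

lemma a_nz [simp]: "a n \<noteq> 0" using a_pos[of n] by simp

lemma alpha_pos [simp]: "\<alpha> n > 0"
  using modulated unfolding periodically_modulated_def by simp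

lemma alpha_nz [simp]: "\<alpha> n \<noteq> 0" using alpha_pos[of n] by linarith

lemma alpha_per: "\<alpha> (int (k * N) + n) = \<alpha> n"
proof (induction k)
  case (Suc k)
  have "\<alpha> (int (Suc k * N) + n) = \<alpha> ((int (k * N) + n) + int N)" by (simp add: algebra_simps)
  also have "\<dots> = \<alpha> n" using modulated Suc unfolding periodically_modulated_def periodic_seq_def by metis
  finally show ?case .
qed simp

lemma beta_per: "\<beta> (int (k * N) + n) = \<beta> n"
proof (induction k)
  case (Suc k)
  have "\<beta> (int (Suc k * N) + n) = \<beta> ((int (k * N) + n) + int N)" by (simp add: algebra_simps)
  also have "\<dots> = \<beta> n" using modulated Suc unfolding periodically_modulated_def periodic_seq_def by metis
  finally show ?case .
qed simp

text \<open>This is the index \<open>(k + 1) * N - 1\<close>. From the pair at \<open>sk k\<close>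
  and \<open>Suc (sk k)\<close> the next \<open>N\<close> steps use the residues 0 to
  \<open>N - 1\<close> in this order, so the block matrices converge to the monodromy matrix with
  starting index 0. The truncated \<open>n - 1\<close> of the hypotheses is never met at 0.\<close>

definition sk :: "nat \<Rightarrow> nat" where "sk k = k * N + M"

lemma sk_Suc: "sk (Suc k) = sk k + N" by (simp add: sk_def)
lemma Suc_sk_j: "Suc (sk k + j) = Suc k * N + j" unfolding sk_def by (simp add: N_eq)

lemma filterlim_block: "filterlim (\<lambda>k. Suc k * N + j) at_top sequentially"
  unfolding filterlim_at_top
proof (intro allI)
  fix Z
  show "\<forall>\<^sub>F k in sequentially. Z \<le> Suc k * N + j"
    using eventually_ge_at_top[of Z]
  proof eventually_elim
    case (elim k)
    have "k * 1 \<le> k * N" by (rule mult_le_mono) (auto simp: N_eq)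
    then show ?case using elim by (simp only: mult_Suc)
  qed
qed

definition Rk :: "nat \<Rightarrow> nat \<Rightarrow> real" where "Rk k j = a (sk k + j) / a (Suc (sk k + j))"
definition Tk :: "nat \<Rightarrow> real \<Rightarrow> nat \<Rightarrow> real" where "Tk k x j = (x - b (Suc (sk k + j))) / a (Suc (sk k + j))"

definition Ck :: "nat \<Rightarrow> real \<Rightarrow> nat \<Rightarrow> real" where "Ck k x j = rsol (Rk k) (Tk k x) 1 0 j"
definition Dk :: "nat \<Rightarrow> real \<Rightarrow> nat \<Rightarrow> real" where "Dk k x j = rsol (Rk k) (Tk k x) 0 1 j"

text \<open>The limits of \<open>Ck\<close> and \<open>Dk\<close> do not depend on \<open>x\<close>:
  the spectral parameter enters as \<open>x / a n\<close>, which tends to 0. Asymptotically only the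
  periodic problem at 0 is seen.\<close>

definition cl :: "nat \<Rightarrow> real" where "cl j = per_sol \<alpha> \<beta> 1 0 j 0"
definition dl :: "nat \<Rightarrow> real" where "dl j = per_sol \<alpha> \<beta> 0 1 j 0"

text \<open>The reciprocal \<open>w\<close> is the order of magnitude of the squared solutions in
  block \<open>k\<close>, and it is the weight in all block averages.\<close>

definition A :: "nat \<Rightarrow> real" where "A k = a (sk k)"
definition w :: "nat \<Rightarrow> real" where "w k = 1 / A k"

lemma A_pos [simp]: "A k > 0" and w_pos [simp]: "w k > 0" by (simp_all add: A_def w_def a_pos)
lemma A_nz [simp]: "A k \<noteq> 0" using A_pos[of k] by linarith

lemma inv_a_lim: "(\<lambda>n. 1 / a n) \<longlonglongrightarrow> 0"
proof -
  have "filterlim a at_top sequentially" using modulated by (simp add: periodically_modulated_def)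
  then show ?thesis by (intro tendsto_divide_0[OF tendsto_const] filterlim_at_top_imp_at_infinity)
qed

lemma Rk_lim: "(\<lambda>k. Rk k j) \<longlonglongrightarrow> \<alpha> (int j - 1) / \<alpha> (int j)"
proof -
  have "(\<lambda>n. \<bar>a (n - 1) / a n - \<alpha> (int n - 1) / \<alpha> (int n)\<bar>) \<longlonglongrightarrow> 0" using modulated by (simp add: periodically_modulated_def)
  from filterlim_compose[OF this filterlim_block[of j]]
  have "(\<lambda>k. \<bar>Rk k j - \<alpha> (int j - 1) / \<alpha> (int j)\<bar>) \<longlonglongrightarrow> 0"
  proof (rule Lim_transform_eventually)
    show "\<forall>\<^sub>F k in sequentially. \<bar>a (Suc k * N + j - 1) / a (Suc k * N + j) - \<alpha> (int (Suc k * N + j) - 1) / \<alpha> (int (Suc k * N + j))\<bar>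
       = \<bar>Rk k j - \<alpha> (int j - 1) / \<alpha> (int j)\<bar>"
    proof (intro always_eventually allI)
      fix k
      have "int (Suc k * N + j) - 1 = int (Suc k * N) + (int j - 1)" "int (Suc k * N + j) = int (Suc k * N) + int j" by simp_all
      then show "\<bar>a (Suc k * N + j - 1) / a (Suc k * N + j) - \<alpha> (int (Suc k * N + j) - 1) / \<alpha> (int (Suc k * N + j))\<bar>
        = \<bar>Rk k j - \<alpha> (int j - 1) / \<alpha> (int j)\<bar>"
        unfolding Rk_def by (metis Suc_sk_j alpha_per diff_Suc_1)
    qed
  qed
  then show ?thesis using LIM_zero_iff tendsto_rabs_zero_iff by blast
qed

lemma ba_lim: "(\<lambda>k. b (Suc (sk k + j)) / a (Suc (sk k + j))) \<longlonglongrightarrow> \<beta> (int j) / \<alpha> (int j)"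
proof -
  have "(\<lambda>n. \<bar>b n / a n - \<beta> (int n) / \<alpha> (int n)\<bar>) \<longlonglongrightarrow> 0" using modulated by (simp add: periodically_modulated_def)
  from filterlim_compose[OF this filterlim_block[of j]]
  have "(\<lambda>k. \<bar>b (Suc (sk k + j)) / a (Suc (sk k + j)) - \<beta> (int j) / \<alpha> (int j)\<bar>) \<longlonglongrightarrow> 0"
  proof (rule Lim_transform_eventually)
    show "\<forall>\<^sub>F k in sequentially. \<bar>b (Suc k * N + j) / a (Suc k * N + j) - \<beta> (int (Suc k * N + j)) / \<alpha> (int (Suc k * N + j))\<bar>
       = \<bar>b (Suc (sk k + j)) / a (Suc (sk k + j)) - \<beta> (int j) / \<alpha> (int j)\<bar>"
      by (intro always_eventually allI) (metis Suc_sk_j alpha_per beta_per of_nat_add)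
  qed
  then show ?thesis using LIM_zero_iff tendsto_rabs_zero_iff by blast
qed

lemma a1_lim: "(\<lambda>k. 1 / a (Suc (sk k + j))) \<longlonglongrightarrow> 0"
  unfolding Suc_sk_j by (rule filterlim_compose[OF inv_a_lim filterlim_block])

lemma w_lim: "w \<longlonglongrightarrow> 0"
proof -
  have "(\<lambda>k. 1 / a (sk (Suc k))) \<longlonglongrightarrow> 0"
    using a1_lim[of M] unfolding sk_Suc by (subst N_eq) simp
  then show ?thesis unfolding w_def A_def by (rule LIMSEQ_imp_Suc)
qed

lemma ubv_Rk: "j < N \<Longrightarrow> ubv C (\<lambda>k x. Rk k j)"
  using ubv_shift[OF ubv_D1[OF D1_a[of j]], of C] unfolding Rk_def Suc_sk_j[symmetric] by (simp add: Suc_sk_j[symmetric])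

lemma Tk_eq: "Tk k x j = x * (1 / a (Suc (sk k + j))) - b (Suc (sk k + j)) / a (Suc (sk k + j))"
  by (simp add: Tk_def diff_divide_distrib)

lemma ubv_Tk:
  assumes "bounded C" "j < N"
  shows "ubv C (\<lambda>k x. Tk k x j)"
proof -
  obtain B where "\<And>x. x \<in> C \<Longrightarrow> \<bar>x\<bar> \<le> B" using assms(1) by (auto simp: bounded_iff)
  then have 1: "ubv C (\<lambda>k x. x)" by (rule ubv_fun)
  show ?thesis unfolding Tk_eq
    using ubv_diff[OF ubv_mult[OF 1 ubv_shift[OF ubv_D1[OF D1_1[OF assms(2)]], of C]] ubv_shift[OF ubv_D1[OF D1_b[OF assms(2)]], of C]]
    by (simp add: Suc_sk_j)
qed

lemma ulim_const_fun: "c \<longlonglongrightarrow> (l::real) \<Longrightarrow> uniform_limit C (\<lambda>k x. c k) (\<lambda>_. l) sequentially"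
  unfolding uniform_limit_iff tendsto_iff by (auto elim!: eventually_mono)

lemma ulim_Tk:
  assumes "bounded C"
  shows "uniform_limit C (\<lambda>k x. Tk k x j) (\<lambda>_. (0 - \<beta> (int j)) / \<alpha> (int j)) sequentially"
proof -
  obtain B where B: "\<And>x. x \<in> C \<Longrightarrow> norm x \<le> B" using assms(1) by (auto simp: bounded_iff)
  have "uo C (\<lambda>_. 1 * 1) (\<lambda>k x. (1 / a (Suc (sk k + j))) * x)"
    by (rule uo_mult(1)[OF _ uO_const_fun[OF B]]) (auto intro!: uo_const tendsto_norm_zero a1_lim)
  moreover have "uo C (\<lambda>_. 1) (\<lambda>k x. b (Suc (sk k + j)) / a (Suc (sk k + j)) - \<beta> (int j) / \<alpha> (int j))"
    by (subst uo_1_iff, rule ulim_const_fun[OF ba_lim])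
  ultimately have "uo C (\<lambda>_. 1) (\<lambda>k x. (1 / a (Suc (sk k + j))) * x - (b (Suc (sk k + j)) / a (Suc (sk k + j)) - \<beta> (int j) / \<alpha> (int j)))"
    using uo_diff by fastforce
  then show ?thesis unfolding Tk_eq uo_1_iff[symmetric] by (simp add: algebra_simps)
qed

lemma ubv_Ck: "bounded C \<Longrightarrow> j \<le> Suc N \<Longrightarrow> ubv C (\<lambda>k x. Ck k x j)"
  and ubv_Dk: "bounded C \<Longrightarrow> j \<le> Suc N \<Longrightarrow> ubv C (\<lambda>k x. Dk k x j)"
  unfolding Ck_def Dk_def by (intro ubv_rsol ubv_Rk ubv_Tk; simp)+

lemma ulim_Ck: "bounded C \<Longrightarrow> uniform_limit C (\<lambda>k x. Ck k x j) (\<lambda>_. cl j) sequentially"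
  and ulim_Dk: "bounded C \<Longrightarrow> uniform_limit C (\<lambda>k x. Dk k x j) (\<lambda>_. dl j) sequentially"
  unfolding Ck_def Dk_def cl_def dl_def per_sol_def by (intro ulim_rsol ulim_const_fun Rk_lim ulim_Tk; simp)+

lemma block_sol:
  assumes "jacobi_rec a b x U"
  shows "U (sk k + j) = Ck k x j * U (sk k) + Dk k x j * U (Suc (sk k))"
proof -
  have "U (sk k + j) = rsol (Rk k) (Tk k x) (U (sk k + 0)) (U (sk k + 1)) j"
    by (rule rsol_unique[where K=j]) (use assms in \<open>auto simp: jacobi_rec_def Rk_def Tk_def\<close>)
  also have "\<dots> = U (sk k) * Ck k x j + U (Suc (sk k)) * Dk k x j"
    unfolding Ck_def Dk_def by (subst rsol_linear) simp
  finally show ?thesis by (simp add: mult.commute)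
qed

lemma det_block: "Ck k x N * Dk k x (Suc N) - Ck k x (Suc N) * Dk k x N = A k / A (Suc k)"
  unfolding Ck_def Dk_def rsol_wronskian Rk_def
  by (simp add: prod_ratio_telescope A_def sk_Suc)

lemma A_ratio: "(\<lambda>k. A k / A (Suc k)) \<longlonglongrightarrow> 1"
proof -
  have "(\<lambda>k. \<Prod>j<N. Rk k j) \<longlonglongrightarrow> (\<Prod>j<N. \<alpha> (int j - 1) / \<alpha> (int j))"
    by (intro tendsto_prod Rk_lim)
  also have "(\<lambda>k. \<Prod>j<N. Rk k j) = (\<lambda>k. A k / A (Suc k))"
    by (auto simp: Rk_def prod_ratio_telescope A_def sk_Suc)
  also have "(\<Prod>j<N. \<alpha> (int j - 1) / \<alpha> (int j)) = \<alpha> (-1) / \<alpha> (int N - 1)"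
  proof -
    have "(\<Prod>j<n. \<alpha> (int j - 1) / \<alpha> (int j)) = \<alpha> (-1) / \<alpha> (int n - 1)" for n
      by (induction n) (auto simp: field_simps)
    then show ?thesis .
  qed
  also have "\<dots> = 1" using alpha_per[of 1 "-1"] by simp
  finally show ?thesis .
qed

lemma det_lim: "cl N * dl (Suc N) - cl (Suc N) * dl N = 1"
proof -
  have "(\<lambda>k. Ck k 0 N * Dk k 0 (Suc N) - Ck k 0 (Suc N) * Dk k 0 N) \<longlonglongrightarrow> cl N * dl (Suc N) - cl (Suc N) * dl N"
    by (intro tendsto_intros tendsto_uniform_limitI[OF ulim_Ck[of "{0}"]] tendsto_uniform_limitI[OF ulim_Dk[of "{0}"]]) auto
  then show ?thesis unfolding det_block using A_ratio LIMSEQ_unique by blast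
qed

text \<open>The pairs must not vanish because the quadratic form below has to be bounded away from 0
  at each single block and not just in the limit.\<close>

definition goodsol :: "real set \<Rightarrow> (nat \<Rightarrow> real \<Rightarrow> real) \<Rightarrow> bool" where
  "goodsol C U \<longleftrightarrow> compact C \<and> (\<forall>n. continuous_on C (U n)) \<and> (\<forall>x\<in>C. jacobi_rec a b x (\<lambda>n. U n x))
     \<and> (\<forall>x\<in>C. \<forall>n. (U n x, U (Suc n) x) \<noteq> (0, 0))"

lemma goodsol_comb:
  assumes "compact C" "(c, d) \<noteq> (0, 0)"
  shows "goodsol C (\<lambda>n x. c * orthP a b n x + d * orthQ a b n x)"
  unfolding goodsol_def
  by (intro conjI allI ballI assms jacobi_comb_nonzero a_pos continuous_intros jacobi_rec_comb jacobi_rec_orthP jacobi_rec_orthQ)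

text \<open>For a solution of the recurrence the bracket is the N-shifted Turan determinant
  \<open>u * v' - v * u'\<close>, where \<open>(u, v)\<close> is the pair at \<open>sk k\<close> and
  \<open>(u', v')\<close> the pair one block later. It is written as a quadratic form in
  \<open>(u, v)\<close> alone so that its definiteness can be used.\<close>

definition Sf :: "(nat \<Rightarrow> real \<Rightarrow> real) \<Rightarrow> nat \<Rightarrow> real \<Rightarrow> real" where
  "Sf U k x = A k * (Ck k x (Suc N) * (U (sk k) x)\<^sup>2 + (Dk k x (Suc N) - Ck k x N) * U (sk k) x * U (Suc (sk k)) x
     - Dk k x N * (U (Suc (sk k)) x)\<^sup>2)"

text \<open>With \<open>X\<close> the block matrix,
  \<open>det (X w, X X w) = det X * det (w, X w)\<close>, and \<open>det X\<close> is
  \<open>A k / A (Suc k)\<close>. The form with the old coefficients thus keeps its value from one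
  block to the next. Only the change of the coefficients is left, evaluated at the new pair; this is
  why relative bounds will refer to the later value.\<close>

lemma Sf_diff:
  assumes "jacobi_rec a b x (\<lambda>n. U n x)"
  shows "Sf U (Suc k) x - Sf U k x = A (Suc k) *
    ((Ck (Suc k) x (Suc N) - Ck k x (Suc N)) * (U (sk (Suc k)) x)\<^sup>2
     + ((Dk (Suc k) x (Suc N) - Dk k x (Suc N)) - (Ck (Suc k) x N - Ck k x N)) * U (sk (Suc k)) x * U (Suc (sk (Suc k))) x
     - (Dk (Suc k) x N - Dk k x N) * (U (Suc (sk (Suc k))) x)\<^sup>2)"
proof -
  define p q r s where "p = Ck k x N" "q = Dk k x N" "r = Ck k x (Suc N)" "s = Dk k x (Suc N)"
  define u v where "u = U (sk k) x" "v = U (Suc (sk k)) x"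
  have u': "U (sk (Suc k)) x = p * u + q * v"
    using block_sol[OF assms, of k N] by (simp add: sk_Suc p_q_r_s_def u_v_def)
  have v': "U (Suc (sk (Suc k))) x = r * u + s * v"
    using block_sol[OF assms, of k "Suc N"] by (simp add: sk_Suc p_q_r_s_def u_v_def)
  have det: "A k = A (Suc k) * (p * s - r * q)"
    using det_block[of k x] by (simp add: p_q_r_s_def field_simps)
  show ?thesis
    unfolding Sf_def p_q_r_s_def[symmetric] u_v_def[symmetric] u' v'
    unfolding det by (simp add: algebra_simps power2_eq_square)
qed

lemma disc_pos: "4 - (cl N + dl (Suc N))\<^sup>2 > 0"
  using ell abs_square_less_1[of "(cl N + dl (Suc N)) / 2"] unfolding cl_def dl_def
  by (simp add: power_divide)

lemma disc_eq: "- ((dl (Suc N) - cl N)\<^sup>2 + 4 * dl N * cl (Suc N)) = 4 - (cl N + dl (Suc N))\<^sup>2"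
  using det_lim by (simp add: power2_eq_square algebra_simps)

text \<open>The discriminant of the block form converges uniformly to a negative number, so the form
  is eventually definite with a uniform constant. The constants \<open>c\<close> and
  \<open>K\<close> serve all functions \<open>U\<close> at once.\<close>

lemma Sf_lower:
  assumes "bounded C"
  obtains c K where "c > 0" "\<And>k x U. k \<ge> K \<Longrightarrow> x \<in> C \<Longrightarrow> c * (A k * ((U (sk k) x)\<^sup>2 + (U (Suc (sk k)) x)\<^sup>2)) \<le> \<bar>Sf U k x\<bar>"
proof -
  define D where "D = 4 - (cl N + dl (Suc N))\<^sup>2"
  have D: "D > 0" using disc_pos by (simp add: D_def)
  have l1: "uniform_limit C (\<lambda>k x. (Dk k x (Suc N) - Ck k x N) * (Dk k x (Suc N) - Ck k x N)) (\<lambda>_. (dl (Suc N) - cl N) * (dl (Suc N) - cl N)) sequentially"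
    by (intro ulim_mult_uo uniform_limit_minus ulim_Ck ulim_Dk assms)
  have l2: "uniform_limit C (\<lambda>k x. Dk k x N * Ck k x (Suc N)) (\<lambda>_. dl N * cl (Suc N)) sequentially"
    by (intro ulim_mult_uo uniform_limit_minus ulim_Ck ulim_Dk assms)
  have "\<forall>\<^sub>F k in sequentially. \<forall>x\<in>C. dist ((Dk k x (Suc N) - Ck k x N) * (Dk k x (Suc N) - Ck k x N)) ((dl (Suc N) - cl N) * (dl (Suc N) - cl N)) < D / 4"
    using uniform_limitD[OF l1, of "D/4"] D by simp
  moreover have "\<forall>\<^sub>F k in sequentially. \<forall>x\<in>C. dist (Dk k x N * Ck k x (Suc N)) (dl N * cl (Suc N)) < D / 16"
    using uniform_limitD[OF l2, of "D/16"] D by simp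
  ultimately have "\<forall>\<^sub>F k in sequentially. \<forall>x\<in>C. - ((Dk k x (Suc N) - Ck k x N)\<^sup>2 + 4 * Dk k x N * Ck k x (Suc N)) \<ge> D / 2"
  proof eventually_elim
    case (elim k)
    show ?case
    proof
      fix x assume "x \<in> C"
      then have "\<bar>(Dk k x (Suc N) - Ck k x N)\<^sup>2 - (dl (Suc N) - cl N)\<^sup>2\<bar> < D/4" "\<bar>Dk k x N * Ck k x (Suc N) - dl N * cl (Suc N)\<bar> < D/16"
        using elim by (auto simp: dist_real_def power2_eq_square)
      moreover have "- ((dl (Suc N) - cl N)\<^sup>2 + 4 * (dl N * cl (Suc N))) = D" using disc_eq by (simp add: D_def)
      ultimately show "- ((Dk k x (Suc N) - Ck k x N)\<^sup>2 + 4 * Dk k x N * Ck k x (Suc N)) \<ge> D / 2"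
        unfolding mult.assoc by linarith
    qed
  qed
  then obtain K where K: "\<And>k x. k \<ge> K \<Longrightarrow> x \<in> C \<Longrightarrow> - ((Dk k x (Suc N) - Ck k x N)\<^sup>2 + 4 * Dk k x N * Ck k x (Suc N)) \<ge> D / 2"
    unfolding eventually_sequentially by blast
  obtain B1 where B1: "\<And>k x. x \<in> C \<Longrightarrow> \<bar>Dk k x N\<bar> \<le> B1" using ubv_Dk[OF assms, of N] unfolding ubv_def by auto
  obtain B2 where B2: "\<And>k x. x \<in> C \<Longrightarrow> \<bar>Ck k x (Suc N)\<bar> \<le> B2" using ubv_Ck[OF assms, of "Suc N"] unfolding ubv_def by auto
  define B where "B = \<bar>B1\<bar> + \<bar>B2\<bar> + 1"
  have B: "B > 0" by (simp add: B_def)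
  show ?thesis
  proof (rule that[of "D / (8 * B)" K])
    show "D / (8 * B) > 0" using D B by simp
    fix k x and U :: "nat \<Rightarrow> real \<Rightarrow> real" assume k: "k \<ge> K" and x: "x \<in> C"
    define u v where "u = U (sk k) x" "v = U (Suc (sk k)) x"
    define f where "f = Ck k x (Suc N) * u\<^sup>2 + (Dk k x (Suc N) - Ck k x N) * u * v - Dk k x N * v\<^sup>2"
    have "D / 2 / 4 * (u\<^sup>2 + v\<^sup>2) \<le> - ((Dk k x (Suc N) - Ck k x N)\<^sup>2 + 4 * Dk k x N * Ck k x (Suc N)) / 4 * (u\<^sup>2 + v\<^sup>2)"
      by (intro mult_right_mono divide_right_mono K k x) auto
    also have "\<dots> \<le> (\<bar>Dk k x N\<bar> + \<bar>Ck k x (Suc N)\<bar>) * \<bar>f\<bar>" unfolding f_def by (rule elliptic_form_lower)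
    also have "\<dots> \<le> B * \<bar>f\<bar>" by (intro mult_right_mono) (use B1[OF x, of k] B2[OF x, of k] in \<open>auto simp: B_def\<close>)
    finally have "D / (8 * B) * (u\<^sup>2 + v\<^sup>2) \<le> \<bar>f\<bar>" using B by (simp add: field_simps)
    then have "A k * (D / (8 * B) * (u\<^sup>2 + v\<^sup>2)) \<le> A k * \<bar>f\<bar>" by (intro mult_left_mono) (auto intro: less_imp_le)
    also have "A k * \<bar>f\<bar> = \<bar>Sf U k x\<bar>" unfolding Sf_def f_def u_v_def by (simp add: abs_mult less_imp_le)
    finally show "D / (8 * B) * (A k * ((U (sk k) x)\<^sup>2 + (U (Suc (sk k)) x)\<^sup>2)) \<le> \<bar>Sf U k x\<bar>"
      by (simp add: u_v_def mult_ac)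
  qed
qed

end

section \<open>Asymptotic diagonalization over one period\<close>

context modulated_jacobi begin

text \<open>\<open>Sf_diff\<close> bounds an increment by summable coefficient differences times the
  squared norm of the pair, and \<open>Sf_lower\<close> bounds this squared norm by the form itself.
  This is the relative bound that \<open>relative_bv_converges\<close> asks for.\<close>

lemma Sf_limit:
  assumes "goodsol C U"
  obtains l c B where "uniform_limit C (Sf U) l sequentially" "c > 0" "\<And>x. x \<in> C \<Longrightarrow> c \<le> \<bar>l x\<bar>" "\<And>x. x \<in> C \<Longrightarrow> \<bar>l x\<bar> \<le> B"
proof -
  have C: "compact C" "bounded C" using assms compact_imp_bounded unfolding goodsol_def by auto
  have cont: "continuous_on C (U n)" for n using assms unfolding goodsol_def by auto
  obtain c0 K where c0: "c0 > 0" and K: "\<And>k x U. k \<ge> K \<Longrightarrow> x \<in> C \<Longrightarrow>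
      c0 * (A k * ((U (sk k) x)\<^sup>2 + (U (Suc (sk k)) x)\<^sup>2)) \<le> \<bar>Sf U k x\<bar>"
    using Sf_lower[OF C(2)] by metis
  obtain d1 where d1: "summable d1" "\<And>k. d1 k \<ge> 0" "\<And>k x. x \<in> C \<Longrightarrow> \<bar>Ck (Suc k) x N - Ck k x N\<bar> \<le> d1 k"
    using ubv_Ck[OF C(2), of N] unfolding ubv_def by auto
  obtain d2 where d2: "summable d2" "\<And>k. d2 k \<ge> 0" "\<And>k x. x \<in> C \<Longrightarrow> \<bar>Dk (Suc k) x N - Dk k x N\<bar> \<le> d2 k"
    using ubv_Dk[OF C(2), of N] unfolding ubv_def by auto
  obtain d3 where d3: "summable d3" "\<And>k. d3 k \<ge> 0" "\<And>k x. x \<in> C \<Longrightarrow> \<bar>Ck (Suc k) x (Suc N) - Ck k x (Suc N)\<bar> \<le> d3 k"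
    using ubv_Ck[OF C(2), of "Suc N"] unfolding ubv_def by auto
  obtain d4 where d4: "summable d4" "\<And>k. d4 k \<ge> 0" "\<And>k x. x \<in> C \<Longrightarrow> \<bar>Dk (Suc k) x (Suc N) - Dk k x (Suc N)\<bar> \<le> d4 k"
    using ubv_Dk[OF C(2), of "Suc N"] unfolding ubv_def by auto
  define d where "d = (\<lambda>k. (d1 k + d2 k + d3 k + d4 k) / c0)"
  have d: "summable d" "\<And>k. d k \<ge> 0"
    unfolding d_def using d1 d2 d3 d4 c0 by (auto intro!: summable_divide summable_add divide_nonneg_pos add_nonneg_nonneg)
  have main: "\<bar>Sf U (Suc k) x - Sf U k x\<bar> \<le> d k * \<bar>Sf U (Suc k) x\<bar>" if k: "k \<ge> K" and x: "x \<in> C" for k x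
  proof -
    have j: "jacobi_rec a b x (\<lambda>n. U n x)" using assms x unfolding goodsol_def by auto
    define u v where "u = U (sk (Suc k)) x" "v = U (Suc (sk (Suc k))) x"
    define e1 e2 e3 e4 where e: "e1 = Ck (Suc k) x N - Ck k x N" "e2 = Dk (Suc k) x N - Dk k x N"
      "e3 = Ck (Suc k) x (Suc N) - Ck k x (Suc N)" "e4 = Dk (Suc k) x (Suc N) - Dk k x (Suc N)"
    have uv: "\<bar>u * v\<bar> \<le> u\<^sup>2 + v\<^sup>2"
      using sum_squares_bound[of "\<bar>u\<bar>" "\<bar>v\<bar>"] mult_nonneg_nonneg[OF abs_ge_zero[of u] abs_ge_zero[of v]]
      unfolding abs_mult power2_abs by linarith
    have eb: "\<bar>e1\<bar> \<le> d1 k" "\<bar>e2\<bar> \<le> d2 k" "\<bar>e3\<bar> \<le> d3 k" "\<bar>e4\<bar> \<le> d4 k" using d1 d2 d3 d4 x e by auto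
    have "\<bar>e3 * u\<^sup>2 + (e4 - e1) * u * v - e2 * v\<^sup>2\<bar> \<le> \<bar>e3\<bar> * u\<^sup>2 + (\<bar>e4\<bar> + \<bar>e1\<bar>) * \<bar>u * v\<bar> + \<bar>e2\<bar> * v\<^sup>2"
    proof -
      have "\<bar>e3 * u\<^sup>2 + (e4 - e1) * u * v - e2 * v\<^sup>2\<bar> \<le> \<bar>e3 * u\<^sup>2\<bar> + \<bar>(e4 - e1) * (u * v)\<bar> + \<bar>e2 * v\<^sup>2\<bar>" by (simp add: mult.assoc)
      also have "\<dots> = \<bar>e3\<bar> * u\<^sup>2 + \<bar>e4 - e1\<bar> * \<bar>u * v\<bar> + \<bar>e2\<bar> * v\<^sup>2" by (simp add: abs_mult)
      also have "\<dots> \<le> \<bar>e3\<bar> * u\<^sup>2 + (\<bar>e4\<bar> + \<bar>e1\<bar>) * \<bar>u * v\<bar> + \<bar>e2\<bar> * v\<^sup>2"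
        by (intro add_mono mult_right_mono) auto
      finally show ?thesis .
    qed
    also have "\<dots> \<le> d3 k * (u\<^sup>2 + v\<^sup>2) + (d4 k + d1 k) * (u\<^sup>2 + v\<^sup>2) + d2 k * (u\<^sup>2 + v\<^sup>2)"
      by (intro add_mono mult_mono) (use eb uv d1(2) d2(2) d3(2) d4(2) in \<open>auto intro: add_mono add_nonneg_nonneg\<close>)
    also have "\<dots> = d k * (c0 * (u\<^sup>2 + v\<^sup>2))" using c0 by (simp add: d_def field_simps)
    finally have *: "\<bar>e3 * u\<^sup>2 + (e4 - e1) * u * v - e2 * v\<^sup>2\<bar> \<le> d k * (c0 * (u\<^sup>2 + v\<^sup>2))" .
    have "\<bar>Sf U (Suc k) x - Sf U k x\<bar> = A (Suc k) * \<bar>e3 * u\<^sup>2 + (e4 - e1) * u * v - e2 * v\<^sup>2\<bar>"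
      unfolding Sf_diff[where U=U, OF j] e[symmetric] u_v_def[symmetric] by (simp add: abs_mult less_imp_le)
    also have "\<dots> \<le> A (Suc k) * (d k * (c0 * (u\<^sup>2 + v\<^sup>2)))" by (intro mult_left_mono *) (simp add: less_imp_le)
    also have "\<dots> = d k * (c0 * (A (Suc k) * (u\<^sup>2 + v\<^sup>2)))" by simp
    also have "\<dots> \<le> d k * \<bar>Sf U (Suc k) x\<bar>" unfolding u_v_def by (intro mult_left_mono K d x) (use k in auto)
    finally show ?thesis .
  qed
  have contC: "continuous_on C (\<lambda>x. Ck k x j)" "continuous_on C (\<lambda>x. Dk k x j)" for k j
    unfolding Ck_def Dk_def by (induction j rule: induct_nat_012) (auto intro!: continuous_intros simp: Tk_def)
  have contS: "continuous_on C (Sf U k)" for k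
    unfolding Sf_def[abs_def] by (intro continuous_intros cont contC)
  have bnd: "\<exists>B. \<forall>x\<in>C. \<bar>Sf U k x\<bar> \<le> B" for k
  proof -
    have "bounded (Sf U k ` C)" using compact_continuous_image[OF contS C(1)] compact_imp_bounded by blast
    then show ?thesis unfolding bounded_iff by auto
  qed
  \<comment> \<open>Definiteness is known from block \<open>K\<close> on, so the sequence is shifted
    by \<open>K\<close>. Compactness and the non-vanishing of the pairs turn pointwise positivity
    into a uniform bound.\<close>
  have low: "\<exists>c>0. \<forall>x\<in>C. \<bar>Sf U (k + K) x\<bar> \<ge> c" for k
  proof (cases "C = {}")
    case False
    have "continuous_on C (\<lambda>x. \<bar>Sf U (k + K) x\<bar>)" by (intro continuous_intros contS)
    from continuous_attains_inf[OF C(1) False this] obtain x where x: "x \<in> C" "\<And>y. y \<in> C \<Longrightarrow> \<bar>Sf U (k+K) x\<bar> \<le> \<bar>Sf U (k+K) y\<bar>" by blast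
    have "(U (sk (k+K)) x, U (Suc (sk (k+K))) x) \<noteq> (0,0)" using assms x unfolding goodsol_def by auto
    then have "(U (sk (k+K)) x)\<^sup>2 + (U (Suc (sk (k+K))) x)\<^sup>2 > 0" by (simp add: sum_power2_gt_zero_iff)
    then have "c0 * (A (k+K) * ((U (sk (k+K)) x)\<^sup>2 + (U (Suc (sk (k+K))) x)\<^sup>2)) > 0" using c0 by simp
    then have "\<bar>Sf U (k+K) x\<bar> > 0" using K[of "k+K" x U] x by linarith
    then show ?thesis using x by blast
  qed (auto intro: exI[of _ 1])
  obtain l c B where l: "uniform_limit C (\<lambda>k. Sf U (k + K)) l sequentially" "c > 0" "\<And>x. x \<in> C \<Longrightarrow> c \<le> \<bar>l x\<bar>" "\<And>x. x \<in> C \<Longrightarrow> \<bar>l x\<bar> \<le> B"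
  proof (rule relative_bv_converges[where f="\<lambda>k. Sf U (k + K)" and \<delta>="\<lambda>k. d (k + K)" and C=C and K=0])
    show "summable (\<lambda>k. d (k + K))" using d by (simp add: summable_iff_shift)
    show "\<bar>Sf U (Suc k + K) x - Sf U (k + K) x\<bar> \<le> d (k + K) * \<bar>Sf U (Suc k + K) x\<bar>" if "x \<in> C" for k x
      using main[of "k+K" x] that by simp
  qed (use d bnd low in auto)
  have "uniform_limit C (Sf U) l sequentially"
    using l(1) unfolding uniform_limit_iff
    by (subst eventually_sequentially_seg[symmetric, of _ K]) auto
  with l show ?thesis using that by blast
qed

section \<open>The rotating coordinate attached to the limit matrix\<close>

lemma norm_comb_square: "(cmod (of_real v - z * of_real u))\<^sup>2 = v\<^sup>2 - 2 * Re z * u * v + (cmod z)\<^sup>2 * u\<^sup>2"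
  unfolding cmod_power2 by (simp add: power2_eq_square algebra_simps)

text \<open>The row vector \<open>(- zeta, 1)\<close> is a left eigenvector of the limit block
  matrix for the eigenvalue \<open>lam\<close>. Of the two conjugate roots the one in the lower
  half-plane is taken; this sign later makes the Weyl functions regular in the upper
  half-plane.\<close>

definition zeta :: complex where
  "zeta = Complex ((dl (Suc N) - cl N) / (2 * dl N)) (- (sqrt (4 - (cl N + dl (Suc N))\<^sup>2) / (2 * \<bar>dl N\<bar>)))"

definition lam :: complex where "lam = of_real (dl (Suc N)) - zeta * of_real (dl N)"

lemma dl_nz: "dl N \<noteq> 0"
proof
  assume "dl N = 0"
  then have "- ((dl (Suc N) - cl N)\<^sup>2) = 4 - (cl N + dl (Suc N))\<^sup>2" using disc_eq by simp
  moreover have "- ((dl (Suc N) - cl N)\<^sup>2) \<le> 0" by simp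
  ultimately show False using disc_pos by linarith
qed

lemma Im_zeta: "Im zeta < 0"
  using disc_pos dl_nz by (simp add: zeta_def)

lemma norm_zeta: "(cmod zeta)\<^sup>2 = - cl (Suc N) / dl N"
proof -
  have "(cmod zeta)\<^sup>2 = ((dl (Suc N) - cl N) / (2 * dl N))\<^sup>2 + (sqrt (4 - (cl N + dl (Suc N))\<^sup>2) / (2 * \<bar>dl N\<bar>))\<^sup>2"
    by (simp add: zeta_def cmod_power2)
  also have "\<dots> = ((dl (Suc N) - cl N)\<^sup>2 + (4 - (cl N + dl (Suc N))\<^sup>2)) / (4 * (dl N)\<^sup>2)"
    using disc_pos by (simp add: power_divide power_mult_distrib add_divide_distrib)
  also have "\<dots> = - cl (Suc N) / dl N"
    unfolding disc_eq[symmetric] using dl_nz by (simp add: field_simps power2_eq_square)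
  finally show ?thesis .
qed

lemma Re_zeta: "Re zeta = (dl (Suc N) - cl N) / (2 * dl N)" by (simp add: zeta_def)

lemma zeta_root: "of_real (dl N) * zeta\<^sup>2 + of_real (cl N - dl (Suc N)) * zeta - of_real (cl (Suc N)) = 0"
proof -
  have "zeta\<^sup>2 = 2 * of_real (Re zeta) * zeta - of_real ((cmod zeta)\<^sup>2)"
    by (simp add: complex_eq_iff Re_power2 Im_power2 cmod_power2) (simp add: power2_eq_square)
  also have "of_real (dl N) * \<dots> = of_real (2 * dl N * Re zeta) * zeta - of_real (dl N * (cmod zeta)\<^sup>2)"
    by (simp add: algebra_simps)
  also have "2 * dl N * Re zeta = dl (Suc N) - cl N" using dl_nz by (simp add: Re_zeta)
  also have "dl N * (cmod zeta)\<^sup>2 = - cl (Suc N)" using dl_nz by (simp add: norm_zeta)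
  finally show ?thesis by (simp add: algebra_simps)
qed

lemma lam_zeta: "lam * zeta = of_real (cl N) * zeta - of_real (cl (Suc N))"
  using zeta_root by (simp add: lam_def algebra_simps power2_eq_square)

lemma Im_lam: "Im lam \<noteq> 0" using Im_zeta dl_nz by (simp add: lam_def)

lemma lam2_ne_1: "lam\<^sup>2 \<noteq> 1"
  using Im_lam by (auto simp: power2_eq_1_iff)

text \<open>The left eigenvector applied to the pair at the start of block \<open>k\<close>. A step
  over one block becomes, up to an error, multiplication by \<open>lam\<close>, and the single
  complex number determines the real pair because \<open>zeta\<close> is not real.\<close>

definition zk :: "(nat \<Rightarrow> real \<Rightarrow> real) \<Rightarrow> nat \<Rightarrow> real \<Rightarrow> complex" where
  "zk U k x = of_real (U (Suc (sk k)) x) - zeta * of_real (U (sk k) x)"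

text \<open>Up to the factor \<open>- 1 / dl N\<close> the squared modulus is the limit of the block
  forms, so convergence of \<open>Sf\<close> becomes convergence of \<open>A k\<close> times the
  squared modulus.\<close>

lemma norm_zk: "(cmod (zk U k x))\<^sup>2 = - (cl (Suc N) * (U (sk k) x)\<^sup>2 + (dl (Suc N) - cl N) * U (sk k) x * U (Suc (sk k)) x
     - dl N * (U (Suc (sk k)) x)\<^sup>2) / dl N"
proof -
  define u v where "u = U (sk k) x" "v = U (Suc (sk k)) x"
  have "(cmod (zk U k x))\<^sup>2 = v\<^sup>2 - 2 * Re zeta * u * v + (cmod zeta)\<^sup>2 * u\<^sup>2"
    unfolding zk_def u_v_def by (rule norm_comb_square)
  also have "\<dots> = - (cl (Suc N) * u\<^sup>2 + (dl (Suc N) - cl N) * u * v - dl N * v\<^sup>2) / dl N"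
    unfolding Re_zeta norm_zeta using dl_nz by (simp add: field_simps)
  finally show ?thesis by (simp add: u_v_def)
qed

lemma abs_w [simp]: "\<bar>w k\<bar> = w k" by (simp add: less_imp_le)

lemma sqrt_w: "sqrt (w k) * sqrt (w k) = w k" by (simp add: less_imp_le)

lemma uv_bounds:
  assumes "goodsol C U"
  shows "uO C (\<lambda>_. 1) (\<lambda>k x. A k * ((U (sk k) x)\<^sup>2 + (U (Suc (sk k)) x)\<^sup>2))" (is ?A)
    and "uO C (\<lambda>k. sqrt (w k)) (\<lambda>k x. U (sk k) x)" (is ?B)
    and "uO C (\<lambda>k. sqrt (w k)) (\<lambda>k x. U (Suc (sk k)) x)" (is ?C)
proof -
  have C: "compact C" "bounded C" using assms compact_imp_bounded unfolding goodsol_def by auto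
  obtain c0 K where c0: "c0 > 0" and K: "\<And>k x U. k \<ge> K \<Longrightarrow> x \<in> C \<Longrightarrow>
      c0 * (A k * ((U (sk k) x)\<^sup>2 + (U (Suc (sk k)) x)\<^sup>2)) \<le> \<bar>Sf U k x\<bar>"
    using Sf_lower[OF C(2)] by metis
  obtain l c B where l: "uniform_limit C (Sf U) l sequentially" "c > 0" "\<And>x. x \<in> C \<Longrightarrow> c \<le> \<bar>l x\<bar>" "\<And>x. x \<in> C \<Longrightarrow> \<bar>l x\<bar> \<le> B"
    using Sf_limit[OF assms] by blast
  define B1 where "B1 = (\<bar>B\<bar> + 1) / c0"
  have B1: "B1 > 0" using c0 by (simp add: B1_def)
  have ev: "\<forall>\<^sub>F k in sequentially. \<forall>x\<in>C. A k * ((U (sk k) x)\<^sup>2 + (U (Suc (sk k)) x)\<^sup>2) \<le> B1"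
    using uniform_limitD[OF l(1) zero_less_one] eventually_ge_at_top[of K]
  proof eventually_elim
    case (elim k)
    show ?case
    proof
      fix x assume x: "x \<in> C"
      have "c0 * (A k * ((U (sk k) x)\<^sup>2 + (U (Suc (sk k)) x)\<^sup>2)) \<le> \<bar>Sf U k x\<bar>" using K elim x by blast
      also have "\<dots> \<le> \<bar>B\<bar> + 1" using elim x l(4)[OF x] by (force simp: dist_real_def)
      finally show "A k * ((U (sk k) x)\<^sup>2 + (U (Suc (sk k)) x)\<^sup>2) \<le> B1" using c0 by (simp add: B1_def field_simps)
    qed
  qed
  show ?A by (rule uOI[where B=B1]) (use ev in \<open>eventually_elim; simp add: less_imp_le\<close>)
  have ev2: "\<forall>\<^sub>F k in sequentially. \<forall>x\<in>C. \<bar>U (sk k) x\<bar> \<le> sqrt B1 * sqrt (w k) \<and> \<bar>U (Suc (sk k)) x\<bar> \<le> sqrt B1 * sqrt (w k)"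
    using ev
  proof eventually_elim
    case (elim k)
    show ?case
    proof
      fix x assume "x \<in> C"
      then have *: "(U (sk k) x)\<^sup>2 + (U (Suc (sk k)) x)\<^sup>2 \<le> B1 * w k" using elim A_pos[of k]
        by (simp add: w_def field_simps)
      have "(U (sk k) x)\<^sup>2 \<le> B1 * w k" "(U (Suc (sk k)) x)\<^sup>2 \<le> B1 * w k"
        using * zero_le_power2[of "U (sk k) x"] zero_le_power2[of "U (Suc (sk k)) x"] by linarith+
      then have "\<bar>U (sk k) x\<bar> \<le> sqrt (B1 * w k)" "\<bar>U (Suc (sk k)) x\<bar> \<le> sqrt (B1 * w k)"
        by (auto intro: real_le_rsqrt)
      then show "\<bar>U (sk k) x\<bar> \<le> sqrt B1 * sqrt (w k) \<and> \<bar>U (Suc (sk k)) x\<bar> \<le> sqrt B1 * sqrt (w k)"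
        by (simp add: real_sqrt_mult)
    qed
  qed
  show ?B by (rule uOI[where B="sqrt B1"]) (use ev2 in \<open>eventually_elim; simp\<close>)
  show ?C by (rule uOI[where B="sqrt B1"]) (use ev2 in \<open>eventually_elim; simp\<close>)
qed

lemma uo_coeffs:
  assumes "bounded C"
  shows "uo C (\<lambda>_. 1) (\<lambda>k x. Ck k x j - cl j)" "uo C (\<lambda>_. 1) (\<lambda>k x. Dk k x j - dl j)"
  by (subst uo_1_iff, rule ulim_Ck ulim_Dk, rule assms)+

lemma norm_zk_limit:
  assumes "goodsol C U"
  obtains g c B where "uniform_limit C (\<lambda>k x. A k * (cmod (zk U k x))\<^sup>2) g sequentially" "c > 0"
    "\<And>x. x \<in> C \<Longrightarrow> c \<le> g x" "\<And>x. x \<in> C \<Longrightarrow> g x \<le> B"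
proof -
  have C: "compact C" "bounded C" using assms compact_imp_bounded unfolding goodsol_def by auto
  obtain l c B where l: "uniform_limit C (Sf U) l sequentially" "c > 0" "\<And>x. x \<in> C \<Longrightarrow> c \<le> \<bar>l x\<bar>" "\<And>x. x \<in> C \<Longrightarrow> \<bar>l x\<bar> \<le> B"
    using Sf_limit[OF assms] by blast
  define g where "g = (\<lambda>x. - l x / dl N)"
  note ub = uv_bounds(2,3)[OF assms]
  have q: "uO C w (\<lambda>k x. U (sk k) x * U (sk k) x)" "uO C w (\<lambda>k x. U (sk k) x * U (Suc (sk k)) x)"
     "uO C w (\<lambda>k x. U (Suc (sk k)) x * U (Suc (sk k)) x)"
    using uO_mult[OF ub(1) ub(1)] uO_mult[OF ub(1) ub(2)] uO_mult[OF ub(2) ub(2)] by (simp_all add: sqrt_w less_imp_le)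
  note um = uo_mult(1)[OF uo_coeffs(1)[OF C(2)]] uo_mult(1)[OF uo_coeffs(2)[OF C(2)]]
  have "uo C (\<lambda>k. 1 * w k) (\<lambda>k x. (Ck k x (Suc N) - cl (Suc N)) * (U (sk k) x * U (sk k) x)
     + ((Dk k x (Suc N) - dl (Suc N)) * (U (sk k) x * U (Suc (sk k)) x) - (Ck k x N - cl N) * (U (sk k) x * U (Suc (sk k)) x))
     - (Dk k x N - dl N) * (U (Suc (sk k)) x * U (Suc (sk k)) x))"
    by (intro uo_add uo_diff um q) (auto intro: less_imp_le)
  then have *: "uo C w (\<lambda>k x. (Ck k x (Suc N) - cl (Suc N)) * (U (sk k) x * U (sk k) x)
     + ((Dk k x (Suc N) - dl (Suc N)) * (U (sk k) x * U (Suc (sk k)) x) - (Ck k x N - cl N) * (U (sk k) x * U (Suc (sk k)) x))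
     - (Dk k x N - dl N) * (U (Suc (sk k)) x * U (Suc (sk k)) x))" by simp
  have "Sf U k x / A k + dl N * (cmod (zk U k x))\<^sup>2 = (Ck k x (Suc N) - cl (Suc N)) * (U (sk k) x * U (sk k) x)
     + ((Dk k x (Suc N) - dl (Suc N)) * (U (sk k) x * U (Suc (sk k)) x) - (Ck k x N - cl N) * (U (sk k) x * U (Suc (sk k)) x))
     - (Dk k x N - dl N) * (U (Suc (sk k)) x * U (Suc (sk k)) x)" for k x
  proof -
    have "Sf U k x / A k = Ck k x (Suc N) * (U (sk k) x)\<^sup>2 + (Dk k x (Suc N) - Ck k x N) * U (sk k) x * U (Suc (sk k)) x
     - Dk k x N * (U (Suc (sk k)) x)\<^sup>2" by (simp add: Sf_def)
    moreover have "dl N * (cmod (zk U k x))\<^sup>2 = - (cl (Suc N) * (U (sk k) x)\<^sup>2 + (dl (Suc N) - cl N) * U (sk k) x * U (Suc (sk k)) x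
     - dl N * (U (Suc (sk k)) x)\<^sup>2)" using dl_nz by (simp add: norm_zk)
    ultimately show ?thesis by (simp only:) (simp add: algebra_simps power2_eq_square)
  qed
  with * have e: "uo C w (\<lambda>k x. Sf U k x / A k + dl N * (cmod (zk U k x))\<^sup>2)" by simp
  have e2: "uo C (\<lambda>_. 1) (\<lambda>k x. A k * (Sf U k x / A k + dl N * (cmod (zk U k x))\<^sup>2))"
  proof -
    have "uO C A (\<lambda>k x. A k)" by (rule uOI[where B=1]) (auto simp: less_imp_le)
    from uo_mult(2)[OF e this] have "uo C (\<lambda>k. w k * A k) (\<lambda>k x. A k * (Sf U k x / A k + dl N * (cmod (zk U k x))\<^sup>2))"
      by (simp add: less_imp_le)
    then show ?thesis by (simp add: w_def)
  qed
  have "uo C (\<lambda>_. 1) (\<lambda>k x. Sf U k x - l x)" using l(1) by (simp add: uo_1_iff)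
  from uo_diff[OF e2 this]
  have e3: "uo C (\<lambda>_. 1) (\<lambda>k x. A k * (Sf U k x / A k + dl N * (cmod (zk U k x))\<^sup>2) - (Sf U k x - l x))" .
  have "uO C (\<lambda>_. 1) (\<lambda>k x. 1 / dl N)" by (rule uO_const_fun) auto
  from uo_mult(1)[OF e3 this]
  have "uo C (\<lambda>_. 1 * 1) (\<lambda>k x. (A k * (Sf U k x / A k + dl N * (cmod (zk U k x))\<^sup>2) - (Sf U k x - l x)) * (1 / dl N))" by simp
  also have "(\<lambda>k x. (A k * (Sf U k x / A k + dl N * (cmod (zk U k x))\<^sup>2) - (Sf U k x - l x)) * (1 / dl N))
    = (\<lambda>k x. A k * (cmod (zk U k x))\<^sup>2 - g x)"
    unfolding g_def using dl_nz by (auto simp: field_simps fun_eq_iff)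
  finally have lim: "uniform_limit C (\<lambda>k x. A k * (cmod (zk U k x))\<^sup>2) g sequentially" by (simp add: uo_1_iff)
  have abs: "\<bar>g x\<bar> = \<bar>l x\<bar> / \<bar>dl N\<bar>" for x by (simp add: g_def)
  \<comment> \<open>The sign of \<open>l\<close> is unknown. Nonnegativity of the approximants
    settles it and turns the bounds on the absolute value of \<open>l\<close> into bounds on
    \<open>g\<close>.\<close>
  have g0: "g x \<ge> 0" if "x \<in> C" for x
    by (rule LIMSEQ_le_const[OF tendsto_uniform_limitI[OF lim that]]) (auto simp: less_imp_le)
  show ?thesis
  proof (rule that[OF lim, of "c / \<bar>dl N\<bar>" "B / \<bar>dl N\<bar>"])
    show "c / \<bar>dl N\<bar> > 0" using l(2) dl_nz by simp
    fix x assume x: "x \<in> C"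
    show "c / \<bar>dl N\<bar> \<le> g x" using abs[of x] g0[OF x] l(3)[OF x] by (simp add: divide_right_mono)
    show "g x \<le> B / \<bar>dl N\<bar>" using abs[of x] g0[OF x] l(4)[OF x] by (simp add: divide_right_mono)
  qed
qed

lemma zk_O:
  assumes "goodsol C U"
  shows "uO C (\<lambda>k. sqrt (w k)) (zk U)"
proof -
  note ub = uv_bounds(2,3)[OF assms]
  have "uO C (\<lambda>k. 1 * sqrt (w k)) (\<lambda>k x. zeta * of_real (U (sk k) x))"
    by (rule uO_mult[OF uO_const_fun]) (use ub in \<open>auto simp: less_imp_le\<close>)
  then have "uO C (\<lambda>k. sqrt (w k)) (\<lambda>k x. of_real (U (Suc (sk k)) x) - zeta * of_real (U (sk k) x))"
    by (intro uO_diff) (use ub in auto)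
  then show ?thesis unfolding zk_def[abs_def] .
qed

lemma zk_step:
  assumes "goodsol C U"
  shows "uo C (\<lambda>k. sqrt (w k)) (\<lambda>k x. zk U (Suc k) x - lam * zk U k x)"
proof -
  have C: "compact C" "bounded C" using assms compact_imp_bounded unfolding goodsol_def by auto
  note ub = uv_bounds(2,3)[OF assms]
  have cz: "uo C (\<lambda>_. 1) (\<lambda>k x. complex_of_real (Ck k x (Suc N) - cl (Suc N)) - zeta * of_real (Ck k x N - cl N))" (is "uo _ _ ?e")
    using uo_mult(2)[OF iffD2[OF uo_of_real uo_coeffs(1)[OF C(2), of N]] uO_const_fun[of C "\<lambda>_. zeta" "cmod zeta"]]
    by (intro uo_diff iffD2[OF uo_of_real] uo_coeffs C) auto
  have dz: "uo C (\<lambda>_. 1) (\<lambda>k x. complex_of_real (Dk k x (Suc N) - dl (Suc N)) - zeta * of_real (Dk k x N - dl N))" (is "uo _ _ ?f")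
    using uo_mult(2)[OF iffD2[OF uo_of_real uo_coeffs(2)[OF C(2), of N]] uO_const_fun[of C "\<lambda>_. zeta" "cmod zeta"]]
    by (intro uo_diff iffD2[OF uo_of_real] uo_coeffs C) auto
  have *: "uo C (\<lambda>k. 1 * sqrt (w k)) (\<lambda>k x. ?e k x * of_real (U (sk k) x) + ?f k x * of_real (U (Suc (sk k)) x))"
    by (intro uo_add uo_mult(1)[OF cz] uo_mult(1)[OF dz] iffD2[OF uO_of_real] ub) (auto simp: less_imp_le)
  show ?thesis
  proof (rule uo_norm_le[OF _ always_eventually, OF _ allI, OF _ ballI])
    show "uo C (\<lambda>k. sqrt (w k)) (\<lambda>k x. ?e k x * of_real (U (sk k) x) + ?f k x * of_real (U (Suc (sk k)) x))" using * by simp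
    fix k x assume x: "x \<in> C"
    have j: "jacobi_rec a b x (\<lambda>n. U n x)" using assms x unfolding goodsol_def by auto
    define u v where "u = complex_of_real (U (sk k) x)" "v = complex_of_real (U (Suc (sk k)) x)"
    have u': "of_real (U (sk (Suc k)) x) = of_real (Ck k x N) * u + of_real (Dk k x N) * v"
      using block_sol[OF j, of k N] by (simp add: sk_Suc u_v_def)
    have v': "of_real (U (Suc (sk (Suc k))) x) = of_real (Ck k x (Suc N)) * u + of_real (Dk k x (Suc N)) * v"
      using block_sol[OF j, of k "Suc N"] by (simp add: sk_Suc u_v_def)
    have "lam * (v - zeta * u) = lam * v - (lam * zeta) * u" by (simp add: algebra_simps)
    then have "zk U (Suc k) x - lam * zk U k x = ?e k x * u + ?f k x * v"
      unfolding zk_def u' v' u_v_def[symmetric] lam_zeta by (simp add: algebra_simps lam_def)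
    then show "norm (zk U (Suc k) x - lam * zk U k x) \<le> norm (?e k x * complex_of_real (U (sk k) x) + ?f k x * complex_of_real (U (Suc (sk k)) x))"
      by (simp add: u_v_def)
  qed
qed

section \<open>Averages with respect to the divergent block weights\<close>

definition W :: "nat \<Rightarrow> real" where "W n = (\<Sum>k<n. w k)"

text \<open>Consecutive values of \<open>a\<close> have bounded ratios, so each residue class of
  \<open>1 / a n\<close> is dominated by a multiple of \<open>w\<close>. Were \<open>w\<close>
  summable, all classes would be, against the Carleman condition.\<close>

lemma W_infinity: "filterlim W at_top sequentially"
proof -
  have "\<not> summable w"
  proof
    assume "summable w"
    have "summable (\<lambda>k. 1 / a (sk k + j))" for j
    proof (induction j)
      case 0 then show ?case using \<open>summable w\<close> by (simp add: w_def[abs_def] A_def)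
    next
      case (Suc j)
      obtain B where B: "\<And>k. \<bar>Rk k j\<bar> \<le> B" "B > 0" using convergent_imp_Bseq[OF convergentI[OF Rk_lim[of j]]]
        unfolding Bseq_def by auto
      show ?case
      proof (rule summable_comparison_test'[where g="\<lambda>k. B * (1 / a (sk k + j))" and N=0])
        fix k
        have "1 / a (sk k + Suc j) = Rk k j * (1 / a (sk k + j))" by (simp add: Rk_def)
        then show "norm (1 / a (sk k + Suc j)) \<le> B * (1 / a (sk k + j))"
          using B(1)[of k] a_pos[of "sk k + j"] by (simp add: abs_mult divide_right_mono)
      qed (use Suc in \<open>rule summable_mult\<close>)
    qed
    then have "summable (\<lambda>k. \<Sum>j<N. 1 / a (sk k + j))" by (intro summable_sum)
    then have "summable (\<lambda>k. \<Sum>j<N. 1 / a (k * N + j + M))" by (simp add: sk_def add_ac)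
    then obtain S where S: "\<And>n. (\<Sum>k<n. \<Sum>j<N. 1 / a (k * N + j + M)) \<le> S"
      using sum_le_suminf[of "\<lambda>k. \<Sum>j<N. 1 / a (k * N + j + M)"] a_pos by (metis (no_types, lifting) divide_nonneg_pos finite_lessThan sum_nonneg zero_le_one)
    have blk: "(\<Sum>i<n * N. 1 / a (i + M)) = (\<Sum>k<n. \<Sum>j<N. 1 / a (k * N + j + M))" for n
    proof -
      have "(\<Sum>i = k * N..<k * N + N. 1 / a (i + M)) = (\<Sum>j<N. 1 / a (k * N + j + M))" for k
        using sum.shift_bounds_nat_ivl[of "\<lambda>i. 1 / a (i + M)" 0 "k * N" N] by (simp add: atLeast0LessThan add_ac)
      then show ?thesis by (simp add: sum.nat_group[symmetric])
    qed
    have "summable (\<lambda>i. 1 / a (i + M))"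
    proof (rule summableI_nonneg_bounded[where x=S])
      fix n
      have "n * 1 \<le> n * N" by (rule mult_le_mono) (auto simp: N_eq)
      then have "(\<Sum>i<n. 1 / a (i + M)) \<le> (\<Sum>i<n * N. 1 / a (i + M))" using a_pos by (intro sum_mono2) (auto simp: less_imp_le)
      also have "\<dots> \<le> S" using blk S by simp
      finally show "(\<Sum>i<n. 1 / a (i + M)) \<le> S" .
    qed (use a_pos in \<open>simp add: less_imp_le\<close>)
    then have "summable (\<lambda>i. 1 / a i)" using summable_iff_shift[of "\<lambda>i. 1 / a i" M] by simp
    then show False using carleman by simp
  qed
  show ?thesis unfolding filterlim_at_top eventually_sequentially
  proof (rule ccontr)
    assume "\<not> (\<forall>Z. \<exists>N. \<forall>n\<ge>N. Z \<le> W n)"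
    then obtain Z where Z: "\<And>N. \<exists>n\<ge>N. W n < Z" by (auto simp: not_le)
    have "summable w"
    proof (rule summableI_nonneg_bounded[where x=Z])
      fix n
      obtain m where "m \<ge> n" "W m < Z" using Z by blast
      moreover have "W n \<le> W m" unfolding W_def by (rule sum_mono2) (use \<open>m \<ge> n\<close> in \<open>auto simp: less_imp_le\<close>)
      ultimately show "sum w {..<n} \<le> Z" by (simp add: W_def)
    qed (simp add: less_imp_le)
    then show False using \<open>\<not> summable w\<close> by simp
  qed
qed

lemma bdd_on:
  fixes f :: "real \<Rightarrow> 'a::real_normed_vector"
  assumes "compact C" "continuous_on C f"
  shows "\<exists>B. \<forall>x\<in>C. norm (f x) \<le> B"
  using compact_imp_bounded[OF compact_continuous_image[OF assms(2,1)]] unfolding bounded_iff by auto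

lemma uo_W:
  fixes e :: "nat \<Rightarrow> real \<Rightarrow> 'a::real_normed_vector"
  assumes "uo C w e" "\<And>k. \<exists>B. \<forall>x\<in>C. norm (e k x) \<le> B"
  shows "uo C W (\<lambda>n x. \<Sum>k<n. e k x)"
  using uo_sum[OF assms(1) _ _ assms(2)] W_infinity unfolding W_def[abs_def] by (simp add: less_imp_le)

lemma uo_W_bounded:
  assumes "uO C (\<lambda>_. 1) e"
  shows "uo C W e"
proof (rule uoI)
  fix \<epsilon> :: real assume "\<epsilon> > 0"
  obtain B where B: "B > 0" "\<forall>\<^sub>F k in sequentially. \<forall>x\<in>C. norm (e k x) \<le> B * 1" using uOE[OF assms] by auto
  have "\<forall>\<^sub>F k in sequentially. W k \<ge> B / \<epsilon>" using W_infinity by (simp add: filterlim_at_top)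
  with B(2) show "\<forall>\<^sub>F k in sequentially. \<forall>x\<in>C. norm (e k x) \<le> \<epsilon> * W k"
  proof eventually_elim
    case (elim k)
    have "B \<le> \<epsilon> * W k" using elim(2) \<open>\<epsilon> > 0\<close> by (simp add: field_simps)
    then show ?case using elim(1) by force
  qed
qed

text \<open>Telescoping \<open>z\<^sub>k\<^sub>+\<^sub>1\<^sup>2 = \<lambda>\<^sup>2 z\<^sub>k\<^sup>2 + o(w\<^sub>k)\<close> with \<open>\<lambda>\<^sup>2 \<noteq> 1\<close> kills the mean of \<open>z\<^sub>k\<^sup>2\<close>.\<close>

lemma zk_square_sum:
  assumes "goodsol C U"
  shows "uo C W (\<lambda>n x. \<Sum>k<n. (zk U k x)\<^sup>2)"
proof -
  have C: "compact C" using assms unfolding goodsol_def by auto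
  have contU: "continuous_on C (U n)" for n using assms unfolding goodsol_def by auto
  have contz: "continuous_on C (zk U k)" for k unfolding zk_def[abs_def] by (intro continuous_intros contU)
  have w0: "sqrt (w k) \<ge> 0" for k by (simp add: less_imp_le)
  have lz: "uO C (\<lambda>k. sqrt (w k)) (\<lambda>k x. lam * zk U k x)"
    using uO_mult[OF uO_const_fun[of C "\<lambda>_. lam" "cmod lam"] zk_O[OF assms]] w0 by simp
  have "uO C (\<lambda>k. sqrt (w k)) (\<lambda>k x. (zk U (Suc k) x - lam * zk U k x) + lam * zk U k x + lam * zk U k x)"
    by (intro uO_add uo_imp_uO[OF zk_step[OF assms]] lz)
  from uo_mult(1)[OF zk_step[OF assms] this w0 w0]
  have "uo C w (\<lambda>k x. (zk U (Suc k) x - lam * zk U k x) * (zk U (Suc k) x - lam * zk U k x + lam * zk U k x + lam * zk U k x))"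
    by (simp add: sqrt_w)
  also have "(\<lambda>k x. (zk U (Suc k) x - lam * zk U k x) * (zk U (Suc k) x - lam * zk U k x + lam * zk U k x + lam * zk U k x))
      = (\<lambda>k x. (zk U (Suc k) x)\<^sup>2 - lam\<^sup>2 * (zk U k x)\<^sup>2)" by (auto simp: fun_eq_iff algebra_simps power2_eq_square)
  finally have "uo C W (\<lambda>n x. \<Sum>k<n. (zk U (Suc k) x)\<^sup>2 - lam\<^sup>2 * (zk U k x)\<^sup>2)"
    by (rule uo_W) (intro bdd_on C continuous_intros contz)
  moreover have "uo C W (\<lambda>n x. (zk U 0 x)\<^sup>2 - (zk U n x)\<^sup>2)"
  proof (intro uo_W_bounded uO_diff)
    have "continuous_on C (\<lambda>x. (zk U 0 x)\<^sup>2)" by (intro continuous_intros contz)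
    then obtain B where "\<And>x. x \<in> C \<Longrightarrow> norm ((zk U 0 x)\<^sup>2) \<le> B"
      using bdd_on[OF C] by blast
    then show "uO C (\<lambda>_. 1) (\<lambda>k x. (zk U 0 x)\<^sup>2)" by (rule uO_const_fun)
    have "uO C w (\<lambda>k x. zk U k x * zk U k x)" using uO_mult[OF zk_O[OF assms] zk_O[OF assms] w0 w0] by (simp add: sqrt_w)
    then obtain B where B: "B > 0" "\<forall>\<^sub>F k in sequentially. \<forall>x\<in>C. norm (zk U k x * zk U k x) \<le> B * w k"
      by (rule uOE) (auto simp: less_imp_le)
    show "uO C (\<lambda>_. 1) (\<lambda>k x. (zk U k x)\<^sup>2)"
    proof (rule uOI[where B=B])
      have "\<forall>\<^sub>F k in sequentially. w k < 1" using order_tendstoD(2)[OF w_lim, of 1] by simp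
      with B(2) show "\<forall>\<^sub>F k in sequentially. \<forall>x\<in>C. cmod ((zk U k x)\<^sup>2) \<le> B * 1"
      proof eventually_elim
        case (elim k)
        have "B * w k \<le> B * 1" using elim B by (intro mult_left_mono) auto
        then show ?case using elim(1) by (fastforce simp: power2_eq_square)
      qed
    qed
  qed
  ultimately have "uo C W (\<lambda>n x. (\<Sum>k<n. (zk U (Suc k) x)\<^sup>2 - lam\<^sup>2 * (zk U k x)\<^sup>2) + ((zk U 0 x)\<^sup>2 - (zk U n x)\<^sup>2))" by (rule uo_add)
  also have "(\<lambda>n x. (\<Sum>k<n. (zk U (Suc k) x)\<^sup>2 - lam\<^sup>2 * (zk U k x)\<^sup>2) + ((zk U 0 x)\<^sup>2 - (zk U n x)\<^sup>2))
     = (\<lambda>n x. (1 - lam\<^sup>2) * (\<Sum>k<n. (zk U k x)\<^sup>2))"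
  proof (intro ext)
    fix n x show "(\<Sum>k<n. (zk U (Suc k) x)\<^sup>2 - lam\<^sup>2 * (zk U k x)\<^sup>2) + ((zk U 0 x)\<^sup>2 - (zk U n x)\<^sup>2) = (1 - lam\<^sup>2) * (\<Sum>k<n. (zk U k x)\<^sup>2)"
      by (induction n) (auto simp: algebra_simps)
  qed
  finally have *: "uo C W (\<lambda>n x. (1 - lam\<^sup>2) * (\<Sum>k<n. (zk U k x)\<^sup>2))" .
  have W0: "W n \<ge> 0" for n unfolding W_def by (intro sum_nonneg) (simp add: less_imp_le)
  have "uo C (\<lambda>k. 1 * W k) (\<lambda>n x. (1 / (1 - lam\<^sup>2)) * ((1 - lam\<^sup>2) * (\<Sum>k<n. (zk U k x)\<^sup>2)))"
    using uo_mult(2)[OF * uO_const_fun[of C "\<lambda>_. 1 / (1 - lam\<^sup>2)" "cmod (1 / (1 - lam\<^sup>2))"]] W0 by simp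
  then show ?thesis using lam2_ne_1 by simp
qed

end

section \<open>The second solution and the limit of the Weyl ratios\<close>

context modulated_jacobi begin

definition zP :: "nat \<Rightarrow> real \<Rightarrow> complex" where "zP = zk (orthP a b)"
definition zQ :: "nat \<Rightarrow> real \<Rightarrow> complex" where "zQ = zk (orthQ a b)"

lemma goodsol_P: "compact C \<Longrightarrow> goodsol C (orthP a b)"
  using goodsol_comb[of C 1 0] by simp
lemma goodsol_Q: "compact C \<Longrightarrow> goodsol C (orthQ a b)"
  using goodsol_comb[of C 0 1] by simp
text \<open>The sum of the two solutions is needed for the polarization in
  \<open>Gz_limit\<close>.\<close>

lemma goodsol_PQ: "compact C \<Longrightarrow> goodsol C (\<lambda>n x. orthP a b n x + orthQ a b n x)"
  using goodsol_comb[of C 1 1] by simp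

lemma uo_scale:
  fixes e :: "nat \<Rightarrow> real \<Rightarrow> 'a::real_normed_field"
  assumes "uo C v e"
  shows "uo C v (\<lambda>k x. c * e k x)"
proof (rule uoI)
  fix \<epsilon> :: real assume "\<epsilon> > 0"
  then have *: "\<epsilon> / (norm c + 1) > 0" by (simp add: add_nonneg_pos)
  from uoD[OF assms this] show "\<forall>\<^sub>F k in sequentially. \<forall>x\<in>C. norm (c * e k x) \<le> \<epsilon> * v k"
  proof eventually_elim
    case (elim k)
    show ?case
    proof
      fix x assume "x \<in> C"
      then have 1: "norm (e k x) \<le> \<epsilon> / (norm c + 1) * v k" using elim by blast
      have "norm (c * e k x) \<le> (norm c + 1) * norm (e k x)" by (simp add: norm_mult mult_right_mono)
      also have "\<dots> \<le> (norm c + 1) * (\<epsilon> / (norm c + 1) * v k)" using 1 by (intro mult_left_mono) auto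
      also have "\<dots> = \<epsilon> * v k"
        using norm_ge_zero[of c] by (simp add: add_nonneg_eq_0_iff)
      finally show "norm (c * e k x) \<le> \<epsilon> * v k" .
    qed
  qed
qed

lemma zk_PQ: "zk (\<lambda>n x. orthP a b n x + orthQ a b n x) k x = zP k x + zQ k x"
  by (simp add: zP_def zQ_def zk_def algebra_simps)

text \<open>The imaginary part is a multiple of the Wronskian, hence known exactly in every block
  and not just in the limit.\<close>

lemma Im_zQzP: "Im (zQ k x * cnj (zP k x)) = Im zeta / A k"
proof -
  have "Im (zQ k x * cnj (zP k x)) = Im zeta * (orthP a b (sk k) x * orthQ a b (Suc (sk k)) x - orthP a b (Suc (sk k)) x * orthQ a b (sk k) x)"
    by (simp add: zP_def zQ_def zk_def algebra_simps)
  also have "\<dots> = Im zeta / A k"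
    using orth_wronskian[where a=a and b=b and n="sk k" and z=x, OF a_pos] by (simp add: A_def field_simps)
  finally show ?thesis .
qed

definition gp :: "real \<Rightarrow> real" where "gp x = lim (\<lambda>k. A k * (cmod (zP k x))\<^sup>2)"
definition Gz :: "real \<Rightarrow> complex" where "Gz x = lim (\<lambda>k. of_real (A k) * (zQ k x * cnj (zP k x)))"

lemma gp_limit:
  assumes "compact C"
  shows "uniform_limit C (\<lambda>k x. A k * (cmod (zP k x))\<^sup>2) gp sequentially"
    and "\<exists>c>0. \<forall>x\<in>C. c \<le> gp x" and "\<exists>B. \<forall>x\<in>C. gp x \<le> B"
proof -
  obtain g c B where g: "uniform_limit C (\<lambda>k x. A k * (cmod (zk (orthP a b) k x))\<^sup>2) g sequentially" "c > 0"
    "\<And>x. x \<in> C \<Longrightarrow> c \<le> g x" "\<And>x. x \<in> C \<Longrightarrow> g x \<le> B"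
    using norm_zk_limit[OF goodsol_P[OF assms]] by blast
  have eq: "gp x = g x" if "x \<in> C" for x
    unfolding gp_def zP_def by (rule limI) (rule tendsto_uniform_limitI[OF g(1) that])
  show "uniform_limit C (\<lambda>k x. A k * (cmod (zP k x))\<^sup>2) gp sequentially"
    using g(1) unfolding zP_def by (rule uniform_limit_cong'[THEN iffD1, rotated -1]) (use eq in auto)
  show "\<exists>c>0. \<forall>x\<in>C. c \<le> gp x" "\<exists>B. \<forall>x\<in>C. gp x \<le> B" using g eq by auto
qed

lemma gp_pos: "gp x > 0"
  using gp_limit(2)[of "{x}"] by auto

lemma continuous_gp: "continuous_on UNIV gp"
proof -
  have "isCont gp x" for x
  proof -
    have "continuous_on (cball x 1) gp"
    proof (rule uniform_limit_theorem[OF _ gp_limit(1)])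
      show "\<forall>\<^sub>F k in sequentially. continuous_on (cball x 1) (\<lambda>x. A k * (cmod (zP k x))\<^sup>2)"
        unfolding zP_def zk_def by (intro always_eventually allI continuous_intros)
    qed auto
    then show ?thesis by (rule continuous_on_interior) auto
  qed
  then show ?thesis by (simp add: continuous_at_imp_continuous_on)
qed

text \<open>So far only squared moduli are known to converge. Polarization with
  \<open>orthP\<close>, \<open>orthQ\<close> and their sum recovers the real part of the mixed
  product; its imaginary part is constant by \<open>Im_zQzP\<close>.\<close>

lemma Gz_limit:
  assumes "compact C"
  shows "uniform_limit C (\<lambda>k x. of_real (A k) * (zQ k x * cnj (zP k x))) Gz sequentially"
    and "\<exists>B. \<forall>x\<in>C. cmod (Gz x) \<le> B" and "x \<in> C \<Longrightarrow> Im (Gz x) = Im zeta"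
proof -
  obtain gq cq B1 where gq': "uniform_limit C (\<lambda>k x. A k * (cmod (zk (orthQ a b) k x))\<^sup>2) gq sequentially"
    and cq: "cq > 0" "\<And>x. x \<in> C \<Longrightarrow> cq \<le> gq x" and gqB: "\<And>x. x \<in> C \<Longrightarrow> gq x \<le> B1"
    by (rule norm_zk_limit[OF goodsol_Q[OF assms]]) (rule that)
  have gq: "uniform_limit C (\<lambda>k x. A k * (cmod (zQ k x))\<^sup>2) gq sequentially" "\<And>x. x \<in> C \<Longrightarrow> gq x \<le> B1"
    using gq' gqB unfolding zQ_def by simp_all
  have gq0: "0 \<le> gq x" if "x \<in> C" for x using cq(1) cq(2)[OF that] by linarith
  obtain gs cs B2 where gs': "uniform_limit C (\<lambda>k x. A k * (cmod (zk (\<lambda>n x. orthP a b n x + orthQ a b n x) k x))\<^sup>2) gs sequentially"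
    and cs: "cs > 0" "\<And>x. x \<in> C \<Longrightarrow> cs \<le> gs x" and gsB: "\<And>x. x \<in> C \<Longrightarrow> gs x \<le> B2"
    by (rule norm_zk_limit[OF goodsol_PQ[OF assms]]) (rule that)
  have gs: "uniform_limit C (\<lambda>k x. A k * (cmod (zP k x + zQ k x))\<^sup>2) gs sequentially" "\<And>x. x \<in> C \<Longrightarrow> gs x \<le> B2"
    using gs' gsB unfolding zk_PQ by simp_all
  have gs0: "0 \<le> gs x" if "x \<in> C" for x using cs(1) cs(2)[OF that] by linarith
  obtain B3 where B3: "\<And>x. x \<in> C \<Longrightarrow> gp x \<le> B3" using gp_limit(3)[OF assms] by blast
  define G where "G = (\<lambda>x. Complex ((gs x - gp x - gq x) / 2) (Im zeta))"
  have pol: "of_real (A k) * (zQ k x * cnj (zP k x)) =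
      Complex ((A k * (cmod (zP k x + zQ k x))\<^sup>2 - A k * (cmod (zP k x))\<^sup>2 - A k * (cmod (zQ k x))\<^sup>2) / 2) (Im zeta)" for k x
  proof -
    have "(cmod (zP k x + zQ k x))\<^sup>2 = (cmod (zP k x))\<^sup>2 + (cmod (zQ k x))\<^sup>2 + 2 * Re (zQ k x * cnj (zP k x))"
      unfolding cmod_power2 by (simp add: power2_eq_square algebra_simps)
    moreover have "Im (of_real (A k) * (zQ k x * cnj (zP k x))) = Im zeta"
    proof -
      have "Im (of_real (A k) * (zQ k x * cnj (zP k x))) = A k * Im (zQ k x * cnj (zP k x))" by simp
      then show ?thesis unfolding Im_zQzP by simp
    qed
    ultimately show ?thesis by (simp only: complex_eq_iff complex.sel) (simp add: algebra_simps)
  qed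
  have "uo C (\<lambda>_. 1) (\<lambda>k x. A k * (cmod (zP k x + zQ k x))\<^sup>2 - gs x)" unfolding uo_1_iff by (rule gs(1))
  moreover have "uo C (\<lambda>_. 1) (\<lambda>k x. A k * (cmod (zQ k x))\<^sup>2 - gq x)" unfolding uo_1_iff by (rule gq(1))
  moreover have "uo C (\<lambda>_. 1) (\<lambda>k x. A k * (cmod (zP k x))\<^sup>2 - gp x)" unfolding uo_1_iff by (rule gp_limit(1)[OF assms])
  ultimately have "uo C (\<lambda>_. 1) (\<lambda>k x. (A k * (cmod (zP k x + zQ k x))\<^sup>2 - gs x) - (A k * (cmod (zP k x))\<^sup>2 - gp x) - (A k * (cmod (zQ k x))\<^sup>2 - gq x))"
    by (intro uo_diff[of C "\<lambda>_. 1" "\<lambda>k x. (A k * (cmod (zP k x + zQ k x))\<^sup>2 - gs x) - (A k * (cmod (zP k x))\<^sup>2 - gp x)"]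
       uo_diff[of C "\<lambda>_. 1" "\<lambda>k x. A k * (cmod (zP k x + zQ k x))\<^sup>2 - gs x"])
  then have "uo C (\<lambda>_. 1) (\<lambda>k x. (1/2) * ((A k * (cmod (zP k x + zQ k x))\<^sup>2 - gs x) - (A k * (cmod (zP k x))\<^sup>2 - gp x) - (A k * (cmod (zQ k x))\<^sup>2 - gq x)))"
    by (rule uo_scale)
  then have "uo C (\<lambda>_. 1) (\<lambda>k x. of_real (A k) * (zQ k x * cnj (zP k x)) - G x)"
  proof (rule uo_norm_le)
    show "\<forall>\<^sub>F k in sequentially. \<forall>x\<in>C. norm (of_real (A k) * (zQ k x * cnj (zP k x)) - G x) \<le>
       norm ((1/2) * ((A k * (cmod (zP k x + zQ k x))\<^sup>2 - gs x) - (A k * (cmod (zP k x))\<^sup>2 - gp x) - (A k * (cmod (zQ k x))\<^sup>2 - gq x)))"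
    proof (intro always_eventually allI ballI)
      fix k x
      have "of_real (A k) * (zQ k x * cnj (zP k x)) - G x
         = of_real ((1/2) * ((A k * (cmod (zP k x + zQ k x))\<^sup>2 - gs x) - (A k * (cmod (zP k x))\<^sup>2 - gp x) - (A k * (cmod (zQ k x))\<^sup>2 - gq x)))"
        unfolding pol G_def by (simp add: complex_eq_iff field_simps)
      then show "norm (of_real (A k) * (zQ k x * cnj (zP k x)) - G x) \<le>
       norm ((1/2) * ((A k * (cmod (zP k x + zQ k x))\<^sup>2 - gs x) - (A k * (cmod (zP k x))\<^sup>2 - gp x) - (A k * (cmod (zQ k x))\<^sup>2 - gq x)))"
        by (simp only: norm_of_real) simp
    qed
  qed
  then have lim: "uniform_limit C (\<lambda>k x. of_real (A k) * (zQ k x * cnj (zP k x))) G sequentially" by (simp add: uo_1_iff)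
  have eq: "Gz x = G x" if "x \<in> C" for x
    unfolding Gz_def by (rule limI) (rule tendsto_uniform_limitI[OF lim that])
  show "uniform_limit C (\<lambda>k x. of_real (A k) * (zQ k x * cnj (zP k x))) Gz sequentially"
    using lim by (rule uniform_limit_cong'[THEN iffD1, rotated -1]) (use eq in auto)
  show "x \<in> C \<Longrightarrow> Im (Gz x) = Im zeta" using eq by (simp add: G_def)
  have "cmod (Gz x) \<le> (\<bar>B1\<bar> + \<bar>B2\<bar> + \<bar>B3\<bar>) + \<bar>Im zeta\<bar>" if "x \<in> C" for x
  proof -
    have "cmod (Gz x) \<le> \<bar>Re (G x)\<bar> + \<bar>Im (G x)\<bar>" unfolding eq[OF that] by (rule cmod_le)
    also have "\<bar>Re (G x)\<bar> \<le> \<bar>B1\<bar> + \<bar>B2\<bar> + \<bar>B3\<bar>"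
      unfolding G_def using gq(2)[OF that] gs(2)[OF that] gq0[OF that] gs0[OF that] gp_pos[of x] B3[OF that] by simp
    finally show ?thesis by (simp add: G_def)
  qed
  then show "\<exists>B. \<forall>x\<in>C. cmod (Gz x) \<le> B" by blast
qed

text \<open>The limit of \<open>zQ k x / zP k x\<close>. Up to sign it is the limit of the boundary
  values of the Weyl functions, which is why \<open>- Im (tau x) / pi\<close> turns out to be the
  density of the orthogonality measure.\<close>

definition tau :: "real \<Rightarrow> complex" where "tau x = Gz x / of_real (gp x)"

lemma Im_tau: "Im (tau x) = Im zeta / gp x"
  using Gz_limit(3)[of "{x}" x] by (simp add: tau_def Im_divide_of_real)

lemma Im_tau_neg: "Im (tau x) < 0"
  unfolding Im_tau using Im_zeta gp_pos[of x] by (simp add: divide_neg_pos)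

text \<open>A real basis of solutions packed into one complex number: the real part is
  \<open>orthP\<close>, and the imaginary part is the combination for which \<open>y\<close> becomes
  asymptotic to \<open>cnj (gam j * zP k x)\<close>, so that from block to block it behaves like a
  pure rotation.\<close>

definition y :: "nat \<Rightarrow> real \<Rightarrow> complex" where
  "y n x = Complex (orthP a b n x) ((orthQ a b n x - Re (tau x) * orthP a b n x) / Im (tau x))"

text \<open>The complex number for which \<open>Re (gam j * zk U k x)\<close> is the limit
  combination of the starting pair at position \<open>j\<close> of the block;
  \<open>Re_gam_zk\<close> is the equation that determines its two components.\<close>

definition gam :: "nat \<Rightarrow> complex" where
  "gam j = Complex (dl (Suc j)) ((cl (Suc j) + dl (Suc j) * Re zeta) / Im zeta)"

lemma Re_gam_zk: "Re (gam j * zk U k x) = cl (Suc j) * U (sk k) x + dl (Suc j) * U (Suc (sk k)) x"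
  using Im_zeta by (simp add: gam_def zk_def field_simps)

lemma tau_bounds:
  assumes "compact C"
  shows "\<exists>B. \<forall>x\<in>C. cmod (tau x) \<le> B" "\<exists>B. \<forall>x\<in>C. \<bar>1 / Im (tau x)\<bar> \<le> B"
proof -
  obtain c where c: "c > 0" "\<And>x. x \<in> C \<Longrightarrow> c \<le> gp x" using gp_limit(2)[OF assms] by blast
  obtain B where B: "\<And>x. x \<in> C \<Longrightarrow> gp x \<le> B" using gp_limit(3)[OF assms] by blast
  obtain D where D: "\<And>x. x \<in> C \<Longrightarrow> cmod (Gz x) \<le> D" using Gz_limit(2)[OF assms] by blast
  have "cmod (tau x) \<le> \<bar>D\<bar> / c" if "x \<in> C" for x
    unfolding tau_def norm_divide norm_of_real using c(1) c(2)[OF that] D[OF that] gp_pos[of x] by (intro frac_le) auto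
  then show "\<exists>B. \<forall>x\<in>C. cmod (tau x) \<le> B" by blast
  have "\<bar>1 / Im (tau x)\<bar> \<le> B / \<bar>Im zeta\<bar>" if "x \<in> C" for x
  proof -
    have "\<bar>1 / Im (tau x)\<bar> = gp x / \<bar>Im zeta\<bar>" unfolding Im_tau using gp_pos[of x] by (simp add: abs_divide)
    then show ?thesis using B[OF that] by (simp only: divide_right_mono abs_ge_zero)
  qed
  then show "\<exists>B. \<forall>x\<in>C. \<bar>1 / Im (tau x)\<bar> \<le> B" by blast
qed

lemma zP_square:
  assumes "compact C"
  shows "uo C w (\<lambda>k x. (cmod (zP k x))\<^sup>2 - gp x * w k)"
proof -
  have "uO C w (\<lambda>k x. w k)" by (rule uOI[where B=1]) (auto simp: less_imp_le)
  from uo_mult(2)[OF iffD2[OF uo_1_iff gp_limit(1)[OF assms]] this]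
  have "uo C w (\<lambda>k x. w k * (A k * (cmod (zP k x))\<^sup>2 - gp x))" by (simp add: less_imp_le)
  also have "(\<lambda>k x. w k * (A k * (cmod (zP k x))\<^sup>2 - gp x)) = (\<lambda>k x. (cmod (zP k x))\<^sup>2 - gp x * w k)"
    by (auto simp: w_def field_simps fun_eq_iff)
  finally show ?thesis .
qed

text \<open>Multiplied by \<open>A k * cnj (zP k x)\<close>, the difference is a combination of the
  errors in \<open>Gz_limit\<close> and \<open>gp_limit\<close>, hence o(1). The lower bound on
  \<open>gp\<close> makes \<open>cmod (zP k x)\<close> at least of order \<open>sqrt (w k)\<close>,
  so dividing by this factor leaves exactly the claimed order.\<close>

lemma zQ_tau:
  assumes "compact C"
  shows "uo C (\<lambda>k. sqrt (w k)) (\<lambda>k x. zQ k x - tau x * zP k x)"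
proof -
  obtain c where c: "c > 0" "\<And>x. x \<in> C \<Longrightarrow> c \<le> gp x" using gp_limit(2)[OF assms] by blast
  obtain B where B: "\<And>x. x \<in> C \<Longrightarrow> cmod (tau x) \<le> B" using tau_bounds(1)[OF assms] by blast
  have *: "uo C (\<lambda>_. 1) (\<lambda>k x. (of_real (A k) * (zQ k x * cnj (zP k x)) - Gz x) - tau x * of_real (A k * (cmod (zP k x))\<^sup>2 - gp x))"
  proof (rule uo_diff)
    show "uo C (\<lambda>_. 1) (\<lambda>k x. of_real (A k) * (zQ k x * cnj (zP k x)) - Gz x)"
      unfolding uo_1_iff by (rule Gz_limit(1)[OF assms])
    have "uo C (\<lambda>_. 1) (\<lambda>k x. A k * (cmod (zP k x))\<^sup>2 - gp x)"
      unfolding uo_1_iff by (rule gp_limit(1)[OF assms])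
    then have 1: "uo C (\<lambda>_. 1) (\<lambda>k x. complex_of_real (A k * (cmod (zP k x))\<^sup>2 - gp x))"
      by (simp only: uo_of_real)
    have 2: "uO C (\<lambda>_. 1) (\<lambda>k x. tau x)" by (rule uO_const_fun[OF B])
    show "uo C (\<lambda>_. 1) (\<lambda>k x. tau x * of_real (A k * (cmod (zP k x))\<^sup>2 - gp x))"
      using uo_mult(2)[OF 1 2] by (simp only: mult_1 zero_le_one)
  qed
  show ?thesis
  proof (rule uoI)
    fix \<epsilon> :: real assume e: "\<epsilon> > 0"
    have "\<epsilon> * sqrt (c/2) > 0" using e c by simp
    have c2: "c/2 > 0" using c by simp
    from eventually_conj[OF uoD[OF * \<open>\<epsilon> * sqrt (c/2) > 0\<close>] uniform_limitD[OF gp_limit(1)[OF assms] c2]]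
    have "\<forall>\<^sub>F k in sequentially. (\<forall>x\<in>C. norm ((of_real (A k) * (zQ k x * cnj (zP k x)) - Gz x) - tau x * of_real (A k * (cmod (zP k x))\<^sup>2 - gp x)) \<le> \<epsilon> * sqrt (c/2) * 1)
       \<and> (\<forall>x\<in>C. dist (A k * (cmod (zP k x))\<^sup>2) (gp x) < c/2)"
      by assumption
    then show "\<forall>\<^sub>F k in sequentially. \<forall>x\<in>C. norm (zQ k x - tau x * zP k x) \<le> \<epsilon> * sqrt (w k)"
    proof eventually_elim
      case (elim k)
      show ?case
      proof
        fix x assume x: "x \<in> C"
        have "dist (A k * (cmod (zP k x))\<^sup>2) (gp x) < c/2" using elim x by blast
        then have "A k * (cmod (zP k x))\<^sup>2 \<ge> c/2" using c(2)[OF x] unfolding dist_real_def by linarith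
        then have "(cmod (zP k x))\<^sup>2 \<ge> c/2 * w k" by (simp add: w_def field_simps)
        then have zl: "cmod (zP k x) \<ge> sqrt (c/2) * sqrt (w k)"
          unfolding real_sqrt_mult[symmetric] by (intro real_le_lsqrt) auto
        have id: "(of_real (A k) * (zQ k x * cnj (zP k x)) - Gz x) - tau x * of_real (A k * (cmod (zP k x))\<^sup>2 - gp x)
          = of_real (A k) * cnj (zP k x) * (zQ k x - tau x * zP k x)"
        proof -
          have 1: "tau x * of_real (gp x) = Gz x" using gp_pos[of x] by (simp add: tau_def)
          have 2: "complex_of_real (A k * (cmod (zP k x))\<^sup>2) = of_real (A k) * (zP k x * cnj (zP k x))"
            by (simp only: of_real_mult complex_norm_square)
          have "(of_real (A k) * (zQ k x * cnj (zP k x)) - Gz x) - tau x * of_real (A k * (cmod (zP k x))\<^sup>2 - gp x)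
             = (of_real (A k) * (zQ k x * cnj (zP k x)) - tau x * of_real (gp x)) - tau x * (of_real (A k) * (zP k x * cnj (zP k x)) - of_real (gp x))"
            by (simp only: of_real_diff 1 2)
          also have "\<dots> = of_real (A k) * cnj (zP k x) * (zQ k x - tau x * zP k x)"
            by (simp add: algebra_simps)
          finally show ?thesis .
        qed
        have *: "A k * cmod (zP k x) * cmod (zQ k x - tau x * zP k x) \<le> \<epsilon> * sqrt (c/2)"
        proof -
          have "norm (of_real (A k) * cnj (zP k x) * (zQ k x - tau x * zP k x)) \<le> \<epsilon> * sqrt (c/2)"
          proof -
            have "norm ((of_real (A k) * (zQ k x * cnj (zP k x)) - Gz x) - tau x * of_real (A k * (cmod (zP k x))\<^sup>2 - gp x)) \<le> \<epsilon> * sqrt (c/2) * 1"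
              using elim x by blast
            then show ?thesis by (simp only: id mult_1_right)
          qed
          then show ?thesis by (simp only: norm_mult norm_of_real complex_mod_cnj abs_of_pos[OF A_pos])
        qed
        then have "A k * (sqrt (c/2) * sqrt (w k)) * cmod (zQ k x - tau x * zP k x) \<le> \<epsilon> * sqrt (c/2)"
        proof -
          have "A k * (sqrt (c/2) * sqrt (w k)) * cmod (zQ k x - tau x * zP k x) \<le> A k * cmod (zP k x) * cmod (zQ k x - tau x * zP k x)"
            by (intro mult_right_mono mult_left_mono zl) (auto simp: less_imp_le)
          then show ?thesis using * by linarith
        qed
        then have "sqrt (c/2) * (A k * sqrt (w k) * cmod (zQ k x - tau x * zP k x)) \<le> sqrt (c/2) * \<epsilon>"
          by (simp only: mult_ac)
        then have "A k * sqrt (w k) * cmod (zQ k x - tau x * zP k x) \<le> \<epsilon>" by (rule mult_left_le_imp_le) (use c in simp)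
        then have "sqrt (w k) * (A k * sqrt (w k) * cmod (zQ k x - tau x * zP k x)) \<le> sqrt (w k) * \<epsilon>"
          by (intro mult_left_mono) (auto simp: less_imp_le)
        also have "sqrt (w k) * (A k * sqrt (w k) * cmod (zQ k x - tau x * zP k x)) = (sqrt (w k) * sqrt (w k)) * A k * cmod (zQ k x - tau x * zP k x)"
          by (simp only: mult_ac)
        also have "\<dots> = cmod (zQ k x - tau x * zP k x)" unfolding sqrt_w by (simp add: w_def)
        finally show "norm (zQ k x - tau x * zP k x) \<le> \<epsilon> * sqrt (w k)" by (simp add: mult.commute)
      qed
    qed
  qed
qed

lemma block_error:
  assumes "goodsol C U"
  shows "uo C (\<lambda>k. sqrt (w k)) (\<lambda>k x. U (Suc (sk k + j)) x - Re (gam j * zk U k x))"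
proof -
  have C: "compact C" "bounded C" using assms compact_imp_bounded unfolding goodsol_def by auto
  note ub = uv_bounds(2,3)[OF assms]
  have w0: "sqrt (w k) \<ge> 0" for k by (simp add: less_imp_le)
  have "uo C (\<lambda>k. 1 * sqrt (w k)) (\<lambda>k x. (Ck k x (Suc j) - cl (Suc j)) * U (sk k) x + (Dk k x (Suc j) - dl (Suc j)) * U (Suc (sk k)) x)"
    by (intro uo_add uo_mult(1)[OF uo_coeffs(1)[OF C(2)]] uo_mult(1)[OF uo_coeffs(2)[OF C(2)]] ub w0) auto
  then have "uo C (\<lambda>k. sqrt (w k)) (\<lambda>k x. (Ck k x (Suc j) - cl (Suc j)) * U (sk k) x + (Dk k x (Suc j) - dl (Suc j)) * U (Suc (sk k)) x)" by simp
  then show ?thesis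
  proof (rule uo_norm_le, intro always_eventually allI ballI)
    fix k x assume x: "x \<in> C"
    have j: "jacobi_rec a b x (\<lambda>n. U n x)" using assms x unfolding goodsol_def by auto
    show "norm (U (Suc (sk k + j)) x - Re (gam j * zk U k x)) \<le> norm ((Ck k x (Suc j) - cl (Suc j)) * U (sk k) x + (Dk k x (Suc j) - dl (Suc j)) * U (Suc (sk k)) x)"
      unfolding Re_gam_zk using block_sol[OF j, of k "Suc j"] by (simp add: algebra_simps)
  qed
qed

text \<open>Put \<open>g = gam j * zP k x\<close>. Then \<open>orthP\<close> is close to
  \<open>Re g\<close> and \<open>orthQ\<close> to \<open>Re (tau x * g)\<close>, whence the
  imaginary part of \<open>y\<close> is close to \<open>- Im g\<close>; this explains the
  conjugate.\<close>

lemma y_asym: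
  assumes "compact C"
  shows "uo C (\<lambda>k. sqrt (w k)) (\<lambda>k x. y (Suc (sk k + j)) x - cnj (gam j * zP k x))"
proof -
  obtain B where B: "\<And>x. x \<in> C \<Longrightarrow> cmod (tau x) \<le> B" using tau_bounds(1)[OF assms] by blast
  have B': "\<bar>Re (tau x)\<bar> \<le> B" if "x \<in> C" for x using B[OF that] abs_Re_le_cmod order_trans by blast
  obtain D where D: "\<And>x. x \<in> C \<Longrightarrow> \<bar>1 / Im (tau x)\<bar> \<le> D" using tau_bounds(2)[OF assms] by blast
  have w0: "sqrt (w k) \<ge> 0" for k by (simp add: less_imp_le)
  define eP eQ where "eP = (\<lambda>k x. orthP a b (Suc (sk k + j)) x - Re (gam j * zP k x))"
    "eQ = (\<lambda>k x. orthQ a b (Suc (sk k + j)) x - Re (gam j * zQ k x))"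
  define eT where "eT = (\<lambda>k x. gam j * (zQ k x - tau x * zP k x))"
  have e1: "uo C (\<lambda>k. sqrt (w k)) eP" "uo C (\<lambda>k. sqrt (w k)) eQ"
    unfolding eP_eQ_def zP_def zQ_def by (intro block_error goodsol_P goodsol_Q assms)+
  have "uo C (\<lambda>k. sqrt (w k)) eT" unfolding eT_def
    using uo_mult(2)[OF zQ_tau[OF assms] uO_const_fun[of C "\<lambda>_. gam j" "cmod (gam j)"]] w0 by simp
  then have e2: "uo C (\<lambda>k. sqrt (w k)) (\<lambda>k x. Re (eT k x))"
    by (rule uo_norm_le) (auto simp: abs_Re_le_cmod)
  have "uo C (\<lambda>k. sqrt (w k)) (\<lambda>k x. Re (tau x) * eP k x)"
    using uo_mult(2)[OF e1(1) uO_const_fun[of C "\<lambda>x. Re (tau x)" B]] w0 B' by simp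
  then have "uo C (\<lambda>k. sqrt (w k)) (\<lambda>k x. eQ k x + Re (eT k x) - Re (tau x) * eP k x)"
    by (intro uo_diff uo_add e1 e2)
  then have e3: "uo C (\<lambda>k. sqrt (w k)) (\<lambda>k x. (1 / Im (tau x)) * (eQ k x + Re (eT k x) - Re (tau x) * eP k x))"
    using uo_mult(2)[OF _ uO_const_fun[of C "\<lambda>x. 1 / Im (tau x)" D]] w0 D by fastforce
  have "uo C (\<lambda>k. sqrt (w k)) (\<lambda>k x. \<i> * of_real ((1 / Im (tau x)) * (eQ k x + Re (eT k x) - Re (tau x) * eP k x)))"
    by (rule uo_norm_le[OF e3], intro always_eventually allI ballI)
      (simp only: norm_mult[of \<i>] norm_ii norm_of_real real_norm_def mult_1 order_refl)
  then have e4: "uo C (\<lambda>k. sqrt (w k)) (\<lambda>k x. of_real (eP k x) + \<i> * of_real ((1 / Im (tau x)) * (eQ k x + Re (eT k x) - Re (tau x) * eP k x)))"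
    using e1 by (intro uo_add) auto
  also have "(\<lambda>k x. of_real (eP k x) + \<i> * of_real ((1 / Im (tau x)) * (eQ k x + Re (eT k x) - Re (tau x) * eP k x)))
     = (\<lambda>k x. y (Suc (sk k + j)) x - cnj (gam j * zP k x))"
  proof (intro ext)
    fix k x
    have nz: "Im (tau x) \<noteq> 0" using Im_tau_neg[of x] by simp
    define Pn Qn where "Pn = orthP a b (Suc (sk k + j)) x" "Qn = orthQ a b (Suc (sk k + j)) x"
    define g where "g = gam j * zP k x"
    have "Re (eT k x) = Re (gam j * zQ k x) - (Re (tau x) * Re g - Im (tau x) * Im g)"
      unfolding eT_def g_def by (simp add: algebra_simps)
    then have "eQ k x + Re (eT k x) - Re (tau x) * eP k x = Qn - Re (tau x) * Pn + Im (tau x) * Im g"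
      unfolding eP_eQ_def Pn_Qn_def[symmetric] g_def[symmetric] by (simp add: algebra_simps)
    then have "(1 / Im (tau x)) * (eQ k x + Re (eT k x) - Re (tau x) * eP k x) = (Qn - Re (tau x) * Pn) / Im (tau x) + Im g"
      using nz by (simp add: field_simps)
    moreover have "eP k x = Pn - Re g" by (simp add: eP_eQ_def Pn_Qn_def g_def)
    ultimately show "of_real (eP k x) + \<i> * of_real ((1 / Im (tau x)) * (eQ k x + Re (eT k x) - Re (tau x) * eP k x))
     = y (Suc (sk k + j)) x - cnj (gam j * zP k x)"
      unfolding y_def Pn_Qn_def[symmetric] g_def[symmetric] by (simp only:) (simp add: complex_eq_iff)
  qed
  finally show ?thesis .
qed

lemma zP_O: "compact C \<Longrightarrow> uO C (\<lambda>k. sqrt (w k)) zP"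
  unfolding zP_def by (intro zk_O goodsol_P)

lemma gamzP_O:
  assumes "compact C" shows "uO C (\<lambda>k. sqrt (w k)) (\<lambda>k x. gam j * zP k x)"
  using uO_mult[OF uO_const_fun[of C "\<lambda>_. gam j" "cmod (gam j)"] zP_O[OF assms]] by (simp add: less_imp_le)

lemma y_O:
  assumes "compact C" shows "uO C (\<lambda>k. sqrt (w k)) (\<lambda>k x. y (Suc (sk k + j)) x)"
proof -
  have "uO C (\<lambda>k. sqrt (w k)) (\<lambda>k x. (y (Suc (sk k + j)) x - cnj (gam j * zP k x)) + cnj (gam j * zP k x))"
    by (intro uO_add uo_imp_uO[OF y_asym] iffD2[OF uO_cnj] gamzP_O assms)
  then show ?thesis by simp
qed

lemma y_square_asym:
  assumes "compact C"
  shows "uo C w (\<lambda>k x. (y (Suc (sk k + j)) x)\<^sup>2 - cnj ((gam j)\<^sup>2 * (zP k x)\<^sup>2))"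
proof -
  have w0: "sqrt (w k) \<ge> 0" for k by (simp add: less_imp_le)
  have "uO C (\<lambda>k. sqrt (w k)) (\<lambda>k x. y (Suc (sk k + j)) x + cnj (gam j * zP k x))"
    by (intro uO_add y_O iffD2[OF uO_cnj] gamzP_O assms)
  from uo_mult(1)[OF y_asym[OF assms] this w0 w0]
  have "uo C w (\<lambda>k x. (y (Suc (sk k + j)) x - cnj (gam j * zP k x)) * (y (Suc (sk k + j)) x + cnj (gam j * zP k x)))"
    by (simp add: sqrt_w)
  also have "(\<lambda>k x. (y (Suc (sk k + j)) x - cnj (gam j * zP k x)) * (y (Suc (sk k + j)) x + cnj (gam j * zP k x)))
     = (\<lambda>k x. (y (Suc (sk k + j)) x)\<^sup>2 - cnj ((gam j)\<^sup>2 * (zP k x)\<^sup>2))"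
    by (auto simp: fun_eq_iff power2_eq_square algebra_simps)
  finally show ?thesis .
qed

lemma y_norm_asym:
  assumes "compact C"
  shows "uo C w (\<lambda>k x. (cmod (y (Suc (sk k + j)) x))\<^sup>2 - (cmod (gam j))\<^sup>2 * gp x * w k)"
proof -
  have w0: "sqrt (w k) \<ge> 0" for k by (simp add: less_imp_le)
  note m1 = uo_mult(1)[OF y_asym[OF assms] iffD2[OF uO_cnj y_O[OF assms]] w0 w0, of j]
  note m2 = uo_mult(2)[OF iffD2[OF uo_cnj y_asym[OF assms]] iffD2[OF uO_cnj gamzP_O[OF assms]] w0 w0, of j]
  have m3: "uo C w (\<lambda>k x. (cmod (gam j))\<^sup>2 * ((cmod (zP k x))\<^sup>2 - gp x * w k))"
    using uo_mult(2)[OF zP_square[OF assms] uO_const_fun[of C "\<lambda>_. (cmod (gam j))\<^sup>2" "(cmod (gam j))\<^sup>2"]] by (simp add: less_imp_le)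
  have "uo C w (\<lambda>k x. (y (Suc (sk k + j)) x - cnj (gam j * zP k x)) * cnj (y (Suc (sk k + j)) x)
     + cnj (gam j * zP k x) * cnj (y (Suc (sk k + j)) x - cnj (gam j * zP k x))
     + of_real ((cmod (gam j))\<^sup>2 * ((cmod (zP k x))\<^sup>2 - gp x * w k)))"
    using m1 m2 by (intro uo_add iffD2[OF uo_of_real m3]) (simp_all add: sqrt_w)
  also have "(\<lambda>k x. (y (Suc (sk k + j)) x - cnj (gam j * zP k x)) * cnj (y (Suc (sk k + j)) x)
     + cnj (gam j * zP k x) * cnj (y (Suc (sk k + j)) x - cnj (gam j * zP k x))
     + of_real ((cmod (gam j))\<^sup>2 * ((cmod (zP k x))\<^sup>2 - gp x * w k)))
     = (\<lambda>k x. complex_of_real ((cmod (y (Suc (sk k + j)) x))\<^sup>2 - (cmod (gam j))\<^sup>2 * gp x * w k))"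
  proof (intro ext)
    fix k x
    define Y g where "Y = y (Suc (sk k + j)) x" "g = gam j * zP k x"
    have g: "of_real ((cmod (gam j))\<^sup>2 * (cmod (zP k x))\<^sup>2) = g * cnj g"
      unfolding Y_g_def by (simp only: complex_norm_square[symmetric]) (simp add: norm_mult power_mult_distrib)
    have "complex_of_real ((cmod (gam j))\<^sup>2 * ((cmod (zP k x))\<^sup>2 - gp x * w k)) = g * cnj g - of_real ((cmod (gam j))\<^sup>2 * gp x * w k)"
      unfolding g[symmetric] by (simp add: algebra_simps)
    moreover have "complex_of_real ((cmod Y)\<^sup>2) = Y * cnj Y" by (rule complex_norm_square)
    ultimately show "(y (Suc (sk k + j)) x - cnj (gam j * zP k x)) * cnj (y (Suc (sk k + j)) x)
     + cnj (gam j * zP k x) * cnj (y (Suc (sk k + j)) x - cnj (gam j * zP k x))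
     + of_real ((cmod (gam j))\<^sup>2 * ((cmod (zP k x))\<^sup>2 - gp x * w k))
     = complex_of_real ((cmod (y (Suc (sk k + j)) x))\<^sup>2 - (cmod (gam j))\<^sup>2 * gp x * w k)"
      unfolding Y_g_def[symmetric] of_real_diff by (simp only:) (simp add: algebra_simps)
  qed
  finally show ?thesis by (simp only: uo_of_real)
qed

section \<open>Averages along the clock \<open>rhos\<close>\<close>

definition drho :: "nat \<Rightarrow> real" where "drho n = \<alpha> (int n) / a n"
text \<open>The sum stops before \<open>n\<close>, so the normalization \<open>\<rho> n\<close> of
  the theorem is \<open>rhos (Suc n)\<close>.\<close>

definition rhos :: "nat \<Rightarrow> real" where "rhos n = (\<Sum>i<n. drho i)"

lemma drho_pos: "drho n > 0" by (simp add: drho_def a_pos)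

text \<open>The numerators \<open>\<alpha>\<close> equalize the residues: within a block
  \<open>a\<close> changes by factors that tend to ratios of \<open>\<alpha>\<close>, so every index
  of block \<open>k\<close> contributes \<open>\<alpha> (-1) * w k\<close> up to o(w).\<close>

lemma drho_block: "uo C w (\<lambda>k x. drho (Suc (sk k + j)) - \<alpha> (-1) * w k)"
proof -
  have *: "drho (Suc (sk k + j)) = w k * (\<alpha> (int j) * (\<Prod>i<Suc j. Rk k i))" for k
  proof -
    have "(\<Prod>i<Suc j. Rk k i) = A k / a (Suc (sk k + j))"
      unfolding Rk_def by (subst prod_ratio_telescope) (auto simp: A_def)
    moreover have "\<alpha> (int (Suc (sk k + j))) = \<alpha> (int j)" unfolding Suc_sk_j using alpha_per[of "Suc k" "int j"] by simp
    ultimately show ?thesis by (simp add: drho_def w_def)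
  qed
  have "(\<Prod>i<n. \<alpha> (int i - 1) / \<alpha> (int i)) = \<alpha> (-1) / \<alpha> (int n - 1)" for n
    by (induction n) (auto simp: field_simps)
  from this[of "Suc j"] have pr: "\<alpha> (int j) * (\<Prod>i<Suc j. \<alpha> (int i - 1) / \<alpha> (int i)) = \<alpha> (-1)" by simp
  have "(\<lambda>k. \<alpha> (int j) * (\<Prod>i<Suc j. Rk k i) - \<alpha> (-1)) \<longlonglongrightarrow> \<alpha> (int j) * (\<Prod>i<Suc j. \<alpha> (int i - 1) / \<alpha> (int i)) - \<alpha> (-1)"
    by (intro tendsto_intros tendsto_prod Rk_lim)
  then have "uo C (\<lambda>_. 1) (\<lambda>k x. \<alpha> (int j) * (\<Prod>i<Suc j. Rk k i) - \<alpha> (-1))"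
    unfolding pr by (intro uo_const tendsto_norm_zero) simp
  moreover have "uO C w (\<lambda>k x. w k)" by (rule uOI[where B=1]) (auto simp: less_imp_le)
  ultimately have "uo C w (\<lambda>k x. w k * (\<alpha> (int j) * (\<Prod>i<Suc j. Rk k i) - \<alpha> (-1)))"
    using uo_mult(2) by (fastforce simp: less_imp_le)
  then show ?thesis unfolding * by (simp add: algebra_simps)
qed

text \<open>\<open>(n - N) div N\<close> counts the complete blocks below \<open>n\<close> that
  follow the first \<open>N\<close> indices. A lower bound suffices, so the first index of each
  block is enough.\<close>

lemma rhos_W: "\<exists>c>0. \<forall>n\<ge>N. c * W ((n - N) div N) \<le> rhos n"
proof -
  have R0: "Rk k 0 > 0" for k by (simp add: Rk_def a_pos)
  have "(\<lambda>k. 1 / Rk k 0) \<longlonglongrightarrow> 1 / (\<alpha> (int 0 - 1) / \<alpha> (int 0))" by (intro tendsto_intros Rk_lim) auto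
  from convergent_imp_Bseq[OF convergentI[OF this]] obtain B where B: "B > 0" "\<And>k. norm (1 / Rk k 0) \<le> B" unfolding Bseq_def by blast
  have R: "1 / B \<le> Rk k 0" for k using B(1) B(2)[of k] R0[of k] by (simp add: field_simps)
  define c where "c = \<alpha> 0 / B"
  have c: "c > 0" using B by (simp add: c_def)
  have dr: "c * w k \<le> drho (Suc k * N)" for k
  proof -
    have eq: "Suc k * N = Suc (sk k + 0)" unfolding Suc_sk_j by simp
    have "\<alpha> (int (Suc k * N)) = \<alpha> 0" using alpha_per[of "Suc k" 0] by simp
    then have "drho (Suc k * N) = \<alpha> 0 * (Rk k 0 * w k)"
      unfolding drho_def unfolding eq by (simp add: Rk_def w_def A_def)
    moreover have "1 / B * w k \<le> Rk k 0 * w k" by (intro mult_right_mono R) (simp add: less_imp_le)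
    ultimately show ?thesis by (simp add: c_def) (metis alpha_pos mult_le_cancel_left_pos times_divide_eq_left times_divide_eq_right mult_1)
  qed
  show ?thesis
  proof (intro exI[of _ c] conjI c allI impI)
    fix n assume n: "n \<ge> N"
    define K where "K = (n - N) div N"
    have inj: "inj_on (\<lambda>k. Suc k * N) {..<K}" by (rule inj_onI) (simp only: mult_cancel2, auto simp: N_eq)
    have sub: "(\<lambda>k. Suc k * N) ` {..<K} \<subseteq> {..<n}"
    proof (rule image_subsetI)
      fix k assume "k \<in> {..<K}"
      then have "Suc k * N \<le> K * N" by (intro mult_right_mono) auto
      also have "\<dots> \<le> n - N" by (simp add: K_def)
      also have "\<dots> < n" using n N_eq by simp
      finally show "Suc k * N \<in> {..<n}" by simp
    qed
    have "c * W K = (\<Sum>k<K. c * w k)" by (simp add: W_def sum_distrib_left)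
    also have "\<dots> \<le> (\<Sum>k<K. drho (Suc k * N))" by (intro sum_mono dr)
    also have "\<dots> = sum drho ((\<lambda>k. Suc k * N) ` {..<K})" by (simp only: sum.reindex[OF inj] comp_def)
    also have "\<dots> \<le> rhos n" unfolding rhos_def by (intro sum_mono2 sub) (auto simp: less_imp_le drho_pos)
    finally show "c * W ((n - N) div N) \<le> rhos n" by (simp add: K_def)
  qed
qed

lemma filterlim_blockindex: "filterlim (\<lambda>n. (n - N) div N) at_top sequentially"
  unfolding filterlim_at_top
proof
  fix Z
  have "Z \<le> (n - N) div N" if "n \<ge> N + Z * N" for n
  proof -
    have "Z * N \<le> n - N" using that by simp
    then have "Z * N div N \<le> (n - N) div N" by (rule div_le_mono)
    moreover have "N \<noteq> 0" by (simp add: N_eq)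
    ultimately show ?thesis by simp
  qed
  then show "\<forall>\<^sub>F n in sequentially. Z \<le> (n - N) div N" unfolding eventually_sequentially by blast
qed

lemma rhos_infinity: "filterlim rhos at_top sequentially"
proof -
  obtain c where c: "c > 0" "\<And>n. n \<ge> N \<Longrightarrow> c * W ((n - N) div N) \<le> rhos n" using rhos_W by blast
  have "filterlim (\<lambda>n. c * W ((n - N) div N)) at_top sequentially"
    by (rule filterlim_tendsto_pos_mult_at_top[OF tendsto_const c(1)]) (rule filterlim_compose[OF W_infinity filterlim_blockindex])
  then show ?thesis
    by (rule filterlim_at_top_mono) (rule eventually_mono[OF eventually_ge_at_top[of N]], rule c(2))
qed

lemma sum_blocks:
  fixes e :: "nat \<Rightarrow> 'a::ab_group_add"
  assumes "n \<ge> N"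
  shows "(\<Sum>i<n. e i) = (\<Sum>i<N. e i) + (\<Sum>k<(n - N) div N. \<Sum>j<N. e (Suc (sk k + j)))
     + (\<Sum>j<(n - N) mod N. e (Suc (sk ((n - N) div N) + j)))"
proof -
  define K J where "K = (n - N) div N" "J = (n - N) mod N"
  have n: "n = Suc K * N + J" using assms div_mult_mod_eq[of "n - N" N] unfolding K_J_def by simp
  have shift: "(\<Sum>i = m..<m + l. e i) = (\<Sum>j<l. e (m + j))" for m l
    using sum.shift_bounds_nat_ivl[of e 0 m l] by (simp add: atLeast0LessThan add_ac)
  have "(\<Sum>i<n. e i) = (\<Sum>i<Suc K * N. e i) + (\<Sum>i = Suc K * N..<Suc K * N + J. e i)"
    unfolding n by (simp only: lessThan_atLeast0 sum.atLeastLessThan_concat[of 0 "Suc K * N" "Suc K * N + J" e] le_add1 zero_le)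
  also have "(\<Sum>i<Suc K * N. e i) = (\<Sum>k<Suc K. \<Sum>j<N. e (k * N + j))"
    by (simp only: sum.nat_group[symmetric] shift)
  also have "\<dots> = (\<Sum>i<N. e i) + (\<Sum>k<K. \<Sum>j<N. e (Suc k * N + j))"
    by (subst sum.lessThan_Suc_shift) simp
  also have "(\<Sum>i = Suc K * N..<Suc K * N + J. e i) = (\<Sum>j<J. e (Suc K * N + j))" by (rule shift)
  finally show ?thesis by (simp only: Suc_sk_j K_J_def)
qed

text \<open>The first \<open>N\<close> terms and the unfinished last block stay bounded, since
  \<open>w\<close> tends to 0, while \<open>rhos\<close> diverges. An average over complete blocks
  thereby becomes an average over all indices.\<close>

lemma partial_blocks:
  fixes e :: "nat \<Rightarrow> real \<Rightarrow> 'a::real_normed_vector"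
  assumes bd: "\<And>n. \<exists>B. \<forall>x\<in>C. norm (e n x) \<le> B"
    and O: "\<And>j. j < N \<Longrightarrow> uO C w (\<lambda>k x. e (Suc (sk k + j)) x)"
    and S: "uo C W (\<lambda>n x. \<Sum>k<n. \<Sum>j<N. e (Suc (sk k + j)) x)"
  shows "uo C rhos (\<lambda>n x. \<Sum>i<n. e i x)"
proof (rule uoI)
  fix \<epsilon> :: real assume e: "\<epsilon> > 0"
  obtain c where c: "c > 0" "\<And>n. n \<ge> N \<Longrightarrow> c * W ((n - N) div N) \<le> rhos n" using rhos_W by blast
  obtain B0 where B0: "\<And>n x. x \<in> C \<Longrightarrow> norm (e n x) \<le> B0 n" using bd by metis
  have ex: "\<exists>B\<ge>0. \<forall>\<^sub>F k in sequentially. \<forall>x\<in>C. norm (e (Suc (sk k + j)) x) \<le> B" if j: "j < N" for j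
  proof -
    obtain B where B: "B > 0" "\<forall>\<^sub>F k in sequentially. \<forall>x\<in>C. norm (e (Suc (sk k + j)) x) \<le> B * w k"
      by (rule uOE[OF O[OF j]]) (rule less_imp_le[OF w_pos], rule that)
    have "\<forall>\<^sub>F k in sequentially. w k < 1" using order_tendstoD(2)[OF w_lim, of 1] by simp
    with B(2) have "\<forall>\<^sub>F k in sequentially. \<forall>x\<in>C. norm (e (Suc (sk k + j)) x) \<le> B"
    proof eventually_elim
      case (elim k)
      have "B * w k \<le> B * 1" using elim B by (intro mult_left_mono) auto
      then show ?case using elim(1) by force
    qed
    then show ?thesis using B(1) less_imp_le by blast
  qed
  \<comment> \<open>The condition is made vacuous for \<open>j\<close> beyond the block so that a
    bound can be chosen for every \<open>j\<close> at once.\<close>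
  define Pr where "Pr = (\<lambda>j B. j < N \<longrightarrow> B \<ge> 0 \<and> (\<forall>\<^sub>F k in sequentially. \<forall>x\<in>C. norm (e (Suc (sk k + j)) x) \<le> B))"
  have "\<forall>j. \<exists>B. Pr j B" using ex unfolding Pr_def by blast
  from choice[OF this] obtain B1 where "\<And>j. Pr j (B1 j)" by blast
  then have B1: "\<And>j. j < N \<Longrightarrow> B1 j \<ge> 0"
    "\<And>j. j < N \<Longrightarrow> \<forall>\<^sub>F k in sequentially. \<forall>x\<in>C. norm (e (Suc (sk k + j)) x) \<le> B1 j" unfolding Pr_def by blast+
  have "\<forall>\<^sub>F k in sequentially. \<forall>j\<in>{..<N}. \<forall>x\<in>C. norm (e (Suc (sk k + j)) x) \<le> B1 j"
    using B1(2) by (intro eventually_ball_finite) auto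
  from filterlim_iff[THEN iffD1, OF filterlim_blockindex, rule_format, OF this]
  have ev1: "\<forall>\<^sub>F n in sequentially. \<forall>j\<in>{..<N}. \<forall>x\<in>C. norm (e (Suc (sk ((n - N) div N) + j)) x) \<le> B1 j" .
  have "\<epsilon> * c / 2 > 0" using e c by simp
  from filterlim_iff[THEN iffD1, OF filterlim_blockindex, rule_format, OF uoD[OF S this]]
  have ev2: "\<forall>\<^sub>F n in sequentially. \<forall>x\<in>C. norm (\<Sum>k<(n - N) div N. \<Sum>j<N. e (Suc (sk k + j)) x) \<le> \<epsilon> * c / 2 * W ((n - N) div N)" .
  have ev3: "\<forall>\<^sub>F n in sequentially. rhos n \<ge> (sum B0 {..<N} + sum B1 {..<N}) / (\<epsilon>/2)"
    using rhos_infinity by (simp add: filterlim_at_top)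
  from ev1 ev2 ev3 eventually_ge_at_top[of N]
  show "\<forall>\<^sub>F n in sequentially. \<forall>x\<in>C. norm (\<Sum>i<n. e i x) \<le> \<epsilon> * rhos n"
  proof eventually_elim
    case (elim n)
    show ?case
    proof
      fix x assume x: "x \<in> C"
      define K J where "K = (n - N) div N" "J = (n - N) mod N"
      have J: "J < N" by (simp add: K_J_def N_eq)
      have "norm (\<Sum>i<N. e i x) \<le> sum B0 {..<N}" by (rule order_trans[OF norm_sum]) (intro sum_mono B0 x)
      moreover have "norm (\<Sum>j<J. e (Suc (sk K + j)) x) \<le> sum B1 {..<N}"
      proof -
        have "norm (\<Sum>j<J. e (Suc (sk K + j)) x) \<le> (\<Sum>j<J. B1 j)"
          using elim(1) x J by (intro order_trans[OF norm_sum] sum_mono) (auto simp: K_J_def)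
        also have "\<dots> \<le> sum B1 {..<N}" by (rule sum_mono2) (use J B1 in auto)
        finally show ?thesis .
      qed
      moreover have "norm (\<Sum>k<K. \<Sum>j<N. e (Suc (sk k + j)) x) \<le> \<epsilon> / 2 * rhos n"
      proof -
        have "norm (\<Sum>k<K. \<Sum>j<N. e (Suc (sk k + j)) x) \<le> \<epsilon> * c / 2 * W K" using elim(2) x by (simp add: K_J_def)
        also have "\<dots> = \<epsilon> / 2 * (c * W K)" by simp
        also have "\<dots> \<le> \<epsilon> / 2 * rhos n" unfolding K_J_def using c(2)[OF elim(4)] e by (intro mult_left_mono) auto
        finally show ?thesis .
      qed
      moreover have "sum B0 {..<N} + sum B1 {..<N} \<le> \<epsilon> / 2 * rhos n"
        using elim(3) e by (simp add: field_simps)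
      ultimately have "norm (\<Sum>i<N. e i x) + norm (\<Sum>k<K. \<Sum>j<N. e (Suc (sk k + j)) x) + norm (\<Sum>j<J. e (Suc (sk K + j)) x) \<le> \<epsilon> * rhos n"
        by (simp add: field_simps)
      then show "norm (\<Sum>i<n. e i x) \<le> \<epsilon> * rhos n"
        unfolding sum_blocks[OF elim(4)] K_J_def
        using norm_triangle_ineq[of "(\<Sum>i<N. e i x) + (\<Sum>k<(n - N) div N. \<Sum>j<N. e (Suc (sk k + j)) x)" "\<Sum>j<(n - N) mod N. e (Suc (sk ((n - N) div N) + j)) x"]
          norm_triangle_ineq[of "\<Sum>i<N. e i x" "\<Sum>k<(n - N) div N. \<Sum>j<N. e (Suc (sk k + j)) x"] by linarith
    qed
  qed
qed

lemma y_bounded: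
  assumes "compact C"
  shows "\<exists>B. \<forall>x\<in>C. cmod (y n x) \<le> B"
proof -
  obtain B where B: "\<And>x. x \<in> C \<Longrightarrow> cmod (tau x) \<le> B" using tau_bounds(1)[OF assms] by blast
  have B': "\<bar>Re (tau x)\<bar> \<le> B" if "x \<in> C" for x using B[OF that] abs_Re_le_cmod order_trans by blast
  obtain D where D: "\<And>x. x \<in> C \<Longrightarrow> \<bar>1 / Im (tau x)\<bar> \<le> D" using tau_bounds(2)[OF assms] by blast
  obtain P where P: "\<And>x. x \<in> C \<Longrightarrow> norm (orthP a b n x) \<le> P" using bdd_on[OF assms continuous_on_orth(1)] by blast
  obtain Q where Q: "\<And>x. x \<in> C \<Longrightarrow> norm (orthQ a b n x) \<le> Q" using bdd_on[OF assms continuous_on_orth(2)] by blast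
  have "cmod (y n x) \<le> P + (Q + B * P) * D" if x: "x \<in> C" for x
  proof -
    have "cmod (y n x) \<le> \<bar>orthP a b n x\<bar> + \<bar>(orthQ a b n x - Re (tau x) * orthP a b n x) * (1 / Im (tau x))\<bar>"
      unfolding y_def by (rule order_trans[OF cmod_le]) simp
    also have "\<dots> \<le> P + (Q + B * P) * D"
    proof (intro add_mono)
      show "\<bar>orthP a b n x\<bar> \<le> P" using P[OF x] by simp
      have "\<bar>orthQ a b n x - Re (tau x) * orthP a b n x\<bar> \<le> \<bar>orthQ a b n x\<bar> + \<bar>Re (tau x)\<bar> * \<bar>orthP a b n x\<bar>"
        using abs_triangle_ineq4[of "orthQ a b n x" "Re (tau x) * orthP a b n x"] by (simp only: abs_mult)
      also have "\<dots> \<le> Q + B * P" using P[OF x] Q[OF x] B'[OF x] by (intro add_mono mult_mono) auto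
      finally show "\<bar>(orthQ a b n x - Re (tau x) * orthP a b n x) * (1 / Im (tau x))\<bar> \<le> (Q + B * P) * D"
        unfolding abs_mult using D[OF x] by (intro mult_mono) auto
    qed
    finally show ?thesis .
  qed
  then show ?thesis by blast
qed

definition Gam :: real where "Gam = (\<Sum>j<N. (cmod (gam j))\<^sup>2)"
text \<open>Half of the mean of the squared modulus of \<open>y\<close> per unit of the clock: a
  block contributes \<open>Gam * gp x * w k\<close> to the squared moduli and
  \<open>N * \<alpha> (-1) * w k\<close> to \<open>rhos\<close>. As the squares of \<open>y\<close>
  have mean 0, this half is the mean of the squared polynomials.\<close>

definition hh :: "real \<Rightarrow> real" where "hh x = Gam * gp x / (2 * real N * \<alpha> (-1))"

lemma alpha_m1_pos: "2 * real N * \<alpha> (-1) > 0" using N_eq by simp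

text \<open>Each position of a block sees a fixed multiple of the squares of \<open>zP\<close>, up
  to conjugation and a summable error; their sums are negligible by
  \<open>zk_square_sum\<close>.\<close>

lemma y_square_mean:
  assumes "compact C"
  shows "uo C rhos (\<lambda>n x. \<Sum>i<n. (y i x)\<^sup>2)"
proof (rule partial_blocks)
  fix n
  obtain B where B: "\<And>x. x \<in> C \<Longrightarrow> cmod (y n x) \<le> B" using y_bounded[OF assms] by blast
  have "norm ((y n x)\<^sup>2) \<le> B\<^sup>2" if "x \<in> C" for x
    unfolding norm_power by (intro power_mono B that) simp
  then show "\<exists>B. \<forall>x\<in>C. norm ((y n x)\<^sup>2) \<le> B" by blast
next
  fix j
  show "uO C w (\<lambda>k x. (y (Suc (sk k + j)) x)\<^sup>2)"
    using uO_mult[OF y_O[OF assms, of j] y_O[OF assms, of j]] by (simp add: sqrt_w power2_eq_square less_imp_le)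
next
  have 1: "uo C W (\<lambda>n x. \<Sum>k<n. (y (Suc (sk k + j)) x)\<^sup>2)" for j
  proof -
    have bd: "\<exists>B. \<forall>x\<in>C. norm ((y (Suc (sk k + j)) x)\<^sup>2 - cnj ((gam j)\<^sup>2 * (zP k x)\<^sup>2)) \<le> B" for k
    proof -
      obtain B where B: "\<And>x. x \<in> C \<Longrightarrow> cmod (y (Suc (sk k + j)) x) \<le> B" using y_bounded[OF assms] by blast
      have "continuous_on C (\<lambda>x. (gam j)\<^sup>2 * (zP k x)\<^sup>2)" unfolding zP_def zk_def by (intro continuous_intros)
      then obtain D where D: "\<And>x. x \<in> C \<Longrightarrow> norm ((gam j)\<^sup>2 * (zP k x)\<^sup>2) \<le> D" using bdd_on[OF assms] by blast
      have "norm ((y (Suc (sk k + j)) x)\<^sup>2 - cnj ((gam j)\<^sup>2 * (zP k x)\<^sup>2)) \<le> B\<^sup>2 + D" if "x \<in> C" for x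
        by (rule order_trans[OF norm_triangle_ineq4]) (intro add_mono, simp only: norm_power, intro power_mono B that norm_ge_zero, simp only: complex_mod_cnj, rule D[OF that])
      then show ?thesis by blast
    qed
    have "uo C W (\<lambda>n x. (\<Sum>k<n. (y (Suc (sk k + j)) x)\<^sup>2 - cnj ((gam j)\<^sup>2 * (zP k x)\<^sup>2)))"
      by (rule uo_W[OF y_square_asym[OF assms] bd])
    moreover have "uo C W (\<lambda>n x. (\<Sum>k<n. (zP k x)\<^sup>2))" unfolding zP_def by (intro zk_square_sum goodsol_P assms)
    then have "uo C W (\<lambda>n x. (gam j)\<^sup>2 * (\<Sum>k<n. (zP k x)\<^sup>2))" by (rule uo_scale)
    then have "uo C W (\<lambda>n x. cnj ((gam j)\<^sup>2 * (\<Sum>k<n. (zP k x)\<^sup>2)))" by (simp only: uo_cnj)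
    ultimately have "uo C W (\<lambda>n x. (\<Sum>k<n. (y (Suc (sk k + j)) x)\<^sup>2 - cnj ((gam j)\<^sup>2 * (zP k x)\<^sup>2)) + cnj ((gam j)\<^sup>2 * (\<Sum>k<n. (zP k x)\<^sup>2)))"
      by (rule uo_add)
    then show ?thesis by (simp add: sum_subtractf sum_distrib_left)
  qed
  have "uo C W (\<lambda>n x. \<Sum>j\<in>J. \<Sum>k<n. (y (Suc (sk k + j)) x)\<^sup>2)" if "finite J" for J
    using that
  proof (induction J rule: finite_induct)
    case empty
    have "W n \<ge> 0" for n unfolding W_def by (intro sum_nonneg) (simp add: less_imp_le)
    then show ?case by (intro uoI) simp
  next
    case (insert j J)
    then show ?case using uo_add[OF 1[of j] insert.IH] by simp
  qed
  then have "uo C W (\<lambda>n x. \<Sum>j<N. \<Sum>k<n. (y (Suc (sk k + j)) x)\<^sup>2)" by simp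
  then show "uo C W (\<lambda>n x. \<Sum>k<n. \<Sum>j<N. (y (Suc (sk k + j)) x)\<^sup>2)"
    by (subst sum.swap) simp
qed

lemma y_norm_mean:
  assumes "compact C"
  shows "uo C rhos (\<lambda>n x. \<Sum>i<n. ((cmod (y i x))\<^sup>2 - 2 * hh x * drho i))"
proof (rule partial_blocks)
  obtain G where G: "\<And>x. x \<in> C \<Longrightarrow> gp x \<le> G" using gp_limit(3)[OF assms] by blast
  have gpB: "norm (gp x) \<le> G" if "x \<in> C" for x using G[OF that] gp_pos[of x] by simp
  have hB: "norm (2 * hh x) \<le> \<bar>2 * (Gam / (2 * real N * \<alpha> (-1)))\<bar> * G" if "x \<in> C" for x
  proof -
    have "2 * hh x = (2 * (Gam / (2 * real N * \<alpha> (-1)))) * gp x" by (simp add: hh_def)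
    then show ?thesis using gpB[OF that] by (simp only: real_norm_def abs_mult) (intro mult_left_mono, auto)
  qed
  have bd: "\<exists>B. \<forall>x\<in>C. norm ((cmod (y n x))\<^sup>2 - 2 * hh x * drho n) \<le> B" for n
  proof -
    obtain B where B: "\<And>x. x \<in> C \<Longrightarrow> cmod (y n x) \<le> B" using y_bounded[OF assms] by blast
    have "norm ((cmod (y n x))\<^sup>2 - 2 * hh x * drho n) \<le> B\<^sup>2 + (\<bar>2 * (Gam / (2 * real N * \<alpha> (-1)))\<bar> * G) * \<bar>drho n\<bar>" if x: "x \<in> C" for x
    proof (rule order_trans[OF norm_triangle_ineq4], rule add_mono)
      show "norm ((cmod (y n x))\<^sup>2) \<le> B\<^sup>2" unfolding norm_power by (intro power_mono) (use B x in auto)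
      show "norm (2 * hh x * drho n) \<le> (\<bar>2 * (Gam / (2 * real N * \<alpha> (-1)))\<bar> * G) * \<bar>drho n\<bar>"
        unfolding norm_mult[of _ "drho n"] real_norm_def[of "drho n"] by (intro mult_right_mono hB x) simp
    qed
    then show ?thesis by blast
  qed
  then show "\<exists>B. \<forall>x\<in>C. norm ((cmod (y n x))\<^sup>2 - 2 * hh x * drho n) \<le> B" for n .
  have wO: "uO C w (\<lambda>k x. w k)" by (rule uOI[where B=1]) (auto simp: less_imp_le)
  have e: "uo C w (\<lambda>k x. ((cmod (y (Suc (sk k + j)) x))\<^sup>2 - 2 * hh x * drho (Suc (sk k + j)))
     - ((cmod (gam j))\<^sup>2 * gp x - 2 * hh x * \<alpha> (-1)) * w k)" (is "uo C w ?e") for j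
  proof -
    have 2: "uO C (\<lambda>_. 1) (\<lambda>k x. 2 * hh x)" by (rule uO_const_fun[OF hB])
    have "uo C w (\<lambda>k x. (2 * hh x) * (drho (Suc (sk k + j)) - \<alpha> (-1) * w k))"
      using uo_mult(2)[OF drho_block 2] by (simp add: less_imp_le)
    from uo_diff[OF y_norm_asym[OF assms, of j] this] show ?thesis by (simp add: algebra_simps)
  qed
  have gO: "uO C w (\<lambda>k x. ((cmod (gam j))\<^sup>2 * gp x - 2 * hh x * \<alpha> (-1)) * w k)" for j
  proof -
    have "norm ((cmod (gam j))\<^sup>2 * gp x - 2 * hh x * \<alpha> (-1)) \<le> (cmod (gam j))\<^sup>2 * G + (\<bar>2 * (Gam / (2 * real N * \<alpha> (-1)))\<bar> * G) * \<bar>\<alpha> (-1)\<bar>" if x: "x \<in> C" for x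
    proof (rule order_trans[OF norm_triangle_ineq4], rule add_mono)
      show "norm ((cmod (gam j))\<^sup>2 * gp x) \<le> (cmod (gam j))\<^sup>2 * G" using gpB[OF x] by (simp add: abs_mult mult_left_mono)
      show "norm (2 * hh x * \<alpha> (-1)) \<le> (\<bar>2 * (Gam / (2 * real N * \<alpha> (-1)))\<bar> * G) * \<bar>\<alpha> (-1)\<bar>"
        unfolding norm_mult[of _ "\<alpha> (-1)"] real_norm_def[of "\<alpha> (-1)"] by (intro mult_right_mono hB x) simp
    qed
    from uO_const_fun[of C "\<lambda>x. (cmod (gam j))\<^sup>2 * gp x - 2 * hh x * \<alpha> (-1)", OF this]
    have "uO C (\<lambda>_. 1) (\<lambda>k x. (cmod (gam j))\<^sup>2 * gp x - 2 * hh x * \<alpha> (-1))" .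
    from uO_mult[OF this wO] show ?thesis by (simp add: less_imp_le)
  qed
  show "uO C w (\<lambda>k x. (cmod (y (Suc (sk k + j)) x))\<^sup>2 - 2 * hh x * drho (Suc (sk k + j)))" for j
    using uO_add[OF uo_imp_uO[OF e[of j]] gO[of j]] by simp
  have "uo C w (\<lambda>k x. \<Sum>j\<in>J. ?e j k x)" if "finite J" for J
    using that
  proof (induction J rule: finite_induct)
    case empty then show ?case by (intro uoI) (simp add: less_imp_le)
  next
    case (insert j J) then show ?case using uo_add[OF e[of j] insert.IH] by simp
  qed
  then have "uo C w (\<lambda>k x. \<Sum>j<N. ?e j k x)" by simp
  also have "(\<lambda>k x. \<Sum>j<N. ?e j k x) = (\<lambda>k x. \<Sum>j<N. ((cmod (y (Suc (sk k + j)) x))\<^sup>2 - 2 * hh x * drho (Suc (sk k + j))))"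
  proof (intro ext)
    fix k x
    have "(\<Sum>j<N. ((cmod (gam j))\<^sup>2 * gp x - 2 * hh x * \<alpha> (-1)) * w k) = (Gam * gp x - real N * (2 * hh x * \<alpha> (-1))) * w k"
      unfolding Gam_def by (simp add: sum_subtractf sum_distrib_right[symmetric] left_diff_distrib)
    \<comment> \<open>The main terms cancel after summation over the whole block, not position by
      position; this equation is what determines \<open>hh\<close>.\<close>
    also have "Gam * gp x - real N * (2 * hh x * \<alpha> (-1)) = 0"
    proof -
      have "N \<noteq> 0" by (simp add: N_eq)
      then show ?thesis by (simp add: hh_def)
    qed
    finally show "(\<Sum>j<N. ?e j k x) = (\<Sum>j<N. ((cmod (y (Suc (sk k + j)) x))\<^sup>2 - 2 * hh x * drho (Suc (sk k + j))))"
      by (simp add: sum_subtractf)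
  qed
  finally show "uo C W (\<lambda>n x. \<Sum>k<n. \<Sum>j<N. ((cmod (y (Suc (sk k + j)) x))\<^sup>2 - 2 * hh x * drho (Suc (sk k + j))))"
  proof (rule uo_W)
    fix k
    have "\<forall>j. \<exists>B. \<forall>x\<in>C. norm ((cmod (y (Suc (sk k + j)) x))\<^sup>2 - 2 * hh x * drho (Suc (sk k + j))) \<le> B" using bd by blast
    then obtain B where B: "\<And>j x. x \<in> C \<Longrightarrow> norm ((cmod (y (Suc (sk k + j)) x))\<^sup>2 - 2 * hh x * drho (Suc (sk k + j))) \<le> B j" by metis
    have "norm (\<Sum>j<N. ((cmod (y (Suc (sk k + j)) x))\<^sup>2 - 2 * hh x * drho (Suc (sk k + j)))) \<le> sum B {..<N}" if "x \<in> C" for x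
      by (rule order_trans[OF norm_sum]) (intro sum_mono B that)
    then show "\<exists>B. \<forall>x\<in>C. norm (\<Sum>j<N. ((cmod (y (Suc (sk k + j)) x))\<^sup>2 - 2 * hh x * drho (Suc (sk k + j)))) \<le> B" by blast
  qed
qed

end

section \<open>Christoffel--Darboux kernels\<close>

lemma discrete_gronwall:
  fixes D k :: "nat \<Rightarrow> real"
  assumes D: "\<And>m. m \<le> n \<Longrightarrow> D m \<le> B + (\<Sum>j<m. k j * D j)" and k: "\<And>j. k j \<ge> 0" and B: "B \<ge> 0" and m: "m \<le> n"
  shows "D m \<le> B * exp (\<Sum>j<m. k j)"
proof -
  have prod: "B + (\<Sum>j<m. k j * (B * (\<Prod>i<j. 1 + k i))) = B * (\<Prod>i<m. 1 + k i)" for m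
    by (induction m) (simp_all add: algebra_simps)
  have "D m \<le> B * (\<Prod>i<m. 1 + k i)" using m
  proof (induction m rule: less_induct)
    case (less m)
    have "D m \<le> B + (\<Sum>j<m. k j * D j)" by (rule D[OF less.prems])
    also have "\<dots> \<le> B + (\<Sum>j<m. k j * (B * (\<Prod>i<j. 1 + k i)))"
      by (intro add_left_mono sum_mono mult_left_mono k less.IH) (use less.prems in auto)
    finally show ?case unfolding prod .
  qed
  also have "\<dots> \<le> B * exp (\<Sum>j<m. k j)"
    unfolding exp_sum[OF finite_lessThan] by (intro mult_left_mono prod_mono B conjI exp_ge_add_one_self) (use k in \<open>auto intro: add_nonneg_nonneg\<close>)
  finally show ?thesis .
qed

text \<open>Summation by parts. The terms \<open>E\<close> are small through their partial sums
  only, and the price is the total variation of \<open>f\<close>.\<close>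

lemma abel_bound:
  fixes E f :: "nat \<Rightarrow> complex"
  assumes "\<And>j. j \<le> m \<Longrightarrow> cmod (\<Sum>i<j. E i) \<le> \<eta>"
  shows "cmod (\<Sum>j<m. E j * f j) \<le> \<eta> * (cmod (f m) + (\<Sum>j<m. cmod (f (Suc j) - f j)))"
proof -
  define S where "S j = (\<Sum>i<j. E i)" for j
  have "(\<Sum>j<m. E j * f j) = S m * f m - (\<Sum>j<m. S (Suc j) * (f (Suc j) - f j))"
    unfolding S_def by (induction m) (simp_all add: algebra_simps)
  also have "cmod \<dots> \<le> cmod (S m * f m) + (\<Sum>j<m. cmod (S (Suc j) * (f (Suc j) - f j)))"
    by (rule order_trans[OF norm_triangle_ineq4]) (intro add_left_mono norm_sum)
  also have "\<dots> \<le> \<eta> * cmod (f m) + (\<Sum>j<m. \<eta> * cmod (f (Suc j) - f j))"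
    unfolding norm_mult using assms[folded S_def] by (intro add_mono sum_mono mult_right_mono) auto
  finally show ?thesis by (simp add: sum_distrib_left distrib_left)
qed

lemma cis_diff_le: "cmod (cis s - cis t) \<le> \<bar>s - t\<bar>"
proof -
  have "cis s - cis t = cis t * (cis (s - t) - 1)" by (simp add: cis_mult algebra_simps)
  then have "cmod (cis s - cis t) = cmod (cis (s - t) - 1)" by (simp add: norm_mult)
  also have "\<dots> \<le> \<bar>s - t\<bar>" using iexp_approx1[of "s - t" 0] by (simp add: cis_conv_exp)
  finally show ?thesis .
qed

lemma cis_approx: "cmod (cis s - 1 - \<i> * of_real s) \<le> s\<^sup>2"
proof -
  have "cmod (iexp s - (\<Sum>k\<le>1. (\<i> * of_real s)^k / fact k)) \<le> \<bar>s\<bar>^2 / fact 2" using iexp_approx1[of s 1] by (simp add: numeral_2_eq_2)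
  also have "\<dots> \<le> s\<^sup>2" by simp
  finally show ?thesis by (simp add: cis_conv_exp diff_diff_eq)
qed

text \<open>\<open>g\<close> is an antiderivative of the cosine, so these increments compare a
  Riemann sum with an integral; over [0, 1] the total increment of \<open>g\<close> is
  \<open>sinc p\<close>.\<close>

lemma sinc_increment:
  fixes p t d :: real
  assumes "d \<ge> 0"
  defines "g \<equiv> \<lambda>t. if p = 0 then t else sin (p * t) / p"
  shows "\<bar>d * cos (p * t) - (g (t + d) - g t)\<bar> \<le> \<bar>p\<bar> * d\<^sup>2"
proof (cases "d = 0")
  case False
  then have d: "d > 0" using assms by simp
  have der: "DERIV g x :> cos (p * x)" for x
    unfolding g_def by (cases "p = 0") (auto intro!: derivative_eq_intros)
  obtain z where z: "z > t" "z < t + d" "g (t + d) - g t = (t + d - t) * cos (p * z)"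
    using MVT2[of t "t + d" g "\<lambda>x. cos (p * x)"] der d by auto
  have "d * cos (p * t) - (g (t + d) - g t) = d * (Re (cis (p * t)) - Re (cis (p * z)))" using z by (simp add: algebra_simps)
  also have "\<bar>\<dots>\<bar> = d * \<bar>Re (cis (p * t) - cis (p * z))\<bar>" using d by (simp add: abs_mult)
  also have "\<dots> \<le> d * cmod (cis (p * t) - cis (p * z))" using d by (intro mult_left_mono abs_Re_le_cmod) auto
  also have "\<dots> \<le> d * \<bar>p * t - p * z\<bar>" using d by (intro mult_left_mono cis_diff_le) auto
  also have "\<bar>p * t - p * z\<bar> = \<bar>p\<bar> * \<bar>t - z\<bar>" by (simp add: abs_mult flip: right_diff_distrib)
  also have "d * (\<bar>p\<bar> * \<bar>t - z\<bar>) \<le> d * (\<bar>p\<bar> * d)" using z d by (intro mult_left_mono) auto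
  finally show ?thesis by (simp add: power2_eq_square mult_ac)
qed (simp add: g_def)

lemma sum_split:
  fixes X E F e :: "nat \<Rightarrow> complex"
  shows "(\<Sum>j<k. X j + c * (E j + F j) - e j) = (\<Sum>j<k. X j) + c * ((\<Sum>j<k. E j) + (\<Sum>j<k. F j)) - (\<Sum>j<k. e j)"
  by (simp add: sum.distrib sum_subtractf sum_distrib_left algebra_simps)

text \<open>Variation of constants: the coefficient with respect to \<open>y\<close> that represents
  the solution at a shifted spectral parameter. Each increment is a real multiple of
  \<open>\<i> * y j\<close>, which is orthogonal to \<open>y j\<close> in the real plane, so the
  current value \<open>Re (cnj (y j) * c)\<close> is left unchanged.\<close>

primrec cseq :: "real \<Rightarrow> (nat \<Rightarrow> complex) \<Rightarrow> nat \<Rightarrow> complex" where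
  "cseq s y 0 = 1"
| "cseq s y (Suc j) = cseq s y j + \<i> * of_real (s * Re (cnj (y j) * cseq s y j)) * y j"

text \<open>The averaging step for one fixed \<open>x\<close>. All errors are measured by one number
  \<open>\<eta>\<close> relative to the total time \<open>R\<close>, so the resulting bounds are
  explicit and become uniform in \<open>x\<close>. In the application \<open>T\<close> is
  \<open>Im (tau x)\<close> and \<open>h\<close> is \<open>hh x\<close>.\<close>

locale averaged =
  fixes y :: "nat \<Rightarrow> complex" and dr :: "nat \<Rightarrow> real" and m :: nat and R h T \<eta> :: real
  assumes dr: "\<And>j. dr j \<ge> 0" and R: "R > 0" "R = (\<Sum>j<m. dr j)" and h: "h \<ge> 0" and eta: "\<eta> \<ge> 0"
    and E: "\<And>j. j \<le> m \<Longrightarrow> \<bar>\<Sum>i<j. ((cmod (y i))\<^sup>2 - 2 * h * dr i)\<bar> \<le> \<eta> * R"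
    and F: "\<And>j. j \<le> m \<Longrightarrow> cmod (\<Sum>i<j. (y i)\<^sup>2) \<le> \<eta> * R"
    and dr_small: "\<And>j. j < m \<Longrightarrow> dr j \<le> \<eta> * R"
begin

definition tt :: "nat \<Rightarrow> real" where "tt j = (\<Sum>i<j. dr i) / R"

lemma tt_Suc: "tt (Suc j) = tt j + dr j / R" by (simp add: tt_def add_divide_distrib)
lemma tt_0: "tt 0 = 0" and tt_m: "tt m = 1" unfolding tt_def using R(1) R(2)[symmetric] by simp_all

lemma sum_dt: "j \<le> m \<Longrightarrow> (\<Sum>i<j. dr i / R) \<le> 1"
proof -
  assume "j \<le> m"
  then have "(\<Sum>i<j. dr i) \<le> R" unfolding R(2) by (intro sum_mono2) (auto simp: dr)
  then show ?thesis using R(1) by (simp add: sum_divide_distrib[symmetric])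
qed

lemma sum_dt2: "j \<le> m \<Longrightarrow> (\<Sum>i<j. (dr i / R)\<^sup>2) \<le> \<eta>"
proof -
  assume j: "j \<le> m"
  have "(\<Sum>i<j. (dr i / R)\<^sup>2) \<le> (\<Sum>i<j. \<eta> * (dr i / R))"
  proof (rule sum_mono)
    fix i assume "i \<in> {..<j}"
    then have "dr i / R \<le> \<eta>" using dr_small[of i] j R(1) by (simp add: field_simps)
    then show "(dr i / R)\<^sup>2 \<le> \<eta> * (dr i / R)" unfolding power2_eq_square using dr[of i] R(1) by (intro mult_right_mono) auto
  qed
  also have "\<dots> = \<eta> * (\<Sum>i<j. dr i / R)" by (simp add: sum_distrib_left)
  also have "\<dots> \<le> \<eta> * 1" by (intro mult_left_mono sum_dt j eta)
  finally show ?thesis by simp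
qed

lemma sum_y: "j \<le> m \<Longrightarrow> (\<Sum>i<j. (cmod (y i))\<^sup>2) \<le> (2 * h + \<eta>) * R"
proof -
  assume j: "j \<le> m"
  have "(\<Sum>i<j. (cmod (y i))\<^sup>2) = (\<Sum>i<j. ((cmod (y i))\<^sup>2 - 2 * h * dr i)) + 2 * h * (\<Sum>i<j. dr i)"
    by (simp add: sum_subtractf sum_distrib_left)
  also have "\<dots> \<le> \<eta> * R + 2 * h * R"
  proof (intro add_mono mult_left_mono)
    show "(\<Sum>i<j. ((cmod (y i))\<^sup>2 - 2 * h * dr i)) \<le> \<eta> * R" using E[OF j] by simp
    show "(\<Sum>i<j. dr i) \<le> R" unfolding R(2) using j by (intro sum_mono2) (auto simp: dr)
  qed (use h in auto)
  finally show ?thesis by (simp add: algebra_simps)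
qed

lemma abel_cis:
  assumes "\<And>j. j \<le> m \<Longrightarrow> cmod (\<Sum>i<j. G i) \<le> \<eta> * R" "k \<le> m"
  shows "cmod (\<Sum>j<k. G j * cis (p * tt j)) \<le> \<eta> * R * (1 + \<bar>p\<bar>)"
proof -
  have "cmod (\<Sum>j<k. G j * cis (p * tt j)) \<le> \<eta> * R * (cmod (cis (p * tt k)) + (\<Sum>j<k. cmod (cis (p * tt (Suc j)) - cis (p * tt j))))"
    by (rule abel_bound) (use assms in auto)
  also have "\<dots> \<le> \<eta> * R * (1 + (\<Sum>j<k. \<bar>p\<bar> * (dr j / R)))"
  proof (intro mult_left_mono add_mono sum_mono)
    fix j
    have "cmod (cis (p * tt (Suc j)) - cis (p * tt j)) \<le> \<bar>p * tt (Suc j) - p * tt j\<bar>" by (rule cis_diff_le)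
    also have "p * tt (Suc j) - p * tt j = p * (dr j / R)" by (simp add: tt_Suc algebra_simps)
    also have "\<bar>p * (dr j / R)\<bar> = \<bar>p\<bar> * (dr j / R)" using dr[of j] R(1) by (simp add: abs_mult)
    finally show "cmod (cis (p * tt (Suc j)) - cis (p * tt j)) \<le> \<bar>p\<bar> * (dr j / R)" .
  qed (use eta R in auto)
  also have "\<dots> \<le> \<eta> * R * (1 + \<bar>p\<bar> * 1)"
    unfolding sum_distrib_left[symmetric] by (intro mult_left_mono add_mono sum_dt assms) (use eta R in auto)
  finally show ?thesis by simp
qed

text \<open>The first summand stems from Abel summation of the oscillating terms, the second from
  the Taylor remainder of the rotation; the exponential is the amplification in Gronwall's
  inequality.\<close>

definition err :: "real \<Rightarrow> real" where
  "err u = (\<bar>u * T\<bar> * \<eta> * (1 + \<bar>u * T * h\<bar>) + (u * T * h)\<^sup>2 * \<eta>) * exp (\<bar>u * T\<bar> * (2 * h + \<eta>))"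

text \<open>The identity \<open>2 * Re (cnj y * c) * y = |y|^2 * c + y^2 * cnj c\<close> splits each
  increment. Replacing \<open>|y|^2\<close> by its mean \<open>2 * h * dr j\<close> and
  \<open>y^2\<close> by 0 leaves a rotation with speed \<open>u * T * h\<close>. The deviation
  \<open>D\<close> is driven by terms with small averages, to which Abel summation applies because
  the rotation has bounded variation, and it feeds back linearly, which Gronwall's inequality
  controls.\<close>

lemma cseq_approx:
  assumes "k \<le> m"
  shows "cmod (cseq (u * T / R) y k - cis (u * T * h * tt k)) \<le> err u"
proof -
  define \<theta> where "\<theta> = u * T * h"
  define s where "s = u * T / R"
  define c where "c = cseq s y"
  define f where "f = (\<lambda>j. cis (\<theta> * tt j))"
  define D where "D = (\<lambda>j. c j - f j)"
  define e where "e = (\<lambda>j. f (Suc j) - f j - \<i> * of_real (\<theta> * (dr j / R)) * f j)"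
  define E' where "E' = (\<lambda>j. complex_of_real ((cmod (y j))\<^sup>2 - 2 * h * dr j))"
  have sR: "\<bar>s\<bar> * R = \<bar>u * T\<bar>" using R(1) by (simp add: s_def abs_mult)
  have step: "D (Suc j) - D j = \<i> * of_real (s / 2) * ((of_real ((cmod (y j))\<^sup>2) * D j + (y j)\<^sup>2 * cnj (D j)))
      + \<i> * of_real (s / 2) * (E' j * f j + (y j)\<^sup>2 * cnj (f j)) - e j" for j
  proof -
    have y2: "complex_of_real ((cmod (y j))\<^sup>2) = y j * cnj (y j)" by (rule complex_norm_square)
    have re: "complex_of_real (Re (cnj (y j) * c j)) = (cnj (y j) * c j + y j * cnj (c j)) / 2"
      using complex_add_cnj[of "cnj (y j) * c j"] by simp
    have th: "\<theta> * (dr j / R) = s * h * dr j" by (simp add: \<theta>_def s_def)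
    have "c (Suc j) - c j = \<i> * of_real s * of_real (Re (cnj (y j) * c j)) * y j" by (simp add: c_def s_def)
    also have "\<dots> = \<i> * of_real (s / 2) * (of_real ((cmod (y j))\<^sup>2) * c j + (y j)\<^sup>2 * cnj (c j))"
      unfolding re y2 by (simp add: power2_eq_square algebra_simps add_divide_distrib)
    finally have "c (Suc j) - c j = \<i> * of_real (s / 2) * (of_real ((cmod (y j))\<^sup>2) * c j + (y j)\<^sup>2 * cnj (c j))" .
    moreover have "f (Suc j) - f j = e j + \<i> * of_real (s / 2) * (2 * of_real (h * dr j)) * f j"
      unfolding e_def th by simp
    ultimately show ?thesis unfolding D_def E'_def by (simp add: algebra_simps)
  qed
  have e: "cmod (e j) \<le> \<theta>\<^sup>2 * (dr j / R)\<^sup>2" for j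
  proof -
    have "f (Suc j) = f j * cis (\<theta> * (dr j / R))" unfolding f_def tt_Suc by (simp add: cis_mult algebra_simps)
    then have "e j = f j * (cis (\<theta> * (dr j / R)) - 1 - \<i> * of_real (\<theta> * (dr j / R)))" unfolding e_def by (simp add: algebra_simps)
    then have "cmod (e j) = cmod (cis (\<theta> * (dr j / R)) - 1 - \<i> * of_real (\<theta> * (dr j / R)))" by (simp add: norm_mult f_def)
    also have "\<dots> \<le> (\<theta> * (dr j / R))\<^sup>2" by (rule cis_approx)
    finally show ?thesis by (simp only: power_mult_distrib)
  qed
  define B where "B = \<bar>u * T\<bar> * \<eta> * (1 + \<bar>\<theta>\<bar>) + \<theta>\<^sup>2 * \<eta>"
  have B0: "B \<ge> 0" using eta by (simp add: B_def)
  have D0: "D 0 = 0" by (simp add: D_def c_def f_def tt_0)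
  have Dbound: "cmod (D k) \<le> B + (\<Sum>j<k. (\<bar>s\<bar> * (cmod (y j))\<^sup>2) * cmod (D j))" if k: "k \<le> m" for k
  proof -
    have tel: "(\<Sum>j<k. D (Suc j) - D j) = D k" using D0 by (simp add: sum_lessThan_telescope)
    have Dk: "D k = (\<Sum>j<k. \<i> * of_real (s / 2) * (of_real ((cmod (y j))\<^sup>2) * D j + (y j)\<^sup>2 * cnj (D j)))
        + \<i> * of_real (s / 2) * ((\<Sum>j<k. E' j * f j) + (\<Sum>j<k. (y j)\<^sup>2 * cnj (f j))) - (\<Sum>j<k. e j)"
      unfolding tel[symmetric] step by (rule sum_split)
    have "cmod (D k) \<le> cmod (\<Sum>j<k. \<i> * of_real (s / 2) * (of_real ((cmod (y j))\<^sup>2) * D j + (y j)\<^sup>2 * cnj (D j)))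
        + cmod (\<i> * of_real (s / 2) * ((\<Sum>j<k. E' j * f j) + (\<Sum>j<k. (y j)\<^sup>2 * cnj (f j)))) + cmod (\<Sum>j<k. e j)"
      unfolding Dk by (rule order_trans[OF norm_triangle_ineq4]) (intro add_right_mono norm_triangle_ineq)
    also have "\<dots> \<le> (\<Sum>j<k. (\<bar>s\<bar> * (cmod (y j))\<^sup>2) * cmod (D j)) + \<bar>u * T\<bar> * \<eta> * (1 + \<bar>\<theta>\<bar>) + \<theta>\<^sup>2 * \<eta>"
    proof (intro add_mono)
      show "cmod (\<Sum>j<k. \<i> * of_real (s / 2) * (of_real ((cmod (y j))\<^sup>2) * D j + (y j)\<^sup>2 * cnj (D j)))
         \<le> (\<Sum>j<k. (\<bar>s\<bar> * (cmod (y j))\<^sup>2) * cmod (D j))"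
      proof (rule order_trans[OF norm_sum], rule sum_mono)
        fix j
        have "cmod (of_real ((cmod (y j))\<^sup>2) * D j + (y j)\<^sup>2 * cnj (D j)) \<le> 2 * (cmod (y j))\<^sup>2 * cmod (D j)"
          by (rule order_trans[OF norm_triangle_ineq]) (simp add: norm_mult norm_power)
        then have "\<bar>s\<bar> / 2 * cmod (of_real ((cmod (y j))\<^sup>2) * D j + (y j)\<^sup>2 * cnj (D j)) \<le> \<bar>s\<bar> / 2 * (2 * (cmod (y j))\<^sup>2 * cmod (D j))"
          by (intro mult_left_mono) auto
        then show "cmod (\<i> * of_real (s / 2) * (of_real ((cmod (y j))\<^sup>2) * D j + (y j)\<^sup>2 * cnj (D j))) \<le> \<bar>s\<bar> * (cmod (y j))\<^sup>2 * cmod (D j)"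
          by (simp only: norm_mult norm_ii norm_of_real abs_divide)
      qed
      have "cmod (\<Sum>j<k. E' j * f j) \<le> \<eta> * R * (1 + \<bar>\<theta>\<bar>)" unfolding f_def
      proof (rule abel_cis[OF _ k])
        fix j assume "j \<le> m"
        have "(\<Sum>i<j. E' i) = complex_of_real (\<Sum>i<j. ((cmod (y i))\<^sup>2 - 2 * h * dr i))" by (simp add: E'_def)
        then show "cmod (\<Sum>i<j. E' i) \<le> \<eta> * R" using E[OF \<open>j \<le> m\<close>] by (simp only: norm_of_real)
      qed
      moreover have "cmod (\<Sum>j<k. (y j)\<^sup>2 * cnj (f j)) \<le> \<eta> * R * (1 + \<bar>\<theta>\<bar>)"
        using abel_cis[OF F k, of "- \<theta>"] by (simp add: f_def cis_cnj)
      ultimately have 1: "cmod ((\<Sum>j<k. E' j * f j) + (\<Sum>j<k. (y j)\<^sup>2 * cnj (f j))) \<le> 2 * (\<eta> * R * (1 + \<bar>\<theta>\<bar>))"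
        by (intro order_trans[OF norm_triangle_ineq]) linarith
      have "cmod (\<i> * of_real (s / 2) * ((\<Sum>j<k. E' j * f j) + (\<Sum>j<k. (y j)\<^sup>2 * cnj (f j))))
        = \<bar>s\<bar> / 2 * cmod ((\<Sum>j<k. E' j * f j) + (\<Sum>j<k. (y j)\<^sup>2 * cnj (f j)))"
        by (simp only: norm_mult norm_ii norm_of_real abs_divide)
      also have "\<dots> \<le> \<bar>s\<bar> / 2 * (2 * (\<eta> * R * (1 + \<bar>\<theta>\<bar>)))" using 1 by (intro mult_left_mono) auto
      also have "\<dots> = (\<bar>s\<bar> * R) * \<eta> * (1 + \<bar>\<theta>\<bar>)" by simp
      finally show "cmod (\<i> * of_real (s / 2) * ((\<Sum>j<k. E' j * f j) + (\<Sum>j<k. (y j)\<^sup>2 * cnj (f j)))) \<le> \<bar>u * T\<bar> * \<eta> * (1 + \<bar>\<theta>\<bar>)"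
        unfolding sR .
      have "cmod (\<Sum>j<k. e j) \<le> (\<Sum>j<k. \<theta>\<^sup>2 * (dr j / R)\<^sup>2)" by (rule order_trans[OF norm_sum]) (intro sum_mono e)
      also have "\<dots> \<le> \<theta>\<^sup>2 * \<eta>" unfolding sum_distrib_left[symmetric] by (intro mult_left_mono sum_dt2 k) auto
      finally show "cmod (\<Sum>j<k. e j) \<le> \<theta>\<^sup>2 * \<eta>" .
    qed
    finally show ?thesis by (simp add: B_def)
  qed
  have "cmod (D k) \<le> B * exp (\<Sum>j<k. \<bar>s\<bar> * (cmod (y j))\<^sup>2)"
    by (rule discrete_gronwall[OF Dbound _ B0 assms]) auto
  also have "\<dots> \<le> B * exp (\<bar>u * T\<bar> * (2 * h + \<eta>))"
  proof (intro mult_left_mono B0)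
    have "(\<Sum>j<k. \<bar>s\<bar> * (cmod (y j))\<^sup>2) = \<bar>s\<bar> * (\<Sum>j<k. (cmod (y j))\<^sup>2)" by (simp add: sum_distrib_left)
    also have "\<dots> \<le> \<bar>s\<bar> * ((2 * h + \<eta>) * R)" by (intro mult_left_mono sum_y assms) auto
    also have "\<dots> = (\<bar>s\<bar> * R) * (2 * h + \<eta>)" by simp
    finally show "exp (\<Sum>j<k. \<bar>s\<bar> * (cmod (y j))\<^sup>2) \<le> exp (\<bar>u * T\<bar> * (2 * h + \<eta>))" unfolding sR by simp
  qed
  finally show ?thesis by (simp add: D_def c_def s_def f_def B_def \<theta>_def err_def)
qed

lemma err_nonneg: "err u \<ge> 0" using eta by (auto simp: err_def intro!: mult_nonneg_nonneg add_nonneg_nonneg)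

text \<open>A product of two real parts is half the real part of two terms. The one with
  \<open>cnj (y j)\<close> squared averages out; the other has mean \<open>2 * h\<close> times the
  cosine of the phase difference \<open>p * tt j\<close>, and the Riemann sum of this cosine over
  the unit interval is \<open>sinc p\<close>.\<close>

lemma kernel_approx:
  fixes u v p q :: real
  defines "p \<equiv> (u - v) * T * h" and "q \<equiv> (u + v) * T * h"
  shows "\<bar>(1 / R) * (\<Sum>j<m. Re (cnj (y j) * cseq (u * T / R) y j) * Re (cnj (y j) * cseq (v * T / R) y j)) - h * sinc p\<bar>
     \<le> (2 * h + \<eta>) * (err u * (1 + err v) + err v) + \<eta> * (2 + \<bar>p\<bar> + \<bar>q\<bar>) + h * \<bar>p\<bar> * \<eta>"
proof -
  define c where "c = cseq (u * T / R) y"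
  define c' where "c' = cseq (v * T / R) y"
  define f where "f = (\<lambda>j. cis (u * T * h * tt j))"
  define f' where "f' = (\<lambda>j. cis (v * T * h * tt j))"
  define E' where "E' = (\<lambda>j. complex_of_real ((cmod (y j))\<^sup>2 - 2 * h * dr j))"
  have y2: "complex_of_real ((cmod (y j))\<^sup>2) = y j * cnj (y j)" for j by (rule complex_norm_square)
  have ReRe: "Re z * Re w = Re (z * cnj w + z * w) / 2" for z w by simp
  have c: "cmod (c j - f j) \<le> err u" "cmod (c' j - f' j) \<le> err v" if "j < m" for j
    using cseq_approx[of j] that by (simp_all add: c_def c'_def f_def f'_def)
  have nf: "cmod (f j) = 1" "cmod (f' j) = 1" for j by (simp_all add: f_def f'_def)
  have c'b: "cmod (c' j) \<le> 1 + err v" if "j < m" for j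
    using norm_triangle_ineq[of "c' j - f' j" "f' j"] c(2)[OF that] nf(2)[of j] by simp
  have prodb: "cmod (c j * w j - f j * w' j) \<le> err u * (1 + err v) + err v"
    if "j < m" "cmod (w j) = cmod (c' j)" "cmod (w j - w' j) = cmod (c' j - f' j)" for j w w'
  proof -
    have eq: "c j * w j - f j * w' j = (c j - f j) * w j + f j * (w j - w' j)" by (simp add: algebra_simps)
    have "cmod (c j * w j - f j * w' j) \<le> cmod (c j - f j) * cmod (w j) + cmod (f j) * cmod (w j - w' j)"
      unfolding eq by (rule order_trans[OF norm_triangle_ineq]) (simp add: norm_mult)
    also have "\<dots> \<le> err u * (1 + err v) + 1 * err v"
      unfolding that nf using c(1)[OF that(1)] c(2)[OF that(1)] c'b[OF that(1)] err_nonneg by (intro add_mono mult_mono) auto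
    finally show ?thesis by simp
  qed
  \<comment> \<open>\<open>X\<close> contains the exact coefficients and \<open>Y\<close> the pure
    rotations. They are compared first, so that Abel summation has to deal with exponentials
    only.\<close>
  define X where "X = (\<lambda>j. (of_real ((cmod (y j))\<^sup>2) * (c j * cnj (c' j)) + (cnj (y j))\<^sup>2 * (c j * c' j)) / 2)"
  define Y where "Y = (\<lambda>j. (of_real ((cmod (y j))\<^sup>2) * (f j * cnj (f' j)) + (cnj (y j))\<^sup>2 * (f j * f' j)) / 2)"
  have XX: "Re (cnj (y j) * c j) * Re (cnj (y j) * c' j) = Re (X j)" for j
    unfolding ReRe X_def y2 by (simp only: Re_divide_numeral[symmetric]) (simp add: power2_eq_square algebra_simps)
  have XY: "cmod (X j - Y j) \<le> (cmod (y j))\<^sup>2 * (err u * (1 + err v) + err v)" if j: "j < m" for j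
  proof -
    have 1: "cmod (c j * cnj (c' j) - f j * cnj (f' j)) \<le> err u * (1 + err v) + err v"
      by (rule prodb[OF j, of "\<lambda>j. cnj (c' j)" "\<lambda>j. cnj (f' j)"]) (simp_all flip: complex_cnj_diff)
    have 2: "cmod (c j * c' j - f j * f' j) \<le> err u * (1 + err v) + err v" by (rule prodb[OF j]) simp_all
    have XYe: "X j - Y j = (of_real ((cmod (y j))\<^sup>2) * (c j * cnj (c' j) - f j * cnj (f' j)) + (cnj (y j))\<^sup>2 * (c j * c' j - f j * f' j)) / 2"
      by (simp add: X_def Y_def algebra_simps diff_divide_distrib add_divide_distrib)
    have "cmod (X j - Y j) \<le> ((cmod (y j))\<^sup>2 * cmod (c j * cnj (c' j) - f j * cnj (f' j)) + (cmod (y j))\<^sup>2 * cmod (c j * c' j - f j * f' j)) / 2"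
      unfolding XYe norm_divide by (simp, rule order_trans[OF norm_triangle_ineq]) (simp add: norm_mult norm_power)
    also have "\<dots> \<le> ((cmod (y j))\<^sup>2 * (err u * (1 + err v) + err v) + (cmod (y j))\<^sup>2 * (err u * (1 + err v) + err v)) / 2"
      by (intro divide_right_mono add_mono mult_left_mono 1 2) auto
    finally show ?thesis by simp
  qed
  have main: "cmod ((\<Sum>j<m. X j) - (\<Sum>j<m. Y j)) \<le> (2 * h + \<eta>) * R * (err u * (1 + err v) + err v)"
  proof -
    have "cmod ((\<Sum>j<m. X j) - (\<Sum>j<m. Y j)) \<le> (\<Sum>j<m. (cmod (y j))\<^sup>2 * (err u * (1 + err v) + err v))"
      unfolding sum_subtractf[symmetric] by (rule order_trans[OF norm_sum]) (intro sum_mono XY, simp)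
    also have "\<dots> \<le> (2 * h + \<eta>) * R * (err u * (1 + err v) + err v)"
      unfolding sum_distrib_right[symmetric] using sum_y[of m] err_nonneg[of u] err_nonneg[of v] by (intro mult_right_mono) auto
    finally show ?thesis .
  qed
  have ff: "f j * cnj (f' j) = cis (p * tt j)" "f j * f' j = cis (q * tt j)" for j
    by (simp_all add: f_def f'_def p_def q_def cis_cnj cis_mult algebra_simps)
  have Ysum: "(\<Sum>j<m. Y j) = ((\<Sum>j<m. E' j * cis (p * tt j)) + (\<Sum>j<m. (cnj (y j))\<^sup>2 * cis (q * tt j))) / 2
      + of_real h * (\<Sum>j<m. of_real (dr j) * cis (p * tt j))"
    unfolding Y_def ff E'_def by (simp add: sum.distrib[symmetric] sum_distrib_left sum_divide_distrib algebra_simps add_divide_distrib diff_divide_distrib)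
  have b1: "cmod (\<Sum>j<m. E' j * cis (p * tt j)) \<le> \<eta> * R * (1 + \<bar>p\<bar>)"
  proof (rule abel_cis)
    fix j assume "j \<le> m"
    have "(\<Sum>i<j. E' i) = complex_of_real (\<Sum>i<j. ((cmod (y i))\<^sup>2 - 2 * h * dr i))" by (simp add: E'_def)
    then show "cmod (\<Sum>i<j. E' i) \<le> \<eta> * R" using E[OF \<open>j \<le> m\<close>] by (simp only: norm_of_real)
  qed simp
  have b2: "cmod (\<Sum>j<m. (cnj (y j))\<^sup>2 * cis (q * tt j)) \<le> \<eta> * R * (1 + \<bar>q\<bar>)"
  proof (rule abel_cis)
    fix j assume "j \<le> m"
    have "(\<Sum>i<j. (cnj (y i))\<^sup>2) = cnj (\<Sum>i<j. (y i)\<^sup>2)" by simp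
    then show "cmod (\<Sum>i<j. (cnj (y i))\<^sup>2) \<le> \<eta> * R" using F[OF \<open>j \<le> m\<close>] by (simp only: complex_mod_cnj)
  qed simp
  define g where "g = (\<lambda>t. if p = 0 then t else sin (p * t) / p)"
  have tel: "(\<Sum>j<m. g (tt (Suc j)) - g (tt j)) = sinc p"
    by (subst sum_lessThan_telescope) (simp add: tt_m tt_0 g_def)
  have riem: "\<bar>(\<Sum>j<m. dr j / R * cos (p * tt j)) - sinc p\<bar> \<le> \<bar>p\<bar> * \<eta>"
  proof -
    have "\<bar>(\<Sum>j<m. dr j / R * cos (p * tt j)) - sinc p\<bar> = \<bar>\<Sum>j<m. (dr j / R * cos (p * tt j) - (g (tt (Suc j)) - g (tt j)))\<bar>"
      unfolding sum_subtractf tel[symmetric] by (simp add: sum_subtractf)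
    also have "\<dots> \<le> (\<Sum>j<m. \<bar>p\<bar> * (dr j / R)\<^sup>2)"
      unfolding tt_Suc g_def
      by (rule order_trans[OF sum_abs], rule sum_mono, rule sinc_increment) (use dr R(1) in auto)
    also have "\<dots> \<le> \<bar>p\<bar> * \<eta>" unfolding sum_distrib_left[symmetric] by (intro mult_left_mono sum_dt2) auto
    finally show ?thesis .
  qed
  have ReY: "Re (\<Sum>j<m. Y j) = Re (((\<Sum>j<m. E' j * cis (p * tt j)) + (\<Sum>j<m. (cnj (y j))\<^sup>2 * cis (q * tt j))) / 2)
      + R * (h * (\<Sum>j<m. dr j / R * cos (p * tt j)))"
  proof -
    have "(\<Sum>j<m. dr j / R * cos (p * tt j)) = (\<Sum>j<m. dr j * cos (p * tt j)) / R" by (simp add: sum_divide_distrib)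
    then have "R * (h * (\<Sum>j<m. dr j / R * cos (p * tt j))) = h * (\<Sum>j<m. dr j * cos (p * tt j))" using R(1) by simp
    moreover have "Re (of_real h * (\<Sum>j<m. of_real (dr j) * cis (p * tt j))) = h * (\<Sum>j<m. dr j * cos (p * tt j))" by simp
    ultimately show ?thesis unfolding Ysum plus_complex.sel by (simp only:)
  qed
  have b3: "\<bar>Re (((\<Sum>j<m. E' j * cis (p * tt j)) + (\<Sum>j<m. (cnj (y j))\<^sup>2 * cis (q * tt j))) / 2)\<bar> \<le> \<eta> * R * (2 + \<bar>p\<bar> + \<bar>q\<bar>)"
  proof -
    have "\<bar>Re (((\<Sum>j<m. E' j * cis (p * tt j)) + (\<Sum>j<m. (cnj (y j))\<^sup>2 * cis (q * tt j))) / 2)\<bar>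
       \<le> cmod (((\<Sum>j<m. E' j * cis (p * tt j)) + (\<Sum>j<m. (cnj (y j))\<^sup>2 * cis (q * tt j))) / 2)" by (rule abs_Re_le_cmod)
    also have "\<dots> \<le> (\<eta> * R * (1 + \<bar>p\<bar>) + \<eta> * R * (1 + \<bar>q\<bar>)) / 2"
      unfolding norm_divide using b1 b2 by (simp, intro order_trans[OF norm_triangle_ineq]) linarith
    also have "\<dots> \<le> \<eta> * R * (2 + \<bar>p\<bar> + \<bar>q\<bar>)"
    proof -
      have "\<eta> * R * (2 + \<bar>p\<bar> + \<bar>q\<bar>) \<ge> 0" using eta R(1) by simp
      then show ?thesis by (simp add: algebra_simps)
    qed
    finally show ?thesis .
  qed
  define S where "S = (\<Sum>j<m. dr j / R * cos (p * tt j))"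
  have "\<bar>(\<Sum>j<m. Re (cnj (y j) * c j) * Re (cnj (y j) * c' j)) - R * (h * sinc p)\<bar>
     \<le> \<bar>Re ((\<Sum>j<m. X j) - (\<Sum>j<m. Y j))\<bar> + \<bar>Re (\<Sum>j<m. Y j) - R * (h * S)\<bar> + \<bar>R * (h * (S - sinc p))\<bar>"
    unfolding XX Re_sum[symmetric] by (simp add: right_diff_distrib)
  also have "\<dots> \<le> (2 * h + \<eta>) * R * (err u * (1 + err v) + err v) + \<eta> * R * (2 + \<bar>p\<bar> + \<bar>q\<bar>) + R * (h * (\<bar>p\<bar> * \<eta>))"
  proof (intro add_mono)
    show "\<bar>Re ((\<Sum>j<m. X j) - (\<Sum>j<m. Y j))\<bar> \<le> (2 * h + \<eta>) * R * (err u * (1 + err v) + err v)"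
      by (rule order_trans[OF abs_Re_le_cmod main])
    show "\<bar>Re (\<Sum>j<m. Y j) - R * (h * S)\<bar> \<le> \<eta> * R * (2 + \<bar>p\<bar> + \<bar>q\<bar>)" unfolding ReY S_def using b3 by simp
    have "\<bar>R * (h * (S - sinc p))\<bar> = R * (h * \<bar>S - sinc p\<bar>)" using R(1) h by (simp add: abs_mult)
    also have "\<dots> \<le> R * (h * (\<bar>p\<bar> * \<eta>))" using riem R(1) h unfolding S_def by (intro mult_left_mono) auto
    finally show "\<bar>R * (h * (S - sinc p))\<bar> \<le> R * (h * (\<bar>p\<bar> * \<eta>))" .
  qed
  also have "\<dots> = R * ((2 * h + \<eta>) * (err u * (1 + err v) + err v) + \<eta> * (2 + \<bar>p\<bar> + \<bar>q\<bar>) + h * \<bar>p\<bar> * \<eta>)"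
    by (simp add: algebra_simps)
  finally have "\<bar>(\<Sum>j<m. Re (cnj (y j) * c j) * Re (cnj (y j) * c' j)) - R * (h * sinc p)\<bar> / R
     \<le> (2 * h + \<eta>) * (err u * (1 + err v) + err v) + \<eta> * (2 + \<bar>p\<bar> + \<bar>q\<bar>) + h * \<bar>p\<bar> * \<eta>"
    using R(1) by (simp only: pos_divide_le_eq mult.commute)
  moreover have "\<bar>(\<Sum>j<m. Re (cnj (y j) * c j) * Re (cnj (y j) * c' j)) - R * (h * sinc p)\<bar> / R
     = \<bar>(1 / R) * (\<Sum>j<m. Re (cnj (y j) * c j) * Re (cnj (y j) * c' j)) - h * sinc p\<bar>"
  proof -
    have "(1 / R) * (\<Sum>j<m. Re (cnj (y j) * c j) * Re (cnj (y j) * c' j)) - h * sinc p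
       = ((\<Sum>j<m. Re (cnj (y j) * c j) * Re (cnj (y j) * c' j)) - R * (h * sinc p)) / R"
      using R(1) by (simp only: diff_divide_distrib) simp
    then show ?thesis using R(1) by (simp only: abs_divide abs_of_pos)
  qed
  ultimately show ?thesis unfolding c_def c'_def by linarith
qed

end

section \<open>Shifting the spectral parameter, and the universality limit\<close>

context modulated_jacobi begin

lemma y_rec: "y (Suc (Suc n)) x = of_real ((x - b (Suc n)) / a (Suc n)) * y (Suc n) x - of_real (a n / a (Suc n)) * y n x"
proof -
  have r: "U (Suc (Suc n)) = (x - b (Suc n)) / a (Suc n) * U (Suc n) - a n / a (Suc n) * U n"
    if "jacobi_rec a b x U" for U using that by (simp add: jacobi_rec_def)
  show ?thesis unfolding y_def r[OF jacobi_rec_orthP] r[OF jacobi_rec_orthQ]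
    by (simp only: complex_eq_iff) (simp add: algebra_simps diff_divide_distrib add_divide_distrib)
qed

lemma y_wronskian: "Im (cnj (y n x) * y (Suc n) x) = 1 / (Im (tau x) * a n)"
proof -
  have T: "Im (tau x) \<noteq> 0" using Im_tau_neg[of x] by simp
  have "Im (cnj (y n x) * y (Suc n) x) = (orthP a b n x * orthQ a b (Suc n) x - orthP a b (Suc n) x * orthQ a b n x) / Im (tau x)"
    unfolding y_def by (simp add: algebra_simps diff_divide_distrib)
  also have "orthP a b n x * orthQ a b (Suc n) x - orthP a b (Suc n) x * orthQ a b n x = 1 / a n"
    using orth_wronskian[where a=a and b=b and n=n and z=x, OF a_pos] by (simp add: field_simps)
  finally show ?thesis by (simp add: mult.commute)
qed

lemma Re_cnj_comb: "Re (cnj (of_real p * u - of_real q * v) * d) = p * Re (cnj u * d) - q * Re (cnj v * d)"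
  by (simp add: algebra_simps)

text \<open>\<open>orthP\<close> at \<open>x + \<epsilon>\<close> solves the recurrence at
  \<open>x\<close> with the source \<open>\<epsilon>\<close> times itself. The Wronskian of the real
  and imaginary parts of \<open>y\<close> is \<open>1 / (Im (tau x) * a n)\<close>, so the factor
  \<open>Im (tau x)\<close> in the coefficient sequence produces exactly the required term with
  \<open>\<epsilon> / a n\<close>.\<close>

lemma orthP_perturb:
  defines "c \<equiv> \<lambda>\<epsilon> x. cseq (\<epsilon> * Im (tau x)) (\<lambda>n. y n x)"
  shows "orthP a b n (x + \<epsilon>) = Re (cnj (y n x) * c \<epsilon> x n)"
proof -
  define T where "T = Im (tau x)"
  have T: "T \<noteq> 0" using Im_tau_neg[of x] by (simp add: T_def)
  define Y where "Y = (\<lambda>n. y n x)"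
  define d where "d = c \<epsilon> x"
  have d0: "d 0 = 1" by (simp add: d_def c_def)
  have dS: "d (Suc n) = d n + \<i> * of_real (\<epsilon> * T * Re (cnj (Y n) * d n)) * Y n" for n
    by (simp add: d_def c_def Y_def T_def)
  have same: "Re (cnj (Y n) * d (Suc n)) = Re (cnj (Y n) * d n)" for n
    unfolding dS by (simp add: algebra_simps)
  have nxt: "Re (cnj (Y (Suc n)) * d (Suc n)) = Re (cnj (Y (Suc n)) * d n) + \<epsilon> / a n * Re (cnj (Y n) * d n)" for n
  proof -
    have "Re (cnj (Y (Suc n)) * d (Suc n)) = Re (cnj (Y (Suc n)) * d n) + \<epsilon> * T * Re (cnj (Y n) * d n) * Im (cnj (Y n) * Y (Suc n))"
      unfolding dS by (simp add: algebra_simps)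
    also have "Im (cnj (Y n) * Y (Suc n)) = 1 / (T * a n)" unfolding Y_def T_def by (rule y_wronskian)
    finally show ?thesis using T by simp
  qed
  have "orthP a b n (x + \<epsilon>) = Re (cnj (Y n) * d n)"
  proof (induction n rule: induct_nat_012)
    case 0
    show ?case by (simp add: d0 Y_def y_def orthP_def)
  next
    case 1
    show ?case unfolding nxt d0 by (simp add: Y_def y_def orthP_def diff_divide_distrib add_divide_distrib)
  next
    case (ge2 n)
    have "orthP a b (Suc (Suc n)) (x + \<epsilon>) = (x + \<epsilon> - b (Suc n)) / a (Suc n) * orthP a b (Suc n) (x + \<epsilon>) - a n / a (Suc n) * orthP a b n (x + \<epsilon>)"
      using jacobi_rec_orthP[of a b "x + \<epsilon>"] by (simp add: jacobi_rec_def)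
    also have "\<dots> = (x + \<epsilon> - b (Suc n)) / a (Suc n) * Re (cnj (Y (Suc n)) * d (Suc n)) - a n / a (Suc n) * Re (cnj (Y n) * d (Suc n))"
      unfolding same ge2 ..
    also have "\<dots> = Re (cnj (Y (Suc (Suc n))) * d (Suc n)) + \<epsilon> / a (Suc n) * Re (cnj (Y (Suc n)) * d (Suc n))"
    proof -
      have Y2: "Y (Suc (Suc n)) = of_real ((x - b (Suc n)) / a (Suc n)) * Y (Suc n) - of_real (a n / a (Suc n)) * Y n"
        unfolding Y_def by (rule y_rec)
      have "Re (cnj (Y (Suc (Suc n))) * d (Suc n)) = (x - b (Suc n)) / a (Suc n) * Re (cnj (Y (Suc n)) * d (Suc n)) - a n / a (Suc n) * Re (cnj (Y n) * d (Suc n))"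
        unfolding Y2 by (rule Re_cnj_comb)
      moreover have "(x + \<epsilon> - b (Suc n)) / a (Suc n) = (x - b (Suc n)) / a (Suc n) + \<epsilon> / a (Suc n)"
        by (simp add: diff_divide_distrib add_divide_distrib)
      ultimately show ?thesis by (simp only: distrib_right)
    qed
    finally show ?case unfolding nxt[of "Suc n"] .
  qed
  then show ?thesis by (simp add: Y_def d_def)
qed

lemma rhos_mono: "i \<le> j \<Longrightarrow> rhos i \<le> rhos j"
  unfolding rhos_def by (intro sum_mono2) (auto simp: less_imp_le drho_pos)

text \<open>Abel summation needs all partial sums up to \<open>m\<close> to be small on the scale of
  the last one. For early \<open>j\<close> this holds because \<open>rhos m\<close> diverges, for
  later ones because \<open>rhos\<close> is monotone.\<close>

lemma uo_prefix:
  fixes f :: "nat \<Rightarrow> real \<Rightarrow> 'a::real_normed_vector"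
  assumes f: "uo C rhos f" and bd: "\<And>n. \<exists>B. \<forall>x\<in>C. norm (f n x) \<le> B" and \<eta>: "\<eta> > 0"
  shows "\<forall>\<^sub>F m in sequentially. \<forall>j\<le>m. \<forall>x\<in>C. norm (f j x) \<le> \<eta> * rhos m"
proof -
  obtain K where K: "\<And>j x. j \<ge> K \<Longrightarrow> x \<in> C \<Longrightarrow> norm (f j x) \<le> \<eta> * rhos j"
    using uoD[OF f \<eta>] unfolding eventually_sequentially by blast
  from bd have "\<forall>n. \<exists>B. \<forall>x\<in>C. norm (f n x) \<le> B" by blast
  from choice[OF this] obtain B where B: "\<And>n x. x \<in> C \<Longrightarrow> norm (f n x) \<le> B n" by blast
  have "\<forall>\<^sub>F m in sequentially. rhos m \<ge> (\<Sum>j<K. \<bar>B j\<bar>) / \<eta>"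
    using rhos_infinity by (simp add: filterlim_at_top)
  then show ?thesis
  proof eventually_elim
    case (elim m)
    show ?case
    proof (intro allI impI ballI)
      fix j x assume j: "j \<le> m" and x: "x \<in> C"
      show "norm (f j x) \<le> \<eta> * rhos m"
      proof (cases "j < K")
        case True
        have "norm (f j x) \<le> \<bar>B j\<bar>" using B[OF x, of j] by linarith
        also have "\<dots> \<le> (\<Sum>j<K. \<bar>B j\<bar>)" by (rule member_le_sum) (use True in auto)
        also have "\<dots> \<le> \<eta> * rhos m" using elim \<eta> by (simp add: field_simps)
        finally show ?thesis .
      next
        case False
        then have "norm (f j x) \<le> \<eta> * rhos j" using K x by simp
        also have "\<dots> \<le> \<eta> * rhos m" using rhos_mono[OF j] \<eta> by (intro mult_left_mono) auto
        finally show ?thesis .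
      qed
    qed
  qed
qed

lemma drho_bounded: "\<exists>B. \<forall>n. drho n \<le> B"
proof -
  have fin: "\<alpha> (int n) \<in> \<alpha> ` int ` {..<N}" for n
  proof -
    have "\<alpha> (int n) = \<alpha> (int (n div N * N) + int (n mod N))" by (metis div_mult_mod_eq of_nat_add)
    also have "\<dots> = \<alpha> (int (n mod N))" by (rule alpha_per)
    finally show ?thesis using N_eq by auto
  qed
  define Mx where "Mx = Max (\<alpha> ` int ` {..<N})"
  have Mx: "\<alpha> (int n) \<le> Mx" for n unfolding Mx_def by (rule Max_ge) (use fin in auto)
  from convergent_imp_Bseq[OF convergentI[OF inv_a_lim]] obtain D where D: "D > 0" "\<And>n. norm (1 / a n) \<le> D" unfolding Bseq_def by blast
  have "drho n \<le> Mx * D" for n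
  proof -
    have "drho n = \<alpha> (int n) * (1 / a n)" by (simp add: drho_def)
    also have "\<dots> \<le> Mx * D"
    proof (rule mult_mono)
      show "1 / a n \<le> D" using D(2)[of n] a_pos[of n] by simp
      show "0 \<le> Mx" using Mx[of n] alpha_pos[of "int n"] by linarith
      show "0 \<le> 1 / a n" using a_pos[of n] by simp
    qed (rule Mx)
    finally show ?thesis .
  qed
  then show ?thesis by blast
qed

text \<open>The speed of rotation up to sign. In \<open>tau_hh\<close> the amplitude
  \<open>gp\<close> cancels, so it does not depend on \<open>x\<close>.\<close>

definition kap :: real where "kap = - Im zeta * Gam / (2 * real N * \<alpha> (-1))"

lemma tau_hh: "Im (tau x) * hh x = - kap"
  using gp_pos[of x] by (simp add: Im_tau hh_def kap_def)

lemma Gam_pos: "Gam > 0"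
proof -
  have "(cmod (gam 0))\<^sup>2 > 0" by (simp add: gam_def dl_def per_sol_def complex_eq_iff)
  moreover have "(cmod (gam 0))\<^sup>2 \<le> Gam" unfolding Gam_def by (rule member_le_sum) (auto simp: N_eq)
  ultimately show ?thesis by linarith
qed

lemma hh_pos: "hh x > 0"
  unfolding hh_def using Gam_pos gp_pos[of x] alpha_m1_pos by simp

theorem universality:
  assumes C: "compact C" and V: "V \<ge> 0" and e: "e > 0"
  shows "\<forall>\<^sub>F n in sequentially. \<forall>x\<in>C. \<forall>u v. \<bar>u\<bar> \<le> V \<longrightarrow> \<bar>v\<bar> \<le> V \<longrightarrow>
    \<bar>1 / rhos (Suc n) * CD_kernel a b n (x + u / rhos (Suc n)) (x + v / rhos (Suc n)) - hh x * sinc ((u - v) * kap)\<bar> < e"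
proof -
  obtain Tb where Tb: "\<And>x. x \<in> C \<Longrightarrow> cmod (tau x) \<le> Tb" using tau_bounds(1)[OF C] by blast
  obtain G where G: "\<And>x. x \<in> C \<Longrightarrow> gp x \<le> G" using gp_limit(3)[OF C] by blast
  define hb where "hb = \<bar>Gam * G / (2 * real N * \<alpha> (-1))\<bar>"
  have hb: "hh x \<le> hb" if "x \<in> C" for x
  proof -
    have "hh x \<le> Gam * G / (2 * real N * \<alpha> (-1))" unfolding hh_def
      using G[OF that] Gam_pos alpha_m1_pos by (intro divide_right_mono mult_left_mono) auto
    then show ?thesis unfolding hb_def by (rule order_trans[OF _ abs_ge_self])
  qed
  define K where "K = V * \<bar>Tb\<bar>"
  have K0: "K \<ge> 0" using V by (simp add: K_def)
  have hb0: "hb \<ge> 0" by (simp add: hb_def)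
  \<comment> \<open>\<open>er\<close> and \<open>tot\<close> are the error bounds of the averaging
    step with \<open>u * T\<close> and \<open>hh x\<close> replaced by their bounds \<open>K\<close>
    and \<open>hb\<close>. They are continuous in \<open>\<eta>\<close> and vanish at 0, which
    provides a suitable \<open>\<eta>\<close>.\<close>
  define er where "er = (\<lambda>\<eta>. (K * \<eta> * (1 + K * hb) + (K * hb)\<^sup>2 * \<eta>) * exp (K * (2 * hb + \<eta>)))"
  define tot where "tot = (\<lambda>\<eta>. (2 * hb + \<eta>) * (er \<eta> * (1 + er \<eta>) + er \<eta>) + \<eta> * (2 + 2 * K * hb + 2 * K * hb) + hb * (2 * K * hb) * \<eta>)"
  have "(tot \<longlongrightarrow> tot 0) (at_right 0)" unfolding tot_def er_def by (intro tendsto_intros)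
  moreover have "tot 0 = 0" by (simp add: tot_def er_def)
  ultimately have "\<forall>\<^sub>F \<eta> in at_right 0. tot \<eta> < e" using e by (auto dest: order_tendstoD)
  moreover have "\<forall>\<^sub>F \<eta> in at_right 0. (0::real) < \<eta>" by (simp add: eventually_at_right_less)
  ultimately have "\<forall>\<^sub>F \<eta> in at_right 0. tot \<eta> < e \<and> 0 < \<eta>" by (rule eventually_conj)
  from eventually_happens[OF this] obtain \<eta> where \<eta>: "\<eta> > 0" "tot \<eta> < e" by auto
  define E1 where "E1 = (\<lambda>n x. \<Sum>i<n. ((cmod (y i x))\<^sup>2 - 2 * hh x * drho i))"
  define F1 where "F1 = (\<lambda>n x. \<Sum>i<n. (y i x)\<^sup>2)"
  from y_bounded[OF C] have "\<forall>n. \<exists>B. \<forall>x\<in>C. cmod (y n x) \<le> B" by blast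
  from choice[OF this] obtain Yb where Yb: "\<And>n x. x \<in> C \<Longrightarrow> cmod (y n x) \<le> Yb n" by blast
  have Yb2: "norm ((y n x)\<^sup>2) \<le> (Yb n)\<^sup>2" if "x \<in> C" for n x
    unfolding norm_power by (intro power_mono Yb that) simp
  have bF: "\<exists>B. \<forall>x\<in>C. norm (F1 n x) \<le> B" for n
  proof -
    have "norm (F1 n x) \<le> (\<Sum>i<n. (Yb i)\<^sup>2)" if "x \<in> C" for x
      unfolding F1_def by (rule order_trans[OF norm_sum]) (intro sum_mono Yb2 that)
    then show ?thesis by blast
  qed
  have bE: "\<exists>B. \<forall>x\<in>C. norm (E1 n x) \<le> B" for n
  proof -
    have "norm (E1 n x) \<le> (\<Sum>i<n. (Yb i)\<^sup>2 + 2 * hb * drho i)" if x: "x \<in> C" for x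
      unfolding E1_def
    proof (rule order_trans[OF norm_sum], intro sum_mono)
      fix i
      have "norm ((cmod (y i x))\<^sup>2 - 2 * hh x * drho i) \<le> (cmod (y i x))\<^sup>2 + 2 * hh x * drho i"
        by (rule order_trans[OF norm_triangle_ineq4]) (use hh_pos[of x] drho_pos[of i] in \<open>simp add: abs_mult\<close>)
      also have "\<dots> \<le> (Yb i)\<^sup>2 + 2 * hb * drho i"
        using Yb2[OF x, of i] hb[OF x] drho_pos[of i] by (intro add_mono mult_right_mono) (auto simp: norm_power)
      finally show "norm ((cmod (y i x))\<^sup>2 - 2 * hh x * drho i) \<le> (Yb i)\<^sup>2 + 2 * hb * drho i" .
    qed
    then show ?thesis by blast
  qed
  have uE: "uo C rhos E1" unfolding E1_def by (rule y_norm_mean[OF C])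
  have uF: "uo C rhos F1" unfolding F1_def by (rule y_square_mean[OF C])
  obtain Db where Db: "\<And>n. drho n \<le> Db" using drho_bounded by blast
  have evd: "\<forall>\<^sub>F m in sequentially. rhos m \<ge> \<bar>Db\<bar> / \<eta>" using rhos_infinity by (simp add: filterlim_at_top)
  have evp: "\<forall>\<^sub>F m in sequentially. rhos m \<ge> 1" using rhos_infinity by (simp add: filterlim_at_top)
  have "\<forall>\<^sub>F m in sequentially. \<forall>x\<in>C. \<forall>u v. \<bar>u\<bar> \<le> V \<longrightarrow> \<bar>v\<bar> \<le> V \<longrightarrow>
    \<bar>1 / rhos m * (\<Sum>j<m. orthP a b j (x + u / rhos m) * orthP a b j (x + v / rhos m)) - hh x * sinc ((u - v) * kap)\<bar> < e"
    using uo_prefix[OF uE bE \<eta>(1)] uo_prefix[OF uF bF \<eta>(1)] evd evp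
  proof eventually_elim
    case (elim m)
    show ?case
    proof (intro ballI allI impI)
      fix x u v assume x: "x \<in> C" and u: "\<bar>u\<bar> \<le> V" and v: "\<bar>v\<bar> \<le> V"
      define T where "T = Im (tau x)"
      interpret av: averaged "\<lambda>n. y n x" drho m "rhos m" "hh x" T \<eta>
      proof
        show "0 \<le> drho j" for j using drho_pos[of j] by simp
        show "0 < rhos m" "0 \<le> hh x" "0 \<le> \<eta>" using elim(4) hh_pos[of x] \<eta> by auto
        show "rhos m = sum drho {..<m}" by (simp add: rhos_def)
        show "\<bar>\<Sum>i<j. (cmod (y i x))\<^sup>2 - 2 * hh x * drho i\<bar> \<le> \<eta> * rhos m" if "j \<le> m" for j
          using elim(1) that x unfolding E1_def real_norm_def by blast
        show "cmod (\<Sum>i<j. (y i x)\<^sup>2) \<le> \<eta> * rhos m" if "j \<le> m" for j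
          using elim(2) that x unfolding F1_def by blast
        show "drho j \<le> \<eta> * rhos m" for j
          using Db[of j] elim(3) \<eta>(1) by (simp add: field_simps)
      qed
      have cp: "Re (cnj (y j x) * cseq (u * T / rhos m) (\<lambda>n. y n x) j) = orthP a b j (x + u / rhos m)" for j u
        unfolding orthP_perturb T_def by simp
      have TK: "\<bar>u * T\<bar> \<le> K" if "\<bar>u\<bar> \<le> V" for u
      proof -
        have "\<bar>T\<bar> \<le> \<bar>Tb\<bar>" using Tb[OF x] abs_Im_le_cmod[of "tau x"] unfolding T_def by linarith
        then show ?thesis unfolding abs_mult K_def using that V by (intro mult_mono) auto
      qed
      have TK2: "\<bar>u * T * hh x\<bar> \<le> K * hb" if "\<bar>u\<bar> \<le> V" for u
        unfolding abs_mult[of _ "hh x"] using TK[OF that] hb[OF x] hh_pos[of x] K0 by (intro mult_mono) auto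
      have erb: "av.err u \<le> er \<eta>" if "\<bar>u\<bar> \<le> V" for u
      proof -
        have sq: "(u * T * hh x)\<^sup>2 \<le> (K * hb)\<^sup>2" using power_mono[OF TK2[OF that] abs_ge_zero, of 2] by (simp only: power2_abs)
        have h2: "2 * hh x + \<eta> \<le> 2 * hb + \<eta>" "0 \<le> 2 * hh x + \<eta>" using hb[OF x] hh_pos[of x] \<eta>(1) by linarith+
        have e1: "\<bar>u * T\<bar> * (2 * hh x + \<eta>) \<le> K * (2 * hb + \<eta>)" by (rule mult_mono[OF TK[OF that] h2(1) K0 h2(2)])
        have e2: "1 + \<bar>u * T * hh x\<bar> \<le> 1 + K * hb" using TK2[OF that] by linarith
        have e3: "\<bar>u * T\<bar> * \<eta> \<le> K * \<eta>" using TK[OF that] \<eta>(1) by (intro mult_right_mono) auto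
        have e4: "0 \<le> K * \<eta>" using K0 \<eta>(1) by simp
        have e5: "\<bar>u * T\<bar> * \<eta> * (1 + \<bar>u * T * hh x\<bar>) \<le> K * \<eta> * (1 + K * hb)" by (rule mult_mono[OF e3 e2 e4]) simp
        have e6: "(u * T * hh x)\<^sup>2 * \<eta> \<le> (K * hb)\<^sup>2 * \<eta>" using sq \<eta>(1) by (intro mult_right_mono) auto
        have e7: "0 \<le> K * \<eta> * (1 + K * hb) + (K * hb)\<^sup>2 * \<eta>" using e4 K0 hb0 \<eta>(1) by (intro add_nonneg_nonneg mult_nonneg_nonneg) auto
        show ?thesis unfolding av.err_def er_def
          by (rule mult_mono[OF add_mono[OF e5 e6] iffD2[OF exp_le_cancel_iff e1] e7]) simp
      qed
      have p: "\<bar>(u - v) * T * hh x\<bar> \<le> 2 * K * hb" "\<bar>(u + v) * T * hh x\<bar> \<le> 2 * K * hb"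
      proof -
        show "\<bar>(u - v) * T * hh x\<bar> \<le> 2 * K * hb"
          unfolding left_diff_distrib using TK2[OF u] TK2[OF v] by linarith
        show "\<bar>(u + v) * T * hh x\<bar> \<le> 2 * K * hb"
          unfolding distrib_right using TK2[OF u] TK2[OF v] by linarith
      qed
      have er0: "er \<eta> \<ge> 0" using order_trans[OF av.err_nonneg erb[OF u]] .
      have "\<bar>1 / rhos m * (\<Sum>j<m. orthP a b j (x + u / rhos m) * orthP a b j (x + v / rhos m)) - hh x * sinc ((u - v) * T * hh x)\<bar>
        \<le> (2 * hh x + \<eta>) * (av.err u * (1 + av.err v) + av.err v) + \<eta> * (2 + \<bar>(u - v) * T * hh x\<bar> + \<bar>(u + v) * T * hh x\<bar>)
          + hh x * \<bar>(u - v) * T * hh x\<bar> * \<eta>"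
        using av.kernel_approx[of u v] unfolding cp .
      also have "\<dots> \<le> tot \<eta>" unfolding tot_def

      proof (intro add_mono)
        have h2: "2 * hh x + \<eta> \<le> 2 * hb + \<eta>" "0 \<le> 2 * hb + \<eta>" using hb[OF x] hb0 \<eta>(1) by linarith+
        have "av.err u * (1 + av.err v) \<le> er \<eta> * (1 + er \<eta>)"
          by (rule mult_mono) (use erb[OF u] erb[OF v] er0 av.err_nonneg[of v] in auto)
        then have e1: "av.err u * (1 + av.err v) + av.err v \<le> er \<eta> * (1 + er \<eta>) + er \<eta>" using erb[OF v] by linarith
        have e2: "0 \<le> av.err u * (1 + av.err v) + av.err v"
          using av.err_nonneg[of u] av.err_nonneg[of v] by (intro add_nonneg_nonneg mult_nonneg_nonneg) auto
        show "(2 * hh x + \<eta>) * (av.err u * (1 + av.err v) + av.err v) \<le> (2 * hb + \<eta>) * (er \<eta> * (1 + er \<eta>) + er \<eta>)"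
          by (rule mult_mono[OF h2(1) e1 h2(2) e2])
        show "\<eta> * (2 + \<bar>(u - v) * T * hh x\<bar> + \<bar>(u + v) * T * hh x\<bar>) \<le> \<eta> * (2 + 2 * K * hb + 2 * K * hb)"
          using p \<eta>(1) by (intro mult_left_mono) linarith+
        have "hh x * \<bar>(u - v) * T * hh x\<bar> \<le> hb * (2 * K * hb)" by (rule mult_mono[OF hb[OF x] p(1) hb0]) simp
        then show "hh x * \<bar>(u - v) * T * hh x\<bar> * \<eta> \<le> hb * (2 * K * hb) * \<eta>" using \<eta>(1) by (intro mult_right_mono) auto
      qed
      also have "\<dots> < e" by (rule \<eta>(2))
      also have "sinc ((u - v) * T * hh x) = sinc ((u - v) * kap)"
      proof -
        have "(u - v) * T * hh x = - ((u - v) * kap)" unfolding mult.assoc using tau_hh[of x] by (simp add: T_def)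
        then show ?thesis by simp
      qed
      finally show "\<bar>1 / rhos m * (\<Sum>j<m. orthP a b j (x + u / rhos m) * orthP a b j (x + v / rhos m)) - hh x * sinc ((u - v) * kap)\<bar> < e" .
    qed
  qed
  \<comment> \<open>The kernel with index \<open>n\<close> has \<open>n + 1\<close> terms, so the
    clock is read at \<open>Suc n\<close>.\<close>
  then have "\<forall>\<^sub>F n in sequentially. \<forall>x\<in>C. \<forall>u v. \<bar>u\<bar> \<le> V \<longrightarrow> \<bar>v\<bar> \<le> V \<longrightarrow>
    \<bar>1 / rhos (Suc n) * (\<Sum>j<Suc n. orthP a b j (x + u / rhos (Suc n)) * orthP a b j (x + v / rhos (Suc n))) - hh x * sinc ((u - v) * kap)\<bar> < e"
    by (simp only: eventually_sequentially_Suc[of "\<lambda>m. \<forall>x\<in>C. \<forall>u v. \<bar>u\<bar> \<le> V \<longrightarrow> \<bar>v\<bar> \<le> V \<longrightarrow>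
    \<bar>1 / rhos m * (\<Sum>j<m. orthP a b j (x + u / rhos m) * orthP a b j (x + v / rhos m)) - hh x * sinc ((u - v) * kap)\<bar> < e"])
  then show ?thesis unfolding CD_kernel_def orth_poly_eq_orthP lessThan_Suc_atMost .
qed

end

section \<open>Logarithmic energy\<close>

lemma borel_prob_measureD:
  assumes "borel_prob_measure M"
  shows "real_distribution M" "prob_space M" "sets M = sets borel" "space M = UNIV"
  using assms sets_eq_imp_space_eq[of M borel]
  by (auto simp: borel_prob_measure_def real_distribution_def real_distribution_axioms_def)

lemma AE_prob_measures_on:
  assumes "M \<in> prob_measures_on F" "F \<in> sets borel"
  shows "AE x in M. x \<in> F"
proof -
  interpret prob_space M using assms borel_prob_measureD by (auto simp: prob_measures_on_def)
  show ?thesis using assms by (intro prob_eq_1[THEN iffD1]) (auto simp: prob_measures_on_def borel_prob_measureD)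
qed

lemma ennreal_amgm: "2 * (x * y) \<le> x * x + y * (y::ennreal)"
proof (cases "x = \<top> \<or> y = \<top>")
  case True
  then show ?thesis by (auto simp: ennreal_top_mult ennreal_mult_top)
next
  case False
  then obtain r s where rs: "r \<ge> 0" "s \<ge> 0" "x = ennreal r" "y = ennreal s" by (metis ennreal_cases)
  have "2 * (r * s) \<le> r * r + s * s" using zero_le_power2[of "r - s"] by (simp add: power2_eq_square algebra_simps)
  then have "ennreal (2 * (r * s)) \<le> ennreal (r * r + s * s)" by (rule ennreal_leI)
  then show ?thesis using rs by (simp add: ennreal_mult ennreal_plus)
qed

section \<open>The logarithmic kernel as a superposition of interval indicators\<close>

definition interval_ind :: "real \<Rightarrow> real \<times> real \<Rightarrow> real \<Rightarrow> ennreal" where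
  "interval_ind R p x = indicator {q. 0 < fst (fst q) \<and> fst (fst q) < R \<and> snd (fst q) \<le> snd q \<and> snd q \<le> snd (fst q) + fst (fst q)} (p, x) * ennreal (1 / fst p)"

text \<open>A superposition of products, hence positive definite; the pair \<open>p\<close> is the
  length and the left end of an interval. For distinct points at distance \<open>d \<le> R\<close>
  the value is \<open>ln (R / d) - 1 + d / R\<close>, the logarithmic kernel up to a constant and a
  multiple of the distance. Restricting the lengths to values below \<open>R\<close> makes the
  integral finite there.\<close>

definition pos_kernel :: "real \<Rightarrow> real \<Rightarrow> real \<Rightarrow> ennreal" where
  "pos_kernel R x y = (\<integral>\<^sup>+p. interval_ind R p x * interval_ind R p y \<partial>(lborel \<Otimes>\<^sub>M lborel))"

lemma interval_ind_measurable [measurable]: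
  "(\<lambda>q. interval_ind R (fst q) (snd q)) \<in> borel_measurable ((borel \<Otimes>\<^sub>M borel) \<Otimes>\<^sub>M borel)"
proof -
  have "{q::(real \<times> real) \<times> real. 0 < fst (fst q) \<and> fst (fst q) < R \<and> snd (fst q) \<le> snd q \<and> snd q \<le> snd (fst q) + fst (fst q)}
    = {q\<in>space ((borel \<Otimes>\<^sub>M borel) \<Otimes>\<^sub>M borel). 0 < fst (fst q) \<and> fst (fst q) < R \<and> snd (fst q) \<le> snd q \<and> snd q \<le> snd (fst q) + fst (fst q)}"
    by (auto simp: space_pair_measure)
  also have "\<dots> \<in> sets ((borel \<Otimes>\<^sub>M borel) \<Otimes>\<^sub>M borel)" by measurable
  finally show ?thesis unfolding interval_ind_def by simp
qed

lemma interval_ind_section [measurable]: "(\<lambda>p. interval_ind R p x) \<in> borel_measurable (borel \<Otimes>\<^sub>M borel)"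
proof -
  have "(\<lambda>p. (p, x)) \<in> (borel \<Otimes>\<^sub>M borel) \<rightarrow>\<^sub>M ((borel \<Otimes>\<^sub>M borel) \<Otimes>\<^sub>M borel)" by measurable
  from measurable_compose[OF this interval_ind_measurable[of R]] show ?thesis by simp
qed

text \<open>The intervals of length \<open>r\<close> that contain both points have their left ends
  in an interval of length \<open>r - \<bar>x - y\<bar>\<close>, and the weight \<open>1 / r\<close>
  occurs twice.\<close>

lemma pos_kernel_eq_integral:
  "pos_kernel R x y = (\<integral>\<^sup>+r\<in>{0<..<R}. ennreal (max 0 (r - \<bar>x - y\<bar>) / r\<^sup>2) \<partial>lborel)"
proof -
  have "pos_kernel R x y = (\<integral>\<^sup>+r. \<integral>\<^sup>+w. interval_ind R (r, w) x * interval_ind R (r, w) y \<partial>lborel \<partial>lborel)"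
    unfolding pos_kernel_def by (subst lborel.nn_integral_fst[symmetric]) (auto intro!: borel_measurable_times_ennreal simp: interval_ind_section)
  also have "\<dots> = (\<integral>\<^sup>+r\<in>{0<..<R}. ennreal (max 0 (r - \<bar>x - y\<bar>) / r\<^sup>2) \<partial>lborel)"
  proof (rule nn_integral_cong)
    fix r :: real
    show "(\<integral>\<^sup>+w. interval_ind R (r, w) x * interval_ind R (r, w) y \<partial>lborel) = ennreal (max 0 (r - \<bar>x - y\<bar>) / r\<^sup>2) * indicator {0<..<R} r"
    proof (cases "0 < r \<and> r < R")
      case True
      have "(\<integral>\<^sup>+w. interval_ind R (r, w) x * interval_ind R (r, w) y \<partial>lborel)
        = (\<integral>\<^sup>+w. ennreal (1 / r\<^sup>2) * indicator {max x y - r .. min x y} w \<partial>lborel)"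
      proof (rule nn_integral_cong)
        fix w :: real
        have "ennreal (1 / r) * ennreal (1 / r) = ennreal (1 / r\<^sup>2)" using True by (simp add: ennreal_mult[symmetric] power2_eq_square)
        then show "interval_ind R (r, w) x * interval_ind R (r, w) y = ennreal (1 / r\<^sup>2) * indicator {max x y - r .. min x y} w"
          using True by (auto simp: interval_ind_def indicator_def max_def min_def split: if_splits)
      qed
      also have "\<dots> = ennreal (1 / r\<^sup>2) * emeasure lborel {max x y - r .. min x y}" by (simp add: nn_integral_cmult_indicator)
      also have "emeasure lborel {max x y - r .. min x y} = ennreal (max 0 (r - \<bar>x - y\<bar>))"
        unfolding emeasure_lborel_Icc_eq by (intro arg_cong[where f=ennreal] | auto simp: max_def min_def abs_if)+
      also have "ennreal (1 / r\<^sup>2) * ennreal (max 0 (r - \<bar>x - y\<bar>)) = ennreal (max 0 (r - \<bar>x - y\<bar>) / r\<^sup>2)"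
        by (subst ennreal_mult[symmetric]) auto
      finally show ?thesis using True by simp
    next
      case False
      then show ?thesis by (auto simp: interval_ind_def)
    qed
  qed
  finally show ?thesis .
qed

lemma pos_kernel_ne:
  assumes "x \<noteq> y" "\<bar>x - y\<bar> \<le> R"
  shows "pos_kernel R x y = ennreal (ln (R / \<bar>x - y\<bar>) - 1 + \<bar>x - y\<bar> / R)"
proof -
  define d where "d = \<bar>x - y\<bar>"
  have d: "0 < d" "d \<le> R" using assms by (auto simp: d_def)
  have "pos_kernel R x y = (\<integral>\<^sup>+r\<in>{d..R}. ennreal (1 / r - d / r\<^sup>2) \<partial>lborel)"
    unfolding pos_kernel_eq_integral d_def[symmetric]
  proof (rule nn_integral_cong_AE)
    have "AE r in lborel. r \<noteq> R" by (rule AE_lborel_singleton)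
    then show "AE r in lborel. ennreal (max 0 (r - d) / r\<^sup>2) * indicator {0<..<R} r = ennreal (1 / r - d / r\<^sup>2) * indicator {d..R} r"
      by eventually_elim (use d in \<open>auto simp: indicator_def max_def diff_divide_distrib power2_eq_square\<close>)
  qed
  also have "\<dots> = ennreal ((ln R + d / R) - (ln d + d / d))"
  proof (rule nn_integral_FTC_Icc[where F="\<lambda>r. ln r + d / r"])
    show "(\<lambda>r. 1 / r - d / r\<^sup>2) \<in> borel_measurable borel" by measurable
    show "((\<lambda>r. ln r + d / r) has_real_derivative 1 / r - d / r\<^sup>2) (at r)" if "r \<in> {d..R}" for r
      using that d by (auto intro!: derivative_eq_intros simp: power2_eq_square)
    show "0 \<le> 1 / r - d / r\<^sup>2" if "r \<in> {d..R}" for r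
      using that d by (auto simp: field_simps power2_eq_square)
  qed (use d in auto)
  also have "(ln R + d / R) - (ln d + d / d) = ln (R / d) - 1 + d / R" using d by (simp add: ln_div)
  finally show ?thesis by (simp only: d_def)
qed

text \<open>The kernel increases when the distance decreases, and at distance
  \<open>R * exp (- v)\<close> it is already at least \<open>v - 1\<close>.\<close>

lemma pos_kernel_diag:
  assumes "R > 0"
  shows "pos_kernel R x x = \<infinity>"
proof -
  have "ennreal (real n) \<le> pos_kernel R x x" for n
  proof -
    define v where "v = real n + 1"
    define d where "d = R * exp (- v)"
    have d: "d > 0" "d \<le> R" using assms by (auto simp: d_def v_def)
    have "pos_kernel R x (x + d) \<le> pos_kernel R x x"
      unfolding pos_kernel_eq_integral by (intro nn_integral_mono mult_right_mono ennreal_leI divide_right_mono) (use d in auto)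
    moreover have "pos_kernel R x (x + d) = ennreal (ln (R / d) - 1 + d / R)"
      using pos_kernel_ne[of x "x + d" R] d by simp
    moreover have "ln (R / d) = real n + 1"
    proof -
      have "R / d = exp v" using assms by (simp add: d_def exp_minus field_simps)
      then show ?thesis by (simp add: v_def)
    qed
    moreover have "ennreal (real n) \<le> ennreal (real n + 1 - 1 + d / R)" using d assms by (intro ennreal_leI) auto
    ultimately show ?thesis by simp
  qed
  then have le: "of_nat n \<le> pos_kernel R x x" for n by (simp add: ennreal_of_nat_eq_real_of_nat)
  show ?thesis
  proof (rule ccontr)
    assume "pos_kernel R x x \<noteq> \<infinity>"
    then have "pos_kernel R x x < \<top>" by (simp add: top.not_eq_extremum)
    then obtain n where "pos_kernel R x x < of_nat n" using ennreal_Ex_less_of_nat by blast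
    then show False using le[of n] by simp
  qed
qed

definition energy2 :: "real \<Rightarrow> real measure \<Rightarrow> real measure \<Rightarrow> ennreal" where
  "energy2 R M M' = (\<integral>\<^sup>+x. \<integral>\<^sup>+y. pos_kernel R x y \<partial>M' \<partial>M)"

definition smooth_mass :: "real \<Rightarrow> real measure \<Rightarrow> real \<times> real \<Rightarrow> ennreal" where
  "smooth_mass R M p = (\<integral>\<^sup>+x. interval_ind R p x \<partial>M)"

text \<open>By Tonelli's theorem the mutual energy becomes an inner product of smoothed masses over
  the space of intervals.\<close>

lemma energy2_eq:
  assumes M: "prob_space M" "sets M = sets borel" and M': "prob_space M'" "sets M' = sets borel"
  shows "energy2 R M M' = (\<integral>\<^sup>+p. smooth_mass R M p * smooth_mass R M' p \<partial>(lborel \<Otimes>\<^sub>M lborel))"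
    and "smooth_mass R M \<in> borel_measurable (lborel \<Otimes>\<^sub>M lborel)"
proof -
  interpret M: prob_space M by fact
  interpret M': prob_space M' by fact
  interpret L: sigma_finite_measure "lborel \<Otimes>\<^sub>M lborel :: (real \<times> real) measure"
    by (simp add: lborel_prod sigma_finite_lborel)
  note [measurable_cong] = M(2) M'(2)
  interpret P': pair_sigma_finite "lborel \<Otimes>\<^sub>M lborel :: (real \<times> real) measure" M' ..
  interpret P: pair_sigma_finite "lborel \<Otimes>\<^sub>M lborel :: (real \<times> real) measure" M ..
  have meas: "(\<lambda>q. interval_ind R (fst q) (snd q)) \<in> borel_measurable ((lborel \<Otimes>\<^sub>M lborel) \<Otimes>\<^sub>M M)"
    "(\<lambda>q. interval_ind R (fst q) (snd q)) \<in> borel_measurable ((lborel \<Otimes>\<^sub>M lborel) \<Otimes>\<^sub>M M')"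
    using interval_ind_measurable[of R] by (simp_all cong: measurable_cong_sets)
  have sec: "(\<lambda>y. interval_ind R p y) \<in> borel_measurable M" "(\<lambda>y. interval_ind R p y) \<in> borel_measurable M'" for p
    using measurable_Pair2[OF meas(1), of p] measurable_Pair2[OF meas(2), of p] by (auto simp: space_pair_measure)
  show sm: "smooth_mass R M \<in> borel_measurable (lborel \<Otimes>\<^sub>M lborel)"
    unfolding smooth_mass_def[abs_def]
    by (rule M.borel_measurable_nn_integral) (use meas(1) in \<open>simp add: case_prod_beta'\<close>)
  have sm': "smooth_mass R M' \<in> borel_measurable (lborel \<Otimes>\<^sub>M lborel)"
    unfolding smooth_mass_def[abs_def]
    by (rule M'.borel_measurable_nn_integral) (use meas(2) in \<open>simp add: case_prod_beta'\<close>)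
  have secp: "(\<lambda>p. interval_ind R p x) \<in> borel_measurable (lborel \<Otimes>\<^sub>M lborel)" for x
    using interval_ind_section[of R x] by (simp cong: measurable_cong_sets)
  have in1: "(\<integral>\<^sup>+y. pos_kernel R x y \<partial>M') = (\<integral>\<^sup>+p. interval_ind R p x * smooth_mass R M' p \<partial>(lborel \<Otimes>\<^sub>M lborel))" for x
  proof -
    have m: "(\<lambda>(p, y). interval_ind R p x * interval_ind R p y) \<in> borel_measurable ((lborel \<Otimes>\<^sub>M lborel) \<Otimes>\<^sub>M M')"
      unfolding case_prod_beta' by (intro borel_measurable_times_ennreal meas measurable_compose[OF measurable_fst secp])
    have "(\<integral>\<^sup>+y. pos_kernel R x y \<partial>M') = (\<integral>\<^sup>+p. \<integral>\<^sup>+y. interval_ind R p x * interval_ind R p y \<partial>M' \<partial>(lborel \<Otimes>\<^sub>M lborel))"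
      unfolding pos_kernel_def using P'.Fubini'[OF m] by simp
    also have "\<dots> = (\<integral>\<^sup>+p. interval_ind R p x * smooth_mass R M' p \<partial>(lborel \<Otimes>\<^sub>M lborel))"
      unfolding smooth_mass_def by (simp add: nn_integral_cmult sec)
    finally show ?thesis .
  qed
  have m: "(\<lambda>(p, x). interval_ind R p x * smooth_mass R M' p) \<in> borel_measurable ((lborel \<Otimes>\<^sub>M lborel) \<Otimes>\<^sub>M M)"
    unfolding case_prod_beta' by (intro borel_measurable_times_ennreal meas measurable_compose[OF measurable_fst sm'])
  have "energy2 R M M' = (\<integral>\<^sup>+p. \<integral>\<^sup>+x. interval_ind R p x * smooth_mass R M' p \<partial>M \<partial>(lborel \<Otimes>\<^sub>M lborel))"
    unfolding energy2_def in1 using P.Fubini'[OF m] by simp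
  also have "\<dots> = (\<integral>\<^sup>+p. smooth_mass R M p * smooth_mass R M' p \<partial>(lborel \<Otimes>\<^sub>M lborel))"
    unfolding smooth_mass_def by (simp add: nn_integral_multc sec)
  finally show "energy2 R M M' = (\<integral>\<^sup>+p. smooth_mass R M p * smooth_mass R M' p \<partial>(lborel \<Otimes>\<^sub>M lborel))" .
qed

text \<open>\<open>2 x y \<le> x^2 + y^2\<close> for the smoothed masses. This form of the
  Cauchy-Schwarz inequality involves no subtraction and stays meaningful for infinite
  energies.\<close>

lemma energy2_amgm:
  assumes M: "prob_space M" "sets M = sets borel" and M': "prob_space M'" "sets M' = sets borel"
  shows "2 * energy2 R M M' \<le> energy2 R M M + energy2 R M' M'"
proof -
  note e = energy2_eq(1)[OF M M'] energy2_eq(1)[OF M M] energy2_eq(1)[OF M' M']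
  note [measurable] = energy2_eq(2)[OF M M'] energy2_eq(2)[OF M' M]
  have "2 * energy2 R M M' = (\<integral>\<^sup>+p. 2 * (smooth_mass R M p * smooth_mass R M' p) \<partial>(lborel \<Otimes>\<^sub>M lborel))"
    unfolding e by (subst nn_integral_cmult) auto
  also have "\<dots> \<le> (\<integral>\<^sup>+p. smooth_mass R M p * smooth_mass R M p + smooth_mass R M' p * smooth_mass R M' p \<partial>(lborel \<Otimes>\<^sub>M lborel))"
    by (intro nn_integral_mono ennreal_amgm)
  also have "\<dots> = energy2 R M M + energy2 R M' M'" unfolding e by (subst nn_integral_add) auto
  finally show ?thesis .
qed

section \<open>Mean distances, the source of strict convexity\<close>

definition dist2 :: "real measure \<Rightarrow> real measure \<Rightarrow> ennreal" where
  "dist2 M M' = (\<integral>\<^sup>+x. \<integral>\<^sup>+y. ennreal \<bar>x - y\<bar> \<partial>M' \<partial>M)"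

text \<open>The distance of two points is the length of the set of levels \<open>w\<close> that
  separate them; Tonelli's theorem turns the two possible orders into products of distribution
  functions.\<close>

lemma dist2_cdf:
  assumes M: "real_distribution M" and M': "real_distribution M'"
  shows "dist2 M M' = (\<integral>\<^sup>+w. ennreal (cdf M w * (1 - cdf M' w) + cdf M' w * (1 - cdf M w)) \<partial>lborel)"
proof -
  interpret M: real_distribution M by fact
  interpret M': real_distribution M' by fact
  interpret P': pair_sigma_finite lborel M' ..
  interpret P: pair_sigma_finite lborel M ..
  define psi where "psi = (\<lambda>w x y. indicator {..w} x * indicator {w<..} y + indicator {..w} y * indicator {w<..} (x::real) :: ennreal)"
  have [measurable]: "(\<lambda>q. indicator {..fst q} (snd q) :: ennreal) \<in> borel_measurable ((borel :: real measure) \<Otimes>\<^sub>M borel)"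
    "(\<lambda>q. indicator {fst q<..} (snd q) :: ennreal) \<in> borel_measurable ((borel :: real measure) \<Otimes>\<^sub>M borel)"
    unfolding indicator_def of_bool_def atMost_iff greaterThan_iff by measurable
  have abs: "ennreal \<bar>x - y\<bar> = (\<integral>\<^sup>+w. psi w x y \<partial>lborel)" for x y
  proof -
    have "psi w x y = indicator {min x y ..< max x y} w" for w
      unfolding psi_def by (auto simp: indicator_def min_def max_def)
    then have "(\<integral>\<^sup>+w. psi w x y \<partial>lborel) = emeasure lborel {min x y ..< max x y}" by simp
    also have "\<dots> = ennreal \<bar>x - y\<bar>" by (auto simp: min_def max_def abs_if)
    finally show ?thesis ..
  qed
  have cm: "emeasure N {..w} = ennreal (cdf N w)" "emeasure N {w<..} = ennreal (1 - cdf N w)" if "real_distribution N" for N w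
  proof -
    interpret N: real_distribution N by fact
    show "emeasure N {..w} = ennreal (cdf N w)" by (simp add: cdf_def N.emeasure_eq_measure)
    have eq: "{w<..} = space N - {..w}" by (auto simp: N.space_eq_univ)
    have "measure N {w<..} = 1 - cdf N w" unfolding cdf_def eq by (rule N.prob_compl) simp
    then show "emeasure N {w<..} = ennreal (1 - cdf N w)" by (simp add: N.emeasure_eq_measure)
  qed
  have c01: "0 \<le> cdf N w" "cdf N w \<le> 1" if "real_distribution N" for N w
  proof -
    interpret N: real_distribution N by fact
    show "0 \<le> cdf N w" "cdf N w \<le> 1" by (simp_all add: N.cdf_nonneg N.cdf_bounded_prob)
  qed
  have in1: "(\<integral>\<^sup>+y. ennreal \<bar>x - y\<bar> \<partial>M') = (\<integral>\<^sup>+w. indicator {..w} x * ennreal (1 - cdf M' w) + ennreal (cdf M' w) * indicator {w<..} x \<partial>lborel)" for x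
  proof -
    have m: "(\<lambda>(w, y). psi w x y) \<in> borel_measurable (lborel \<Otimes>\<^sub>M M')"
      unfolding psi_def case_prod_beta' indicator_def of_bool_def atMost_iff greaterThan_iff by measurable
    have "(\<integral>\<^sup>+y. ennreal \<bar>x - y\<bar> \<partial>M') = (\<integral>\<^sup>+w. \<integral>\<^sup>+y. psi w x y \<partial>M' \<partial>lborel)"
      unfolding abs using P'.Fubini'[OF m] by simp
    also have "(\<lambda>w. \<integral>\<^sup>+y. psi w x y \<partial>M') = (\<lambda>w. indicator {..w} x * ennreal (1 - cdf M' w) + ennreal (cdf M' w) * indicator {w<..} x)"
      unfolding psi_def by (auto simp: nn_integral_add nn_integral_cmult nn_integral_multc cm[OF M'] fun_eq_iff)
    finally show ?thesis .
  qed
  have [measurable]: "cdf N \<in> borel_measurable borel" if "real_distribution N" for N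
  proof -
    interpret N: real_distribution N by fact
    show ?thesis by (intro borel_measurable_mono) (auto intro: monoI N.cdf_nondecreasing)
  qed
  note [measurable] = this[OF M] this[OF M']
  have m: "(\<lambda>(w, x). indicator {..w} x * ennreal (1 - cdf M' w) + ennreal (cdf M' w) * indicator {w<..} x) \<in> borel_measurable (lborel \<Otimes>\<^sub>M M)"
    unfolding case_prod_beta' indicator_def of_bool_def atMost_iff greaterThan_iff by measurable
  have "dist2 M M' = (\<integral>\<^sup>+w. \<integral>\<^sup>+x. indicator {..w} x * ennreal (1 - cdf M' w) + ennreal (cdf M' w) * indicator {w<..} x \<partial>M \<partial>lborel)"
    unfolding dist2_def in1 using P.Fubini'[OF m] by simp
  also have "\<dots> = (\<integral>\<^sup>+w. ennreal (cdf M w * (1 - cdf M' w) + cdf M' w * (1 - cdf M w)) \<partial>lborel)"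
  proof (rule nn_integral_cong)
    fix w
    have "(\<integral>\<^sup>+x. indicator {..w} x * ennreal (1 - cdf M' w) + ennreal (cdf M' w) * indicator {w<..} x \<partial>M)
       = ennreal (cdf M w) * ennreal (1 - cdf M' w) + ennreal (cdf M' w) * ennreal (1 - cdf M w)"
      by (auto simp: nn_integral_add nn_integral_cmult nn_integral_multc cm[OF M])
    also have "\<dots> = ennreal (cdf M w * (1 - cdf M' w) + cdf M' w * (1 - cdf M w))"
      using c01[OF M, of w] c01[OF M', of w] by (simp add: ennreal_mult ennreal_plus)
    finally show "(\<integral>\<^sup>+x. indicator {..w} x * ennreal (1 - cdf M' w) + ennreal (cdf M' w) * indicator {w<..} x \<partial>M)
       = ennreal (cdf M w * (1 - cdf M' w) + cdf M' w * (1 - cdf M w))" .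
  qed
  finally show ?thesis .
qed

lemma cdf_measurable: "real_distribution N \<Longrightarrow> cdf N \<in> borel_measurable borel"
proof -
  assume "real_distribution N"
  then interpret N: real_distribution N .
  show ?thesis by (intro borel_measurable_mono) (auto intro: monoI N.cdf_nondecreasing)
qed

text \<open>An algebraic identity under the integral of \<open>dist2_cdf\<close>. The defect is the
  squared L2 distance of the distribution functions, and this term is what makes the minimizer
  unique.\<close>

lemma dist2_parallelogram:
  assumes M: "real_distribution M" and M': "real_distribution M'"
  shows "dist2 M M + dist2 M' M' + 2 * (\<integral>\<^sup>+w. ennreal ((cdf M w - cdf M' w)\<^sup>2) \<partial>lborel) = 2 * dist2 M M'"
proof -
  note [measurable] = cdf_measurable[OF M] cdf_measurable[OF M']
  have c01: "0 \<le> cdf N w" "cdf N w \<le> 1" if "real_distribution N" for N w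
  proof -
    interpret N: real_distribution N by fact
    show "0 \<le> cdf N w" "cdf N w \<le> 1" by (simp_all add: N.cdf_nonneg N.cdf_bounded_prob)
  qed
  have "dist2 M M + dist2 M' M' + 2 * (\<integral>\<^sup>+w. ennreal ((cdf M w - cdf M' w)\<^sup>2) \<partial>lborel)
    = (\<integral>\<^sup>+w. ennreal (cdf M w * (1 - cdf M w) + cdf M w * (1 - cdf M w)) + ennreal (cdf M' w * (1 - cdf M' w) + cdf M' w * (1 - cdf M' w))
       + 2 * ennreal ((cdf M w - cdf M' w)\<^sup>2) \<partial>lborel)"
    unfolding dist2_cdf[OF M M] dist2_cdf[OF M' M'] by (simp add: nn_integral_add nn_integral_cmult)
  also have "\<dots> = (\<integral>\<^sup>+w. 2 * ennreal (cdf M w * (1 - cdf M' w) + cdf M' w * (1 - cdf M w)) \<partial>lborel)"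
  proof (rule nn_integral_cong)
    fix w
    define f g where "f = cdf M w" "g = cdf M' w"
    have fg: "0 \<le> f" "f \<le> 1" "0 \<le> g" "g \<le> 1" using c01[OF M] c01[OF M'] by (auto simp: f_g_def)
    have t: "(2::ennreal) = ennreal 2" by simp
    have "ennreal (f * (1 - f) + f * (1 - f)) + ennreal (g * (1 - g) + g * (1 - g)) + ennreal 2 * ennreal ((f - g)\<^sup>2)
      = ennreal (f * (1 - f) + f * (1 - f) + (g * (1 - g) + g * (1 - g)) + 2 * (f - g)\<^sup>2)"
      using fg by (simp only: ennreal_plus[symmetric] ennreal_mult[symmetric] add_nonneg_nonneg mult_nonneg_nonneg zero_le_power2 diff_ge_0_iff_ge zero_le_numeral)
    also have "f * (1 - f) + f * (1 - f) + (g * (1 - g) + g * (1 - g)) + 2 * (f - g)\<^sup>2 = 2 * (f * (1 - g) + g * (1 - f))"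
      by (simp add: power2_eq_square algebra_simps)
    also have "ennreal \<dots> = ennreal 2 * ennreal (f * (1 - g) + g * (1 - f))" using fg by (intro ennreal_mult) auto
    finally show "ennreal (cdf M w * (1 - cdf M w) + cdf M w * (1 - cdf M w)) + ennreal (cdf M' w * (1 - cdf M' w) + cdf M' w * (1 - cdf M' w))
       + 2 * ennreal ((cdf M w - cdf M' w)\<^sup>2) = 2 * ennreal (cdf M w * (1 - cdf M' w) + cdf M' w * (1 - cdf M w))"
      unfolding t f_g_def .
  qed
  also have "\<dots> = 2 * dist2 M M'" unfolding dist2_cdf[OF M M'] by (rule nn_integral_cmult) measurable
  finally show ?thesis .
qed

text \<open>Distribution functions that agree almost everywhere agree everywhere by continuity from
  the right.\<close>

lemma cdf_L2_zero_imp_eq: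
  assumes M: "real_distribution M" and M': "real_distribution M'"
    and z: "(\<integral>\<^sup>+w. ennreal ((cdf M w - cdf M' w)\<^sup>2) \<partial>lborel) = 0"
  shows "M = M'"
proof (rule cdf_unique[OF M M'], rule ext)
  interpret M: real_distribution M by fact
  interpret M': real_distribution M' by fact
  note [measurable] = cdf_measurable[OF M] cdf_measurable[OF M']
  fix x
  have ae: "AE w in lborel. cdf M w - cdf M' w = 0"
    using z by (subst (asm) nn_integral_0_iff_AE) (auto simp: ennreal_eq_0_iff elim: AE_mp)
  show "cdf M x = cdf M' x"
  proof (rule ccontr)
    assume ne: "cdf M x \<noteq> cdf M' x"
    have "((\<lambda>w. cdf M w - cdf M' w) \<longlongrightarrow> cdf M x - cdf M' x) (at_right x)"
      using M.cdf_is_right_cont[of x] M'.cdf_is_right_cont[of x] unfolding continuous_within by (intro tendsto_diff)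
    then have "\<forall>\<^sub>F w in at_right x. cdf M w - cdf M' w \<noteq> 0" by (rule tendsto_imp_eventually_ne) (use ne in simp)
    then obtain b where b: "b > x" "\<And>w. x < w \<Longrightarrow> w < b \<Longrightarrow> cdf M w - cdf M' w \<noteq> 0"
      unfolding eventually_at_right_field by blast
    have "AE w in lborel. w \<notin> {x<..<b}" using ae by eventually_elim (use b in auto)
    then have "{x<..<b} \<in> null_sets lborel" by (subst AE_iff_null_sets) auto
    then have "emeasure lborel {x<..<b} = 0" by (rule null_setsD1)
    then show False using b by simp
  qed
qed

lemma ennreal_le_cancel_diff:
  assumes "ennreal a \<le> ennreal b" "0 \<le> b" shows "a \<le> b"
  using assms by (simp add: ennreal_le_iff)

text \<open>Subtracting the conditionally positive definite kernel \<open>-\<bar>x - y\<bar> / R\<close> from the logarithmic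
  kernel leaves, up to a constant, a superposition of products of interval indicators on
  bounded sets. Hence the logarithmic energy is strictly convex, and a measure with constant
  potential is the only minimizer.\<close>

theorem equilibrium_unique:
  assumes F: "F \<in> sets borel" "\<And>x. x \<in> F \<Longrightarrow> \<bar>x\<bar> \<le> B"
    and w: "\<omega> \<in> prob_measures_on F" and w0: "\<omega>0 \<in> prob_measures_on F"
    and atom: "\<And>x. AE y in \<omega>0. y \<noteq> x"
    and pot: "\<And>x. x \<in> F \<Longrightarrow> integrable \<omega>0 (\<lambda>y. ln \<bar>x - y\<bar>)"
      "\<And>x. x \<in> F \<Longrightarrow> (\<integral>y. ln \<bar>x - y\<bar> \<partial>\<omega>0) = c"
    and le: "log_energy \<omega> \<le> log_energy \<omega>0"
  shows "\<omega> = \<omega>0"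
proof -
  have bw: "borel_prob_measure \<omega>" "borel_prob_measure \<omega>0" using w w0 by (auto simp: prob_measures_on_def)
  note D = borel_prob_measureD[OF bw(1)] borel_prob_measureD[OF bw(2)]
  interpret W: real_distribution \<omega> by (rule D(1))
  interpret W0: real_distribution \<omega>0 by (rule D(5))
  have ae: "AE x in \<omega>. x \<in> F" "AE x in \<omega>0. x \<in> F" using AE_prob_measures_on w w0 F(1) by auto
  \<comment> \<open>The first entry makes \<open>R\<close> exceed all distances in \<open>F\<close>.
    The second makes \<open>ln R - 1\<close> and \<open>\<kappa>\<close> nonnegative, so that the
    constants can be handled as extended nonnegative numbers.\<close>
  define R where "R = max (2 * \<bar>B\<bar> + 1) (exp (1 + \<bar>c\<bar>))"
  have R: "R > 0" "2 * \<bar>B\<bar> \<le> R" unfolding R_def by auto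
  have lnR: "ln R \<ge> 1 + \<bar>c\<bar>"
  proof -
    have "ln (exp (1 + \<bar>c\<bar>)) \<le> ln R" by (rule ln_mono) (use R(1) in \<open>auto simp: R_def\<close>)
    then show ?thesis by simp
  qed
  have dR: "\<bar>x - y\<bar> \<le> R" if "x \<in> F" "y \<in> F" for x y using F(2)[OF that(1)] F(2)[OF that(2)] R(2) by linarith
  define \<kappa> where "\<kappa> = ln R - 1 - c"
  have \<kappa>: "\<kappa> \<ge> 0" using lnR by (simp add: \<kappa>_def)
  define pos where "pos = (\<lambda>\<nu>. \<integral>\<^sup>+x. \<integral>\<^sup>+y. e2ennreal (log_kernel x y) \<partial>\<nu> \<partial>\<nu>)"
  define neg where "neg = (\<lambda>\<nu>. \<integral>\<^sup>+x. \<integral>\<^sup>+y. e2ennreal (- log_kernel x y) \<partial>\<nu> \<partial>\<nu>)"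
  \<comment> \<open>Negative terms are moved to the opposite side, so that the decomposition also
    holds on the diagonal, where both sides are infinite.\<close>
  have kern: "e2ennreal (log_kernel x y) + (ennreal (\<bar>x - y\<bar> / R) + ennreal (ln R - 1)) = pos_kernel R x y + e2ennreal (- log_kernel x y)"
    if "x \<in> F" "y \<in> F" for x y
  proof (cases "x = y")
    case True
    then show ?thesis using pos_kernel_diag[OF R(1)] by (simp add: log_kernel_def)
  next
    case False
    define d where "d = \<bar>x - y\<bar>"
    have d: "d > 0" "d \<le> R" using False dR[OF that] by (auto simp: d_def)
    have l1: "ln R - 1 \<ge> 0" using lnR by linarith
    have k: "ln (R / d) - 1 + d / R \<ge> 0"
    proof -
      have "ln (d / R) \<le> d / R - 1" using d R by (intro ln_le_minus_one) auto
      then show ?thesis using d R by (simp add: ln_div)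
    qed
    have e: "e2ennreal (ereal z) = ennreal z" for z by (simp add: ennreal.abs_eq e2ennreal_def enn2ereal_inverse e2ennreal_ereal)
    have "e2ennreal (log_kernel x y) = ennreal (max 0 (- ln d))" "e2ennreal (- log_kernel x y) = ennreal (max 0 (ln d))"
      using False by (auto simp: log_kernel_def e d_def ennreal_neg max_def)
    moreover have "ennreal (max 0 (- ln d)) + (ennreal (d / R) + ennreal (ln R - 1)) = ennreal (max 0 (- ln d) + (d / R + (ln R - 1)))"
      using d R l1 by simp
    moreover have "ennreal (ln (R / d) - 1 + d / R) + ennreal (max 0 (ln d)) = ennreal (ln (R / d) - 1 + d / R + max 0 (ln d))"
      using k by simp
    moreover have "max 0 (- ln d) + (d / R + (ln R - 1)) = ln (R / d) - 1 + d / R + max 0 (ln d)"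
      using d R by (simp add: ln_div max_def)
    moreover have "pos_kernel R x y = ennreal (ln (R / d) - 1 + d / R)" using pos_kernel_ne[OF False dR[OF that]] by (simp only: d_def)
    ultimately show ?thesis unfolding d_def[symmetric] by (simp only:)
  qed
  have km: "(\<lambda>q. log_kernel (fst q) (snd q)) \<in> borel_measurable (borel \<Otimes>\<^sub>M borel)"
    unfolding log_kernel_def by measurable
  have pm: "(\<lambda>q. pos_kernel R (fst q) (snd q)) \<in> borel_measurable (borel \<Otimes>\<^sub>M borel)"
  proof -
    have "(\<lambda>q. \<integral>\<^sup>+r\<in>{0<..<R}. ennreal (max 0 (r - \<bar>fst q - snd q\<bar>) / r\<^sup>2) \<partial>lborel) \<in> borel_measurable ((borel :: real measure) \<Otimes>\<^sub>M borel)"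
      by (rule lborel.borel_measurable_nn_integral) measurable
    then show ?thesis by (simp add: pos_kernel_eq_integral)
  qed
  have meas: "(\<lambda>q. f (fst q) (snd q)) \<in> borel_measurable (borel \<Otimes>\<^sub>M borel) \<Longrightarrow>
      (\<lambda>y. f x y) \<in> borel_measurable \<nu>' \<and> (\<lambda>x. \<integral>\<^sup>+y. f x y \<partial>\<nu>') \<in> borel_measurable \<nu>"
    if "prob_space \<nu>'" "sets \<nu>' = sets borel" "sets \<nu> = sets borel" for f :: "real \<Rightarrow> real \<Rightarrow> ennreal" and \<nu> \<nu>' x
  proof -
    assume f: "(\<lambda>q. f (fst q) (snd q)) \<in> borel_measurable (borel \<Otimes>\<^sub>M borel)"
    interpret N': prob_space \<nu>' by fact
    have f': "(\<lambda>(x, y). f x y) \<in> borel_measurable (borel \<Otimes>\<^sub>M \<nu>')"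
    proof -
      have s: "sets (borel \<Otimes>\<^sub>M \<nu>') = sets ((borel :: real measure) \<Otimes>\<^sub>M borel)"
        by (rule sets_pair_measure_cong) (simp_all add: that(2))
      show ?thesis unfolding measurable_cong_sets[OF s refl] case_prod_beta' by (rule f)
    qed
    have "(\<lambda>x. \<integral>\<^sup>+y. f x y \<partial>\<nu>') \<in> borel_measurable borel" by (rule N'.borel_measurable_nn_integral[OF f'])
    moreover have "(\<lambda>y. f x y) \<in> borel_measurable \<nu>'" using measurable_Pair2[OF f', of x] by simp
    ultimately show ?thesis unfolding measurable_cong_sets[OF that(3) refl] by blast
  qed
  have em: "(\<lambda>q. e2ennreal (log_kernel (fst q) (snd q))) \<in> borel_measurable (borel \<Otimes>\<^sub>M borel)"
    "(\<lambda>q. e2ennreal (- log_kernel (fst q) (snd q))) \<in> borel_measurable (borel \<Otimes>\<^sub>M borel)"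
    "(\<lambda>q. ennreal \<bar>fst q - snd q\<bar>) \<in> borel_measurable ((borel :: real measure) \<Otimes>\<^sub>M borel)"
    using km by measurable
  have identity: "pos \<nu> + (dist2 \<nu> \<nu> / ennreal R + ennreal (ln R - 1)) = energy2 R \<nu> \<nu> + neg \<nu>"
    and neg_fin: "neg \<nu> < \<infinity>" if n: "\<nu> = \<omega> \<or> \<nu> = \<omega>0" for \<nu>
  proof -
    have nD: "prob_space \<nu>" "sets \<nu> = sets borel" "AE x in \<nu>. x \<in> F" using n D ae by auto
    interpret N: prob_space \<nu> by (rule nD(1))
    note ms = meas[OF nD(1,2,2)]
    have sec: "(\<lambda>y. e2ennreal (log_kernel x y)) \<in> borel_measurable \<nu>" "(\<lambda>y. e2ennreal (- log_kernel x y)) \<in> borel_measurable \<nu>"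
       "(\<lambda>y. ennreal \<bar>x - y\<bar>) \<in> borel_measurable \<nu>" "(\<lambda>y. pos_kernel R x y) \<in> borel_measurable \<nu>" for x
      using ms[OF em(1)] ms[OF em(2)] ms[OF em(3)] ms[OF pm] by blast+
    have out: "(\<lambda>x. \<integral>\<^sup>+y. e2ennreal (log_kernel x y) \<partial>\<nu>) \<in> borel_measurable \<nu>" "(\<lambda>x. \<integral>\<^sup>+y. e2ennreal (- log_kernel x y) \<partial>\<nu>) \<in> borel_measurable \<nu>"
       "(\<lambda>x. \<integral>\<^sup>+y. ennreal \<bar>x - y\<bar> \<partial>\<nu>) \<in> borel_measurable \<nu>" "(\<lambda>x. \<integral>\<^sup>+y. pos_kernel R x y \<partial>\<nu>) \<in> borel_measurable \<nu>"
      using ms[OF em(1)] ms[OF em(2)] ms[OF em(3)] ms[OF pm] by blast+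
    note [measurable] = sec out
    note [measurable_cong] = nD(2)
    have div: "(\<integral>\<^sup>+y. ennreal \<bar>x - y\<bar> / ennreal R \<partial>\<nu>) = (\<integral>\<^sup>+y. ennreal \<bar>x - y\<bar> \<partial>\<nu>) / ennreal R" for x
      by (rule nn_integral_divide) (rule sec)
    have div2: "(\<integral>\<^sup>+x. (\<integral>\<^sup>+y. ennreal \<bar>x - y\<bar> \<partial>\<nu>) / ennreal R \<partial>\<nu>) = (\<integral>\<^sup>+x. \<integral>\<^sup>+y. ennreal \<bar>x - y\<bar> \<partial>\<nu> \<partial>\<nu>) / ennreal R"
      by (rule nn_integral_divide) (rule out)
    have dd: "ennreal (\<bar>x - y\<bar> / R) = ennreal \<bar>x - y\<bar> / ennreal R" for x y using R by (simp add: divide_ennreal)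
    have "pos \<nu> + (dist2 \<nu> \<nu> / ennreal R + ennreal (ln R - 1))
       = (\<integral>\<^sup>+x. \<integral>\<^sup>+y. e2ennreal (log_kernel x y) + (ennreal \<bar>x - y\<bar> / ennreal R + ennreal (ln R - 1)) \<partial>\<nu> \<partial>\<nu>)"
      unfolding pos_def dist2_def
      by (simp add: nn_integral_add div div2 N.emeasure_space_1)
    also have "\<dots> = (\<integral>\<^sup>+x. \<integral>\<^sup>+y. pos_kernel R x y + e2ennreal (- log_kernel x y) \<partial>\<nu> \<partial>\<nu>)"
    proof (rule nn_integral_cong_AE)
      show "AE x in \<nu>. (\<integral>\<^sup>+y. e2ennreal (log_kernel x y) + (ennreal \<bar>x - y\<bar> / ennreal R + ennreal (ln R - 1)) \<partial>\<nu>)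
         = (\<integral>\<^sup>+y. pos_kernel R x y + e2ennreal (- log_kernel x y) \<partial>\<nu>)"
        using nD(3)
      proof eventually_elim
        case (elim x)
        show ?case by (rule nn_integral_cong_AE) (use nD(3) in \<open>eventually_elim; use elim in \<open>simp only: kern[symmetric] dd\<close>\<close>)
      qed
    qed
    also have "\<dots> = energy2 R \<nu> \<nu> + neg \<nu>"
      unfolding energy2_def neg_def by (simp add: nn_integral_add sec out)
    finally show "pos \<nu> + (dist2 \<nu> \<nu> / ennreal R + ennreal (ln R - 1)) = energy2 R \<nu> \<nu> + neg \<nu>" .
    have "neg \<nu> \<le> (\<integral>\<^sup>+x. \<integral>\<^sup>+y. ennreal (ln R) \<partial>\<nu> \<partial>\<nu>)"
      unfolding neg_def
    proof (rule nn_integral_mono_AE)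
      show "AE x in \<nu>. (\<integral>\<^sup>+y. e2ennreal (- log_kernel x y) \<partial>\<nu>) \<le> (\<integral>\<^sup>+y. ennreal (ln R) \<partial>\<nu>)"
        using nD(3)
      proof eventually_elim
        case (elim x)
        show ?case
        proof (rule nn_integral_mono_AE)
          show "AE y in \<nu>. e2ennreal (- log_kernel x y) \<le> ennreal (ln R)"
            using nD(3)
          proof eventually_elim
            case (elim y)
            show ?case
            proof (cases "x = y")
              case False
              then have "ln \<bar>x - y\<bar> \<le> ln R" using dR[OF \<open>x \<in> F\<close> elim] by (intro ln_mono) auto
              then show ?thesis using False by (simp add: log_kernel_def e2ennreal_ereal ennreal_leI)
            qed (simp add: log_kernel_def e2ennreal_neg)
          qed
        qed
      qed
    qed
    also have "\<dots> < \<infinity>" by (simp add: N.emeasure_space_1)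
    finally show "neg \<nu> < \<infinity>" .
  qed
  have d2fin: "dist2 \<nu> \<nu>' \<le> ennreal R" if n: "\<nu> = \<omega> \<or> \<nu> = \<omega>0" "\<nu>' = \<omega> \<or> \<nu>' = \<omega>0" for \<nu> \<nu>'
  proof -
    have nD: "prob_space \<nu>" "AE x in \<nu>. x \<in> F" "prob_space \<nu>'" "AE x in \<nu>'. x \<in> F" using n D ae by auto
    interpret N: prob_space \<nu> by (rule nD(1))
    interpret N': prob_space \<nu>' by (rule nD(3))
    have "dist2 \<nu> \<nu>' \<le> (\<integral>\<^sup>+x. \<integral>\<^sup>+y. ennreal R \<partial>\<nu>' \<partial>\<nu>)"
      unfolding dist2_def
    proof (rule nn_integral_mono_AE)
      show "AE x in \<nu>. (\<integral>\<^sup>+y. ennreal \<bar>x - y\<bar> \<partial>\<nu>') \<le> (\<integral>\<^sup>+y. ennreal R \<partial>\<nu>')"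
        using nD(2)
      proof eventually_elim
        case (elim x)
        show ?case by (rule nn_integral_mono_AE) (use nD(4) in \<open>eventually_elim; use elim dR in \<open>auto intro: ennreal_leI\<close>\<close>)
      qed
    qed
    also have "\<dots> = ennreal R" by (simp add: N.emeasure_space_1 N'.emeasure_space_1)
    finally show ?thesis .
  qed
  \<comment> \<open>Here the constant potential enters: integrated against \<open>\<omega>0\<close>,
    the logarithm gives \<open>c\<close> at every point of \<open>F\<close>, so only the mean
    distance still depends on \<open>\<nu>\<close>.\<close>
  have mixed: "energy2 R \<nu> \<omega>0 = ennreal \<kappa> + dist2 \<nu> \<omega>0 / ennreal R" if n: "\<nu> = \<omega> \<or> \<nu> = \<omega>0" for \<nu>
  proof -
    have nD: "prob_space \<nu>" "sets \<nu> = sets borel" "AE x in \<nu>. x \<in> F" using n D ae by auto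
    interpret N: prob_space \<nu> by (rule nD(1))
    have inner: "(\<integral>\<^sup>+y. pos_kernel R x y \<partial>\<omega>0) = ennreal \<kappa> + (\<integral>\<^sup>+y. ennreal \<bar>x - y\<bar> \<partial>\<omega>0) / ennreal R" if x: "x \<in> F" for x
    proof -
      have idist: "integrable \<omega>0 (\<lambda>y. \<bar>x - y\<bar>)"
        by (rule W0.integrable_const_bound[where B=R]) (use ae(2) dR[OF x] in \<open>auto elim: AE_mp\<close>)
      have i: "integrable \<omega>0 (\<lambda>y. (ln R - 1) - ln \<bar>x - y\<bar> + \<bar>x - y\<bar> / R)"
        using pot(1)[OF x] idist by (intro Bochner_Integration.integrable_add Bochner_Integration.integrable_diff integrable_divide_zero) auto
      have "(\<integral>\<^sup>+y. pos_kernel R x y \<partial>\<omega>0) = (\<integral>\<^sup>+y. ennreal ((ln R - 1) - ln \<bar>x - y\<bar> + \<bar>x - y\<bar> / R) \<partial>\<omega>0)"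
      proof (rule nn_integral_cong_AE)
        show "AE y in \<omega>0. pos_kernel R x y = ennreal ((ln R - 1) - ln \<bar>x - y\<bar> + \<bar>x - y\<bar> / R)"
          using ae(2) atom[of x]
          by eventually_elim (use dR[OF x] R in \<open>auto simp: pos_kernel_ne ln_div algebra_simps\<close>)
      qed
      also have "\<dots> = ennreal (\<integral>y. (ln R - 1) - ln \<bar>x - y\<bar> + \<bar>x - y\<bar> / R \<partial>\<omega>0)"
      proof (rule nn_integral_eq_integral[OF i])
        show "AE y in \<omega>0. 0 \<le> (ln R - 1) - ln \<bar>x - y\<bar> + \<bar>x - y\<bar> / R"
          using ae(2) atom[of x]
        proof eventually_elim
          case (elim y)
          define d where "d = \<bar>x - y\<bar>"
          have d: "d > 0" using elim by (auto simp: d_def)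
          have "ln (d / R) \<le> d / R - 1" using d R by (intro ln_le_minus_one) auto
          then show ?case using d R unfolding d_def[symmetric] by (simp add: ln_div)
        qed
      qed
      also have "(\<integral>y. (ln R - 1) - ln \<bar>x - y\<bar> + \<bar>x - y\<bar> / R \<partial>\<omega>0) = \<kappa> + (\<integral>y. \<bar>x - y\<bar> \<partial>\<omega>0) / R"
        using pot(1)[OF x] pot(2)[OF x] idist W0.prob_space by (simp add: \<kappa>_def)
      also have "ennreal (\<kappa> + (\<integral>y. \<bar>x - y\<bar> \<partial>\<omega>0) / R) = ennreal \<kappa> + ennreal (\<integral>y. \<bar>x - y\<bar> \<partial>\<omega>0) / ennreal R"
        using \<kappa> R by (simp add: divide_ennreal)
      also have "ennreal (\<integral>y. \<bar>x - y\<bar> \<partial>\<omega>0) = (\<integral>\<^sup>+y. ennreal \<bar>x - y\<bar> \<partial>\<omega>0)"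
        by (rule nn_integral_eq_integral[symmetric, OF idist]) auto
      finally show ?thesis .
    qed
    have out: "(\<lambda>x. \<integral>\<^sup>+y. ennreal \<bar>x - y\<bar> \<partial>\<omega>0) \<in> borel_measurable \<nu>"
      using meas[OF D(6,7) nD(2) em(3)] by blast
    have "energy2 R \<nu> \<omega>0 = (\<integral>\<^sup>+x. ennreal \<kappa> + (\<integral>\<^sup>+y. ennreal \<bar>x - y\<bar> \<partial>\<omega>0) / ennreal R \<partial>\<nu>)"
      unfolding energy2_def by (rule nn_integral_cong_AE) (use nD(3) in \<open>eventually_elim; simp add: inner\<close>)
    also have "\<dots> = ennreal \<kappa> + dist2 \<nu> \<omega>0 / ennreal R"
    proof -
      note [measurable] = out
      have div2: "(\<integral>\<^sup>+x. (\<integral>\<^sup>+y. ennreal \<bar>x - y\<bar> \<partial>\<omega>0) / ennreal R \<partial>\<nu>) = (\<integral>\<^sup>+x. \<integral>\<^sup>+y. ennreal \<bar>x - y\<bar> \<partial>\<omega>0 \<partial>\<nu>) / ennreal R"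
        by (rule nn_integral_divide) (rule out)
      show ?thesis unfolding dist2_def by (simp add: nn_integral_add div2 N.emeasure_space_1)
    qed
    finally show ?thesis .
  qed
  have ex: "\<exists>r\<ge>0. dist2 \<nu> \<nu>' = ennreal r" if "\<nu> = \<omega> \<or> \<nu> = \<omega>0" "\<nu>' = \<omega> \<or> \<nu>' = \<omega>0" for \<nu> \<nu>'
    using d2fin[OF that] by (cases "dist2 \<nu> \<nu>'") (auto simp: top_unique)
  obtain d11 where d11: "d11 \<ge> 0" "dist2 \<omega> \<omega> = ennreal d11" using ex[of \<omega> \<omega>] by blast
  obtain d10 where d10: "d10 \<ge> 0" "dist2 \<omega> \<omega>0 = ennreal d10" using ex[of \<omega> \<omega>0] by blast
  obtain d00 where d00: "d00 \<ge> 0" "dist2 \<omega>0 \<omega>0 = ennreal d00" using ex[of \<omega>0 \<omega>0] by blast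
  obtain n1 where n1: "n1 \<ge> 0" "neg \<omega> = ennreal n1" using neg_fin[of \<omega>] by (cases "neg \<omega>") auto
  obtain n0 where n0: "n0 \<ge> 0" "neg \<omega>0 = ennreal n0" using neg_fin[of \<omega>0] by (cases "neg \<omega>0") auto
  have l1: "ln R - 1 \<ge> 0" using lnR by linarith
  have e10: "energy2 R \<omega> \<omega>0 = ennreal (\<kappa> + d10 / R)" "energy2 R \<omega>0 \<omega>0 = ennreal (\<kappa> + d00 / R)"
    using mixed[of \<omega>] mixed[of \<omega>0] d10 d00 \<kappa> R by (simp_all add: divide_ennreal)
  have id0: "pos \<omega>0 + ennreal (d00 / R + (ln R - 1)) = ennreal (\<kappa> + d00 / R + n0)"
    using identity[of \<omega>0] d00 n0 e10 \<kappa> R l1 by (simp add: divide_ennreal)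
  then have "pos \<omega>0 \<noteq> \<top>" by auto
  then obtain p0 where p0: "p0 \<ge> 0" "pos \<omega>0 = ennreal p0" by (cases "pos \<omega>0") auto
  have "ennreal (p0 + (d00 / R + (ln R - 1))) = ennreal (\<kappa> + d00 / R + n0)"
    using id0 p0 d00 R l1 by simp
  then have p0eq: "p0 + (d00 / R + (ln R - 1)) = \<kappa> + d00 / R + n0"
    using p0 d00 R l1 n0 \<kappa> by (subst (asm) ennreal_inj) auto
  have le': "enn2ereal (pos \<omega>) - enn2ereal (neg \<omega>) \<le> enn2ereal (pos \<omega>0) - enn2ereal (neg \<omega>0)"
    using le unfolding log_energy_def pos_def neg_def .
  have "pos \<omega> \<noteq> \<top>"
  proof
    assume "pos \<omega> = \<top>"
    then show False using le' p0 n0 n1 by (simp add: top_ereal_def)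
  qed
  then obtain p1 where p1: "p1 \<ge> 0" "pos \<omega> = ennreal p1" by (cases "pos \<omega>") auto
  have p10: "p1 - n1 \<le> p0 - n0" using le' p1 p0 n0 n1 by simp
  have id1: "energy2 R \<omega> \<omega> + ennreal n1 = ennreal (p1 + (d11 / R + (ln R - 1)))"
    using identity[of \<omega>] d11 n1 p1 R l1 by (simp add: divide_ennreal)
  then have "energy2 R \<omega> \<omega> \<noteq> \<top>" by auto
  then obtain e11 where e11: "e11 \<ge> 0" "energy2 R \<omega> \<omega> = ennreal e11" by (cases "energy2 R \<omega> \<omega>") auto
  have "ennreal (e11 + n1) = ennreal (p1 + (d11 / R + (ln R - 1)))" using id1 e11 n1 by simp
  then have e11eq: "e11 + n1 = p1 + (d11 / R + (ln R - 1))"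
    using e11 n1 p1 d11 R l1 by (subst (asm) ennreal_inj) auto
  have "2 * energy2 R \<omega> \<omega>0 \<le> energy2 R \<omega> \<omega> + energy2 R \<omega>0 \<omega>0" by (rule energy2_amgm[OF D(2,3,6,7)])
  then have "ennreal (2 * (\<kappa> + d10 / R)) \<le> ennreal (e11 + (\<kappa> + d00 / R))"
  proof -
    have t: "2 * ennreal x = ennreal (2 * x)" if "x \<ge> 0" for x using that by (simp add: ennreal_mult)
    assume "2 * energy2 R \<omega> \<omega>0 \<le> energy2 R \<omega> \<omega> + energy2 R \<omega>0 \<omega>0"
    moreover have "\<kappa> + d10 / R \<ge> 0" "\<kappa> + d00 / R \<ge> 0" using \<kappa> d10 d00 R by auto
    ultimately show ?thesis unfolding e10 e11(2) t[OF \<open>\<kappa> + d10 / R \<ge> 0\<close>] ennreal_plus[OF e11(1) \<open>\<kappa> + d00 / R \<ge> 0\<close>] by simp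
  qed
  then have "2 * (\<kappa> + d10 / R) \<le> e11 + (\<kappa> + d00 / R)"
    by (rule ennreal_le_cancel_diff) (use \<kappa> d00 e11 R in auto)
  \<comment> \<open>Eliminating the energies leaves an inequality between mean distances. It is
    opposite to the one contained in \<open>dist2_parallelogram\<close>, and together they force the
    defect \<open>I\<close> to vanish.\<close>
  moreover have "2 * x10 \<le> x11 + x00"
    if "2 * (k + x10) \<le> e + (k + x00)" "e + n = p + (x11 + (l - 1))" "p' + (x00 + (l - 1)) = k + x00 + n'" "p - n \<le> p' - n'"
    for x10 x11 x00 k e n n' p p' l :: real
    using that by argo
  ultimately have "2 * (d10 / R) \<le> d11 / R + d00 / R" using e11eq p0eq p10 by blast
  then have dd: "2 * d10 \<le> d11 + d00" using R by (simp add: field_simps)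
  define I where "I = (\<integral>\<^sup>+w. ennreal ((cdf \<omega> w - cdf \<omega>0 w)\<^sup>2) \<partial>lborel)"
  have par: "ennreal d11 + ennreal d00 + 2 * I = 2 * ennreal d10"
    using dist2_parallelogram[OF D(1) D(5)] unfolding I_def d11 d00 d10 .
  have "I = 0"
  proof -
    have t: "2 * ennreal d10 = ennreal (2 * d10)" using d10 by (simp add: ennreal_mult)
    have "I \<noteq> \<top>"
    proof
      assume "I = \<top>"
      then show False using par unfolding t by (simp add: ennreal_mult_top)
    qed
    then obtain i where i: "i \<ge> 0" "I = ennreal i" by (cases I) auto
    have "ennreal (d11 + d00 + 2 * i) = ennreal (2 * d10)" using par i d11 d00 d10 by (simp add: ennreal_mult)
    then have "d11 + d00 + 2 * i = 2 * d10" using i d11 d00 d10 by (subst (asm) ennreal_inj) auto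
    then show ?thesis using dd i by simp
  qed
  then show ?thesis using cdf_L2_zero_imp_eq[OF D(1) D(5)] by (simp add: I_def)
qed

section \<open>The logarithmic potential of the arcsine law\<close>

text \<open>Two measures are compared: the one with density \<open>\<bar>g' x\<bar>\<close> on
  \<open>P\<close>, and the image, under the inverse of \<open>g\<close>, of Lebesgue measure on the
  range. They agree because both assign to a Borel subset of \<open>P\<close> the length of its
  image. The inverse is set to 0 off the range in order to be Borel on the whole line.\<close>

lemma nn_integral_injective_substitution:
  fixes g g' :: "real \<Rightarrow> real" and h :: "real \<Rightarrow> ennreal"
  assumes P: "open P" and inj: "inj_on g P" and der: "\<And>x. x \<in> P \<Longrightarrow> (g has_real_derivative g' x) (at x)"
    and bd: "bounded (g ` P)" and g'm: "(\<lambda>x. ennreal \<bar>g' x\<bar> * indicator P x) \<in> borel_measurable borel"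
    and h: "h \<in> borel_measurable borel"
  obtains k where "\<And>x. x \<in> P \<Longrightarrow> k (g x) = x" "(\<lambda>t. h (k t) * indicator (g ` P) t) \<in> borel_measurable borel"
    "(\<integral>\<^sup>+x. (ennreal \<bar>g' x\<bar> * indicator P x) * h x \<partial>lborel) = (\<integral>\<^sup>+t. h (k t) * indicator (g ` P) t \<partial>lborel)"
proof -
  have cg: "continuous_on P g" by (rule DERIV_continuous_on) (rule has_field_derivative_at_within[OF der])
  obtain k0 where "homeomorphism P (g ` P) g k0"
    by (rule invariance_of_domain_homeomorphism[OF P cg _ inj]) simp_all
  then have k0: "continuous_on (g ` P) k0" "\<And>x. x \<in> P \<Longrightarrow> k0 (g x) = x" by (auto simp: homeomorphism_def)
  define Q where "Q = g ` P"
  have oQ: "open Q" unfolding Q_def by (rule invariance_of_domain[OF cg P inj])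
  have [measurable]: "Q \<in> sets borel" using oQ by simp
  define k where "k t = indicator Q t * k0 t" for t
  have [measurable]: "k \<in> borel_measurable borel"
    using borel_measurable_continuous_on_indicator[OF _ k0(1)[folded Q_def]] by (simp add: k_def[abs_def])
  have kg: "k (g x) = x" if "x \<in> P" for x using that k0(2) by (simp add: k_def Q_def)
  define M1 where "M1 = density lborel (\<lambda>x. ennreal \<bar>g' x\<bar> * indicator P x)"
  define M2 where "M2 = distr (density lborel (indicator Q)) borel k"
  note [measurable] = g'm h
  have "M1 = M2"
  proof (rule measure_eqI)
    show "sets M1 = sets M2" by (simp add: M1_def M2_def)
    fix A assume "A \<in> sets M1"
    then have A [measurable]: "A \<in> sets borel" by (simp add: M1_def)
    define S where "S = A \<inter> P"
    have Sb [measurable]: "S \<in> sets borel" using P by (simp add: S_def)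
    have img: "g ` S = k -` A \<inter> Q" unfolding S_def Q_def using kg by auto
    have gSb: "g ` S \<in> sets borel" unfolding img using measurable_sets[of k borel borel A] by simp
    have gSl: "g ` S \<in> lmeasurable"
      by (rule bounded_set_imp_lmeasurable[OF bounded_subset[OF bd]]) (use gSb in \<open>auto simp: S_def\<close>)
    have "(\<lambda>x. \<bar>g' x\<bar> * 1) absolutely_integrable_on S \<and> integral S (\<lambda>x. \<bar>g' x\<bar> * 1) = measure lebesgue (g ` S)"
    proof (subst has_absolute_integral_change_of_variables_1'[where f="\<lambda>_. 1" and g=g])
      show "S \<in> sets lebesgue" using Sb by simp
      show "(g has_real_derivative g' x) (at x within S)" if "x \<in> S" for x
        using der that by (auto simp: S_def intro: has_field_derivative_at_within)
      show "inj_on g S" using inj by (rule inj_on_subset) (auto simp: S_def)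
      show "(\<lambda>_. 1::real) absolutely_integrable_on g ` S \<and> integral (g ` S) (\<lambda>_. 1) = measure lebesgue (g ` S)"
        using gSl by (simp add: lmeasure_integral absolutely_integrable_on_const)
    qed
    then have "((\<lambda>x. \<bar>g' x\<bar>) has_integral measure lebesgue (g ` S)) S"
      by (simp add: has_integral_iff set_lebesgue_integral_eq_integral(1))
    from nn_integral_has_integral_lebesgue'[OF _ this]
    have "(\<integral>\<^sup>+x. ennreal \<bar>g' x\<bar> * indicator S x \<partial>lborel) = ennreal (measure lebesgue (g ` S))" by simp
    also have "\<dots> = emeasure lebesgue (g ` S)" using gSl by (simp add: emeasure_eq_measure2)
    also have "\<dots> = emeasure lborel (g ` S)" using gSb by simp
    finally have e: "(\<integral>\<^sup>+x. ennreal \<bar>g' x\<bar> * indicator S x \<partial>lborel) = emeasure lborel (g ` S)" .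
    have "emeasure M1 A = (\<integral>\<^sup>+x. ennreal \<bar>g' x\<bar> * indicator P x * indicator A x \<partial>lborel)"
      unfolding M1_def by (rule emeasure_density) measurable
    also have "\<dots> = (\<integral>\<^sup>+x. ennreal \<bar>g' x\<bar> * indicator S x \<partial>lborel)"
      by (intro nn_integral_cong) (auto simp: S_def indicator_def)
    finally have e1: "emeasure M1 A = emeasure lborel (g ` S)" unfolding e .
    have "emeasure M2 A = emeasure (density lborel (indicator Q)) (k -` A \<inter> space lborel)"
      unfolding M2_def by (subst emeasure_distr) auto
    also have "\<dots> = (\<integral>\<^sup>+x. indicator Q x * indicator (k -` A) x \<partial>lborel)"
      by (subst emeasure_density) (use measurable_sets[of k borel borel A] in auto)
    also have "\<dots> = (\<integral>\<^sup>+x. indicator (g ` S) x \<partial>lborel)"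
      by (intro nn_integral_cong) (auto simp: img indicator_def)
    also have "\<dots> = emeasure lborel (g ` S)" using gSb by simp
    finally show "emeasure M1 A = emeasure M2 A" unfolding e1 by simp
  qed
  then have "(\<integral>\<^sup>+x. h x \<partial>M1) = (\<integral>\<^sup>+x. h x \<partial>M2)" by simp
  moreover have "(\<integral>\<^sup>+x. h x \<partial>M1) = (\<integral>\<^sup>+x. (ennreal \<bar>g' x\<bar> * indicator P x) * h x \<partial>lborel)"
    unfolding M1_def by (rule nn_integral_density) measurable
  moreover have "(\<integral>\<^sup>+x. h x \<partial>M2) = (\<integral>\<^sup>+t. indicator Q t * h (k t) \<partial>lborel)"
    unfolding M2_def by (subst nn_integral_distr, measurable) (subst nn_integral_density, auto)
  ultimately have "(\<integral>\<^sup>+x. (ennreal \<bar>g' x\<bar> * indicator P x) * h x \<partial>lborel) = (\<integral>\<^sup>+t. h (k t) * indicator (g ` P) t \<partial>lborel)"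
    by (simp add: Q_def mult.commute)
  moreover have "(\<lambda>t. h (k t) * indicator (g ` P) t) \<in> borel_measurable borel" unfolding Q_def[symmetric] by measurable
  ultimately show ?thesis using that kg by blast
qed

text \<open>The shift by \<open>ln 2\<close> makes the function nonnegative, so that its integrals
  can be split and moved before their finiteness is known.\<close>

definition lsin :: "real \<Rightarrow> real" where "lsin u = ln 2 - ln \<bar>2 * sin (u / 2)\<bar>"

lemma lsin_nonneg: "lsin u \<ge> 0"
proof (cases "sin (u / 2) = 0")
  case False
  then have "ln \<bar>2 * sin (u / 2)\<bar> \<le> ln 2" by (subst ln_le_cancel_iff) (auto simp: abs_mult)
  then show ?thesis by (simp add: lsin_def)
qed (simp add: lsin_def)

lemma lsin_measurable [measurable]: "lsin \<in> borel_measurable borel"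
  unfolding lsin_def[abs_def] by measurable

lemma lsin_minus: "lsin (- u) = lsin u" by (simp add: lsin_def)

lemma lsin_periodic: "lsin (u + 2 * pi) = lsin u"
  by (simp add: lsin_def add_divide_distrib)

lemma two_cos_diff:
  assumes "cos s \<noteq> cos t"
  shows "ln \<bar>2 * cos s - 2 * cos t\<bar> = 2 * ln 2 - lsin (t - s) - lsin (t + s)"
proof -
  have e: "2 * cos s - 2 * cos t = (2 * sin ((t - s) / 2)) * (2 * sin ((t + s) / 2))"
    by (simp only: right_diff_distrib[symmetric] cos_diff_cos) (simp add: add.commute)
  have "2 * sin ((t - s) / 2) \<noteq> 0" "2 * sin ((t + s) / 2) \<noteq> 0" using assms e by auto
  then show ?thesis unfolding e abs_mult[of "2 * sin ((t - s) / 2)"] lsin_def by (subst ln_mult) auto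
qed

text \<open>Half-open intervals concatenate without overlap.\<close>

definition lsin_int :: "real \<Rightarrow> real \<Rightarrow> ennreal" where
  "lsin_int a b = (\<integral>\<^sup>+u. ennreal (lsin u) * indicator {a<..b} u \<partial>lborel)"

lemma lsin_int_add: "a \<le> b \<Longrightarrow> b \<le> c \<Longrightarrow> lsin_int a c = lsin_int a b + lsin_int b c"
  unfolding lsin_int_def
  by (subst nn_integral_add[symmetric], measurable, rule nn_integral_cong) (auto simp: indicator_def)

lemma lsin_int_shift: "(\<integral>\<^sup>+u. ennreal (lsin (u + s)) * indicator {a<..b} u \<partial>lborel) = lsin_int (a + s) (b + s)"
  unfolding lsin_int_def
  by (subst nn_integral_real_affine[where c=1 and t=s and f="\<lambda>u. ennreal (lsin u) * indicator {a + s<..b + s} u"])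
     (auto intro!: nn_integral_cong simp: indicator_def add.commute)

lemma lsin_int_period: "lsin_int (a + 2 * pi) (b + 2 * pi) = lsin_int a b"
  unfolding lsin_int_shift[symmetric] lsin_periodic by (simp add: lsin_int_def)

lemma lsin_int_reflect: "lsin_int (- b) (- a) = lsin_int a b"
proof -
  have "lsin_int a b = (\<integral>\<^sup>+u. ennreal (lsin (- u)) * indicator {a<..b} (- u) \<partial>lborel)"
    unfolding lsin_int_def
    by (subst nn_integral_real_affine[where c="-1" and t=0 and f="\<lambda>u. ennreal (lsin u) * indicator {a<..b} u"]) auto
  also have "\<dots> = lsin_int (- b) (- a)" unfolding lsin_int_def lsin_minus
  proof (rule nn_integral_cong_AE)
    have "AE u in lborel. u \<noteq> - a" "AE u in lborel. u \<noteq> - b" by (rule AE_lborel_singleton)+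
    then show "AE u in lborel. ennreal (lsin u) * indicator {a<..b} (- u) = ennreal (lsin u) * indicator {- b<..- a} u"
      by eventually_elim (auto simp: indicator_def)
  qed
  finally show ?thesis ..
qed

text \<open>The substitution \<open>u = \<theta> \<plusminus> \<phi>\<close> turns the integral into one over a full period.\<close>

lemma lsin_sum_integral:
  assumes "0 \<le> \<phi>" "\<phi> \<le> pi"
  shows "(\<integral>\<^sup>+\<theta>. ennreal (lsin (\<theta> - \<phi>) + lsin (\<theta> + \<phi>)) * indicator {0<..pi} \<theta> \<partial>lborel) = lsin_int (- pi) pi"
proof -
  have "(\<integral>\<^sup>+\<theta>. ennreal (lsin (\<theta> - \<phi>) + lsin (\<theta> + \<phi>)) * indicator {0<..pi} \<theta> \<partial>lborel)
    = (\<integral>\<^sup>+\<theta>. (ennreal (lsin (\<theta> + (- \<phi>))) * indicator {0<..pi} \<theta> + ennreal (lsin (\<theta> + \<phi>)) * indicator {0<..pi} \<theta>) \<partial>lborel)"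
    by (intro nn_integral_cong) (simp add: ennreal_plus[OF lsin_nonneg lsin_nonneg] distrib_right del: ennreal_plus)
  also have "\<dots> = lsin_int (- \<phi>) (pi - \<phi>) + lsin_int \<phi> (\<phi> + pi)"
    by (subst nn_integral_add, measurable) (simp only: lsin_int_shift, simp add: add.commute)
  also have "lsin_int (- \<phi>) (pi - \<phi>) = lsin_int (\<phi> - pi) \<phi>" using lsin_int_reflect[of "pi - \<phi>" "- \<phi>"] by simp
  also have "lsin_int (\<phi> - pi) \<phi> + lsin_int \<phi> (\<phi> + pi) = lsin_int (\<phi> - pi) (\<phi> + pi)" by (rule lsin_int_add[symmetric]) (use pi_ge_zero in auto)
  also have "\<dots> = lsin_int (\<phi> - pi) pi + lsin_int pi (\<phi> + pi)" by (rule lsin_int_add) (use assms in auto)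
  also have "lsin_int pi (\<phi> + pi) = lsin_int (- pi) (\<phi> - pi)" using lsin_int_period[of "- pi" "\<phi> - pi"] by (simp add: add.commute)
  also have "lsin_int (\<phi> - pi) pi + lsin_int (- pi) (\<phi> - pi) = lsin_int (- pi) pi"
    using lsin_int_add[of "- pi" "\<phi> - pi" pi] assms by (simp add: add.commute)
  finally show ?thesis .
qed

lemma lsin_int_finite: "lsin_int (- pi) pi < \<infinity>"
proof -
  have *: "lsin_int 0 pi < \<infinity>"
  proof -
    have i: "(\<lambda>x::real. x powr (- 1 / 2)) integrable_on {0..pi}" by (rule integrable_on_powr_from_0) auto
    obtain v where "((\<lambda>x::real. 2 + 2 * x powr (- 1 / 2)) has_integral v) {0..pi}"
      using integrable_add[OF integrable_const_ivl[of 2 0 pi] integrable_on_cmult_left[OF i, of 2]] by (auto simp: integrable_on_def)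
    from nn_integral_has_integral_lebesgue'[OF _ this]
    have v: "(\<integral>\<^sup>+x. ennreal (2 + 2 * x powr (- 1 / 2)) * indicator {0..pi} x \<partial>lborel) = ennreal v" by simp
    have "lsin_int 0 pi \<le> (\<integral>\<^sup>+x. ennreal (2 + 2 * x powr (- 1 / 2)) * indicator {0..pi} x \<partial>lborel)"
      unfolding lsin_int_def
    proof (rule nn_integral_mono)
      fix u
      have "lsin u \<le> 2 + 2 * u powr (- 1 / 2)" if u: "0 < u" "u \<le> pi"
      proof -
        \<comment> \<open>By concavity the sine lies above its chord from 0 to
          \<open>pi / 2\<close>.\<close>
        have sn: "sin (u / 2) \<ge> u / pi"
        proof -
          have "concave_on {0..pi} sin"
            by (rule f''_le0_imp_concave[where f'=cos and f''="\<lambda>x. - sin x"]) (auto intro!: derivative_eq_intros sin_ge_zero)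
          then have "(1 - u / pi) * sin 0 + u / pi * sin (pi / 2) \<le> sin ((1 - u / pi) *\<^sub>R 0 + (u / pi) *\<^sub>R (pi / 2))"
            by (rule concave_onD) (use u in auto)
          then show ?thesis by simp
        qed
        \<comment> \<open>The inverse square root of \<open>u\<close>. Applying
          \<open>ln s \<le> s - 1\<close> to it trades the logarithmic singularity for an integrable
          power.\<close>
        define s where "s = u powr (- 1 / 2)"
        have "ln s \<le> s - 1" using u by (intro ln_le_minus_one) (simp add: s_def)
        moreover have "ln s = - (1 / 2) * ln u" using u by (simp add: s_def ln_powr)
        ultimately have lu: "- ln u \<le> 2 * s - 2" by simp
        have "ln (2 * (u / pi)) \<le> ln \<bar>2 * sin (u / 2)\<bar>"
        proof (subst ln_le_cancel_iff)
          have up: "u / pi > 0" using u by simp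
          show "0 < 2 * (u / pi)" using up by simp
          show "0 < \<bar>2 * sin (u / 2)\<bar>" "2 * (u / pi) \<le> \<bar>2 * sin (u / 2)\<bar>" using sn up by linarith+
        qed
        moreover have "ln (2 * (u / pi)) = ln 2 + ln u - ln pi" using u by (simp add: ln_mult ln_div)
        moreover have "ln pi \<le> pi - 1" by (intro ln_le_minus_one) simp
        ultimately show ?thesis using lu pi_less_4 unfolding lsin_def s_def[symmetric] by simp
      qed
      then show "ennreal (lsin u) * indicator {0<..pi} u \<le> ennreal (2 + 2 * u powr (- 1 / 2)) * indicator {0..pi} u"
        by (cases "u \<in> {0<..pi}") (simp_all add: ennreal_leI del: ennreal_plus)
    qed
    then show ?thesis unfolding v by (simp add: order.strict_trans1)
  qed
  have "lsin_int (- pi) pi = lsin_int (- pi) 0 + lsin_int 0 pi" by (rule lsin_int_add) auto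
  also have "lsin_int (- pi) 0 = lsin_int 0 pi" using lsin_int_reflect[of pi 0] by (simp add: lsin_int_reflect[of 0 pi, symmetric])
  finally show ?thesis using * by (simp add: ennreal_add_less_top)
qed

section \<open>The discriminant of the periodic problem\<close>

text \<open>The recurrence of \<open>per_sol\<close> over an arbitrary field: reality of the roots
  of the trace is proved with complex arguments. The polynomial version \<open>per_poly\<close>
  supplies degrees and derivatives.\<close>

definition per_gen :: "(int \<Rightarrow> real) \<Rightarrow> (int \<Rightarrow> real) \<Rightarrow> 'a \<Rightarrow> 'a \<Rightarrow> nat \<Rightarrow> 'a \<Rightarrow> 'a::real_normed_field" where
  "per_gen \<alpha> \<beta> c d j z =
     rsol (\<lambda>j. of_real (\<alpha> (int j - 1) / \<alpha> (int j))) (\<lambda>j. (z - of_real (\<beta> (int j))) / of_real (\<alpha> (int j))) c d j"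

definition per_poly :: "(int \<Rightarrow> real) \<Rightarrow> (int \<Rightarrow> real) \<Rightarrow> 'a \<Rightarrow> 'a \<Rightarrow> nat \<Rightarrow> 'a::real_normed_field poly" where
  "per_poly \<alpha> \<beta> c d j =
     rsol (\<lambda>j. [:of_real (\<alpha> (int j - 1) / \<alpha> (int j)):])
       (\<lambda>j. [:- of_real (\<beta> (int j)) / of_real (\<alpha> (int j)), 1 / of_real (\<alpha> (int j)):]) [:c:] [:d:] j"

lemma poly_per_poly: "poly (per_poly \<alpha> \<beta> c d j) z = per_gen \<alpha> \<beta> c d j z"
  unfolding per_poly_def per_gen_def
  by (induction j rule: induct_nat_012) (simp_all add: diff_divide_distrib left_diff_distrib)

lemma per_gen_of_real: "per_gen \<alpha> \<beta> (of_real c) (of_real d) j (of_real x) = of_real (per_sol \<alpha> \<beta> c d j x)"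
  unfolding per_gen_def per_sol_def by (induction j rule: induct_nat_012) simp_all

lemma per_gen_real: "per_gen \<alpha> \<beta> c d j (x::real) = per_sol \<alpha> \<beta> c d j x"
  by (simp add: per_gen_def per_sol_def)

lemma degree_per_poly:
  "degree (per_poly \<alpha> \<beta> 1 0 n :: 'a::real_normed_field poly) \<le> n - 1"
  "degree (per_poly \<alpha> \<beta> 0 1 (Suc n) :: 'a poly) \<le> n"
  "coeff (per_poly \<alpha> \<beta> 0 1 (Suc n) :: 'a poly) n = of_real (\<Prod>j<n. 1 / \<alpha> (int j))"
proof -
  let ?r = "\<lambda>j. [:of_real (\<alpha> (int j - 1) / \<alpha> (int j)):] :: 'a poly"
  let ?t = "\<lambda>j. [:- of_real (\<beta> (int j)) / of_real (\<alpha> (int j)), 1 / of_real (\<alpha> (int j)):] :: 'a poly"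
  have st: "degree (?t j * p - ?r j * q) \<le> Suc m" if "degree p \<le> m" "degree q \<le> m" for j m p q
  proof (rule degree_diff_le)
    have "degree (?t j * p) \<le> degree (?t j) + degree p" by (rule degree_mult_le)
    also have "degree (?t j) \<le> 1" by simp
    finally show "degree (?t j * p) \<le> Suc m" using that by simp
    have "degree (?r j * q) \<le> degree (?r j) + degree q" by (rule degree_mult_le)
    then show "degree (?r j * q) \<le> Suc m" using that by simp
  qed
  show "degree (per_poly \<alpha> \<beta> 1 0 n :: 'a poly) \<le> n - 1"
    unfolding per_poly_def
  proof (induction n rule: induct_nat_012)
    case (ge2 n)
    show ?case using st[OF order_trans[OF ge2(2)] order_trans[OF ge2(1)], of n n] by simp
  qed simp_all
  have *: "degree (per_poly \<alpha> \<beta> 0 1 (Suc n) :: 'a poly) \<le> n \<and> degree (per_poly \<alpha> \<beta> 0 1 n :: 'a poly) \<le> n" for n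
    unfolding per_poly_def
  proof (induction n)
    case (Suc n)
    then show ?case using st[of "rsol ?r ?t [:0:] [:1:] (Suc n)" n "rsol ?r ?t [:0:] [:1:] n" n] by simp
  qed simp
  then show "degree (per_poly \<alpha> \<beta> 0 1 (Suc n) :: 'a poly) \<le> n" by blast
  show "coeff (per_poly \<alpha> \<beta> 0 1 (Suc n) :: 'a poly) n = of_real (\<Prod>j<n. 1 / \<alpha> (int j))"
  proof (induction n)
    case (Suc n)
    have "coeff (per_poly \<alpha> \<beta> 0 1 n :: 'a poly) (Suc n) = 0" "coeff (per_poly \<alpha> \<beta> 0 1 (Suc n) :: 'a poly) (Suc n) = 0"
      using *[of n] by (auto intro!: coeff_eq_0)
    then show ?case using Suc by (simp add: per_poly_def mult.commute)
  qed (simp add: per_poly_def)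
qed

lemma per_gen_comb: "per_gen \<alpha> \<beta> c d j z = c * per_gen \<alpha> \<beta> 1 0 j z + d * per_gen \<alpha> \<beta> 0 1 j z"
  unfolding per_gen_def by (rule rsol_linear)

locale periodic_jacobi =
  fixes N :: nat and \<alpha> \<beta> :: "int \<Rightarrow> real"
  assumes N1: "N \<ge> 1" and per: "\<And>n. \<alpha> (n + int N) = \<alpha> n" and al: "\<And>n. \<alpha> n > 0"
begin

abbreviation "c0 j z \<equiv> per_gen \<alpha> \<beta> 1 0 j z"
abbreviation "d0 j z \<equiv> per_gen \<alpha> \<beta> 0 1 j z"

lemma alN: "\<alpha> (int N - 1) = \<alpha> (-1)" using per[of "-1"] by (simp add: add.commute)

lemma al_nz: "\<alpha> n \<noteq> 0" using al[of n] by simp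

lemma per_gen_rec: "of_real (\<alpha> (int j)) * per_gen \<alpha> \<beta> c d (Suc (Suc j)) z
   = (z - of_real (\<beta> (int j))) * per_gen \<alpha> \<beta> c d (Suc j) z - of_real (\<alpha> (int j - 1)) * per_gen \<alpha> \<beta> c d j z"
  using al_nz[of "int j"] by (simp add: per_gen_def right_diff_distrib)

lemma pderiv_rec: "of_real (\<alpha> (int j)) * poly (pderiv (per_poly \<alpha> \<beta> c d (Suc (Suc j)))) z
   = per_gen \<alpha> \<beta> c d (Suc j) z + (z - of_real (\<beta> (int j))) * poly (pderiv (per_poly \<alpha> \<beta> c d (Suc j))) z
     - of_real (\<alpha> (int j - 1)) * poly (pderiv (per_poly \<alpha> \<beta> c d j)) z"
  using al_nz[of "int j"] unfolding poly_per_poly[symmetric]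
  by (simp add: per_poly_def pderiv_diff pderiv_mult pderiv_pCons pderiv_smult) (simp add: field_simps)

lemma wronskian_N: "c0 N z * d0 (Suc N) z - c0 (Suc N) z * d0 N z = 1"
proof -
  have "(\<Prod>j<n. \<alpha> (int j - 1) / \<alpha> (int j)) = \<alpha> (-1) / \<alpha> (int n - 1)" for n
  proof (induction n)
    case (Suc n)
    then show ?case using al_nz[of "int n - 1"] by simp
  qed (simp add: al_nz)
  then have "(\<Prod>j<N. \<alpha> (int j - 1) / \<alpha> (int j)) = 1" by (simp add: alN al_nz)
  then show ?thesis unfolding per_gen_def rsol_wronskian of_real_prod[symmetric] by simp
qed

text \<open>The Wronskian of a solution with the \<open>x\<close>-derivative of another one.\<close>

lemma pderiv_wronskian:
  "of_real (\<alpha> (int j - 1)) * (poly (pderiv (per_poly \<alpha> \<beta> u0 u1 (Suc j))) z * per_gen \<alpha> \<beta> v0 v1 j z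
     - poly (pderiv (per_poly \<alpha> \<beta> u0 u1 j)) z * per_gen \<alpha> \<beta> v0 v1 (Suc j) z)
   = (\<Sum>i<j. per_gen \<alpha> \<beta> u0 u1 (Suc i) z * per_gen \<alpha> \<beta> v0 v1 (Suc i) z)"
proof (induction j)
  case 0
  show ?case by (simp add: per_poly_def pderiv_pCons)
next
  case (Suc j)
  define U U' V where "U = (\<lambda>j. per_gen \<alpha> \<beta> u0 u1 j z)" "U' = (\<lambda>j. poly (pderiv (per_poly \<alpha> \<beta> u0 u1 j)) z)" "V = (\<lambda>j. per_gen \<alpha> \<beta> v0 v1 j z)"
  have "of_real (\<alpha> (int (Suc j) - 1)) * (U' (Suc (Suc j)) * V (Suc j) - U' (Suc j) * V (Suc (Suc j)))
    = (of_real (\<alpha> (int j)) * U' (Suc (Suc j))) * V (Suc j) - U' (Suc j) * (of_real (\<alpha> (int j)) * V (Suc (Suc j)))"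
    by (simp add: algebra_simps)
  also have "\<dots> = U (Suc j) * V (Suc j) + of_real (\<alpha> (int j - 1)) * (U' (Suc j) * V j - U' j * V (Suc j))"
    unfolding U_U'_V_def pderiv_rec per_gen_rec by (simp add: algebra_simps)
  finally show ?case using Suc unfolding U_U'_V_def by simp
qed

text \<open>The discriminant of the periodic problem: the trace of the monodromy matrix as a
  polynomial in the spectral parameter.\<close>

definition TP :: "'a::real_normed_field poly" where "TP = per_poly \<alpha> \<beta> 1 0 N + per_poly \<alpha> \<beta> 0 1 (Suc N)"

definition lead :: real where "lead = (\<Prod>j<N. 1 / \<alpha> (int j))"

lemma lead_pos: "lead > 0" unfolding lead_def by (intro prod_pos) (simp add: al)

lemma poly_TP: "poly TP z = c0 N z + d0 (Suc N) z" by (simp add: TP_def poly_per_poly)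

lemma TP_degree: "degree (TP :: 'a::real_normed_field poly) = N" "coeff (TP :: 'a poly) N = of_real lead"
proof -
  have "coeff (per_poly \<alpha> \<beta> 1 0 N :: 'a poly) N = 0"
    by (rule coeff_eq_0) (use degree_per_poly(1)[of \<alpha> \<beta> N] N1 in \<open>auto intro: le_less_trans\<close>)
  then show co: "coeff (TP :: 'a poly) N = of_real lead" unfolding TP_def by (simp add: degree_per_poly(3) lead_def)
  have "degree (TP :: 'a poly) \<le> N" unfolding TP_def
    by (rule degree_add_le) (use degree_per_poly(1)[of \<alpha> \<beta> N, where 'a='a] degree_per_poly(2)[of \<alpha> \<beta> N, where 'a='a] in auto)
  moreover have "N \<le> degree (TP :: 'a poly)" by (rule le_degree) (use co lead_pos in simp)
  ultimately show "degree (TP :: 'a poly) = N" by simp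
qed

text \<open>Four instances of \<open>pderiv_wronskian\<close> over one period form a linear system
  for the derivatives of the diagonal entries, and the unit determinant solves it. The sum is the
  quadratic form of the monodromy matrix along the fundamental solutions, the same form that
  determines \<open>Gam\<close>; this links the equilibrium density with \<open>kap\<close>.\<close>

lemma pderiv_TP:
  fixes z :: "'a::real_normed_field"
  shows "of_real (\<alpha> (-1)) * poly (pderiv TP) z = (\<Sum>i<N. d0 N z * (c0 (Suc i) z)\<^sup>2
     + (d0 (Suc N) z - c0 N z) * (c0 (Suc i) z * d0 (Suc i) z) - c0 (Suc N) z * (d0 (Suc i) z)\<^sup>2)"
proof -
  define p q r s A where "p = c0 N z" "q = d0 N z" "r = c0 (Suc N) z" "s = d0 (Suc N) z" "A = (of_real (\<alpha> (-1)) :: 'a)"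
  define c' c1' where "c' = poly (pderiv (per_poly \<alpha> \<beta> 1 0 N)) z" "c1' = poly (pderiv (per_poly \<alpha> \<beta> 1 0 (Suc N))) z"
  define d' d1' where "d' = poly (pderiv (per_poly \<alpha> \<beta> 0 1 N)) z" "d1' = poly (pderiv (per_poly \<alpha> \<beta> 0 1 (Suc N))) z"
  define cc cd dd where "cc = (\<Sum>i<N. (c0 (Suc i) z)\<^sup>2)" "cd = (\<Sum>i<N. c0 (Suc i) z * d0 (Suc i) z)" "dd = (\<Sum>i<N. (d0 (Suc i) z)\<^sup>2)"
  note defs = p_q_r_s_A_def c'_c1'_def d'_d1'_def cc_cd_dd_def
  have det: "p * s - r * q = 1" unfolding defs by (rule wronskian_N)
  have e: "A * (c1' * p - c' * r) = cc" "A * (c1' * q - c' * s) = cd" "A * (d1' * p - d' * r) = cd" "A * (d1' * q - d' * s) = dd"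
    using pderiv_wronskian[of N 1 0 z 1 0] pderiv_wronskian[of N 1 0 z 0 1] pderiv_wronskian[of N 0 1 z 1 0] pderiv_wronskian[of N 0 1 z 0 1]
    unfolding alN defs by (simp_all add: power2_eq_square mult.commute)
  have "A * c' * (p * s - r * q) = q * cc - p * cd" unfolding e(1,2)[symmetric] by (simp add: algebra_simps)
  moreover have "A * d1' * (p * s - r * q) = s * cd - r * dd" unfolding e(3,4)[symmetric] by (simp add: algebra_simps)
  ultimately have "A * c' = q * cc - p * cd" "A * d1' = s * cd - r * dd" unfolding det mult_1_right by this+
  then have "A * (c' + d1') = q * cc + (s - p) * cd - r * dd" by (simp add: algebra_simps)
  also have "\<dots> = (\<Sum>i<N. q * (c0 (Suc i) z)\<^sup>2 + (s - p) * (c0 (Suc i) z * d0 (Suc i) z) - r * (d0 (Suc i) z)\<^sup>2)"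
    unfolding cc_cd_dd_def by (simp only: sum.distrib sum_subtractf sum_distrib_left)
  finally show ?thesis unfolding defs TP_def by (simp add: pderiv_add)
qed

definition Tr :: "real \<Rightarrow> real" where "Tr = poly TP"

lemma c0_of_real: "c0 j (of_real x) = of_real (c0 j x)" and d0_of_real: "d0 j (of_real x) = of_real (d0 j x)"
  using per_gen_of_real[of \<alpha> \<beta> 1 0 j x] per_gen_of_real[of \<alpha> \<beta> 0 1 j x] by (simp_all add: per_gen_real)

lemma TP_of_real: "poly TP (of_real x) = of_real (Tr x)"
  unfolding Tr_def poly_TP c0_of_real d0_of_real by simp

lemma pderiv_TP_of_real: "poly (pderiv TP) (of_real x) = of_real (poly (pderiv TP) x)"
proof -
  have "of_real (\<alpha> (-1)) * poly (pderiv TP) (of_real x) = of_real (\<alpha> (-1) * poly (pderiv TP) x)"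
    unfolding pderiv_TP c0_of_real d0_of_real using pderiv_TP[of x] by simp
  then show ?thesis using al_nz[of "-1"] by simp
qed

lemma elliptic_square:
  fixes p q r s c d :: real
  assumes "p * s - r * q = 1"
  shows "q * (q * c\<^sup>2 + (s - p) * (c * d) - r * d\<^sup>2) = (q * c + (s - p) / 2 * d)\<^sup>2 + d\<^sup>2 * ((4 - (p + s)\<^sup>2) / 4)"
proof -
  have r: "r * q = p * s - 1" using assms by simp
  have "q * (q * c\<^sup>2 + (s - p) * (c * d) - r * d\<^sup>2) = q\<^sup>2 * c\<^sup>2 + (s - p) * q * c * d - (r * q) * d\<^sup>2"
    by (simp add: power2_eq_square algebra_simps)
  then show ?thesis unfolding r by (simp add: power2_eq_square field_simps)
qed

text \<open>Multiplied by \<open>q\<close>, every summand of \<open>pderiv_TP\<close> is a square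
  plus a positive multiple of a square as long as the trace lies strictly between -2 and 2. The
  summand with \<open>i = 0\<close> is strictly positive because the second solution equals 1
  there.\<close>

lemma pderiv_TP_nz:
  assumes "\<bar>Tr x\<bar> < 2"
  shows "poly (pderiv TP) x \<noteq> 0"
proof
  assume z: "poly (pderiv TP) x = 0"
  define p q r s where "p = c0 N x" "q = d0 N x" "r = c0 (Suc N) x" "s = d0 (Suc N) x"
  have det: "p * s - r * q = 1" unfolding p_q_r_s_def by (rule wronskian_N)
  have tr: "(p + s)\<^sup>2 < 4" using assms abs_square_less_1[of "(p + s) / 2"] unfolding Tr_def poly_TP p_q_r_s_def[symmetric] by (simp add: power_divide)
  define S where "S i = q * (c0 (Suc i) x)\<^sup>2 + (s - p) * (c0 (Suc i) x * d0 (Suc i) x) - r * (d0 (Suc i) x)\<^sup>2" for i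
  have S: "q * S i = (q * c0 (Suc i) x + (s - p) / 2 * d0 (Suc i) x)\<^sup>2 + (d0 (Suc i) x)\<^sup>2 * ((4 - (p + s)\<^sup>2) / 4)" for i
    unfolding S_def by (rule elliptic_square[OF det])
  have "q * S 0 \<le> (\<Sum>i<N. q * S i)" by (rule member_le_sum) (use N1 S tr in auto)
  also have "\<dots> = q * (\<alpha> (-1) * poly (pderiv TP) x)"
    using pderiv_TP[of x] unfolding p_q_r_s_def[symmetric] S_def[symmetric] by (simp add: sum_distrib_left)
  also have "\<dots> = 0" using z by simp
  finally have "q * S 0 \<le> 0" .
  moreover have "d0 (Suc 0) x = 1" by (simp add: per_gen_def)
  then have "q * S 0 > 0" unfolding S using tr by (intro add_nonneg_pos) auto
  ultimately show False by simp
qed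

lemma singular_kernel:
  fixes p q r s l :: complex
  assumes "(p - l) * (s - l) = q * r"
  obtains u v where "(u, v) \<noteq> (0, 0)" "(p - l) * u + q * v = 0" "r * u + (s - l) * v = 0"
proof (cases "q = 0 \<and> p - l = 0")
  case True
  show ?thesis
  proof (cases "r = 0 \<and> s - l = 0")
    case True
    then show ?thesis using that[of 1 0] \<open>q = 0 \<and> p - l = 0\<close> by simp
  next
    case False
    then show ?thesis using that[of "l - s" r] \<open>q = 0 \<and> p - l = 0\<close> by (auto simp: algebra_simps)
  qed
next
  case False
  then show ?thesis using that[of q "l - p"] assms by (auto simp: algebra_simps)
qed

text \<open>For \<open>\<bar>t\<bar> < 2\<close> the monodromy matrix has an eigenvalue of modulus 1, so that Green's formula
  over one period applies to a Floquet solution.\<close>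

lemma elliptic_real_roots:
  assumes t: "\<bar>t\<bar> < 2" and T: "poly TP z = complex_of_real t"
  shows "Im z = 0"
proof (rule ccontr)
  assume nz: "Im z \<noteq> 0"
  \<comment> \<open>A root of the characteristic equation for trace \<open>t\<close> and determinant
    1. Its modulus 1 makes the two boundary terms of \<open>green\<close> cancel over a full
    period.\<close>
  define l where "l = Complex (t / 2) (sqrt (1 - (t / 2)\<^sup>2))"
  have t2: "(t / 2)\<^sup>2 \<le> 1" using t abs_square_le_1[of "t / 2"] by simp
  have l1: "(cmod l)\<^sup>2 = 1" unfolding cmod_power2 l_def using t2 by simp
  have l2: "l * l = of_real t * l - 1"
    using t2 by (simp add: l_def complex_eq_iff power2_eq_square[symmetric] power_divide) (simp add: power2_eq_square)
  define p q r s where "p = c0 N z" "q = d0 N z" "r = c0 (Suc N) z" "s = d0 (Suc N) z"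
  have det: "p * s - r * q = 1" unfolding p_q_r_s_def by (rule wronskian_N)
  have tr: "p + s = of_real t" using T unfolding poly_TP p_q_r_s_def .
  have "(p - l) * (s - l) = p * s - (p + s) * l + l * l" by (simp add: algebra_simps)
  also have "\<dots> = q * r" unfolding tr l2 using det by (simp add: algebra_simps)
  finally obtain u v where uv: "(u, v) \<noteq> (0, 0)" "(p - l) * u + q * v = 0" "r * u + (s - l) * v = 0" by (rule singular_kernel)
  define U where "U j = per_gen \<alpha> \<beta> u v j z" for j
  have U0: "U 0 = u" "U (Suc 0) = v" by (simp_all add: U_def per_gen_def)
  have UN: "U N = l * u" "U (Suc N) = l * v"
    using uv(2,3) unfolding U_def per_gen_comb[of \<alpha> \<beta> u v] p_q_r_s_def[symmetric] by (simp_all add: algebra_simps)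
  have green: "Im z * (\<Sum>j<n. (cmod (U (Suc j)))\<^sup>2) = \<alpha> (int n - 1) * Im (U (Suc n) * cnj (U n)) - \<alpha> (-1) * Im (v * cnj u)" for n
  proof (induction n)
    case (Suc n)
    have "\<alpha> (int n) * Im (U (Suc (Suc n)) * cnj (U (Suc n))) = Im ((of_real (\<alpha> (int n)) * U (Suc (Suc n))) * cnj (U (Suc n)))" by (simp add: algebra_simps)
    also have "\<dots> = Im (((z - of_real (\<beta> (int n))) * U (Suc n) - of_real (\<alpha> (int n - 1)) * U n) * cnj (U (Suc n)))"
      unfolding U_def per_gen_rec ..
    also have "\<dots> = Im z * (cmod (U (Suc n)))\<^sup>2 + \<alpha> (int n - 1) * Im (U (Suc n) * cnj (U n))"
      unfolding cmod_power2 by (simp add: power2_eq_square algebra_simps)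
    finally show ?case using Suc by (simp add: algebra_simps)
  qed (simp add: U0)
  have "U (Suc N) * cnj (U N) = of_real ((cmod l)\<^sup>2) * (v * cnj u)" unfolding UN complex_norm_square by simp
  then have "Im z * (\<Sum>j<N. (cmod (U (Suc j)))\<^sup>2) = 0" using green[of N] unfolding alN l1 by simp
  then have "(\<Sum>j<N. (cmod (U (Suc j)))\<^sup>2) = 0" using nz by simp
  then have Uz: "U (Suc j) = 0" if "j < N" for j using that by (subst (asm) sum_nonneg_eq_0_iff) auto
  have "v = 0" using Uz[of 0] U0 N1 by simp
  moreover have "U N = 0" using Uz[of "N - 1"] N1 by simp
  then have "u = 0" using UN(1) l1 by auto
  ultimately show False using uv(1) by simp
qed

text \<open>All complex roots are real by \<open>elliptic_real_roots\<close> and simple by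
  \<open>pderiv_TP_nz\<close>. Hence their number equals the degree, and the polynomial splits over
  the reals.\<close>

theorem elliptic_factor:
  assumes t: "\<bar>t\<bar> < 2"
  shows "finite {x. Tr x = t}" "card {x. Tr x = t} = N" "Tr x - t = lead * (\<Prod>y\<in>{x. Tr x = t}. x - y)"
proof -
  define p where "p = (TP - [:of_real t:] :: complex poly)"
  define R where "R = {x. Tr x = t}"
  have dp: "degree p = N" unfolding p_def
    diff_conv_add_uminus using N1 TP_degree(1)[where 'a=complex] by (subst degree_add_eq_left) auto
  have p0: "p \<noteq> 0" using dp N1 by auto
  have "coeff [:complex_of_real t:] N = 0" using N1 by (intro coeff_eq_0) simp
  then have "coeff p N = of_real lead" unfolding p_def coeff_diff TP_degree(2) by (simp only: diff_0_right)
  then have lc: "lead_coeff p = of_real lead" unfolding dp .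
  have roots: "{z. poly p z = 0} = of_real ` R"
  proof (intro equalityI subsetI)
    fix z assume "z \<in> {z. poly p z = 0}"
    then have e: "poly TP z = complex_of_real t" by (simp add: p_def)
    have "Im z = 0" by (rule elliptic_real_roots[OF t e])
    then have z: "z = of_real (Re z)" by (simp add: complex_eq_iff)
    have "complex_of_real (Tr (Re z)) = of_real t" unfolding TP_of_real[symmetric] z[symmetric] by (rule e)
    then have "Re z \<in> R" unfolding R_def of_real_eq_iff by simp
    with z show "z \<in> of_real ` R" by (rule image_eqI)
  qed (auto simp: R_def p_def TP_of_real)
  have simple: "order z p = 1" if "poly p z = 0" for z
  proof -
    have "z \<in> of_real ` R" using that unfolding roots[symmetric] by simp
    then obtain x where x: "z = of_real x" "x \<in> R" by (rule imageE)
    have "poly (pderiv TP) x \<noteq> 0" by (rule pderiv_TP_nz) (use t x in \<open>simp add: R_def\<close>)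
    then have "poly (pderiv p) z \<noteq> 0" using pderiv_TP_of_real[of x, where 'a=complex] by (simp add: p_def x pderiv_diff pderiv_pCons)
    then have "order z (pderiv p) = 0" by (rule order_0I)
    moreover have "order z p \<noteq> 0" using that p0 by (simp add: order_root)
    moreover have "pderiv p \<noteq> 0" using \<open>poly (pderiv p) z \<noteq> 0\<close> by auto
    ultimately show ?thesis using order_pderiv[of p z] p0 that by simp
  qed
  have fin: "finite {z. poly p z = 0}" by (rule poly_roots_finite[OF p0])
  have inj: "inj_on complex_of_real R" by (simp add: inj_on_def)
  show f: "finite {x. Tr x = t}" using fin unfolding roots R_def[symmetric] by (rule finite_imageD[OF _ inj])
  have dec: "smult (of_real lead) (\<Prod>z\<in>of_real ` R. [:-z, 1:]) = p"
    using complex_poly_decompose[of p] unfolding lc roots[symmetric] by (simp add: simple cong: prod.cong_simp)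
  have "degree p = degree (\<Prod>z\<in>complex_of_real ` R. [:-z, 1:])" unfolding dec[symmetric] using lead_pos by simp
  also have "\<dots> = card (complex_of_real ` R)" by (subst degree_prod_eq_sum_degree) auto
  also have "\<dots> = card R" by (rule card_image[OF inj])
  finally show "card {x. Tr x = t} = N" unfolding dp R_def by simp
  have "complex_of_real (Tr x - t) = poly p (of_real x)" by (simp add: p_def TP_of_real)
  also have "\<dots> = of_real lead * (\<Prod>z\<in>of_real ` R. of_real x - z)" unfolding dec[symmetric] by (simp add: poly_prod)
  also have "(\<Prod>z\<in>complex_of_real ` R. of_real x - z) = (\<Prod>y\<in>R. of_real (x - y))" by (subst prod.reindex[OF inj]) simp
  also have "of_real lead * (\<Prod>y\<in>R. complex_of_real (x - y)) = complex_of_real (lead * (\<Prod>y\<in>R. x - y))" by simp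
  finally show "Tr x - t = lead * (\<Prod>y\<in>{x. Tr x = t}. x - y)" unfolding of_real_eq_iff R_def .
qed

lemma Tr_deriv: "(Tr has_real_derivative poly (pderiv TP) x) (at x)"
  unfolding Tr_def by (rule poly_DERIV)

lemma transfer_product_eq: "transfer_product \<alpha> \<beta> k 0 x =
   vector [vector [per_sol \<alpha> \<beta> 1 0 k x, per_sol \<alpha> \<beta> 0 1 k x], vector [per_sol \<alpha> \<beta> 1 0 (Suc k) x, per_sol \<alpha> \<beta> 0 1 (Suc k) x]]"
proof (induction k)
  case (Suc k)
  then show ?case
    by (simp add: transfer_matrix_def vec_eq_iff forall_2 matrix_matrix_mult_def sum_2 per_sol_def)
qed (simp add: vec_eq_iff forall_2 mat_def per_sol_def)

lemma trace_monodromy: "trace (monodromy N \<alpha> \<beta> 0 x) = Tr x"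
  unfolding monodromy_def transfer_product_eq Tr_def poly_TP per_gen_real by (simp add: trace_def sum_2)

end

section \<open>The equilibrium measure\<close>

context periodic_jacobi
begin

definition Om :: "real set" where "Om = {x. \<bar>Tr x\<bar> < 2}"
definition Th :: "real \<Rightarrow> real" where "Th x = arccos (Tr x / 2)"
definition Th' :: "real \<Rightarrow> real" where "Th' x = - (poly (pderiv TP) x / sqrt (4 - (Tr x)\<^sup>2))"
text \<open>The pullback under the trace of the arcsine law on [-2, 2], that is, of the uniform law
  for the angle \<open>Th\<close> in \<open>Tr x = 2 * cos (Th x)\<close>. The factor
  \<open>real N\<close> accounts for the number of preimages.\<close>

definition om0 :: "real measure" where "om0 = density lborel (\<lambda>x. ennreal (\<bar>Th' x\<bar> / (real N * pi)) * indicator Om x)"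

lemma continuous_Tr: "continuous_on A Tr" unfolding Tr_def by (intro continuous_intros)

lemma Tr_measurable [measurable]: "Tr \<in> borel_measurable borel" "Th' \<in> borel_measurable borel"
proof -
  show m [measurable]: "Tr \<in> borel_measurable borel" by (rule borel_measurable_continuous_onI[OF continuous_Tr])
  have [measurable]: "poly (pderiv TP) \<in> borel_measurable (borel :: real measure)"
    by (rule borel_measurable_continuous_onI) (intro continuous_intros)
  show "Th' \<in> borel_measurable borel" unfolding Th'_def[abs_def] by measurable
qed

lemma open_Om: "open Om"
proof -
  have "Om = Tr -` {- 2<..<2}" by (auto simp: Om_def)
  then show ?thesis using open_vimage[OF open_greaterThanLessThan continuous_Tr] by simp
qed

lemma Om_measurable [measurable]: "Om \<in> sets borel" using open_Om by simp

lemma Th_cos: "x \<in> Om \<Longrightarrow> 0 < Th x \<and> Th x < pi \<and> 2 * cos (Th x) = Tr x"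
  unfolding Th_def Om_def using arccos_lt_bounded[of "Tr x / 2"] by auto

lemma sqrt_pos: "x \<in> Om \<Longrightarrow> 4 - (Tr x)\<^sup>2 > 0"
  unfolding Om_def using abs_square_less_1[of "Tr x / 2"] by (simp add: power_divide)

lemma Th_deriv:
  assumes "x \<in> Om"
  shows "(Th has_real_derivative Th' x) (at x)"
proof -
  have b: "- 1 < Tr x / 2" "Tr x / 2 < 1" using assms by (auto simp: Om_def)
  have "sqrt (4 - (Tr x)\<^sup>2) = sqrt (4 * (1 - (Tr x / 2)\<^sup>2))" by (simp add: power_divide)
  also have "\<dots> = 2 * sqrt (1 - (Tr x / 2)\<^sup>2)" by (simp only: real_sqrt_mult) simp
  finally have s: "sqrt (4 - (Tr x)\<^sup>2) = 2 * sqrt (1 - (Tr x / 2)\<^sup>2)" .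
  have "(Th has_real_derivative inverse (- sqrt (1 - (Tr x / 2)\<^sup>2)) * (poly (pderiv TP) x / 2)) (at x)"
    unfolding Th_def[abs_def] by (rule DERIV_chain2[where f=arccos and g="\<lambda>x. Tr x / 2", OF DERIV_arccos[OF b]]) (rule DERIV_cdivide[OF Tr_deriv])
  then show ?thesis unfolding Th'_def s by (simp add: field_simps)
qed

section \<open>Bands and the integration over roots\<close>

definition Zs :: "real set" where "Zs = {x. \<bar>Tr x\<bar> = 2}"
text \<open>Counting the points of \<open>Zs\<close> to the left of \<open>x\<close> labels the
  components of \<open>Om\<close>. The resulting pieces \<open>Pc k\<close> are open, disjoint and
  possibly empty; no ordering of the band edges has to be established.\<close>

definition idx :: "real \<Rightarrow> nat" where "idx x = card {z\<in>Zs. z < x}"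
definition Pc :: "nat \<Rightarrow> real set" where "Pc k = {x\<in>Om. idx x = k}"

lemma finite_Zs: "finite Zs"
proof -
  have *: "finite {x. Tr x = t}" for t
  proof -
    have "coeff (TP - [:t:]) N = lead" using N1 by (simp add: TP_degree(2) coeff_eq_0)
    then have "TP - [:t:] \<noteq> 0" using lead_pos by auto
    then show ?thesis using poly_roots_finite[of "TP - [:t:]"] by (simp add: Tr_def)
  qed
  have "Zs = {x. Tr x = 2} \<union> {x. Tr x = - 2}" by (auto simp: Zs_def)
  then show ?thesis using * by simp
qed

lemma idx_le: "idx x \<le> card Zs" unfolding idx_def by (intro card_mono finite_Zs) auto

lemma open_Pc: "open (Pc k)"
proof (rule openI)
  fix x assume x: "x \<in> Pc k"
  have "open (Om \<inter> - Zs)" using open_Om finite_imp_closed[OF finite_Zs] by (intro open_Int) auto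
  moreover have "x \<in> Om \<inter> - Zs" using x by (auto simp: Pc_def Om_def Zs_def)
  ultimately obtain e where e: "e > 0" "ball x e \<subseteq> Om \<inter> - Zs" using openE by blast
  have "ball x e \<subseteq> Pc k"
  proof
    fix y assume y: "y \<in> ball x e"
    have "z < y \<longleftrightarrow> z < x" if "z \<in> Zs" for z
    proof -
      have "z \<notin> ball x e" using e(2) that by auto
      then have "e \<le> \<bar>x - z\<bar>" by (simp add: dist_real_def)
      moreover have "\<bar>x - y\<bar> < e" using y by (simp add: dist_real_def)
      ultimately show ?thesis by linarith
    qed
    then have "{z\<in>Zs. z < y} = {z\<in>Zs. z < x}" by auto
    then show "y \<in> Pc k" using x y e(2) by (auto simp: Pc_def idx_def)
  qed
  then show "\<exists>e>0. ball x e \<subseteq> Pc k" using e(1) by blast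
qed

text \<open>Two points with the same label have no point of \<open>Zs\<close> between them, so by
  the intermediate value theorem the segment stays in \<open>Om\<close>. Equal traces would yield a
  critical point on it by Rolle's theorem, against \<open>pderiv_TP_nz\<close>.\<close>

lemma Tr_inj_Pc: "inj_on Tr (Pc k)"
proof -
  have neq: "Tr x \<noteq> Tr y" if xy: "x \<in> Pc k" "y \<in> Pc k" "x < y" for x y
  proof -
  have sub: "{z\<in>Zs. z < x} \<subseteq> {z\<in>Zs. z < y}" using xy(3) by auto
  have eq: "{z\<in>Zs. z < x} = {z\<in>Zs. z < y}"
    by (rule card_subset_eq[OF _ sub]) (use xy finite_Zs in \<open>auto simp: Pc_def idx_def\<close>)
  have noZ: "z \<notin> Zs" if "x \<le> z" "z \<le> y" for z
  proof
    assume "z \<in> Zs"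
    moreover have "z \<noteq> y" using \<open>z \<in> Zs\<close> xy(2) by (auto simp: Pc_def Om_def Zs_def)
    ultimately have "z \<in> {z\<in>Zs. z < y}" using that by simp
    then show False unfolding eq[symmetric] using that by simp
  qed
  have in_Om: "s \<in> Om" if s: "x \<le> s" "s \<le> y" for s
  proof (rule ccontr)
    assume "s \<notin> Om"
    then have big: "\<bar>Tr s\<bar> \<ge> 2" by (simp add: Om_def)
    have "\<exists>z\<ge>x. z \<le> s \<and> \<bar>Tr z\<bar> = 2"
    proof (rule IVT'[of "\<lambda>z. \<bar>Tr z\<bar>"])
      show "\<bar>Tr x\<bar> \<le> 2" using xy(1) by (simp add: Pc_def Om_def)
      show "continuous_on {x..s} (\<lambda>z. \<bar>Tr z\<bar>)" by (intro continuous_intros continuous_Tr)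
    qed (use big s in auto)
    then obtain z where "x \<le> z" "z \<le> s" "\<bar>Tr z\<bar> = 2" by blast
    then show False using noZ[of z] s by (simp add: Zs_def)
  qed
  show ?thesis
  proof
    assume e: "Tr x = Tr y"
    have "\<exists>z. x < z \<and> z < y \<and> (\<lambda>v. poly (pderiv TP) z * v) = (\<lambda>v. 0)"
      by (rule Rolle_deriv[OF xy(3) e continuous_Tr]) (rule Tr_deriv[unfolded has_field_derivative_def])
    then obtain z where z: "x < z" "z < y" "(\<lambda>v. poly (pderiv TP) z * v) = (\<lambda>v. 0)" by (elim exE conjE)
    from fun_cong[OF z(3), of 1] have "poly (pderiv TP) z = 0" by simp
    then show False using pderiv_TP_nz[of z] in_Om[of z] z by (simp add: Om_def)
  qed
  qed
  show ?thesis
  proof (rule inj_onI)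
    fix x y assume "x \<in> Pc k" "y \<in> Pc k" "Tr x = Tr y"
    then show "x = y" using neq[of x y] neq[of y x] by (cases x y rule: linorder_cases) simp_all
  qed
qed

text \<open>Substituting \<open>Tr x = 2 cos \<theta>\<close>: the measure \<open>om0\<close> is the average over \<open>\<theta>\<close> of the
  normalized counting measures of the roots.\<close>

lemma om0_integral:
  assumes h [measurable]: "h \<in> borel_measurable borel"
  shows "(\<integral>\<^sup>+x. h x \<partial>om0) = ennreal (1 / (real N * pi)) *
    (\<integral>\<^sup>+\<theta>. (\<Sum>y\<in>{y. Tr y = 2 * cos \<theta>}. h y) * indicator {0<..<pi} \<theta> \<partial>lborel)"
proof -
  let ?K = "{..card Zs}"
  have Pb [measurable]: "Pc k \<in> sets borel" for k using open_Pc by simp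
  define Q where "Q k \<kappa> \<longleftrightarrow> (\<forall>x\<in>Pc k. \<kappa> (Th x) = x) \<and> (\<lambda>t. h (\<kappa> t) * indicator (Th ` Pc k) t) \<in> borel_measurable borel \<and>
    (\<integral>\<^sup>+x. (ennreal \<bar>Th' x\<bar> * indicator (Pc k) x) * h x \<partial>lborel) = (\<integral>\<^sup>+t. h (\<kappa> t) * indicator (Th ` Pc k) t \<partial>lborel)" for k \<kappa>
  have "\<exists>\<kappa>. Q k \<kappa>" for k
  proof (rule nn_integral_injective_substitution[of "Pc k" Th Th' h])
    fix \<kappa>
    assume "\<And>x. x \<in> Pc k \<Longrightarrow> \<kappa> (Th x) = x" "(\<lambda>t. h (\<kappa> t) * indicator (Th ` Pc k) t) \<in> borel_measurable borel"
      "(\<integral>\<^sup>+x. (ennreal \<bar>Th' x\<bar> * indicator (Pc k) x) * h x \<partial>lborel) = (\<integral>\<^sup>+t. h (\<kappa> t) * indicator (Th ` Pc k) t \<partial>lborel)"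
    then have "Q k \<kappa>" unfolding Q_def by simp
    then show "\<exists>\<kappa>. Q k \<kappa>" by blast
  next
    show "inj_on Th (Pc k)"
    proof (rule inj_onI)
      fix x y assume xy: "x \<in> Pc k" "y \<in> Pc k" "Th x = Th y"
      then have "Tr x = Tr y" using Th_cos[of x] Th_cos[of y] by (simp add: Pc_def)
      then show "x = y" using inj_onD[OF Tr_inj_Pc] xy by blast
    qed
    show "bounded (Th ` Pc k)" by (rule bounded_subset[of "{0..pi}"]) (use Th_cos in \<open>force simp: Pc_def\<close>)+
    show "(Th has_real_derivative Th' x) (at x)" if "x \<in> Pc k" for x using that by (intro Th_deriv) (simp add: Pc_def)
    show "(\<lambda>x. ennreal \<bar>Th' x\<bar> * indicator (Pc k) x) \<in> borel_measurable borel" by measurable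
  next
    show "open (Pc k)" by (rule open_Pc)
    show "h \<in> borel_measurable borel" by (rule h)
  qed
  then have "\<exists>\<kappa>. \<forall>k. Q k (\<kappa> k)" by (intro choice allI)
  then obtain \<kappa> where Q: "\<forall>k. Q k (\<kappa> k)" by (rule exE)
  then have \<kappa>: "\<And>k x. x \<in> Pc k \<Longrightarrow> \<kappa> k (Th x) = x"
    "\<And>k. (\<lambda>t. h (\<kappa> k t) * indicator (Th ` Pc k) t) \<in> borel_measurable borel"
    "\<And>k. (\<integral>\<^sup>+x. (ennreal \<bar>Th' x\<bar> * indicator (Pc k) x) * h x \<partial>lborel) = (\<integral>\<^sup>+t. h (\<kappa> k t) * indicator (Th ` Pc k) t \<partial>lborel)"
    unfolding Q_def by (blast, blast, blast)
  have ind: "(indicator Om x :: ennreal) = (\<Sum>k\<in>?K. indicator (Pc k) x)" for x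
  proof (cases "x \<in> Om")
    case True
    then have "(\<Sum>k\<in>?K. indicator (Pc k) x) = (\<Sum>k\<in>?K. if k = idx x then 1 else (0::ennreal))"
      by (intro sum.cong) (auto simp: Pc_def indicator_def)
    then show ?thesis using True idx_le[of x] by simp
  qed (simp add: Pc_def)
  \<comment> \<open>Every root of \<open>Tr y = 2 * cos t\<close> lies in exactly one piece, and a
    piece contains at most one root, namely the inverse of \<open>Th\<close> at \<open>t\<close>. So
    the sum over the pieces is the sum over the roots.\<close>
  have pt: "(\<Sum>k\<in>?K. h (\<kappa> k t) * indicator (Th ` Pc k) t) = (\<Sum>y\<in>{y. Tr y = 2 * cos t}. h y) * indicator {0<..<pi} t" for t
  proof (cases "t \<in> {0<..<pi}")
    case False
    then have "t \<notin> Th ` Pc k" for k using Th_cos by (force simp: Pc_def)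
    then show ?thesis using False by simp
  next
    case True
    define R where "R = {y. Tr y = 2 * cos t}"
    have ct: "\<bar>cos t\<bar> < 1" using True cos_monotone_0_pi[of 0 t] cos_monotone_0_pi[of t pi] by auto
    have RO: "R \<subseteq> Om" using ct by (auto simp: R_def Om_def abs_mult)
    have RTh: "Th y = t \<longleftrightarrow> y \<in> R" if "y \<in> Om" for y
    proof
      assume "y \<in> R"
      then show "Th y = t" using True by (simp add: R_def Th_def arccos_cos)
    qed (use Th_cos[OF that] in \<open>auto simp: R_def\<close>)
    have fR: "finite R" unfolding R_def by (rule elliptic_factor(1)) (use ct in \<open>simp add: abs_mult\<close>)
    have "(\<Sum>y\<in>R. h y) = (\<Sum>k\<in>?K. \<Sum>y\<in>{y\<in>R. idx y = k}. h y)"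
      by (rule sum.group[symmetric]) (use fR idx_le in auto)
    also have "\<dots> = (\<Sum>k\<in>?K. h (\<kappa> k t) * indicator (Th ` Pc k) t)"
    proof (rule sum.cong[OF refl])
      fix k
      show "(\<Sum>y\<in>{y\<in>R. idx y = k}. h y) = h (\<kappa> k t) * indicator (Th ` Pc k) t"
      proof (cases "t \<in> Th ` Pc k")
        case True
        then obtain x where x: "x \<in> Pc k" "t = Th x" by blast
        have "y = x" if "y \<in> R" "idx y = k" for y
        proof -
          have y: "Th y = Th x" "y \<in> Pc k" using RTh[of y] RO that unfolding x(2) by (auto simp: Pc_def)
          show ?thesis using \<kappa>(1)[OF y(2)] \<kappa>(1)[OF x(1)] unfolding y(1) by simp
        qed
        moreover have "x \<in> R" "idx x = k" using RTh[of x] x by (auto simp: Pc_def)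
        ultimately have "{y\<in>R. idx y = k} = {x}" by blast
        then show ?thesis using True \<kappa>(1)[OF x(1)] unfolding x(2) by simp
      next
        case False
        then have emp: "{y\<in>R. idx y = k} = {}" using RTh RO unfolding Pc_def by blast
        show ?thesis unfolding emp using False by simp
      qed
    qed
    finally show ?thesis using True by (simp add: R_def)
  qed
  have "(\<integral>\<^sup>+x. h x \<partial>om0) = (\<integral>\<^sup>+x. (ennreal (\<bar>Th' x\<bar> / (real N * pi)) * indicator Om x) * h x \<partial>lborel)"
    unfolding om0_def by (rule nn_integral_density) measurable
  also have "\<dots> = (\<integral>\<^sup>+x. ennreal (1 / (real N * pi)) * (\<Sum>k\<in>?K. (ennreal \<bar>Th' x\<bar> * indicator (Pc k) x) * h x) \<partial>lborel)"
  proof (rule nn_integral_cong)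
    fix x
    have "ennreal (\<bar>Th' x\<bar> / (real N * pi)) = ennreal (1 / (real N * pi)) * ennreal \<bar>Th' x\<bar>"
      by (subst ennreal_mult[symmetric]) auto
    then show "(ennreal (\<bar>Th' x\<bar> / (real N * pi)) * indicator Om x) * h x
       = ennreal (1 / (real N * pi)) * (\<Sum>k\<in>?K. (ennreal \<bar>Th' x\<bar> * indicator (Pc k) x) * h x)"
      unfolding ind sum_distrib_right[symmetric] sum_distrib_left[symmetric] by (simp add: mult_ac)
  qed
  also have "\<dots> = ennreal (1 / (real N * pi)) * (\<integral>\<^sup>+x. (\<Sum>k\<in>?K. (ennreal \<bar>Th' x\<bar> * indicator (Pc k) x) * h x) \<partial>lborel)"
    by (rule nn_integral_cmult) measurable
  also have "(\<integral>\<^sup>+x. (\<Sum>k\<in>?K. (ennreal \<bar>Th' x\<bar> * indicator (Pc k) x) * h x) \<partial>lborel)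
      = (\<Sum>k\<in>?K. \<integral>\<^sup>+x. (ennreal \<bar>Th' x\<bar> * indicator (Pc k) x) * h x \<partial>lborel)"
    by (rule nn_integral_sum) measurable
  also have "\<dots> = (\<integral>\<^sup>+t. (\<Sum>k\<in>?K. h (\<kappa> k t) * indicator (Th ` Pc k) t) \<partial>lborel)"
    unfolding \<kappa>(3) by (rule nn_integral_sum[symmetric]) (use \<kappa>(2) in simp)
  finally show ?thesis unfolding pt .
qed

lemma cos_abs_less: "t \<in> {0<..<pi} \<Longrightarrow> \<bar>2 * cos t\<bar> < 2"
  using cos_monotone_0_pi[of 0 t] cos_monotone_0_pi[of t pi] by auto

lemma Tr_bounded: "\<exists>B\<ge>1. \<forall>x. \<bar>Tr x\<bar> \<le> 2 \<longrightarrow> \<bar>x\<bar> \<le> B"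
proof -
  obtain c q where q: "(TP :: real poly) = pCons c q" by (cases "TP :: real poly")
  have "q \<noteq> 0" using TP_degree(1)[where 'a=real] N1 unfolding q by auto
  from poly_infinity[OF this, of 3 c] obtain r where r: "\<And>z::real. r \<le> \<bar>z\<bar> \<Longrightarrow> 3 \<le> \<bar>Tr z\<bar>"
    unfolding q[symmetric] Tr_def by auto
  have "\<bar>x\<bar> \<le> max 1 r" if "\<bar>Tr x\<bar> \<le> 2" for x using r[of x] that by (cases "r \<le> \<bar>x\<bar>") auto
  then show ?thesis by (intro exI[of _ "max 1 r"]) auto
qed

lemma om0_sets: "sets om0 = sets borel" by (simp add: om0_def)

lemma om0_AE: "AE y in om0. y \<in> Om" "AE y in om0. y \<noteq> x"
proof -
  have m: "(\<lambda>x. ennreal (\<bar>Th' x\<bar> / (real N * pi)) * indicator Om x) \<in> borel_measurable lborel" by measurable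
  show "AE y in om0. y \<in> Om" unfolding om0_def AE_density[OF m] by (rule AE_I2) (auto simp: indicator_def)
  show "AE y in om0. y \<noteq> x" unfolding om0_def AE_density[OF m] using AE_lborel_singleton[of x] by eventually_elim simp
qed

lemma om0_prob: "om0 \<in> prob_measures_on {x. \<bar>Tr x\<bar> \<le> 2}"
proof -
  have "(\<Sum>y\<in>{y. Tr y = 2 * cos t}. 1) * indicator {0<..<pi} t = ennreal (real N) * indicator {0<..<pi} t" for t
    using elliptic_factor(2)[OF cos_abs_less[of t]] by (cases "t \<in> {0<..<pi}") (simp_all add: ennreal_of_nat_eq_real_of_nat)
  then have "(\<integral>\<^sup>+x. 1 \<partial>om0) = ennreal (1 / (real N * pi)) * (\<integral>\<^sup>+t. ennreal (real N) * indicator {0<..<pi} t \<partial>lborel)"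
    using om0_integral[of "\<lambda>_. 1"] by simp
  also have "(\<integral>\<^sup>+t. ennreal (real N) * indicator {0<..<pi} t \<partial>lborel) = ennreal (real N * pi)"
    by (subst nn_integral_cmult) (simp_all add: ennreal_mult)
  also have "ennreal (1 / (real N * pi)) * ennreal (real N * pi) = 1"
    using N1 by (subst ennreal_mult[symmetric]) auto
  finally have p: "prob_space om0" by (intro prob_spaceI) simp
  interpret prob_space om0 by (rule p)
  have "measure om0 {x. \<bar>Tr x\<bar> \<le> 2} = 1"
  proof (rule prob_eq_1[THEN iffD2])
    show "{x. \<bar>Tr x\<bar> \<le> 2} \<in> events" unfolding om0_sets by measurable
    show "AE x in om0. x \<in> {x. \<bar>Tr x\<bar> \<le> 2}" using om0_AE(1) by eventually_elim (simp add: Om_def)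
  qed
  then show ?thesis using p by (simp add: prob_measures_on_def borel_prob_measure_def om0_sets)
qed

text \<open>By the factorization of the trace polynomial, averaging over the roots of
  \<open>Tr y = 2 * cos \<theta>\<close> turns the potential into an integral of
  \<open>ln \<bar>Tr x - 2 * cos \<theta>\<bar>\<close> over \<open>\<theta>\<close>, up to
  constants. With \<open>Tr x = 2 * cos \<phi>\<close> this integral does not depend on
  \<open>\<phi>\<close>, by \<open>lsin_sum_integral\<close>.\<close>

lemma om0_potential:
  "\<exists>c. \<forall>x. \<bar>Tr x\<bar> \<le> 2 \<longrightarrow> integrable om0 (\<lambda>y. ln \<bar>x - y\<bar>) \<and> (\<integral>y. ln \<bar>x - y\<bar> \<partial>om0) = c"
proof -
  obtain B where B: "B \<ge> 1" "\<And>x. \<bar>Tr x\<bar> \<le> 2 \<Longrightarrow> \<bar>x\<bar> \<le> B" using Tr_bounded by blast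
  obtain m0 where m0: "lsin_int (- pi) pi = ennreal m0" "m0 \<ge> 0" using lsin_int_finite by (cases "lsin_int (- pi) pi") auto
  define K where "K = real N * ln (2 * B) + ln lead - 2 * ln 2"
  define c where "c = (K * pi + m0) / (real N * pi)"
  have "integrable om0 (\<lambda>y. ln \<bar>x - y\<bar>) \<and> (\<integral>y. ln \<bar>x - y\<bar> \<partial>om0) = ln (2 * B) - c" if x: "\<bar>Tr x\<bar> \<le> 2" for x
  proof -
    interpret prob_space om0 using om0_prob by (simp add: prob_measures_on_def borel_prob_measure_def)
    define \<phi> where "\<phi> = arccos (Tr x / 2)"
    have \<phi>: "0 \<le> \<phi>" "\<phi> \<le> pi" "2 * cos \<phi> = Tr x" using x arccos_bounded[of "Tr x / 2"] unfolding \<phi>_def by auto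
    \<comment> \<open>Since \<open>2 * B\<close> bounds all distances in the set, \<open>f\<close>
      is nonnegative there and \<open>om0_integral\<close> applies to it; the sign and the constant
      are undone at the end.\<close>
    define f where "f y = ln (2 * B) - ln \<bar>x - y\<bar>" for y
    have fm [measurable]: "f \<in> borel_measurable borel" unfolding f_def[abs_def] by measurable
    have f0: "f y \<ge> 0" if "\<bar>Tr y\<bar> \<le> 2" for y
    proof (cases "x = y")
      case False
      have "\<bar>x - y\<bar> \<le> 2 * B" using B(2)[OF x] B(2)[OF that] by linarith
      then have "ln \<bar>x - y\<bar> \<le> ln (2 * B)" using False B(1) by (subst ln_le_cancel_iff) auto
      then show ?thesis by (simp add: f_def)
    qed (use B(1) in \<open>simp add: f_def\<close>)
    define L where "L \<theta> = lsin (\<theta> - \<phi>) + lsin (\<theta> + \<phi>)" for \<theta>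
    have L0: "L \<theta> \<ge> 0" for \<theta> unfolding L_def by (intro add_nonneg_nonneg lsin_nonneg)
    have Lm [measurable]: "L \<in> borel_measurable borel" unfolding L_def[abs_def] by measurable
    have sum: "(\<Sum>y\<in>{y. Tr y = 2 * cos \<theta>}. f y) = K + L \<theta> \<and> (\<Sum>y\<in>{y. Tr y = 2 * cos \<theta>}. ennreal (f y)) = ennreal (K + L \<theta>) \<and> 0 \<le> K + L \<theta>"
      if t: "\<theta> \<in> {0<..<pi}" "\<theta> \<noteq> \<phi>" for \<theta>
    proof -
      define R where "R = {y. Tr y = 2 * cos \<theta>}"
      note fac = elliptic_factor[OF cos_abs_less[OF t(1)], folded R_def]
      have ne: "cos \<phi> \<noteq> cos \<theta>" using cos_inj_pi[of \<phi> \<theta>] \<phi> t by auto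
      have xy: "x - y \<noteq> 0" if "y \<in> R" for y using that ne \<phi>(3) by (auto simp: R_def)
      have "ln \<bar>2 * cos \<phi> - 2 * cos \<theta>\<bar> = ln (lead * (\<Prod>y\<in>R. \<bar>x - y\<bar>))"
        unfolding \<phi>(3) fac(3)[of x] using lead_pos by (simp add: abs_mult abs_prod)
      also have "\<dots> = ln lead + ln (\<Prod>y\<in>R. \<bar>x - y\<bar>)"
        using lead_pos xy fac(1) by (subst ln_mult) auto
      also have "ln (\<Prod>y\<in>R. \<bar>x - y\<bar>) = (\<Sum>y\<in>R. ln \<bar>x - y\<bar>)" by (rule ln_prod[OF fac(1)]) (use xy in auto)
      finally have e: "(\<Sum>y\<in>R. ln \<bar>x - y\<bar>) = 2 * ln 2 - L \<theta> - ln lead"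
        unfolding two_cos_diff[OF ne] L_def by simp
      have s: "(\<Sum>y\<in>R. f y) = K + L \<theta>" unfolding f_def sum_subtractf e by (simp add: fac(2) K_def)
      have fR: "f y \<ge> 0" if "y \<in> R" for y using that cos_abs_less[OF t(1)] by (intro f0) (simp add: R_def)
      then have "(\<Sum>y\<in>R. ennreal (f y)) = ennreal (K + L \<theta>)" by (simp add: s[symmetric])
      moreover have "0 \<le> (\<Sum>y\<in>R. f y)" by (intro sum_nonneg fR)
      ultimately show ?thesis using s unfolding R_def by simp
    qed
    have iL: "integrable lborel (\<lambda>\<theta>. L \<theta> * indicator {0<..pi} \<theta>) \<and> (\<integral>\<theta>. L \<theta> * indicator {0<..pi} \<theta> \<partial>lborel) = m0"
    proof (rule nn_integral_eq_integrable[THEN iffD1])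
      show "(\<integral>\<^sup>+\<theta>. ennreal (L \<theta> * indicator {0<..pi} \<theta>) \<partial>lborel) = ennreal m0"
        unfolding m0(1)[symmetric] lsin_sum_integral[OF \<phi>(1,2), symmetric] L_def[symmetric]
        by (intro nn_integral_cong) (auto simp: indicator_def)
    qed (use L0 m0 in auto)
    have iK: "integrable lborel (\<lambda>\<theta>. K * indicator {0<..pi} \<theta>)" "(\<integral>\<theta>. K * indicator {0<..pi} \<theta> \<partial>lborel) = K * pi" by simp_all
    define g where "g \<theta> = K * indicator {0<..pi} \<theta> + L \<theta> * indicator {0<..pi} \<theta>" for \<theta>
    have ig: "integrable lborel g" "(\<integral>\<theta>. g \<theta> \<partial>lborel) = K * pi + m0"
      unfolding g_def[abs_def] using iL iK by simp_all
    have AE: "AE \<theta> in lborel. \<theta> \<noteq> \<phi> \<and> \<theta> \<noteq> pi" using AE_lborel_singleton[of \<phi>] AE_lborel_singleton[of pi] by eventually_elim simp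
    have g0: "AE \<theta> in lborel. 0 \<le> g \<theta>" using AE
    proof eventually_elim
      case (elim \<theta>)
      then show ?case using sum[of \<theta>] by (cases "\<theta> \<in> {0<..<pi}") (auto simp: g_def indicator_def)
    qed
    have c0: "K * pi + m0 \<ge> 0" unfolding ig(2)[symmetric] by (rule integral_nonneg_AE[OF g0])
    have "(\<integral>\<^sup>+\<theta>. (\<Sum>y\<in>{y. Tr y = 2 * cos \<theta>}. ennreal (f y)) * indicator {0<..<pi} \<theta> \<partial>lborel) = (\<integral>\<^sup>+\<theta>. ennreal (g \<theta>) \<partial>lborel)"
      by (rule nn_integral_cong_AE) (use AE in eventually_elim, use sum in \<open>auto simp: g_def indicator_def\<close>)
    also have "\<dots> = ennreal (K * pi + m0)" using nn_integral_eq_integral[OF ig(1) g0] ig(2) by simp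
    finally have "(\<integral>\<^sup>+y. ennreal (f y) \<partial>om0) = ennreal (1 / (real N * pi)) * ennreal (K * pi + m0)"
      by (subst om0_integral) (simp_all add: om0_sets)
    also have "\<dots> = ennreal c" unfolding c_def using c0 by (subst ennreal_mult[symmetric]) auto
    finally have fi: "(\<integral>\<^sup>+y. ennreal (f y) \<partial>om0) = ennreal c" .
    have "integrable om0 f \<and> (\<integral>y. f y \<partial>om0) = c"
    proof (rule nn_integral_eq_integrable[THEN iffD1, OF _ _ _ fi])
      show "f \<in> borel_measurable om0" using fm measurable_cong_sets[OF om0_sets refl] by blast
      show "AE y in om0. 0 \<le> f y" using om0_AE(1) by eventually_elim (use f0 in \<open>simp add: Om_def\<close>)
      show "0 \<le> c" unfolding c_def using c0 by simp
    qed
    then have "integrable om0 (\<lambda>y. ln (2 * B) - f y)" "(\<integral>y. ln (2 * B) - f y \<partial>om0) = ln (2 * B) - c"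
      using prob_space by simp_all
    then show ?thesis by (simp add: f_def)
  qed
  then show ?thesis by blast
qed

theorem equilibrium_measure_eq:
  assumes "equilibrium_measure {x. \<bar>Tr x\<bar> \<le> 2} \<omega>"
  shows "\<omega> = om0"
proof -
  obtain B where B: "\<And>x. \<bar>Tr x\<bar> \<le> 2 \<Longrightarrow> \<bar>x\<bar> \<le> B" using Tr_bounded by blast
  obtain c where c: "\<And>x. \<bar>Tr x\<bar> \<le> 2 \<Longrightarrow> integrable om0 (\<lambda>y. ln \<bar>x - y\<bar>) \<and> (\<integral>y. ln \<bar>x - y\<bar> \<partial>om0) = c"
    using om0_potential by blast
  show ?thesis
  proof (rule equilibrium_unique[where F="{x. \<bar>Tr x\<bar> \<le> 2}" and B=B and c=c])
    show "{x. \<bar>Tr x\<bar> \<le> 2} \<in> sets borel" by measurable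
    show "\<omega> \<in> prob_measures_on {x. \<bar>Tr x\<bar> \<le> 2}" "log_energy \<omega> \<le> log_energy om0"
      using assms om0_prob by (auto simp: equilibrium_measure_def)
    show "om0 \<in> prob_measures_on {x. \<bar>Tr x\<bar> \<le> 2}" by (rule om0_prob)
    show "AE y in om0. y \<noteq> x" for x by (rule om0_AE(2))
  qed (use B c in auto)
qed

end

section \<open>Continuous densities\<close>

text \<open>If the values differed at \<open>x\<close>, continuity would keep the densities apart by
  a third of the gap on a small interval, and they would assign different masses to it.\<close>

lemma cont_density_unique:
  assumes S: "open S" and f: "is_cont_density_on S M f" and g: "is_cont_density_on S M g" and x: "x \<in> S"
  shows "f x = g x"
proof -
  have False if f: "is_cont_density_on S M f" and g: "is_cont_density_on S M g" and less: "f x < g x" for f g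
  proof -
    define e where "e = (g x - f x) / 3"
    have e: "e > 0" using less by (simp add: e_def)
    have "isCont f x" "isCont g x" using f g S x by (auto simp: is_cont_density_on_def continuous_on_eq_continuous_at)
    then have "\<forall>\<^sub>F y in nhds x. dist (f y) (f x) < e" "\<forall>\<^sub>F y in nhds x. dist (g y) (g x) < e"
      using e by (auto simp: isCont_def tendsto_iff eventually_at_filter elim!: eventually_mono)
    moreover have "\<forall>\<^sub>F y in nhds x. y \<in> S" by (rule eventually_nhds_in_open[OF S x])
    ultimately have "\<forall>\<^sub>F y in nhds x. dist (f y) (f x) < e \<and> dist (g y) (g x) < e \<and> y \<in> S" by eventually_elim simp
    then obtain d where d: "d > 0" "\<And>y. dist y x < d \<Longrightarrow> dist (f y) (f x) < e \<and> dist (g y) (g x) < e \<and> y \<in> S"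
      unfolding eventually_nhds_metric by blast
    define A where "A = {x - d<..<x + d}"
    have A: "f y \<le> f x + e \<and> f x + 2 * e \<le> g y \<and> y \<in> S" if "y \<in> A" for y
    proof -
      have "dist y x < d" using that by (auto simp: A_def dist_real_def)
      then have "\<bar>f y - f x\<bar> < e" "\<bar>g y - g x\<bar> < e" "y \<in> S" using d(2)[of y] by (simp_all add: dist_real_def)
      moreover have "g x = f x + 3 * e" by (simp add: e_def field_simps)
      ultimately show ?thesis by linarith
    qed
    have fx: "f x \<ge> 0" using f x by (simp add: is_cont_density_on_def)
    have Ab: "A \<in> sets borel" "A \<subseteq> S" using A by (auto simp: A_def)
    have "ennreal (f x + 2 * e) * emeasure lborel A = (\<integral>\<^sup>+y. ennreal (f x + 2 * e) * indicator A y \<partial>lborel)"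
      by (rule nn_integral_cmult_indicator[symmetric]) (use Ab in simp)
    also have "\<dots> \<le> (\<integral>\<^sup>+y. ennreal (g y) * indicator A y \<partial>lborel)"
      by (rule nn_integral_mono) (use A in \<open>auto simp: indicator_def intro!: ennreal_leI\<close>)
    also have "\<dots> = emeasure M A" using g Ab by (simp add: is_cont_density_on_def)
    also have "\<dots> = (\<integral>\<^sup>+y. ennreal (f y) * indicator A y \<partial>lborel)" using f Ab by (simp add: is_cont_density_on_def)
    also have "\<dots> \<le> (\<integral>\<^sup>+y. ennreal (f x + e) * indicator A y \<partial>lborel)"
      by (rule nn_integral_mono) (use A in \<open>auto simp: indicator_def intro!: ennreal_leI\<close>)
    also have "\<dots> = ennreal (f x + e) * emeasure lborel A"
      by (rule nn_integral_cmult_indicator) (use Ab in simp)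
    also have "emeasure lborel A = ennreal (2 * d)" using d(1) by (simp add: A_def)
    finally have le: "(f x + 2 * e) * (2 * d) \<le> (f x + e) * (2 * d)"
      using fx e d(1) by (simp add: ennreal_mult[symmetric] ennreal_le_iff del: ennreal_plus)
    then have "f x + 2 * e \<le> f x + e" using d(1) by (simp add: mult_le_cancel_right)
    then show False using e by simp
  qed
  from this[OF f g] this[OF g f] show ?thesis by (cases "f x" "g x" rule: linorder_cases) simp_all
qed

lemma cont_density_on_eq:
  assumes "open S" "is_cont_density_on S M f" "x \<in> S"
  shows "cont_density_on S M x = f x"
  unfolding cont_density_on_def
  by (rule cont_density_unique[OF assms(1) _ assms(2,3)]) (rule someI[of "is_cont_density_on S M", OF assms(2)])

text \<open>The formula for the equilibrium density degenerates at finitely many interior points of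
  the set, the closed gaps; there the limits have to supply the values.\<close>

lemma continuous_extension_finite:
  fixes g :: "real \<Rightarrow> real"
  assumes S: "open S" and Z: "finite Z" and c: "\<And>x. x \<in> S - Z \<Longrightarrow> isCont g x"
    and lim: "\<And>x. x \<in> S \<inter> Z \<Longrightarrow> \<exists>l. (g \<longlongrightarrow> l) (at x)"
  obtains f where "continuous_on S f" "\<And>x. x \<notin> Z \<Longrightarrow> f x = g x"
proof
  define f where "f x = (if x \<in> Z then Lim (at x) g else g x)" for x
  show "f x = g x" if "x \<notin> Z" for x using that by (simp add: f_def)
  have "isCont f x" if x: "x \<in> S" for x
  proof -
    have "open (- (Z - {x}))" using Z by (intro open_Compl finite_imp_closed) auto
    then have "\<forall>\<^sub>F y in at x. y \<in> - (Z - {x})" by (rule eventually_at_in_open') simp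
    then have ev: "\<forall>\<^sub>F y in at x. g y = f y"
      using eventually_neq_at_within[of x] by eventually_elim (simp add: f_def)
    have "(g \<longlongrightarrow> f x) (at x)"
    proof (cases "x \<in> Z")
      case True
      then obtain l where l: "(g \<longlongrightarrow> l) (at x)" using lim[of x] x by blast
      then have "Lim (at x) g = l" by (intro tendsto_Lim) simp
      then show ?thesis using l True by (simp add: f_def)
    next
      case False
      then show ?thesis using c[of x] x by (simp add: f_def isCont_def)
    qed
    then show ?thesis unfolding isCont_def by (rule Lim_transform_eventually[OF _ ev])
  qed
  then show "continuous_on S f" using S by (simp add: continuous_on_eq_continuous_at)
qed

context periodic_jacobi
begin

text \<open>At an interior point where the trace is 2 or -2, the polynomial
  \<open>p = 4 - Tr^2\<close> has a local minimum with value 0, hence a zero of some order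
  \<open>n + 2\<close>. The square of \<open>Th'\<close> is the squared derivative of
  \<open>p\<close> divided by \<open>4 * Tr^2 * p\<close>; the numerator vanishes to order at least
  \<open>2 * n + 2\<close>, so a factor \<open>(x - x0)^n\<close> and a regular quotient
  remain.\<close>

lemma Th'_limit:
  assumes x0: "x0 \<in> interior {x. \<bar>Tr x\<bar> \<le> 2}" "x0 \<in> Zs"
  shows "\<exists>l. ((\<lambda>x. \<bar>Th' x\<bar>) \<longlongrightarrow> l) (at x0)"
proof -
  define p where "p = [:4:] - (TP :: real poly) * TP"
  have pe: "poly p x = 4 - (Tr x)\<^sup>2" for x by (simp add: p_def Tr_def power2_eq_square)
  have dp: "poly (pderiv p) x = - 2 * Tr x * poly (pderiv TP) x" for x
    by (simp add: p_def pderiv_diff pderiv_pCons pderiv_mult Tr_def)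
  have Tx0: "(Tr x0)\<^sup>2 = 4" using x0(2) power2_abs[of "Tr x0"] by (simp add: Zs_def)
  have pz: "poly p x0 = 0" by (simp add: pe Tx0)
  have p0: "p \<noteq> 0"
  proof
    assume "p = 0"
    then have "\<bar>Tr x\<bar> = 2" for x using pe[of x] abs_square_eq_1[of "Tr x / 2"] by (simp add: power_divide)
    then have "Zs = UNIV" by (auto simp: Zs_def)
    then show False using finite_Zs infinite_UNIV_char_0[where 'a=real] by simp
  qed
  have ev1: "\<forall>\<^sub>F x in nhds x0. \<bar>Tr x\<bar> \<le> 2"
    using eventually_nhds_in_open[OF open_interior x0(1)] interior_subset[of "{x. \<bar>Tr x\<bar> \<le> 2}"] by (auto elim!: eventually_mono)
  then obtain d where d: "d > 0" "\<And>x. \<bar>x0 - x\<bar> < d \<Longrightarrow> \<bar>Tr x\<bar> \<le> 2"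
    unfolding eventually_nhds_metric dist_real_def by (metis abs_minus_commute)
  have "poly (pderiv p) x0 = 0"
  proof (rule DERIV_local_min[OF poly_DERIV d(1)])
    show "\<forall>y. \<bar>x0 - y\<bar> < d \<longrightarrow> poly p x0 \<le> poly p y"
    proof (intro allI impI)
      fix y assume "\<bar>x0 - y\<bar> < d"
      then have "(Tr y)\<^sup>2 \<le> 4" using d(2)[of y] abs_square_le_1[of "Tr y / 2"] by (simp add: power_divide)
      then show "poly p x0 \<le> poly p y" unfolding pz by (simp add: pe)
    qed
  qed
  moreover have "pderiv p \<noteq> 0"
  proof
    assume "pderiv p = 0"
    then obtain h where "p = [:h:]" using pderiv_iszero by blast
    then show False using pz p0 by simp
  qed
  ultimately have ord: "order x0 p = Suc (order x0 (pderiv p))" "order x0 (pderiv p) \<noteq> 0"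
    using order_pderiv[OF p0 pz] by (simp_all add: order_root)
  then obtain n where n: "order x0 (pderiv p) = Suc n" "order x0 p = Suc (Suc n)" by (cases "order x0 (pderiv p)") auto
  obtain q where q: "p = [:- x0, 1:] ^ Suc (Suc n) * q" "\<not> [:- x0, 1:] dvd q" using order_decomp[OF p0, of x0] n by auto
  obtain r where r: "pderiv p = [:- x0, 1:] ^ Suc n * r" using order_1[of x0 "pderiv p"] n by (auto elim!: dvdE)
  have qz: "poly q x0 \<noteq> 0" using q(2) by (simp add: poly_eq_0_iff_dvd)
  define h where "h x = (x - x0) ^ n * (poly r x)\<^sup>2 / (4 * (Tr x)\<^sup>2 * poly q x)" for x
  have ch: "isCont h x0" unfolding h_def[abs_def] Tr_def using qz Tx0
    by (intro continuous_intros) (auto simp: Tr_def)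
  have "(\<lambda>x. sqrt (h x)) \<midarrow>x0\<rightarrow> sqrt (h x0)" by (intro tendsto_real_sqrt) (use ch in \<open>simp add: isCont_def\<close>)
  moreover have "\<forall>\<^sub>F x in at x0. sqrt (h x) = \<bar>Th' x\<bar>"
  proof -
    have "\<forall>\<^sub>F x in at x0. Tr x \<noteq> 0"
      by (rule tendsto_imp_eventually_ne[of _ "Tr x0"]) (use Tx0 DERIV_isCont[OF Tr_deriv] in \<open>auto simp: isCont_def\<close>)
    moreover have "open (- (Zs - {x0}))" using finite_Zs by (intro open_Compl finite_imp_closed) auto
    then have "\<forall>\<^sub>F x in at x0. x \<in> - (Zs - {x0})" by (rule eventually_at_in_open') simp
    moreover have "\<forall>\<^sub>F x in at x0. \<bar>Tr x\<bar> \<le> 2" using ev1 by (auto simp: eventually_at_filter elim!: eventually_mono)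
    ultimately show ?thesis using eventually_neq_at_within[of x0]
    proof eventually_elim
      case (elim x)
      then have O: "x \<in> Om" by (auto simp: Zs_def Om_def)
      have nz: "x - x0 \<noteq> 0" using elim by simp
      have lin: "poly [:- x0, 1:] x = x - x0" by simp
      have P: "4 - (Tr x)\<^sup>2 = (x - x0) ^ Suc (Suc n) * poly q x" unfolding pe[symmetric] q(1) poly_mult poly_power lin ..
      have D: "- 2 * Tr x * poly (pderiv TP) x = (x - x0) ^ Suc n * poly r x" unfolding dp[symmetric] r poly_mult poly_power lin ..
      have qx: "poly q x \<noteq> 0" using P sqrt_pos[OF O] by auto
      have "4 * (Tr x)\<^sup>2 * (poly (pderiv TP) x)\<^sup>2 = (- 2 * Tr x * poly (pderiv TP) x)\<^sup>2" by (simp add: power2_eq_square)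
      also have "\<dots> = ((x - x0) ^ Suc (Suc n)) * ((x - x0) ^ n * (poly r x)\<^sup>2)" unfolding D by (simp add: power2_eq_square)
      finally have E: "4 * (Tr x)\<^sup>2 * (poly (pderiv TP) x)\<^sup>2 = ((x - x0) ^ Suc (Suc n)) * ((x - x0) ^ n * (poly r x)\<^sup>2)" .
      have "(Th' x)\<^sup>2 = (poly (pderiv TP) x)\<^sup>2 / (4 - (Tr x)\<^sup>2)"
        unfolding Th'_def using sqrt_pos[OF O] by (simp add: power_divide)
      also have "\<dots> = (4 * (Tr x)\<^sup>2 * (poly (pderiv TP) x)\<^sup>2) / (4 * (Tr x)\<^sup>2 * (4 - (Tr x)\<^sup>2))" using elim by simp
      also have "\<dots> = h x"
      proof -
        have "(X * A) / (t * (X * c)) = A / (t * c)" if "X \<noteq> 0" for X A t c :: real using that by simp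
        then show ?thesis unfolding E unfolding P h_def using nz by (simp del: power_Suc)
      qed
      finally show ?case by (metis real_sqrt_abs)
    qed
  qed
  ultimately show ?thesis by (intro exI) (rule Lim_transform_eventually)
qed

text \<open>A continuous density on the whole interior has to be exhibited before the choice in
  \<open>cont_density_on\<close> says anything. The exceptional points form a null set and do not
  affect the measure.\<close>

theorem om0_density:
  obtains f where "is_cont_density_on (interior {x. \<bar>Tr x\<bar> \<le> 2}) om0 f" "\<And>x. x \<in> Om \<Longrightarrow> f x = \<bar>Th' x\<bar> / (real N * pi)"
proof -
  define S where "S = interior {x. \<bar>Tr x\<bar> \<le> 2}"
  have SO: "x \<in> Om" if "x \<in> S - Zs" for x using that interior_subset[of "{x. \<bar>Tr x\<bar> \<le> 2}"] by (force simp: S_def Om_def Zs_def)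
  obtain f where f: "continuous_on S f" "\<And>x. x \<notin> Zs \<Longrightarrow> f x = \<bar>Th' x\<bar>"
  proof (rule continuous_extension_finite[of S Zs "\<lambda>x. \<bar>Th' x\<bar>"])
    show "isCont (\<lambda>x. \<bar>Th' x\<bar>) x" if "x \<in> S - Zs" for x
      using sqrt_pos[OF SO[OF that]] unfolding Th'_def Tr_def by (intro continuous_intros) auto
    show "\<exists>l. ((\<lambda>x. \<bar>Th' x\<bar>) \<longlongrightarrow> l) (at x)" if "x \<in> S \<inter> Zs" for x using that by (intro Th'_limit) (auto simp: S_def)
  qed (auto simp: S_def finite_Zs)
  define F where "F x = \<bar>f x\<bar> / (real N * pi)" for x
  have FO: "F x = \<bar>Th' x\<bar> / (real N * pi)" if "x \<notin> Zs" for x using f(2)[OF that] by (simp add: F_def)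
  have "is_cont_density_on S om0 F" unfolding is_cont_density_on_def
  proof (intro conjI ballI impI)
    show "continuous_on S F" unfolding F_def[abs_def] using N1 by (intro continuous_intros f(1)) simp
    show "0 \<le> F x" for x by (simp add: F_def)
    fix A :: "real set" assume A: "A \<in> sets borel" "A \<subseteq> S"
    have "emeasure om0 A = (\<integral>\<^sup>+x. ennreal (\<bar>Th' x\<bar> / (real N * pi)) * indicator Om x * indicator A x \<partial>lborel)"
      unfolding om0_def by (rule emeasure_density) (use A in measurable)
    also have "\<dots> = (\<integral>\<^sup>+x\<in>A. ennreal (F x) \<partial>lborel)"
    proof (rule nn_integral_cong_AE)
      have "AE x in lborel. x \<notin> Zs" using finite_imp_null_set_lborel[OF finite_Zs] by (rule AE_not_in)
      then show "AE x in lborel. ennreal (\<bar>Th' x\<bar> / (real N * pi)) * indicator Om x * indicator A x = ennreal (F x) * indicator A x"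
        by eventually_elim (use SO A FO in \<open>auto simp: indicator_def\<close>)
    qed
    finally show "emeasure om0 A = (\<integral>\<^sup>+x\<in>A. ennreal (F x) \<partial>lborel)" .
  qed
  moreover have "F x = \<bar>Th' x\<bar> / (real N * pi)" if "x \<in> Om" for x by (rule FO) (use that in \<open>auto simp: Om_def Zs_def\<close>)
  ultimately show ?thesis using that unfolding S_def by blast
qed

theorem equilibrium_density:
  assumes "equilibrium_measure {x. \<bar>Tr x\<bar> \<le> 2} \<omega>" "\<bar>Tr x\<bar> < 2"
  shows "cont_density_on (interior {x. \<bar>Tr x\<bar> \<le> 2}) \<omega> x = \<bar>Th' x\<bar> / (real N * pi)"
proof -
  have x: "x \<in> Om" using assms(2) by (simp add: Om_def)
  have "Om \<subseteq> interior {x. \<bar>Tr x\<bar> \<le> 2}" by (rule interior_maximal[OF _ open_Om]) (auto simp: Om_def)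
  then have xi: "x \<in> interior {x. \<bar>Tr x\<bar> \<le> 2}" using x by blast
  show ?thesis
  proof (rule om0_density)
    fix f assume f: "is_cont_density_on (interior {x. \<bar>Tr x\<bar> \<le> 2}) om0 f" "\<And>x. x \<in> Om \<Longrightarrow> f x = \<bar>Th' x\<bar> / (real N * pi)"
    show ?thesis unfolding equilibrium_measure_eq[OF assms(1)]
      using cont_density_on_eq[OF open_interior f(1) xi] f(2)[OF x] by simp
  qed
qed

end

section \<open>Poisson integrals\<close>

lemma cauchy_kernel_integral:
  fixes s t :: real
  assumes "t > 0"
  shows "integrable lborel (\<lambda>x. t / ((x - s)\<^sup>2 + t\<^sup>2))" "(\<integral>x. t / ((x - s)\<^sup>2 + t\<^sup>2) \<partial>lborel) = pi"
proof -
  have pos: "(x - s)\<^sup>2 + t\<^sup>2 > 0" for x using assms by (simp add: add_nonneg_pos)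
  have der: "DERIV (\<lambda>x. arctan ((x - s) / t)) x :> t / ((x - s)\<^sup>2 + t\<^sup>2)" for x
  proof -
    have "DERIV (\<lambda>x. arctan ((x - s) / t)) x :> (1 / t) / (1 + ((x - s) / t)\<^sup>2)"
      using assms by (auto intro!: derivative_eq_intros simp: divide_simps)
    also have "(1 / t) / (1 + ((x - s) / t)\<^sup>2) = t / ((x - s)\<^sup>2 + t\<^sup>2)"
      using assms pos[of x] by (simp add: power_divide divide_simps) (simp add: power2_eq_square algebra_simps)
    finally show ?thesis .
  qed
  have lin: "filterlim (\<lambda>x. (x - s) / t) at_top at_top" "filterlim (\<lambda>x. (x - s) / t) at_bot at_bot"
    using assms by real_asymp+
  have lims: "((\<lambda>x. arctan ((x - s) / t)) \<longlongrightarrow> pi/2) at_top" "((\<lambda>x. arctan ((x - s) / t)) \<longlongrightarrow> - (pi/2)) at_bot"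
    by (rule filterlim_compose[OF tendsto_arctan_at_top lin(1)]) (rule filterlim_compose[OF tendsto_arctan_at_bot lin(2)])
  note ftc = interval_integral_FTC_nonneg[where F="\<lambda>x. arctan ((x - s) / t)" and f="\<lambda>x. t / ((x - s)\<^sup>2 + t\<^sup>2)" and a="-\<infinity>" and b="\<infinity>" and A="-(pi/2)" and B="pi/2"]
  have c: "isCont (\<lambda>x. t / ((x - s)\<^sup>2 + t\<^sup>2)) x" for x
    using pos[of x] by (intro continuous_intros) auto
  have 1: "set_integrable lborel (einterval (-\<infinity>) \<infinity>) (\<lambda>x. t / ((x - s)\<^sup>2 + t\<^sup>2))"
    by (rule ftc(1)) (use der c pos assms lims in \<open>auto simp: less_imp_le ereal_tendsto_simps\<close>)
  have 2: "(LBINT x=-\<infinity>..\<infinity>. t / ((x - s)\<^sup>2 + t\<^sup>2)) = pi/2 - (-(pi/2))"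
    by (rule ftc(2)) (use der c pos assms lims in \<open>auto simp: less_imp_le ereal_tendsto_simps\<close>)
  show "integrable lborel (\<lambda>x. t / ((x - s)\<^sup>2 + t\<^sup>2))" using 1 by (simp add: set_integrable_def)
  show "(\<integral>x. t / ((x - s)\<^sup>2 + t\<^sup>2) \<partial>lborel) = pi" using 2 by (simp add: interval_lebesgue_integral_def set_lebesgue_integral_def)
qed

text \<open>Cauchy's theorem for \<open>f\<close>: subtracting \<open>m w\<close> removes the
  singularity at \<open>w\<close>, and the pole at \<open>cnj w\<close> lies outside the closed
  half-plane. The half circle of radius \<open>R\<close> contributes O(1 / R), so the integral over
  the real line is 0. There \<open>f * Im w\<close> is \<open>m - m w\<close> times the Poisson
  kernel, whose integral is \<open>pi\<close>.\<close>

lemma halfplane_poisson: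
  fixes m :: "complex \<Rightarrow> complex"
  assumes cont: "continuous_on {z. Im z \<ge> 0} m" and hol: "\<And>z. Im z > 0 \<Longrightarrow> m field_differentiable (at z)"
    and bd: "\<And>z. Im z \<ge> 0 \<Longrightarrow> cmod (m z) \<le> B" and w: "Im w > 0"
  shows "integrable lborel (\<lambda>x. m (of_real x) * of_real (Im w / ((x - Re w)\<^sup>2 + (Im w)\<^sup>2)))"
    and "(\<integral>x. m (of_real x) * of_real (Im w / ((x - Re w)\<^sup>2 + (Im w)\<^sup>2)) \<partial>lborel) = pi * m w"
proof -
  define S where "S = {z::complex. Im z \<ge> 0}"
  define g where "g = (\<lambda>z. if z = w then deriv m w else (m z - m w) / (z - w))"
  define f where "f = (\<lambda>z. g z / (z - cnj w))"
  have B0: "B \<ge> 0" using order_trans[OF norm_ge_zero[of "m 0"] bd[of 0]] by simp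
  have wS: "w \<in> S" using w by (simp add: S_def)
  have nz: "z - cnj w \<noteq> 0" if "z \<in> S" for z using that w by (auto simp: S_def complex_eq_iff)
  have contg: "continuous_on S g"
    unfolding continuous_on_eq_continuous_within
  proof
    fix z assume z: "z \<in> S"
    show "continuous (at z within S) g"
    proof (cases "z = w")
      case True
      have "(m has_field_derivative deriv m w) (at w)"
        using hol[OF w] by (simp add: field_differentiable_derivI)
      then have "((\<lambda>z. (m z - m w) / (z - w)) \<longlongrightarrow> deriv m w) (at w)"
        by (simp add: has_field_derivative_iff)
      then have "(g \<longlongrightarrow> deriv m w) (at w)"
        by (rule Lim_transform_eventually) (auto simp: g_def eventually_at_filter)
      moreover have "g w = deriv m w" by (simp add: g_def)
      ultimately have "isCont g w" by (simp add: isCont_def)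
      then show ?thesis unfolding True by (rule continuous_at_imp_continuous_at_within)
    next
      case False
      have "continuous (at z within S) (\<lambda>z. (m z - m w) / (z - w))"
        using cont z False unfolding S_def continuous_on_eq_continuous_within by (intro continuous_intros) auto
      then show ?thesis
        by (rule continuous_transform_within[where \<delta>="dist z w"]) (use False z in \<open>auto simp: g_def dist_commute\<close>)
    qed
  qed
  have contf: "continuous_on S f"
    unfolding f_def by (intro continuous_intros contg) (use nz in auto)
  have int: "interior S = {z. Im z > 0}"
    using interior_halfspace_ge[of \<i> 0] by (simp add: S_def)
  have diff: "f field_differentiable (at z)" if z: "z \<in> interior S - {w}" for z
  proof -
    have z': "Im z > 0" "z \<noteq> w" using z int by auto
    have zS: "z \<in> S" using z' by (simp add: S_def)
    have "(\<lambda>z. (m z - m w) / (z - w) / (z - cnj w)) field_differentiable (at z)"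
      using z' nz[OF zS] by (intro field_differentiable_divide field_differentiable_diff hol) auto
    then show ?thesis
      by (rule field_differentiable_transform_within[where d="dist z w" and S=UNIV, rotated 3]) (use z' in \<open>auto simp: f_def g_def dist_commute\<close>)
  qed
  have convS: "convex S" using convex_halfspace_Im_ge[of 0] by (simp add: S_def)
  \<comment> \<open>For \<open>R \<ge> 2 * cmod w\<close> both factors of the denominator have
    modulus at least \<open>R / 2\<close> on the half circle, and the numerator is at most
    \<open>2 * B\<close>; the arc has length \<open>pi * R\<close>.\<close>
  have zero: "cmod (integral {-R..R} (\<lambda>x. f (of_real x))) \<le> 8 * pi * B / R" if R: "R > 0" "R \<ge> 2 * cmod w" for R
  proof -
    define l where "l = linepath (-complex_of_real R) (of_real R)"
    define c where "c = part_circlepath 0 R 0 pi"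
    have li: "path_image l \<subseteq> S"
      unfolding l_def path_image_linepath by (rule closed_segment_subset) (auto simp: S_def convS[unfolded S_def])
    have ci: "path_image c \<subseteq> S"
    proof
      fix z assume "z \<in> path_image c"
      then have "z \<in> (\<lambda>x. 0 + complex_of_real R * cis x) ` {0..pi}"
        unfolding c_def path_image_part_circlepath' by (simp only: closed_segment_eq_real_ivl pi_ge_zero if_True)
      then obtain t where zt: "z = 0 + complex_of_real R * cis t" and t: "t \<in> {0..pi}" by (rule imageE)
      have "z = of_real R * cis t" "0 \<le> t" "t \<le> pi" using zt t by auto
      then show "z \<in> S" using R sin_ge_zero[of t] by (simp add: S_def)
    qed
    have join: "pathfinish l = pathstart c" by (simp add: l_def c_def)
    have clo: "pathfinish (l +++ c) = pathstart (l +++ c)" by (simp add: l_def c_def exp_eq_polar)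
    have vp: "valid_path l" "valid_path c" by (simp_all add: l_def c_def)
    have "(f has_contour_integral 0) (l +++ c)"
    proof (rule Cauchy_theorem_convex[OF contf convS, where K="{w}"])
      show "valid_path (l +++ c)" using vp join by (rule valid_path_join)
      show "path_image (l +++ c) \<subseteq> S" using path_image_join_subset li ci by blast
    qed (use diff clo in auto)
    moreover have il: "f contour_integrable_on l" unfolding l_def
      by (rule contour_integrable_continuous_linepath) (use li contf continuous_on_subset in \<open>auto simp: l_def\<close>)
    have ic: "f contour_integrable_on c" unfolding c_def
      by (rule contour_integrable_continuous_part_circlepath) (use ci contf continuous_on_subset in \<open>auto simp: c_def\<close>)
    ultimately have "contour_integral l f + contour_integral c f = 0"
      using contour_integral_join[OF il ic vp] by (simp add: contour_integral_unique)
    then have eq: "contour_integral l f = - contour_integral c f" by (simp add: eq_neg_iff_add_eq_0)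
    have "cmod (contour_integral c f) \<le> (8 * B / R\<^sup>2) * R * \<bar>pi - 0\<bar>"
      unfolding c_def
    proof (rule contour_integral_bound_part_circlepath)
      show "f contour_integrable_on part_circlepath 0 R 0 pi" using ic by (simp add: c_def)
      fix z assume z: "z \<in> path_image (part_circlepath 0 R 0 pi)"
      have zR: "cmod z = R" using in_path_image_part_circlepath[OF z] R by simp
      have zS: "z \<in> S" using z ci by (auto simp: c_def)
      have d1: "cmod (z - w) \<ge> R/2" "cmod (z - cnj w) \<ge> R/2"
        using norm_triangle_ineq2[of z w] norm_triangle_ineq2[of z "cnj w"] zR R(2) by simp_all
      have zw: "z \<noteq> w" using d1(1) R(1) by auto
      have "cmod (f z) = cmod (m z - m w) / (cmod (z - w) * cmod (z - cnj w))"
        using zw by (simp add: f_def g_def norm_divide norm_mult)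
      also have "\<dots> \<le> (2 * B) / (R/2 * (R/2))"
      proof (rule frac_le)
        show "cmod (m z - m w) \<le> 2 * B"
          using norm_triangle_ineq4[of "m z" "m w"] bd[of z] bd[of w] zS wS by (simp add: S_def)
        show "R/2 * (R/2) \<le> cmod (z - w) * cmod (z - cnj w)" by (rule mult_mono) (use d1 R in auto)
      qed (use R B0 in auto)
      also have "\<dots> = 8 * B / R\<^sup>2" by (simp add: power2_eq_square)
      finally show "cmod (f z) \<le> 8 * B / R\<^sup>2" .
    qed (use R B0 in auto)
    also have "(8 * B / R\<^sup>2) * R * \<bar>pi - 0\<bar> = 8 * pi * B / R" using R by (simp add: power2_eq_square)
    finally have 1: "cmod (contour_integral l f) \<le> 8 * pi * B / R" using eq by simp
    have "contour_integral l f = integral {-R..R} (\<lambda>x. f (of_real x))"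
      unfolding l_def using contour_integral_linepath_Reals_eq[of "- complex_of_real R" "of_real R" f] R by simp
    then show ?thesis using 1 by simp
  qed
  have fx: "f (of_real x) * of_real (Im w) = (m (of_real x) - m w) * of_real (Im w / ((x - Re w)\<^sup>2 + (Im w)\<^sup>2))" for x
  proof -
    have "of_real x \<noteq> w" using w by (auto simp: complex_eq_iff)
    moreover have "(of_real x - w) * (of_real x - cnj w) = of_real ((x - Re w)\<^sup>2 + (Im w)\<^sup>2)"
      by (simp add: complex_eq_iff power2_eq_square algebra_simps)
    ultimately show ?thesis by (simp add: f_def g_def flip: of_real_power of_real_add of_real_diff)
  qed
  define k where "k x = Im w / ((x - Re w)\<^sup>2 + (Im w)\<^sup>2)" for x
  have k: "integrable lborel k" "integral\<^sup>L lborel k = pi" unfolding k_def[abs_def] using cauchy_kernel_integral[OF w] by auto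
  have k0: "k x \<ge> 0" for x unfolding k_def using w by simp
  have contm: "continuous_on UNIV (\<lambda>x. m (complex_of_real x))"
    by (rule continuous_on_compose2[OF cont]) (auto intro!: continuous_intros)
  have mm: "(\<lambda>x. m (complex_of_real x)) \<in> borel_measurable borel" by (rule borel_measurable_continuous_onI[OF contm])
  have kk: "k \<in> borel_measurable borel" using k(1) by auto
  show i1: "integrable lborel (\<lambda>x. m (of_real x) * of_real (Im w / ((x - Re w)\<^sup>2 + (Im w)\<^sup>2)))"
    unfolding k_def[symmetric]
  proof (rule Bochner_Integration.integrable_bound[of lborel "\<lambda>x. B * k x"])
    show "integrable lborel (\<lambda>x. B * k x)" using k by simp
    show "(\<lambda>x. m (complex_of_real x) * complex_of_real (k x)) \<in> borel_measurable lborel" using mm kk by measurable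
    show "AE x in lborel. norm (m (complex_of_real x) * complex_of_real (k x)) \<le> norm (B * k x)"
      using bd k0 B0 by (auto simp: norm_mult abs_mult intro!: mult_right_mono)
  qed
  have i2: "integrable lborel (\<lambda>x. m w * of_real (k x))" using k by (intro integrable_mult_right integrable_of_real)
  define F where "F = (\<lambda>x. f (complex_of_real x) * of_real (Im w))"
  have F_eq: "F x = m (of_real x) * of_real (k x) - m w * of_real (k x)" for x
    unfolding F_def fx k_def by (simp only: left_diff_distrib)
  have iF: "integrable lborel F" unfolding F_eq[abs_def] using i1 i2 unfolding k_def[symmetric] by (rule Bochner_Integration.integrable_diff)
  have "(\<lambda>n. \<integral>x. indicator {-real n..real n} x *\<^sub>R F x \<partial>lborel) \<longlonglongrightarrow> integral\<^sup>L lborel F"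
  proof (rule integral_dominated_convergence[where w="\<lambda>x. norm (F x)"])
    show "AE x in lborel. (\<lambda>n. indicator {-real n..real n} x *\<^sub>R F x) \<longlonglongrightarrow> F x"
    proof (rule AE_I2)
      fix x :: real
      have "\<forall>\<^sub>F n in sequentially. indicator {-real n..real n} x *\<^sub>R F x = F x"
        using eventually_ge_at_top[of "nat \<lceil>\<bar>x\<bar>\<rceil>"]
      proof eventually_elim
        case (elim n)
        then have "\<bar>x\<bar> \<le> real n" by linarith
        then show ?case by (auto simp: indicator_def)
      qed
      then show "(\<lambda>n. indicator {-real n..real n} x *\<^sub>R F x) \<longlonglongrightarrow> F x" by (rule tendsto_eventually)
    qed
  qed (use iF in \<open>auto simp: indicator_def\<close>)
  moreover have "(\<lambda>n. \<integral>x. indicator {-real n..real n} x *\<^sub>R F x \<partial>lborel) \<longlonglongrightarrow> 0"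
  proof (rule Lim_null_comparison)
    show "\<forall>\<^sub>F n in sequentially. norm (\<integral>x. indicator {-real n..real n} x *\<^sub>R F x \<partial>lborel) \<le> (8 * pi * B * Im w) / real n"
      using eventually_ge_at_top[of "nat \<lceil>2 * cmod w\<rceil>"] eventually_gt_at_top[of 0]
    proof eventually_elim
      case (elim n)
      have "set_integrable lborel {-real n..real n} F"
        unfolding set_integrable_def by (rule integrable_mult_indicator[OF _ iF]) simp
      from set_borel_integral_eq_integral(2)[OF this]
      have "(\<integral>x. indicator {-real n..real n} x *\<^sub>R F x \<partial>lborel) = integral {-real n..real n} F"
        by (simp add: set_lebesgue_integral_def)
      also have "\<dots> = integral {-real n..real n} (\<lambda>x. f (of_real x)) * of_real (Im w)"
        unfolding F_def by simp
      finally have "norm (\<integral>x. indicator {-real n..real n} x *\<^sub>R F x \<partial>lborel) = cmod (integral {-real n..real n} (\<lambda>x. f (of_real x))) * Im w"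
        using w by (simp add: norm_mult)
      also have "\<dots> \<le> (8 * pi * B / real n) * Im w"
      proof -
        have "0 < real n" "2 * cmod w \<le> real n" using elim by linarith+
        then show ?thesis using w by (intro mult_right_mono zero) auto
      qed
      finally show ?case by simp
    qed
    show "(\<lambda>n. (8 * pi * B * Im w) / real n) \<longlonglongrightarrow> 0" by real_asymp
  qed
  ultimately have "integral\<^sup>L lborel F = 0" using LIMSEQ_unique by blast
  moreover have "integral\<^sup>L lborel F = (\<integral>x. m (of_real x) * of_real (k x) \<partial>lborel) - (\<integral>x. m w * of_real (k x) \<partial>lborel)"
    unfolding F_eq[abs_def] using i1 i2 unfolding k_def[symmetric] by (rule Bochner_Integration.integral_diff)
  moreover have "(\<integral>x. m w * of_real (k x) \<partial>lborel) = m w * of_real pi" using k by simp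
  ultimately show "(\<integral>x. m (of_real x) * of_real (Im w / ((x - Re w)\<^sup>2 + (Im w)\<^sup>2)) \<partial>lborel) = pi * m w"
    unfolding k_def[symmetric] by simp
qed

text \<open>Fourier transforms turn the Poisson smoothing of a measure into multiplication by the
  characteristic function of a Cauchy distribution, which does not vanish near the origin.\<close>

definition cauchy_dist :: "real measure" where
  "cauchy_dist = density lborel (\<lambda>x. ennreal (1 / (pi * (1 + x\<^sup>2))))"

lemma cauchy_dist_real_distribution: "real_distribution cauchy_dist"
proof -
  have fe: "1 / (pi * (1 + x\<^sup>2)) = 1 / pi * (1 / ((x - 0)\<^sup>2 + 1\<^sup>2))" for x :: real by (simp add: add.commute)
  have "(\<integral>\<^sup>+x. ennreal (1 / (pi * (1 + x\<^sup>2))) \<partial>lborel) = ennreal (\<integral>x. 1 / pi * (1 / ((x - 0)\<^sup>2 + 1\<^sup>2)) \<partial>lborel)"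
    unfolding fe
  proof (rule nn_integral_eq_integral)
    show "integrable lborel (\<lambda>x::real. 1 / pi * (1 / ((x - 0)\<^sup>2 + 1\<^sup>2)))"
      using cauchy_kernel_integral(1)[of 1 0] by (intro integrable_mult_right) simp
  qed (auto intro!: AE_I2)
  also have "(\<integral>x. 1 / pi * (1 / ((x - 0)\<^sup>2 + 1\<^sup>2)) \<partial>lborel) = 1"
    unfolding integral_mult_right_zero cauchy_kernel_integral(2)[OF zero_less_one] by simp
  finally have "emeasure cauchy_dist (space cauchy_dist) = 1"
    unfolding cauchy_dist_def by (subst emeasure_density) auto
  then have "prob_space cauchy_dist" by (rule prob_spaceI)
  then show ?thesis by (simp add: real_distribution_def real_distribution_axioms_def cauchy_dist_def)
qed

lemma poisson_fourier:
  fixes M :: "real measure"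
  assumes M: "finite_measure M" "sets M = sets borel" and t: "t > 0"
  shows "(CLBINT s. iexp (\<xi> * s) * complex_of_real (\<integral>x. t / ((x - s)\<^sup>2 + t\<^sup>2) \<partial>M)) = pi * char cauchy_dist (\<xi> * t) * char M \<xi>"
proof -
  interpret M: finite_measure M by fact
  interpret pair_sigma_finite M lborel ..
  note [measurable_cong] = M(2)
  define K where "K = (\<lambda>x s. iexp (\<xi> * s) * complex_of_real (t / ((x - s)\<^sup>2 + t\<^sup>2)))"
  have nK: "norm (K x s) = t / ((s - x)\<^sup>2 + t\<^sup>2)" for x s
    unfolding K_def norm_mult norm_of_real using t by (simp add: power2_commute)
  have Km: "case_prod K \<in> borel_measurable (M \<Otimes>\<^sub>M lborel)" unfolding K_def by measurable
  have Ki: "integrable lborel (K x)" for x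
  proof (rule Bochner_Integration.integrable_bound[OF cauchy_kernel_integral(1)[OF t, of x]])
    show "K x \<in> borel_measurable lborel" unfolding K_def by measurable
    show "AE s in lborel. norm (K x s) \<le> norm (t / ((s - x)\<^sup>2 + t\<^sup>2))" by (intro AE_I2) (simp only: nK real_norm_def abs_ge_self)
  qed
  have pairI: "integrable (M \<Otimes>\<^sub>M lborel) (case_prod K)"
  proof (rule Fubini_integrable[OF Km])
    show "integrable M (\<lambda>x. \<integral>y. norm (case_prod K (x, y)) \<partial>lborel)"
      unfolding prod.case nK cauchy_kernel_integral(2)[OF t] by simp
  qed (simp add: Ki)
  \<comment> \<open>The substitution \<open>s = x + t * r\<close> centres and rescales the kernel.
    The centre leaves the factor \<open>iexp (\<xi> * x)\<close>, which later integrates to the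
    characteristic function of \<open>M\<close>.\<close>
  have inner: "(\<integral>s. K x s \<partial>lborel) = iexp (\<xi> * x) * (pi * char cauchy_dist (\<xi> * t))" for x
  proof -
    have "(\<integral>s. K x s \<partial>lborel) = \<bar>t\<bar> *\<^sub>R (\<integral>r. K x (x + t * r) \<partial>lborel)"
      by (rule lborel_integral_real_affine) (use t in simp)
    also have "\<dots> = (\<integral>r. \<bar>t\<bar> *\<^sub>R K x (x + t * r) \<partial>lborel)" by simp
    also have "(\<lambda>r. \<bar>t\<bar> *\<^sub>R K x (x + t * r)) = (\<lambda>r. iexp (\<xi> * x) * (pi * ((1 / (pi * (1 + r\<^sup>2))) *\<^sub>R iexp ((\<xi> * t) * r))))"
    proof
      fix r :: real
      have pos: "1 + r\<^sup>2 > 0" using zero_le_power2[of r] by linarith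
      have "t * (t / ((x - (x + t * r))\<^sup>2 + t\<^sup>2)) = 1 / (1 + r\<^sup>2)"
      proof -
        have "(x - (x + t * r))\<^sup>2 + t\<^sup>2 = t\<^sup>2 * (1 + r\<^sup>2)" by (simp add: power2_eq_square algebra_simps)
        then show ?thesis using t pos by (simp add: power2_eq_square)
      qed
      then have "\<bar>t\<bar> *\<^sub>R K x (x + t * r) = iexp (\<xi> * (x + t * r)) * complex_of_real (1 / (1 + r\<^sup>2))"
        unfolding K_def using t by (simp only: scaleR_conv_of_real abs_of_pos of_real_mult[symmetric] mult.left_commute[of "complex_of_real t"])
      also have "iexp (\<xi> * (x + t * r)) = iexp (\<xi> * x) * iexp ((\<xi> * t) * r)"
        by (simp add: exp_add[symmetric] algebra_simps)
      finally show "\<bar>t\<bar> *\<^sub>R K x (x + t * r) = iexp (\<xi> * x) * (pi * ((1 / (pi * (1 + r\<^sup>2))) *\<^sub>R iexp ((\<xi> * t) * r)))"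
        by (simp add: scaleR_conv_of_real)
    qed
    also have "(\<integral>r. iexp (\<xi> * x) * (pi * ((1 / (pi * (1 + r\<^sup>2))) *\<^sub>R iexp ((\<xi> * t) * r))) \<partial>lborel)
       = iexp (\<xi> * x) * (pi * (\<integral>r. (1 / (pi * (1 + r\<^sup>2))) *\<^sub>R iexp ((\<xi> * t) * r) \<partial>lborel))"
      by (simp only: integral_mult_right_zero)
    also have "(\<integral>r. (1 / (pi * (1 + r\<^sup>2))) *\<^sub>R iexp ((\<xi> * t) * r) \<partial>lborel) = char cauchy_dist (\<xi> * t)"
      unfolding char_def cauchy_dist_def by (subst integral_density) (auto intro!: add_nonneg_nonneg)
    finally show ?thesis .
  qed
  have "(CLBINT s. iexp (\<xi> * s) * complex_of_real (\<integral>x. t / ((x - s)\<^sup>2 + t\<^sup>2) \<partial>M)) = (\<integral>s. (\<integral>x. K x s \<partial>M) \<partial>lborel)"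
    unfolding K_def by (simp only: integral_mult_right_zero integral_complex_of_real)
  also have "\<dots> = (\<integral>x. (\<integral>s. K x s \<partial>lborel) \<partial>M)" by (rule Fubini_integral[OF pairI])
  also have "\<dots> = (\<integral>x. iexp (\<xi> * x) * (pi * char cauchy_dist (\<xi> * t)) \<partial>M)" unfolding inner ..
  also have "\<dots> = char M \<xi> * (pi * char cauchy_dist (\<xi> * t))"
    unfolding char_def by (simp only: integral_mult_left_zero)
  finally show ?thesis by (simp add: mult_ac)
qed

text \<open>For each frequency a small \<open>t\<close> makes the Cauchy factor nonzero, because it
  is continuous with value 1 at 0. In the application the mass of \<open>M2\<close> is a priori only
  known to be at most 1; that it equals 1 is read off from the characteristic functions at
  0.\<close>

lemma poisson_unique:
  fixes M1 M2 :: "real measure"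
  assumes M1: "real_distribution M1" and M2: "finite_measure M2" "sets M2 = sets borel"
    and eq: "\<And>s t. t > 0 \<Longrightarrow> (\<integral>x. t / ((x - s)\<^sup>2 + t\<^sup>2) \<partial>M1) = (\<integral>x. t / ((x - s)\<^sup>2 + t\<^sup>2) \<partial>M2)"
  shows "M1 = M2"
proof -
  interpret M1: real_distribution M1 by fact
  interpret C: real_distribution cauchy_dist by (rule cauchy_dist_real_distribution)
  interpret M2: finite_measure M2 by fact
  have ch: "char M1 \<xi> = char M2 \<xi>" for \<xi>
  proof -
    have "((\<lambda>t. char cauchy_dist (\<xi> * t)) \<longlongrightarrow> char cauchy_dist (\<xi> * 0)) (at_right 0)"
      by (intro isCont_tendsto_compose[OF C.isCont_char] tendsto_intros)
    then have "((\<lambda>t. char cauchy_dist (\<xi> * t)) \<longlongrightarrow> 1) (at_right 0)" by (simp add: C.char_zero)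
    then have "\<forall>\<^sub>F t in at_right 0. char cauchy_dist (\<xi> * t) \<noteq> 0" by (rule tendsto_imp_eventually_ne) simp
    moreover have "\<forall>\<^sub>F t in at_right 0. (0::real) < t" by (simp add: eventually_at_right_less)
    ultimately have "\<forall>\<^sub>F t in at_right 0. char cauchy_dist (\<xi> * t) \<noteq> 0 \<and> 0 < t" by (rule eventually_conj)
    from eventually_happens[OF this] obtain t where t: "char cauchy_dist (\<xi> * t) \<noteq> 0" "t > 0" by auto
    have "pi * char cauchy_dist (\<xi> * t) * char M1 \<xi> = pi * char cauchy_dist (\<xi> * t) * char M2 \<xi>"
      unfolding poisson_fourier[OF M1.finite_measure_axioms M1.events_eq_borel t(2), symmetric]
        poisson_fourier[OF M2 t(2), symmetric] eq[OF t(2)] ..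
    then show ?thesis using t(1) by simp
  qed
  have "char M2 0 = 1" using ch[of 0] M1.char_zero by simp
  then have "complex_of_real (measure M2 (space M2)) = 1" by (simp add: char_def scaleR_conv_of_real)
  then have "measure M2 (space M2) = 1" by (simp only: of_real_eq_1_iff)
  then have "prob_space M2" by (intro prob_spaceI) (simp add: M2.emeasure_eq_measure)
  then have "real_distribution M2" using M2 by (simp add: real_distribution_def real_distribution_axioms_def)
  then show ?thesis using M1 ch by (intro Levy_uniqueness) auto
qed

section \<open>Weyl functions and the orthogonality measure\<close>

lemma jacobi_rec_eq:
  assumes "jacobi_rec a b z U" "a (Suc n) > 0"
  shows "of_real (a (Suc n)) * U (Suc (Suc n)) = (z - of_real (b (Suc n))) * U (Suc n) - of_real (a n) * U n"
proof -
  have "U (Suc (Suc n)) = (z - of_real (b (Suc n))) / of_real (a (Suc n)) * U (Suc n) - of_real (a n / a (Suc n)) * U n"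
    using assms(1) unfolding jacobi_rec_def by blast
  then show ?thesis using assms(2) by (simp only:) (simp add: right_diff_distrib)
qed

text \<open>Green's formula for the recurrence with the inhomogeneity \<open>e\<close> at the left end point.\<close>

lemma jacobi_green:
  fixes z e :: complex
  assumes a: "\<And>n. a n > 0" and U: "jacobi_rec a b z U" and e: "of_real (a 0) * U 1 = (z - of_real (b 0)) * U 0 + e"
  shows "Im z * (\<Sum>j\<le>n. (cmod (U j))\<^sup>2) = a n * Im (U (Suc n) * cnj (U n)) - Im (e * cnj (U 0))"
proof (induction n)
  case 0
  have "a 0 * Im (U 1 * cnj (U 0)) = Im (of_real (a 0) * U 1 * cnj (U 0))" by (simp add: algebra_simps)
  also have "\<dots> = Im (((z - of_real (b 0)) * U 0 + e) * cnj (U 0))" unfolding e ..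
  also have "\<dots> = Im z * (cmod (U 0))\<^sup>2 + Im (e * cnj (U 0))"
    unfolding cmod_power2 by (simp add: power2_eq_square algebra_simps)
  finally show ?case by simp
next
  case (Suc n)
  have "a (Suc n) * Im (U (Suc (Suc n)) * cnj (U (Suc n))) = Im (of_real (a (Suc n)) * U (Suc (Suc n)) * cnj (U (Suc n)))" by (simp add: algebra_simps)
  also have "\<dots> = Im (((z - of_real (b (Suc n))) * U (Suc n) - of_real (a n) * U n) * cnj (U (Suc n)))"
    unfolding jacobi_rec_eq[OF U a] ..
  also have "\<dots> = Im z * (cmod (U (Suc n)))\<^sup>2 + a n * Im (U (Suc n) * cnj (U n))"
    unfolding cmod_power2 by (simp add: power2_eq_square algebra_simps)
  finally show ?case using Suc by (simp add: algebra_simps)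
qed

lemma orthP_start: "a 0 > 0 \<Longrightarrow> of_real (a 0) * orthP a b 1 z = (z - of_real (b 0)) * orthP a b 0 z + 0"
  and orthQ_start: "a 0 > 0 \<Longrightarrow> of_real (a 0) * orthQ a b 1 z = (z - of_real (b 0)) * orthQ a b 0 z + 1"
  by (simp_all add: orthP_def orthQ_def)

lemma orthP_0: "orthP a b 0 z = 1" and orthQ_0: "orthQ a b 0 z = 0" by (simp_all add: orthP_def orthQ_def)

definition weyl_num :: "(nat \<Rightarrow> real) \<Rightarrow> (nat \<Rightarrow> real) \<Rightarrow> complex \<Rightarrow> nat \<Rightarrow> complex \<Rightarrow> complex" where
  "weyl_num a b \<zeta> n z = orthQ a b (Suc n) z - \<zeta> * orthQ a b n z"

definition weyl_den :: "(nat \<Rightarrow> real) \<Rightarrow> (nat \<Rightarrow> real) \<Rightarrow> complex \<Rightarrow> nat \<Rightarrow> complex \<Rightarrow> complex" where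
  "weyl_den a b \<zeta> n z = orthP a b (Suc n) z - \<zeta> * orthP a b n z"

text \<open>The number \<open>m\<close> for which \<open>U = m * orthP + orthQ\<close> satisfies the
  boundary condition \<open>U (Suc n) = \<zeta> * U n\<close>.\<close>

definition weyl_m :: "(nat \<Rightarrow> real) \<Rightarrow> (nat \<Rightarrow> real) \<Rightarrow> complex \<Rightarrow> nat \<Rightarrow> complex \<Rightarrow> complex" where
  "weyl_m a b \<zeta> n z = - weyl_num a b \<zeta> n z / weyl_den a b \<zeta> n z"

text \<open>At a zero \<open>orthP\<close> itself would satisfy the boundary condition. Green's
  formula then equates a nonnegative number with a nonpositive one, and \<open>orthP\<close> would
  vanish at two consecutive indices.\<close>

lemma weyl_den_nz:
  assumes a: "\<And>n. a n > 0" and \<zeta>: "Im \<zeta> < 0" and z: "Im z \<ge> 0"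
  shows "weyl_den a b \<zeta> n z \<noteq> 0"
proof
  assume "weyl_den a b \<zeta> n z = 0"
  then have eq: "orthP a b (Suc n) z = \<zeta> * orthP a b n z" by (simp add: weyl_den_def)
  have "Im z * (\<Sum>j\<le>n. (cmod (orthP a b j z))\<^sup>2) = a n * Im (orthP a b (Suc n) z * cnj (orthP a b n z)) - Im (0 * cnj (orthP a b 0 z))"
    by (rule jacobi_green[OF a jacobi_rec_orthP]) (rule orthP_start[OF a])
  also have "orthP a b (Suc n) z * cnj (orthP a b n z) = \<zeta> * of_real ((cmod (orthP a b n z))\<^sup>2)"
    unfolding eq complex_norm_square by simp
  finally have g: "Im z * (\<Sum>j\<le>n. (cmod (orthP a b j z))\<^sup>2) = a n * (Im \<zeta> * (cmod (orthP a b n z))\<^sup>2)" by simp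
  have "Im z * (\<Sum>j\<le>n. (cmod (orthP a b j z))\<^sup>2) \<ge> 0" using z by (intro mult_nonneg_nonneg sum_nonneg) auto
  then have "Im \<zeta> * (cmod (orthP a b n z))\<^sup>2 \<ge> 0" using g a[of n] by (simp add: zero_le_mult_iff)
  then have "orthP a b n z = 0" using \<zeta> by (simp add: zero_le_mult_iff)
  then show False using eq jacobi_comb_nonzero[OF a, where c=1 and d=0 and b=b and n=n and z=z] by simp
qed

text \<open>For the solution \<open>U\<close> with the boundary condition, the boundary term of
  Green's formula at \<open>n\<close> is nonpositive, so \<open>Im z\<close> times the square sum is
  at most \<open>cmod m\<close>. Since \<open>U 0 = m\<close>, this bounds first \<open>m\<close>
  and then the square sum.\<close>

lemma weyl_m_bounds:
  fixes a b :: "nat \<Rightarrow> real" and n :: nat and m z \<zeta> :: complex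
  assumes a: "\<And>n. a n > 0" and \<zeta>: "Im \<zeta> < 0" and z: "Im z > 0"
  defines "m \<equiv> weyl_m a b \<zeta> n z"
  shows "cmod m \<le> 1 / Im z" and "(\<Sum>j\<le>n. (cmod (m * orthP a b j z + 1 * orthQ a b j z))\<^sup>2) \<le> 1 / (Im z)\<^sup>2"
proof -
  define U where "U = (\<lambda>j. m * orthP a b j z + 1 * orthQ a b j z)"
  have U0: "U 0 = m" by (simp add: U_def orthP_0 orthQ_0)
  have nz: "weyl_den a b \<zeta> n z \<noteq> 0" by (rule weyl_den_nz[OF a \<zeta>]) (use z in simp)
  have "m * weyl_den a b \<zeta> n z + weyl_num a b \<zeta> n z = 0" using nz by (simp add: m_def weyl_m_def)
  then have Un: "U (Suc n) = \<zeta> * U n"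
    by (simp add: U_def weyl_den_def weyl_num_def algebra_simps)
  have "of_real (a 0) * U 1 = m * (of_real (a 0) * orthP a b 1 z) + of_real (a 0) * orthQ a b 1 z"
    by (simp add: U_def algebra_simps)
  also have "\<dots> = (z - of_real (b 0)) * U 0 + 1"
    unfolding orthP_start[of a, OF a] orthQ_start[of a, OF a] U_def by (simp add: algebra_simps)
  finally have st: "of_real (a 0) * U 1 = (z - of_real (b 0)) * U 0 + 1" .
  have rec: "jacobi_rec a b z U" unfolding U_def by (intro jacobi_rec_comb jacobi_rec_orthP jacobi_rec_orthQ)
  have "Im z * (\<Sum>j\<le>n. (cmod (U j))\<^sup>2) = a n * Im (U (Suc n) * cnj (U n)) - Im (1 * cnj (U 0))"
    by (rule jacobi_green[OF a rec st])
  also have "U (Suc n) * cnj (U n) = \<zeta> * of_real ((cmod (U n))\<^sup>2)" unfolding Un complex_norm_square by simp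
  finally have g: "Im z * (\<Sum>j\<le>n. (cmod (U j))\<^sup>2) = a n * (Im \<zeta> * (cmod (U n))\<^sup>2) + Im m" by (simp add: U0)
  have "a n * (Im \<zeta> * (cmod (U n))\<^sup>2) \<le> 0" using a[of n] \<zeta> by (simp add: mult_nonneg_nonpos mult_nonpos_nonneg)
  then have g2: "Im z * (\<Sum>j\<le>n. (cmod (U j))\<^sup>2) \<le> cmod m" using g abs_Im_le_cmod[of m] by linarith
  have "(cmod (U 0))\<^sup>2 \<le> (\<Sum>j\<le>n. (cmod (U j))\<^sup>2)" by (rule member_le_sum) auto
  then have "Im z * (cmod m)\<^sup>2 \<le> Im z * (\<Sum>j\<le>n. (cmod (U j))\<^sup>2)" unfolding U0 using z by (intro mult_left_mono) auto
  then have "Im z * (cmod m)\<^sup>2 \<le> cmod m" using g2 by linarith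
  then show b1: "cmod m \<le> 1 / Im z"
    using z by (cases "cmod m = 0") (auto simp: power2_eq_square field_simps)
  have "(\<Sum>j\<le>n. (cmod (U j))\<^sup>2) \<le> cmod m / Im z"
    using g2 z by (simp add: pos_le_divide_eq mult.commute)
  also have "\<dots> \<le> (1 / Im z) / Im z" using b1 z by (intro divide_right_mono) auto
  finally have "(\<Sum>j\<le>n. (cmod (U j))\<^sup>2) \<le> (1 / Im z) / Im z" .
  then show "(\<Sum>j\<le>n. (cmod (m * orthP a b j z + 1 * orthQ a b j z))\<^sup>2) \<le> 1 / (Im z)\<^sup>2"
    by (simp add: U_def power2_eq_square)
qed

text \<open>The polynomials are real on the real line, so after multiplication with the conjugate
  denominator only the Wronskian contributes to the imaginary part.\<close>

lemma weyl_m_Im_real: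
  fixes x :: real
  assumes a: "\<And>n. a n > 0" and \<zeta>: "Im \<zeta> < 0"
  shows "Im (weyl_m a b \<zeta> n (of_real x)) = - Im \<zeta> / (a n * (cmod (weyl_den a b \<zeta> n (of_real x)))\<^sup>2)"
proof -
  define P P' Q Q' where "P = orthP a b n x" "P' = orthP a b (Suc n) x" "Q = orthQ a b n x" "Q' = orthQ a b (Suc n) x"
  have W: "a n * (P * Q' - P' * Q) = 1" unfolding P_P'_Q_Q'_def using orth_wronskian[where a=a and b=b and n=n and z=x, OF a] by simp
  define D where "D = complex_of_real P' - \<zeta> * of_real P"
  define E where "E = complex_of_real Q' - \<zeta> * of_real Q"
  have DE: "weyl_den a b \<zeta> n (of_real x) = D" "weyl_num a b \<zeta> n (of_real x) = E"
    unfolding weyl_den_def weyl_num_def orthP_of_real orthQ_of_real by (simp_all add: D_def E_def P_P'_Q_Q'_def)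
  have nz: "D \<noteq> 0" unfolding DE(1)[symmetric] by (rule weyl_den_nz[OF a \<zeta>]) simp
  have "- E / D = - (E * cnj D) / of_real ((cmod D)\<^sup>2)"
    using nz unfolding complex_norm_square by simp
  then have "Im (- E / D) = Im (- (E * cnj D)) / (cmod D)\<^sup>2" by (simp only: Im_divide_of_real)
  also have "Im (- (E * cnj D)) = - Im \<zeta> * (P * Q' - P' * Q)" unfolding D_def E_def by (simp add: algebra_simps)
  also have "P * Q' - P' * Q = 1 / a n" using W a[of n] by (simp add: field_simps)
  finally show ?thesis unfolding weyl_m_def DE by simp
qed

text \<open>Far out, each step of the recurrence multiplies the modulus by at least
  \<open>K\<close>. This will keep the Weyl denominator from cancelling and make the Weyl function
  bounded near infinity.\<close>

lemma orthP_growth: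
  fixes z :: complex
  assumes a: "\<And>n. a n > 0" and K: "K \<ge> 1" and z: "cmod z \<ge> (\<Sum>j\<le>Suc n. \<bar>b j\<bar> + K * a j)" and j: "j \<le> n"
  shows "K * cmod (orthP a b j z) \<le> cmod (orthP a b (Suc j) z) \<and> 1 \<le> cmod (orthP a b j z)"
  using j
proof (induction j)
  have t0: "\<bar>b j\<bar> + K * a j \<ge> 0" for j using a[of j] K by simp
  case 0
  have "\<bar>b 0\<bar> + K * a 0 \<le> (\<Sum>j\<le>Suc n. \<bar>b j\<bar> + K * a j)" by (rule member_le_sum) (use t0 in auto)
  then have "K * a 0 \<le> cmod (z - of_real (b 0))"
    using z norm_triangle_ineq2[of z "of_real (b 0)"] unfolding norm_of_real by linarith
  then show ?case using a[of 0] by (simp add: orthP_def norm_divide pos_le_divide_eq)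
next
  have t0: "\<bar>b j\<bar> + K * a j \<ge> 0" for j using a[of j] K by simp
  case (Suc j)
  have IH: "K * cmod (orthP a b j z) \<le> cmod (orthP a b (Suc j) z)" "1 \<le> cmod (orthP a b j z)" using Suc by auto
  have IH2: "cmod (orthP a b j z) \<le> cmod (orthP a b (Suc j) z)"
    using IH mult_right_mono[OF K, of "cmod (orthP a b j z)"] by simp
  have "(\<Sum>i\<in>{Suc j, j}. \<bar>b i\<bar> + K * a i) \<le> (\<Sum>j\<le>Suc n. \<bar>b j\<bar> + K * a j)"
    by (rule sum_mono2) (use Suc.prems t0 in auto)
  then have s: "(\<bar>b (Suc j)\<bar> + K * a (Suc j)) + (\<bar>b j\<bar> + K * a j) \<le> cmod z" using z by simp
  have aK: "a j \<le> K * a j" using mult_right_mono[OF K, of "a j"] a[of j] by simp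
  have "a (Suc j) * cmod (orthP a b (Suc (Suc j)) z) = cmod (of_real (a (Suc j)) * orthP a b (Suc (Suc j)) z)"
    using a[of "Suc j"] by (simp add: norm_mult)
  also have "\<dots> = cmod ((z - of_real (b (Suc j))) * orthP a b (Suc j) z - of_real (a j) * orthP a b j z)"
    by (subst jacobi_rec_eq[OF jacobi_rec_orthP a]) (rule refl)
  finally have 1: "a (Suc j) * cmod (orthP a b (Suc (Suc j)) z) \<ge> cmod (z - of_real (b (Suc j))) * cmod (orthP a b (Suc j) z) - a j * cmod (orthP a b j z)"
    using norm_triangle_ineq2[of "(z - of_real (b (Suc j))) * orthP a b (Suc j) z" "of_real (a j) * orthP a b j z"] a[of j] by (simp add: norm_mult)
  have 2: "a j * cmod (orthP a b j z) \<le> a j * cmod (orthP a b (Suc j) z)" using IH2 a[of j] by (intro mult_left_mono) auto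
  have "K * a (Suc j) + a j \<le> cmod (z - of_real (b (Suc j)))"
    using s aK norm_triangle_ineq2[of z "of_real (b (Suc j))"] unfolding norm_of_real by linarith
  then have "(K * a (Suc j) + a j) * cmod (orthP a b (Suc j) z) \<le> cmod (z - of_real (b (Suc j))) * cmod (orthP a b (Suc j) z)"
    by (rule mult_right_mono) simp
  then have "a (Suc j) * (K * cmod (orthP a b (Suc j) z)) \<le> a (Suc j) * cmod (orthP a b (Suc (Suc j)) z)"
    using 1 2 by (simp add: algebra_simps)
  then show ?case using IH IH2 a[of "Suc j"] by simp
qed

text \<open>By the Wronskian the quotient \<open>orthQ / orthP\<close> changes from \<open>j\<close>
  to \<open>j + 1\<close> by the reciprocal of \<open>a j\<close> times two consecutive values of
  \<open>orthP\<close>, whose moduli are at least 1.\<close>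

lemma orthQ_le_orthP:
  fixes z :: complex
  assumes a: "\<And>n. a n > 0" and P: "\<And>j. j \<le> n \<Longrightarrow> 1 \<le> cmod (orthP a b j z)" and j: "j \<le> n"
  shows "cmod (orthQ a b j z) \<le> cmod (orthP a b j z) * (\<Sum>i<j. 1 / a i)"
  using j
proof (induction j)
  case (Suc j)
  define P0 P1 Q0 Q1 where "P0 = orthP a b j z" "P1 = orthP a b (Suc j) z" "Q0 = orthQ a b j z" "Q1 = orthQ a b (Suc j) z"
  have n: "1 \<le> cmod P0" "1 \<le> cmod P1" using P[of j] P[of "Suc j"] Suc.prems by (auto simp: P0_P1_Q0_Q1_def)
  have nz: "P0 \<noteq> 0" using n by auto
  have "of_real (a j) * (P0 * Q1 - P1 * Q0) = 1" unfolding P0_P1_Q0_Q1_def by (rule orth_wronskian[OF a])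
  then have "P0 * Q1 - P1 * Q0 = of_real (1 / a j)" using a[of j] by (simp add: field_simps)
  then have "P0 * Q1 = P1 * Q0 + of_real (1 / a j)" by (simp add: algebra_simps)
  then have "cmod P0 * cmod Q1 \<le> cmod P1 * cmod Q0 + 1 / a j"
    using norm_triangle_ineq[of "P1 * Q0" "of_real (1 / a j)"] a[of j] by (simp only: norm_mult[symmetric] norm_of_real) simp
  also have "\<dots> \<le> cmod P1 * (cmod P0 * (\<Sum>i<j. 1 / a i)) + (cmod P0 * cmod P1) * (1 / a j)"
  proof (intro add_mono mult_left_mono)
    show "cmod Q0 \<le> cmod P0 * (\<Sum>i<j. 1 / a i)" using Suc unfolding P0_P1_Q0_Q1_def by simp
    have "1 \<le> cmod P0 * cmod P1" using mult_mono[OF n] by simp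
    then show "1 / a j \<le> cmod P0 * cmod P1 * (1 / a j)" using a[of j] mult_right_mono[of 1 "cmod P0 * cmod P1" "1 / a j"] by simp
  qed auto
  also have "\<dots> = cmod P0 * (cmod P1 * (\<Sum>i<Suc j. 1 / a i))" by (simp add: algebra_simps)
  finally show ?case using nz unfolding P0_P1_Q0_Q1_def by simp
qed (simp add: orthQ_0)

lemma continuous_on_orth_complex:
  fixes S :: "complex set"
  shows "continuous_on S (\<lambda>z. orthP a b n z)" "continuous_on S (\<lambda>z. orthQ a b n z)"
  unfolding orthP_def orthQ_def divide_inverse
  by (induction n rule: induct_nat_012) (auto intro!: continuous_intros)

lemma field_differentiable_orth:
  fixes z :: complex
  shows "(\<lambda>z. orthP a b n z) field_differentiable (at z)" "(\<lambda>z. orthQ a b n z) field_differentiable (at z)"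
  unfolding orthP_def orthQ_def divide_inverse
  by (induction n rule: induct_nat_012) (auto intro!: derivative_intros)

lemma weyl_m_regular:
  assumes a: "\<And>n. a n > 0" and \<zeta>: "Im \<zeta> < 0"
  shows "continuous_on {z. Im z \<ge> 0} (weyl_m a b \<zeta> n)"
    and "Im z > 0 \<Longrightarrow> weyl_m a b \<zeta> n field_differentiable (at z)"
    and "\<exists>B. \<forall>z. Im z \<ge> 0 \<longrightarrow> cmod (weyl_m a b \<zeta> n z) \<le> B"
proof -
  show c: "continuous_on {z. Im z \<ge> 0} (weyl_m a b \<zeta> n)"
    unfolding weyl_m_def[abs_def] using weyl_den_nz[OF a \<zeta>]
    by (intro continuous_intros) (auto simp: weyl_num_def weyl_den_def intro!: continuous_intros continuous_on_orth_complex)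
  have nz: "weyl_den a b \<zeta> n z \<noteq> 0" if "Im z > 0" for z by (rule weyl_den_nz[OF a \<zeta>]) (use that in simp)
  show "weyl_m a b \<zeta> n field_differentiable (at z)" if "Im z > 0"
    unfolding weyl_m_def[abs_def]
  proof (rule field_differentiable_divide)
    show "(\<lambda>z. - weyl_num a b \<zeta> n z) field_differentiable (at z)" unfolding weyl_num_def
      by (intro field_differentiable_minus field_differentiable_diff field_differentiable_mult field_differentiable_const field_differentiable_orth)
    show "weyl_den a b \<zeta> n field_differentiable (at z)" unfolding weyl_den_def[abs_def]
      by (intro field_differentiable_diff field_differentiable_mult field_differentiable_const field_differentiable_orth)
  qed (rule nz[OF that])
  \<comment> \<open>With this growth factor \<open>cmod \<zeta> * cmod P0\<close> is at most half of
    \<open>cmod P1\<close>, so the denominator keeps at least half of the modulus of its leading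
    term.\<close>
  define K where "K = 2 * cmod \<zeta> + 1"
  define r where "r = (\<Sum>j\<le>Suc (Suc n). \<bar>b j\<bar> + K * a j)"
  define S where "S = (\<Sum>i<Suc n. 1 / a i)"
  have S0: "S \<ge> 0" unfolding S_def by (intro sum_nonneg) (use a in \<open>simp add: less_imp_le\<close>)
  have K: "K \<ge> 1" by (simp add: K_def)
  have out: "cmod (weyl_m a b \<zeta> n z) \<le> 4 * S" if z: "cmod z \<ge> r" for z
  proof -
    define P0 P1 where "P0 = orthP a b n z" "P1 = orthP a b (Suc n) z"
    have g: "K * cmod (orthP a b j z) \<le> cmod (orthP a b (Suc j) z) \<and> 1 \<le> cmod (orthP a b j z)" if "j \<le> Suc n" for j
      by (rule orthP_growth[OF a K _ that]) (use z in \<open>simp add: r_def\<close>)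
    have P: "K * cmod P0 \<le> cmod P1" "1 \<le> cmod P0" "1 \<le> cmod P1" using g[of n] g[of "Suc n"] by (auto simp: P0_P1_def)
    have zP: "2 * (cmod \<zeta> * cmod P0) \<le> cmod P1" using P(1) unfolding K_def by (simp add: distrib_right) (use P(2) in linarith)
    have den: "cmod P1 / 2 \<le> cmod (weyl_den a b \<zeta> n z)"
      using norm_triangle_ineq2[of P1 "\<zeta> * P0"] zP unfolding weyl_den_def P0_P1_def[symmetric] norm_mult by linarith
    have Q: "cmod (orthQ a b j z) \<le> cmod (orthP a b j z) * S" if "j \<le> Suc n" for j
    proof -
      have "cmod (orthQ a b j z) \<le> cmod (orthP a b j z) * (\<Sum>i<j. 1 / a i)" by (rule orthQ_le_orthP[OF a _ that]) (use g in auto)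
      also have "\<dots> \<le> cmod (orthP a b j z) * S" unfolding S_def
        by (intro mult_left_mono sum_mono2) (use that a in \<open>auto simp: less_imp_le\<close>)
      finally show ?thesis .
    qed
    have "cmod (weyl_num a b \<zeta> n z) \<le> cmod (orthQ a b (Suc n) z) + cmod \<zeta> * cmod (orthQ a b n z)"
      unfolding weyl_num_def by (rule order_trans[OF norm_triangle_ineq4]) (simp add: norm_mult)
    also have "\<dots> \<le> cmod P1 * S + cmod \<zeta> * (cmod P0 * S)"
      using Q[of n] Q[of "Suc n"] by (intro add_mono mult_left_mono) (auto simp: P0_P1_def)
    also have "\<dots> = (cmod P1 + cmod \<zeta> * cmod P0) * S" by (simp add: algebra_simps)
    also have "\<dots> \<le> (2 * cmod P1) * S"
    proof (rule mult_right_mono[OF _ S0])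
      have "0 \<le> cmod \<zeta> * cmod P0" by simp
      then show "cmod P1 + cmod \<zeta> * cmod P0 \<le> 2 * cmod P1" using zP by linarith
    qed
    finally have num: "cmod (weyl_num a b \<zeta> n z) \<le> (4 * S) * (cmod P1 / 2)" by (simp add: mult_ac)
    also have "\<dots> \<le> (4 * S) * cmod (weyl_den a b \<zeta> n z)" using den S0 by (intro mult_left_mono) auto
    finally have nm: "cmod (weyl_num a b \<zeta> n z) \<le> (4 * S) * cmod (weyl_den a b \<zeta> n z)" .
    have "cmod (weyl_den a b \<zeta> n z) > 0" using den P(3) by linarith
    then show ?thesis unfolding weyl_m_def using nm by (simp add: norm_divide pos_divide_le_eq)
  qed
  have "compact (cball 0 r \<inter> {z::complex. Im z \<ge> 0})"
    by (intro compact_Int_closed compact_cball closed_halfspace_Im_ge)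
  moreover have "continuous_on (cball 0 r \<inter> {z::complex. Im z \<ge> 0}) (weyl_m a b \<zeta> n)" by (rule continuous_on_subset[OF c]) auto
  ultimately have "bounded (weyl_m a b \<zeta> n ` (cball 0 r \<inter> {z::complex. Im z \<ge> 0}))"
    using compact_continuous_image compact_imp_bounded by blast
  then obtain B where B': "\<forall>z \<in> cball 0 r \<inter> {z::complex. Im z \<ge> 0}. cmod (weyl_m a b \<zeta> n z) \<le> B" by (auto simp: bounded_iff)
  have B: "cmod (weyl_m a b \<zeta> n z) \<le> B" if "cmod z \<le> r" "Im z \<ge> 0" for z using B' that by auto
  have "cmod (weyl_m a b \<zeta> n z) \<le> max B (4 * S)" if "Im z \<ge> 0" for z
    using B[of z] out[of z] that by (cases "cmod z \<le> r") (auto simp: le_max_iff_disj)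
  then show "\<exists>B. \<forall>z. Im z \<ge> 0 \<longrightarrow> cmod (weyl_m a b \<zeta> n z) \<le> B" by blast
qed

section \<open>The Stieltjes transform and the limit point case\<close>

lemma orth_integrals:
  assumes o: "orthonormalizing_measure a b \<mu>"
  shows "real_distribution \<mu>"
    and "integrable \<mu> (\<lambda>x. orthP a b m x * orthP a b n x)"
    and "(\<integral>x. orthP a b m x * orthP a b n x \<partial>\<mu>) = (if m = n then 1 else 0)"
    and "orthP a b n \<in> borel_measurable \<mu>"
    and "integrable \<mu> (orthP a b n)" and "(\<integral>x. orthP a b n x \<partial>\<mu>) = (if n = 0 then 1 else 0)"
proof -
  show rd: "real_distribution \<mu>" using o sets_eq_imp_space_eq[of \<mu> borel]
    by (auto simp: orthonormalizing_measure_def borel_prob_measure_def real_distribution_def real_distribution_axioms_def)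
  show 1: "integrable \<mu> (\<lambda>x. orthP a b m x * orthP a b n x)" "(\<integral>x. orthP a b m x * orthP a b n x \<partial>\<mu>) = (if m = n then 1 else 0)" for m n
    using o unfolding orthonormalizing_measure_def orth_poly_eq_orthP by auto
  interpret real_distribution \<mu> by (rule rd)
  show "orthP a b n \<in> borel_measurable \<mu>"
    using borel_measurable_continuous_onI[OF continuous_on_orth(1)] unfolding measurable_cong_sets[OF events_eq_borel refl] .
  show "integrable \<mu> (orthP a b n)" "(\<integral>x. orthP a b n x \<partial>\<mu>) = (if n = 0 then 1 else 0)"
    using 1[of 0 n] by (auto simp: orthP_0)
qed

text \<open>Bessel's inequality: the squared distance of \<open>g\<close> from its partial Fourier
  sum \<open>s\<close> is nonnegative.\<close>

lemma bessel_orth: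
  assumes o: "orthonormalizing_measure a b \<mu>" and g: "g \<in> borel_measurable borel" "\<And>x. \<bar>g x\<bar> \<le> B"
  shows "(\<Sum>j\<le>n. (\<integral>x. g x * orthP a b j x \<partial>\<mu>)\<^sup>2) \<le> (\<integral>x. (g x)\<^sup>2 \<partial>\<mu>)"
proof -
  interpret real_distribution \<mu> by (rule orth_integrals(1)[OF o])
  note [measurable] = orth_integrals(4)[OF o]
  define c where "c = (\<lambda>j. \<integral>x. g x * orthP a b j x \<partial>\<mu>)"
  have gm [measurable]: "g \<in> borel_measurable \<mu>" using g(1) by simp
  have ig2: "integrable \<mu> (\<lambda>x. (g x)\<^sup>2)"
    by (rule integrable_const_bound[where B="B\<^sup>2"]) (use g(2) in \<open>auto intro!: AE_I2 simp: abs_le_square_iff[symmetric] intro: order_trans[OF _ abs_ge_self]\<close>)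
  have igp: "integrable \<mu> (\<lambda>x. g x * orthP a b j x)" for j
    by (rule Bochner_Integration.integrable_bound[OF integrable_mult_right[OF orth_integrals(5)[OF o, of j], of B]])
       (use g(2) in \<open>auto simp: abs_mult intro!: AE_I2 mult_right_mono intro: order_trans[OF _ abs_ge_self]\<close>)
  define s where "s = (\<lambda>x. \<Sum>j\<le>n. c j * orthP a b j x)"
  have gs: "g x * s x = (\<Sum>j\<le>n. c j * (g x * orthP a b j x))" for x unfolding s_def by (simp add: sum_distrib_left mult_ac)
  have ss: "s x * s x = (\<Sum>i\<le>n. \<Sum>j\<le>n. (c i * c j) * (orthP a b i x * orthP a b j x))" for x
    unfolding s_def by (simp add: sum_product mult_ac)
  have igs: "integrable \<mu> (\<lambda>x. g x * s x)" unfolding gs by (intro Bochner_Integration.integrable_sum integrable_mult_right igp)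
  have iss: "integrable \<mu> (\<lambda>x. s x * s x)" unfolding ss by (intro Bochner_Integration.integrable_sum integrable_mult_right orth_integrals(2)[OF o])
  have Igs: "(\<integral>x. g x * s x \<partial>\<mu>) = (\<Sum>j\<le>n. (c j)\<^sup>2)"
    unfolding gs by (subst Bochner_Integration.integral_sum) (auto simp: igp c_def power2_eq_square)
  have Iss: "(\<integral>x. s x * s x \<partial>\<mu>) = (\<Sum>j\<le>n. (c j)\<^sup>2)"
  proof -
    have "(\<integral>x. s x * s x \<partial>\<mu>) = (\<Sum>i\<le>n. \<Sum>j\<le>n. (c i * c j) * (if i = j then 1 else 0))"
      unfolding ss by (subst Bochner_Integration.integral_sum, intro Bochner_Integration.integrable_sum integrable_mult_right orth_integrals(2)[OF o],
        subst Bochner_Integration.integral_sum, intro integrable_mult_right orth_integrals(2)[OF o]) (simp add: orth_integrals(3)[OF o])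
    also have "\<dots> = (\<Sum>j\<le>n. (c j)\<^sup>2)" by (simp add: power2_eq_square if_distrib[of "\<lambda>t. _ * t"] cong: if_cong)
    finally show ?thesis .
  qed
  have "0 \<le> (\<integral>x. (g x - s x)\<^sup>2 \<partial>\<mu>)" by simp
  also have "(\<lambda>x. (g x - s x)\<^sup>2) = (\<lambda>x. (g x)\<^sup>2 - 2 * (g x * s x) + s x * s x)" by (auto simp: power2_eq_square algebra_simps)
  also have "(\<integral>x. (g x)\<^sup>2 - 2 * (g x * s x) + s x * s x \<partial>\<mu>) = (\<integral>x. (g x)\<^sup>2 \<partial>\<mu>) - 2 * (\<Sum>j\<le>n. (c j)\<^sup>2) + (\<Sum>j\<le>n. (c j)\<^sup>2)"
    using ig2 igs iss by (simp add: Igs Iss)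
  finally show ?thesis by (simp add: c_def)
qed

definition stieltjes :: "real measure \<Rightarrow> complex \<Rightarrow> complex" where
  "stieltjes M z = (\<integral>x. 1 / (of_real x - z) \<partial>M)"

text \<open>The Fourier coefficients of \<open>1 / (x - z)\<close> satisfy the recurrence at
  \<open>z\<close>: \<open>x / (x - z) = 1 + z / (x - z)\<close>, and the constant 1 is orthogonal
  to all \<open>orthP\<close> but the first, which produces the inhomogeneity at the left end.
  Bessel's inequality for the real and the imaginary part separately gives the factor 2.\<close>

lemma stieltjes_orth:
  assumes a: "\<And>n. a n > 0" and o: "orthonormalizing_measure a b \<mu>" and z: "Im z > 0"
  defines "c \<equiv> \<lambda>n. (\<integral>x. of_real (orthP a b n x) * (1 / (of_real x - z)) \<partial>\<mu>)"
  shows "c n = stieltjes \<mu> z * orthP a b n z + 1 * orthQ a b n z"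
    and "(\<Sum>j\<le>n. (cmod (c j))\<^sup>2) \<le> 2 / (Im z)\<^sup>2"
    and "Im (stieltjes \<mu> z) = (\<integral>x. Im z / ((x - Re z)\<^sup>2 + (Im z)\<^sup>2) \<partial>\<mu>)"
proof -
  interpret real_distribution \<mu> by (rule orth_integrals(1)[OF o])
  note [measurable] = orth_integrals(4)[OF o]
  define k where "k x = 1 / (complex_of_real x - z)" for x
  have nz: "complex_of_real x - z \<noteq> 0" for x using z by (auto simp: complex_eq_iff)
  have km [measurable]: "k \<in> borel_measurable borel" unfolding k_def[abs_def] by measurable
  have kb: "cmod (k x) \<le> 1 / Im z" for x
  proof -
    have "Im z \<le> cmod (complex_of_real x - z)" using abs_Im_le_cmod[of "complex_of_real x - z"] z by simp
    then show ?thesis using z unfolding k_def norm_divide by (simp add: frac_le)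
  qed
  have ik: "integrable \<mu> (\<lambda>x. of_real (orthP a b n x) * k x)" for n
  proof (rule Bochner_Integration.integrable_bound[OF integrable_mult_right[OF orth_integrals(5)[OF o, of n], of "1 / Im z"]])
    show "AE x in \<mu>. norm (complex_of_real (orthP a b n x) * k x) \<le> norm (1 / Im z * orthP a b n x)"
    proof (rule AE_I2)
      fix x
      have "norm (complex_of_real (orthP a b n x) * k x) = \<bar>orthP a b n x\<bar> * cmod (k x)" by (simp add: norm_mult)
      also have "\<dots> \<le> \<bar>orthP a b n x\<bar> * (1 / Im z)" by (intro mult_left_mono kb) simp
      finally show "norm (complex_of_real (orthP a b n x) * k x) \<le> norm (1 / Im z * orthP a b n x)" using z by (simp add: abs_mult mult.commute)
    qed
  qed measurable
  have c_k: "c n = (\<integral>x. of_real (orthP a b n x) * k x \<partial>\<mu>)" for n by (simp add: c_def k_def)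
  have xk: "complex_of_real x * k x = 1 + z * k x" for x using nz[of x] by (simp add: k_def field_simps)
  have ip: "integrable \<mu> (\<lambda>x. complex_of_real (orthP a b n x))" for n using orth_integrals(5)[OF o] by simp
  have Ip: "(\<integral>x. complex_of_real (orthP a b n x) \<partial>\<mu>) = (if n = 0 then 1 else 0)" for n using orth_integrals(6)[OF o, of n] by simp
  have c0: "c 0 = stieltjes \<mu> z" by (simp add: c_k stieltjes_def k_def orthP_0)
  have rec1: "of_real (a 0) * c 1 = (z - of_real (b 0)) * c 0 + 1"
  proof -
    have "of_real (a 0) * c 1 = (\<integral>x. of_real (a 0) * (of_real (orthP a b 1 x) * k x) \<partial>\<mu>)" by (simp add: c_k)
    also have "(\<lambda>x. of_real (a 0) * (of_real (orthP a b 1 x) * k x)) = (\<lambda>x. complex_of_real (orthP a b 0 x) + (z - of_real (b 0)) * (of_real (orthP a b 0 x) * k x))"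
    proof
      fix x
      have "complex_of_real (a 0) * complex_of_real (orthP a b 1 x) = complex_of_real x - of_real (b 0)"
        using a[of 0] by (simp add: orthP_def)
      then have "of_real (a 0) * (of_real (orthP a b 1 x) * k x) = complex_of_real x * k x - of_real (b 0) * k x"
        by (simp add: mult.assoc[symmetric] left_diff_distrib)
      then show "of_real (a 0) * (of_real (orthP a b 1 x) * k x) = complex_of_real (orthP a b 0 x) + (z - of_real (b 0)) * (of_real (orthP a b 0 x) * k x)"
        unfolding xk by (simp add: orthP_0 algebra_simps)
    qed
    also have "(\<integral>x. complex_of_real (orthP a b 0 x) + (z - of_real (b 0)) * (of_real (orthP a b 0 x) * k x) \<partial>\<mu>) = 1 + (z - of_real (b 0)) * c 0"
      by (subst Bochner_Integration.integral_add[OF ip integrable_mult_right[OF ik]]) (simp only: Ip refl if_True integral_mult_right_zero c_k)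
    finally show ?thesis by (simp add: add.commute)
  qed
  have rec2: "of_real (a (Suc n)) * c (Suc (Suc n)) = (z - of_real (b (Suc n))) * c (Suc n) - of_real (a n) * c n" for n
  proof -
    have "of_real (a (Suc n)) * c (Suc (Suc n)) = (\<integral>x. of_real (a (Suc n)) * (of_real (orthP a b (Suc (Suc n)) x) * k x) \<partial>\<mu>)" by (simp add: c_k)
    also have "(\<lambda>x. of_real (a (Suc n)) * (of_real (orthP a b (Suc (Suc n)) x) * k x))
      = (\<lambda>x. complex_of_real (orthP a b (Suc n) x) + ((z - of_real (b (Suc n))) * (of_real (orthP a b (Suc n) x) * k x) - of_real (a n) * (of_real (orthP a b n x) * k x)))"
    proof
      fix x
      have "a (Suc n) * orthP a b (Suc (Suc n)) x = (x - b (Suc n)) * orthP a b (Suc n) x - a n * orthP a b n x"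
        using jacobi_rec_eq[where z=x and U="\<lambda>n. orthP a b n x", OF jacobi_rec_orthP a] by simp
      then have "complex_of_real (a (Suc n)) * of_real (orthP a b (Suc (Suc n)) x)
          = (of_real x - of_real (b (Suc n))) * of_real (orthP a b (Suc n) x) - of_real (a n) * of_real (orthP a b n x)"
        by (metis of_real_diff of_real_mult)
      then have "of_real (a (Suc n)) * (of_real (orthP a b (Suc (Suc n)) x) * k x)
         = of_real (orthP a b (Suc n) x) * (of_real x * k x) - of_real (b (Suc n)) * of_real (orthP a b (Suc n) x) * k x - of_real (a n) * of_real (orthP a b n x) * k x"
        by (simp add: mult.assoc[symmetric] left_diff_distrib)
      then show "of_real (a (Suc n)) * (of_real (orthP a b (Suc (Suc n)) x) * k x)
        = complex_of_real (orthP a b (Suc n) x) + ((z - of_real (b (Suc n))) * (of_real (orthP a b (Suc n) x) * k x) - of_real (a n) * (of_real (orthP a b n x) * k x))"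
        unfolding xk by (simp add: algebra_simps)
    qed
    also have "(\<integral>x. complex_of_real (orthP a b (Suc n) x) + ((z - of_real (b (Suc n))) * (of_real (orthP a b (Suc n) x) * k x) - of_real (a n) * (of_real (orthP a b n x) * k x)) \<partial>\<mu>)
       = 0 + ((z - of_real (b (Suc n))) * c (Suc n) - of_real (a n) * c n)"
      by (subst Bochner_Integration.integral_add[OF ip Bochner_Integration.integrable_diff[OF integrable_mult_right[OF ik] integrable_mult_right[OF ik]]],
          subst Bochner_Integration.integral_diff[OF integrable_mult_right[OF ik] integrable_mult_right[OF ik]])
         (simp only: Ip nat.distinct if_False integral_mult_right_zero c_k)
    finally show ?thesis by simp
  qed
  have ac: "of_real (a n) \<noteq> (0::complex)" for n using a[of n] by simp
  define V where "V n = stieltjes \<mu> z * orthP a b n z + 1 * orthQ a b n z" for n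
  have "c n = V n" for n
  proof (induction n rule: induct_nat_012)
    case 0
    show ?case by (simp add: c0 V_def orthP_0 orthQ_0)
  next
    case 1
    have "of_real (a 0) * V 1 = stieltjes \<mu> z * (of_real (a 0) * orthP a b 1 z) + of_real (a 0) * orthQ a b 1 z"
      by (simp add: V_def algebra_simps)
    also have "\<dots> = (z - of_real (b 0)) * c 0 + 1"
      unfolding orthP_start[of a, OF a] orthQ_start[of a, OF a] by (simp add: c0 orthP_0 orthQ_0)
    finally have "of_real (a 0) * V 1 = of_real (a 0) * c 1" using rec1 by simp
    then show ?case using ac[of 0] by simp
  next
    case (ge2 n)
    have "jacobi_rec a b z V" unfolding V_def[abs_def] by (intro jacobi_rec_comb jacobi_rec_orthP jacobi_rec_orthQ)
    from jacobi_rec_eq[OF this a, of n] have "of_real (a (Suc n)) * V (Suc (Suc n)) = of_real (a (Suc n)) * c (Suc (Suc n))"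
      unfolding rec2 ge2 .
    then show ?case using ac[of "Suc n"] by simp
  qed
  then show "c n = stieltjes \<mu> z * orthP a b n z + 1 * orthQ a b n z" by (simp add: V_def)
  have Rek: "Re (c j) = (\<integral>x. Re (k x) * orthP a b j x \<partial>\<mu>)" "Im (c j) = (\<integral>x. Im (k x) * orthP a b j x \<partial>\<mu>)" for j
    unfolding c_k using integral_Re[OF ik[of j]] integral_Im[OF ik[of j]] by (simp_all add: mult.commute)
  have ck: "(cmod (c j))\<^sup>2 = (\<integral>x. Re (k x) * orthP a b j x \<partial>\<mu>)\<^sup>2 + (\<integral>x. Im (k x) * orthP a b j x \<partial>\<mu>)\<^sup>2" for j
    unfolding cmod_power2 Rek ..
  have sqb: "(\<integral>x. (f x)\<^sup>2 \<partial>\<mu>) \<le> (1 / Im z)\<^sup>2" if f: "\<And>x. \<bar>f x\<bar> \<le> 1 / Im z" for f :: "real \<Rightarrow> real"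
  proof -
    have fb: "(f x)\<^sup>2 \<le> (1 / Im z)\<^sup>2" for x using power_mono[OF f[of x] abs_ge_zero, of 2] by simp
    have "(\<integral>x. (f x)\<^sup>2 \<partial>\<mu>) \<le> (\<integral>x. (1 / Im z)\<^sup>2 \<partial>\<mu>)"
      by (rule integral_mono') (use fb in auto)
    then show ?thesis using prob_space by simp
  qed
  have Rb: "\<bar>Re (k x)\<bar> \<le> 1 / Im z" "\<bar>Im (k x)\<bar> \<le> 1 / Im z" for x
    using order_trans[OF abs_Re_le_cmod kb] order_trans[OF abs_Im_le_cmod kb] by auto
  have "(\<Sum>j\<le>n. (cmod (c j))\<^sup>2) \<le> (\<integral>x. (Re (k x))\<^sup>2 \<partial>\<mu>) + (\<integral>x. (Im (k x))\<^sup>2 \<partial>\<mu>)"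
    unfolding ck sum.distrib by (intro add_mono bessel_orth[OF o, where B="1 / Im z"] Rb) measurable
  also have "\<dots> \<le> (1 / Im z)\<^sup>2 + (1 / Im z)\<^sup>2" by (intro add_mono sqb Rb)
  finally show "(\<Sum>j\<le>n. (cmod (c j))\<^sup>2) \<le> 2 / (Im z)\<^sup>2" by (simp add: power_divide)
  have ik0: "integrable \<mu> k" using ik[of 0] by (simp add: orthP_0)
  have "Im (k x) = Im z / ((x - Re z)\<^sup>2 + (Im z)\<^sup>2)" for x
    unfolding k_def by (simp add: Im_divide)
  then show "Im (stieltjes \<mu> z) = (\<integral>x. Im z / ((x - Re z)\<^sup>2 + (Im z)\<^sup>2) \<partial>\<mu>)"
    unfolding stieltjes_def k_def[symmetric] using integral_Im[OF ik0] by simp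
qed

text \<open>If \<open>orthP\<close> were square summable at \<open>z\<close>, so would be
  \<open>orthQ\<close>, because \<open>stieltjes \<mu> z * orthP + orthQ\<close> is. Then the
  Wronskians, that is the numbers \<open>1 / a n\<close>, would be summable, against the Carleman
  condition.\<close>

lemma sum_sq_orthP_unbounded:
  assumes a: "\<And>n. a n > 0" and carl: "\<not> summable (\<lambda>n. 1 / a n)" and o: "orthonormalizing_measure a b \<mu>" and z: "Im z > 0"
  shows "filterlim (\<lambda>n. \<Sum>j\<le>n. (cmod (orthP a b j z))\<^sup>2) at_top sequentially"
proof -
  define p where "p = (\<lambda>j. orthP a b j z)"
  define q where "q = (\<lambda>j. orthQ a b j z)"
  define m where "m = stieltjes \<mu> z"
  have c: "(\<Sum>j\<le>n. (cmod (m * p j + q j))\<^sup>2) \<le> 2 / (Im z)\<^sup>2" for n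
    using stieltjes_orth(2)[where a=a and b=b and \<mu>=\<mu> and z=z and n=n, OF a o z]
    unfolding stieltjes_orth(1)[where a=a and b=b and \<mu>=\<mu> and z=z, OF a o z] by (simp add: p_def q_def m_def)
  have sq: "(norm (u + v))\<^sup>2 \<le> 2 * (norm u)\<^sup>2 + 2 * (norm v)\<^sup>2" for u v :: complex
  proof -
    have "(norm (u + v))\<^sup>2 \<le> (norm u + norm v)\<^sup>2" by (intro power_mono norm_triangle_ineq) simp
    also have "\<dots> \<le> 2 * (norm u)\<^sup>2 + 2 * (norm v)\<^sup>2" using sum_squares_bound[of "norm u" "norm v"] by (simp add: power2_sum)
    finally show ?thesis .
  qed
  have ns: "\<not> summable (\<lambda>j. (cmod (p j))\<^sup>2)"
  proof
    assume sp: "summable (\<lambda>j. (cmod (p j))\<^sup>2)"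
    have sc: "summable (\<lambda>j. (cmod (m * p j + q j))\<^sup>2)"
    proof (rule summableI_nonneg_bounded)
      show "(\<Sum>i<n. (cmod (m * p i + q i))\<^sup>2) \<le> 2 / (Im z)\<^sup>2" for n
      proof -
        have "(\<Sum>i<n. (cmod (m * p i + q i))\<^sup>2) \<le> (\<Sum>i\<le>n. (cmod (m * p i + q i))\<^sup>2)" by (rule sum_mono2) auto
        then show ?thesis using c[of n] by linarith
      qed
    qed simp
    have sq': "summable (\<lambda>j. (cmod (q j))\<^sup>2)"
    proof (rule summable_comparison_test')
      show "summable (\<lambda>j. 2 * (cmod (m * p j + q j))\<^sup>2 + 2 * ((cmod m)\<^sup>2 * (cmod (p j))\<^sup>2))"
        by (intro summable_add summable_mult sc sp)
      show "norm ((cmod (q n))\<^sup>2) \<le> 2 * (cmod (m * p n + q n))\<^sup>2 + 2 * ((cmod m)\<^sup>2 * (cmod (p n))\<^sup>2)" if "n \<ge> 0" for n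
        using sq[of "m * p n + q n" "- (m * p n)"] by (simp add: norm_mult power_mult_distrib)
    qed
    have "summable (\<lambda>n. 1 / a n)"
    proof (rule summable_comparison_test')
      show "summable (\<lambda>j. ((cmod (p j))\<^sup>2 + (cmod (q (Suc j)))\<^sup>2) + ((cmod (p (Suc j)))\<^sup>2 + (cmod (q j))\<^sup>2))"
        using sp sq' by (intro summable_add) (auto simp: summable_Suc_iff[of "\<lambda>j. (cmod (p j))\<^sup>2"] summable_Suc_iff[of "\<lambda>j. (cmod (q j))\<^sup>2"])
      show "norm (1 / a n) \<le> ((cmod (p n))\<^sup>2 + (cmod (q (Suc n)))\<^sup>2) + ((cmod (p (Suc n)))\<^sup>2 + (cmod (q n))\<^sup>2)" if "n \<ge> 0" for n
      proof -
        have e: "of_real (a n) * (p n * q (Suc n) - p (Suc n) * q n) = 1"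
          unfolding p_def q_def by (rule orth_wronskian[OF a])
        have "complex_of_real (a n) \<noteq> 0" using a[of n] by simp
        then have eq: "complex_of_real (1 / a n) = p n * q (Suc n) - p (Suc n) * q n"
          using arg_cong[OF e, of "\<lambda>t. t / of_real (a n)"] by simp
        have "norm (1 / a n) = cmod (complex_of_real (1 / a n))" by (simp add: norm_divide)
        also have "\<dots> \<le> cmod (p n) * cmod (q (Suc n)) + cmod (p (Suc n)) * cmod (q n)"
          unfolding eq by (rule order_trans[OF norm_triangle_ineq4]) (simp add: norm_mult)
        also have "\<dots> \<le> ((cmod (p n))\<^sup>2 + (cmod (q (Suc n)))\<^sup>2) + ((cmod (p (Suc n)))\<^sup>2 + (cmod (q n))\<^sup>2)"
        proof (rule add_mono)
          have t: "u * v \<le> u\<^sup>2 + v\<^sup>2" if "u \<ge> 0" "v \<ge> 0" for u v :: real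
            using sum_squares_bound[of u v] mult_nonneg_nonneg[OF that] by linarith
          show "cmod (p n) * cmod (q (Suc n)) \<le> (cmod (p n))\<^sup>2 + (cmod (q (Suc n)))\<^sup>2"
            "cmod (p (Suc n)) * cmod (q n) \<le> (cmod (p (Suc n)))\<^sup>2 + (cmod (q n))\<^sup>2" by (auto intro!: t)
        qed
        finally show ?thesis .
      qed
    qed
    then show False using carl by simp
  qed
  have "\<exists>n. (\<Sum>j\<le>n. (cmod (p j))\<^sup>2) \<ge> Z" for Z
  proof (rule ccontr)
    assume n: "\<not> (\<exists>n. (\<Sum>j\<le>n. (cmod (p j))\<^sup>2) \<ge> Z)"
    have "(\<Sum>j<n. (cmod (p j))\<^sup>2) \<le> Z" for n
    proof -
      have "(\<Sum>j<n. (cmod (p j))\<^sup>2) \<le> (\<Sum>j\<le>n. (cmod (p j))\<^sup>2)" by (rule sum_mono2) auto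
      moreover have "(\<Sum>j\<le>n. (cmod (p j))\<^sup>2) < Z" using n by (simp add: not_le)
      ultimately show ?thesis by simp
    qed
    then have "summable (\<lambda>j. (cmod (p j))\<^sup>2)" by (intro summableI_nonneg_bounded) auto
    then show False using ns by simp
  qed
  moreover have "mono (\<lambda>n. \<Sum>j\<le>n. (cmod (p j))\<^sup>2)" by (intro monoI sum_mono2) auto
  ultimately have "filterlim (\<lambda>n. \<Sum>j\<le>n. (cmod (p j))\<^sup>2) at_top sequentially"
    unfolding filterlim_at_top eventually_sequentially
  proof (intro allI)
    fix Z :: real
    assume ex: "\<And>Z. \<exists>n. Z \<le> (\<Sum>j\<le>n. (cmod (p j))\<^sup>2)" and mo: "mono (\<lambda>n. \<Sum>j\<le>n. (cmod (p j))\<^sup>2)"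
    obtain n where n: "Z \<le> (\<Sum>j\<le>n. (cmod (p j))\<^sup>2)" using ex by blast
    have "Z \<le> (\<Sum>j\<le>n'. (cmod (p j))\<^sup>2)" if "n \<le> n'" for n' using n monoD[OF mo that] by simp
    then show "\<exists>k. \<forall>n\<ge>k. Z \<le> (\<Sum>j\<le>n. (cmod (p j))\<^sup>2)" by blast
  qed
  then show ?thesis unfolding p_def .
qed

text \<open>With \<open>weyl_m\<close> as well as with \<open>stieltjes \<mu> z\<close> as
  coefficient of \<open>orthP\<close>, the combination with \<open>orthQ\<close> has square sums up
  to \<open>n\<close> bounded independently of \<open>n\<close>. So the squared difference of the
  two coefficients times the divergent square sum of \<open>orthP\<close> stays bounded.\<close>

lemma weyl_limit:
  assumes a: "\<And>n. a n > 0" and \<zeta>: "Im \<zeta> < 0" and carl: "\<not> summable (\<lambda>n. 1 / a n)" and o: "orthonormalizing_measure a b \<mu>" and z: "Im z > 0"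
  shows "(\<lambda>n. weyl_m a b \<zeta> n z) \<longlonglongrightarrow> stieltjes \<mu> z"
proof -
  define p where "p = (\<lambda>j. orthP a b j z)"
  define q where "q = (\<lambda>j. orthQ a b j z)"
  define m where "m = stieltjes \<mu> z"
  define S where "S n = (\<Sum>j\<le>n. (cmod (p j))\<^sup>2)" for n
  have S: "filterlim S at_top sequentially" unfolding S_def p_def by (rule sum_sq_orthP_unbounded[OF a carl o z])
  have c: "(\<Sum>j\<le>n. (cmod (m * p j + q j))\<^sup>2) \<le> 2 / (Im z)\<^sup>2" for n
    using stieltjes_orth(2)[where a=a and b=b and \<mu>=\<mu> and z=z and n=n, OF a o z]
    unfolding stieltjes_orth(1)[where a=a and b=b and \<mu>=\<mu> and z=z, OF a o z] by (simp add: p_def q_def m_def)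
  have bd: "(cmod (weyl_m a b \<zeta> n z - m))\<^sup>2 * S n \<le> 6 / (Im z)\<^sup>2" for n
  proof -
    define v where "v = weyl_m a b \<zeta> n z"
    have vb: "(\<Sum>j\<le>n. (cmod (v * p j + q j))\<^sup>2) \<le> 1 / (Im z)\<^sup>2"
      using weyl_m_bounds(2)[where a=a and b=b and n=n and z=z and \<zeta>=\<zeta>, OF a \<zeta> z] by (simp add: p_def q_def v_def)
    have t: "(cmod (v - m))\<^sup>2 * (cmod (p j))\<^sup>2 \<le> 2 * (cmod (v * p j + q j))\<^sup>2 + 2 * (cmod (m * p j + q j))\<^sup>2" for j
    proof -
      have eq: "(v - m) * p j = (v * p j + q j) - (m * p j + q j)" by (simp add: algebra_simps)
      have "(cmod (v - m))\<^sup>2 * (cmod (p j))\<^sup>2 = (cmod ((v - m) * p j))\<^sup>2" by (simp add: norm_mult power_mult_distrib)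
      also have "\<dots> \<le> (cmod (v * p j + q j) + cmod (m * p j + q j))\<^sup>2"
        unfolding eq by (intro power_mono norm_triangle_ineq4) simp
      also have "\<dots> \<le> 2 * (cmod (v * p j + q j))\<^sup>2 + 2 * (cmod (m * p j + q j))\<^sup>2"
        using sum_squares_bound[of "cmod (v * p j + q j)" "cmod (m * p j + q j)"] by (simp add: power2_sum)
      finally show ?thesis .
    qed
    have "(cmod (v - m))\<^sup>2 * S n = (\<Sum>j\<le>n. (cmod (v - m))\<^sup>2 * (cmod (p j))\<^sup>2)" by (simp add: S_def sum_distrib_left)
    also have "\<dots> \<le> (\<Sum>j\<le>n. 2 * (cmod (v * p j + q j))\<^sup>2 + 2 * (cmod (m * p j + q j))\<^sup>2)" by (intro sum_mono t)
    also have "\<dots> = 2 * (\<Sum>j\<le>n. (cmod (v * p j + q j))\<^sup>2) + 2 * (\<Sum>j\<le>n. (cmod (m * p j + q j))\<^sup>2)"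
      by (simp add: sum.distrib sum_distrib_left)
    also have "\<dots> \<le> 6 / (Im z)\<^sup>2" using vb c[of n] by simp
    finally show ?thesis unfolding v_def .
  qed
  have "(\<lambda>n. (cmod (weyl_m a b \<zeta> n z - m))\<^sup>2) \<longlonglongrightarrow> 0"
  proof (rule tendsto_sandwich[of "\<lambda>_. 0"])
    show "\<forall>\<^sub>F n in sequentially. (cmod (weyl_m a b \<zeta> n z - m))\<^sup>2 \<le> (6 / (Im z)\<^sup>2) / S n"
      using filterlim_at_top_dense[THEN iffD1, OF S, rule_format, of 0]
      by eventually_elim (use bd in \<open>simp add: pos_le_divide_eq del: divide_divide_eq_left\<close>)
    show "(\<lambda>n. (6 / (Im z)\<^sup>2) / S n) \<longlonglongrightarrow> 0"
      by (rule tendsto_divide_0[OF tendsto_const]) (rule filterlim_at_top_imp_at_infinity[OF S])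
  qed auto
  then have "(\<lambda>n. weyl_m a b \<zeta> n z - m) \<longlonglongrightarrow> 0" by (simp add: tendsto_norm_zero_iff)
  then show ?thesis unfolding m_def by (simp add: LIM_zero_iff)
qed

text \<open>Mass might escape to infinity, but the Poisson kernel is small there; a common bound on
  the masses and locally uniform convergence therefore suffice. The limit inherits the mass bound by
  Fatou's lemma.\<close>

lemma poisson_limit:
  fixes r :: "nat \<Rightarrow> real \<Rightarrow> real" and r0 :: "real \<Rightarrow> real"
  assumes rm [measurable]: "\<And>k. r k \<in> borel_measurable borel" "r0 \<in> borel_measurable borel"
    and r0: "\<And>k x. r k x \<ge> 0" "\<And>x. r0 x \<ge> 0" and mass: "\<And>k. (\<integral>\<^sup>+x. r k x \<partial>lborel) \<le> ennreal pi"
    and lim: "\<And>C. compact C \<Longrightarrow> uniform_limit C r r0 sequentially"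
  shows "(\<integral>\<^sup>+x. r0 x \<partial>lborel) \<le> ennreal pi"
    and "t > 0 \<Longrightarrow> (\<lambda>k. \<integral>x. r k x * (t / ((x - s)\<^sup>2 + t\<^sup>2)) \<partial>lborel) \<longlonglongrightarrow> (\<integral>x. r0 x * (t / ((x - s)\<^sup>2 + t\<^sup>2)) \<partial>lborel)"
proof -
  have pt: "(\<lambda>k. r k x) \<longlonglongrightarrow> r0 x" for x using tendsto_uniform_limitI[OF lim[of "{x}"], of x] by simp
  have "(\<integral>\<^sup>+x. r0 x \<partial>lborel) = (\<integral>\<^sup>+x. liminf (\<lambda>k. ennreal (r k x)) \<partial>lborel)"
    by (intro nn_integral_cong lim_imp_Liminf[symmetric] tendsto_ennrealI pt) simp
  also have "\<dots> \<le> liminf (\<lambda>k. \<integral>\<^sup>+x. r k x \<partial>lborel)" by (rule nn_integral_liminf) measurable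
  also have "\<dots> \<le> liminf (\<lambda>k::nat. ennreal pi)" by (intro Liminf_mono always_eventually allI mass)
  also have "\<dots> = ennreal pi" by (rule Liminf_const) simp
  finally show m0: "(\<integral>\<^sup>+x. r0 x \<partial>lborel) \<le> ennreal pi" .
  have int: "integrable lborel f" "(\<integral>x. f x \<partial>lborel) \<le> pi"
    if "f \<in> borel_measurable borel" "\<And>x. f x \<ge> 0" "(\<integral>\<^sup>+x. f x \<partial>lborel) \<le> ennreal pi" for f :: "real \<Rightarrow> real"
  proof -
    show i: "integrable lborel f" using that by (intro integrableI_bounded) (auto simp: order.strict_trans1[OF that(3)])
    have "ennreal (\<integral>x. f x \<partial>lborel) \<le> ennreal pi" using nn_integral_eq_integral[OF i] that by simp
    then show "(\<integral>x. f x \<partial>lborel) \<le> pi" by (simp add: ennreal_le_iff)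
  qed
  note ik = int[OF rm(1) r0(1) mass] and i0 = int[OF rm(2) r0(2) m0]
  assume t: "t > 0"
  define p where "p x = t / ((x - s)\<^sup>2 + t\<^sup>2)" for x
  have pp: "p x \<ge> 0" for x using t by (simp add: p_def)
  have pm [measurable]: "p \<in> borel_measurable borel" unfolding p_def[abs_def] by measurable
  have pb: "p x \<le> 1 / t" for x
  proof -
    have "p x \<le> t / t\<^sup>2" unfolding p_def using t by (intro divide_left_mono) (auto intro!: add_nonneg_pos mult_pos_pos)
    then show ?thesis using t by (simp add: power2_eq_square)
  qed
  have ip: "integrable lborel p" "(\<integral>x. p x \<partial>lborel) = pi"
  proof -
    note h = halfplane_poisson[where m="\<lambda>_. 1" and B=1 and w="Complex s t"]
    have "integrable lborel (\<lambda>x. complex_of_real (p x))" "(\<integral>x. complex_of_real (p x) \<partial>lborel) = pi"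
      using h t by (auto simp: p_def)
    then show "integrable lborel p" "(\<integral>x. p x \<partial>lborel) = pi" by (auto simp: complex_of_real_integrable_eq)
  qed
  have irp: "integrable lborel (\<lambda>x. f x * p x)" if "integrable lborel f" for f :: "real \<Rightarrow> real"
  proof (rule Bochner_Integration.integrable_bound[OF integrable_mult_right[OF that, of "1 / t"]])
    show "AE x in lborel. norm (f x * p x) \<le> norm (1 / t * f x)"
    proof (rule AE_I2)
      fix x
      have "\<bar>f x\<bar> * \<bar>p x\<bar> \<le> \<bar>f x\<bar> * (1 / t)" using pb[of x] pp[of x] by (intro mult_left_mono) auto
      then show "norm (f x * p x) \<le> norm (1 / t * f x)" using t by (simp add: abs_mult mult.commute)
    qed
    show "(\<lambda>x. f x * p x) \<in> borel_measurable lborel" using borel_measurable_integrable[OF that] by measurable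
  qed
  show "(\<lambda>k. \<integral>x. r k x * (t / ((x - s)\<^sup>2 + t\<^sup>2)) \<partial>lborel) \<longlonglongrightarrow> (\<integral>x. r0 x * (t / ((x - s)\<^sup>2 + t\<^sup>2)) \<partial>lborel)"
    unfolding p_def[symmetric]
  proof (rule LIMSEQ_I)
    fix e :: real assume e: "e > 0"
    \<comment> \<open>The estimate collects three portions \<open>\<epsilon> * pi\<close>, one from
      the compact interval and two from the tails; the 4 leaves a strict margin.\<close>
    define \<epsilon> where "\<epsilon> = e / (4 * pi)"
    have \<epsilon>: "\<epsilon> > 0" using e by (simp add: \<epsilon>_def)
    define R where "R = t / \<epsilon> + 1"
    have R1: "R \<ge> 1" using \<epsilon> t by (simp add: R_def)
    have tail: "p x \<le> \<epsilon>" if "\<bar>x - s\<bar> > R" for x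
    proof -
      have "t / \<epsilon> \<le> R" by (simp add: R_def)
      also have "R \<le> R\<^sup>2" using R1 by (simp add: self_le_power)
      also have "R\<^sup>2 \<le> (x - s)\<^sup>2" using power_mono[of R "\<bar>x - s\<bar>" 2] that R1 by simp
      finally have "t \<le> \<epsilon> * (x - s)\<^sup>2" using \<epsilon> by (simp add: pos_divide_le_eq mult.commute)
      also have "\<dots> \<le> \<epsilon> * ((x - s)\<^sup>2 + t\<^sup>2)" using \<epsilon> by simp
      finally show ?thesis unfolding p_def using t by (simp add: pos_divide_le_eq add_nonneg_pos)
    qed
    have "uniform_limit {s - R..s + R} r r0 sequentially" by (rule lim) simp
    from uniform_limitD[OF this \<epsilon>] obtain K where K: "\<And>k x. k \<ge> K \<Longrightarrow> x \<in> {s - R..s + R} \<Longrightarrow> dist (r k x) (r0 x) < \<epsilon>"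
      unfolding eventually_sequentially by blast
    have "norm ((\<integral>x. r k x * p x \<partial>lborel) - (\<integral>x. r0 x * p x \<partial>lborel)) < e" if k: "k \<ge> K" for k
    proof -
      have "(\<integral>x. r k x * p x \<partial>lborel) - (\<integral>x. r0 x * p x \<partial>lborel) = (\<integral>x. r k x * p x - r0 x * p x \<partial>lborel)"
        by (rule Bochner_Integration.integral_diff[symmetric, OF irp[OF ik(1)] irp[OF i0(1)]])
      also have "norm \<dots> \<le> (\<integral>x. norm (r k x * p x - r0 x * p x) \<partial>lborel)" by (rule integral_norm_bound)
      also have "\<dots> \<le> (\<integral>x. \<epsilon> * p x + \<epsilon> * (r k x + r0 x) \<partial>lborel)"
      proof (rule integral_mono)
        show "integrable lborel (\<lambda>x. norm (r k x * p x - r0 x * p x))" by (intro integrable_norm Bochner_Integration.integrable_diff irp ik i0)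
        show "integrable lborel (\<lambda>x. \<epsilon> * p x + \<epsilon> * (r k x + r0 x))" by (intro Bochner_Integration.integrable_add integrable_mult_right ip ik i0)
        fix x
        have eq: "norm (r k x * p x - r0 x * p x) = \<bar>r k x - r0 x\<bar> * p x"
          using pp[of x] by (simp add: abs_mult left_diff_distrib[symmetric])
        show "norm (r k x * p x - r0 x * p x) \<le> \<epsilon> * p x + \<epsilon> * (r k x + r0 x)"
        proof (cases "\<bar>x - s\<bar> \<le> R")
          case True
          then have "\<bar>r k x - r0 x\<bar> < \<epsilon>" using K[OF k, of x] by (auto simp: dist_real_def abs_le_iff)
          then have "\<bar>r k x - r0 x\<bar> * p x \<le> \<epsilon> * p x" using pp[of x] by (intro mult_right_mono) auto
          moreover have "\<epsilon> * (r k x + r0 x) \<ge> 0" using \<epsilon> r0 by simp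
          ultimately show ?thesis unfolding eq by linarith
        next
          case False
          then have "\<bar>r k x - r0 x\<bar> * p x \<le> (r k x + r0 x) * \<epsilon>" using tail[of x] pp[of x] r0(1)[of k x] r0(2)[of x] by (intro mult_mono) auto
          moreover have "\<epsilon> * p x \<ge> 0" using \<epsilon> pp by simp
          ultimately show ?thesis unfolding eq by (simp add: mult.commute)
        qed
      qed
      also have "\<dots> = \<epsilon> * pi + \<epsilon> * ((\<integral>x. r k x \<partial>lborel) + (\<integral>x. r0 x \<partial>lborel))"
        using ip ik(1)[of k] i0(1) by simp
      also have "\<dots> \<le> \<epsilon> * pi + \<epsilon> * (pi + pi)" using ik(2)[of k] i0(2) \<epsilon> by (intro add_left_mono mult_left_mono add_mono) auto
      also have "\<dots> < e" using e by (simp add: \<epsilon>_def)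
      finally show ?thesis .
    qed
    then show "\<exists>K. \<forall>k\<ge>K. norm ((\<integral>x. r k x * p x \<partial>lborel) - (\<integral>x. r0 x * p x \<partial>lborel)) < e" by blast
  qed
qed

text \<open>The kernel multiplied by \<open>t\<close> tends to 1 pointwise as \<open>t\<close>
  grows, so decay of the Poisson integrals of order \<open>K / t\<close> bounds the mass by Fatou's
  lemma.\<close>

lemma poisson_mass:
  fixes r :: "real \<Rightarrow> real"
  assumes rm [measurable]: "r \<in> borel_measurable borel" and r0: "\<And>x. r x \<ge> 0"
    and i: "\<And>t. t > 0 \<Longrightarrow> integrable lborel (\<lambda>x. r x * (t / (x\<^sup>2 + t\<^sup>2)))"
    and le: "\<And>t. t > 0 \<Longrightarrow> (\<integral>x. r x * (t / (x\<^sup>2 + t\<^sup>2)) \<partial>lborel) \<le> K / t"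
  shows "(\<integral>\<^sup>+x. r x \<partial>lborel) \<le> ennreal K"
proof -
  define f where "f n x = r x * (((real n + 1)\<^sup>2) / (x\<^sup>2 + (real n + 1)\<^sup>2))" for n x
  have fm [measurable]: "f n \<in> borel_measurable borel" for n unfolding f_def[abs_def] by measurable
  have lim: "(\<lambda>n. f n x) \<longlonglongrightarrow> r x" for x
  proof -
    have "(\<lambda>n. ((real n + 1)\<^sup>2) / (x\<^sup>2 + (real n + 1)\<^sup>2)) \<longlonglongrightarrow> 1" by real_asymp
    from tendsto_mult[OF tendsto_const this, of "r x"] show ?thesis by (simp add: f_def)
  qed
  have b: "(\<integral>\<^sup>+x. f n x \<partial>lborel) \<le> ennreal K" for n
  proof -
    define t where "t = real n + 1"
    have t: "t > 0" by (simp add: t_def)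
    have fe: "f n x = t * (r x * (t / (x\<^sup>2 + t\<^sup>2)))" for x by (simp add: f_def t_def power2_eq_square)
    have "(\<integral>\<^sup>+x. f n x \<partial>lborel) = ennreal (\<integral>x. t * (r x * (t / (x\<^sup>2 + t\<^sup>2))) \<partial>lborel)"
      unfolding fe by (rule nn_integral_eq_integral) (use t r0 in \<open>auto intro!: integrable_mult_right i simp del: times_divide_eq_right\<close>)
    also have "(\<integral>x. t * (r x * (t / (x\<^sup>2 + t\<^sup>2))) \<partial>lborel) = t * (\<integral>x. r x * (t / (x\<^sup>2 + t\<^sup>2)) \<partial>lborel)" by (rule integral_mult_right_zero)
    finally have eq: "(\<integral>\<^sup>+x. f n x \<partial>lborel) = ennreal (t * (\<integral>x. r x * (t / (x\<^sup>2 + t\<^sup>2)) \<partial>lborel))" .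
    have "t * (\<integral>x. r x * (t / (x\<^sup>2 + t\<^sup>2)) \<partial>lborel) \<le> t * (K / t)" using le[OF t] t by (intro mult_left_mono) auto
    also have "\<dots> = K" using t by simp
    finally show ?thesis unfolding eq by (rule ennreal_leI)
  qed
  have "(\<integral>\<^sup>+x. r x \<partial>lborel) = (\<integral>\<^sup>+x. liminf (\<lambda>n. ennreal (f n x)) \<partial>lborel)"
    by (intro nn_integral_cong lim_imp_Liminf[symmetric] tendsto_ennrealI lim) simp
  also have "\<dots> \<le> liminf (\<lambda>n. \<integral>\<^sup>+x. f n x \<partial>lborel)" by (rule nn_integral_liminf) measurable
  also have "\<dots> \<le> liminf (\<lambda>n::nat. ennreal K)" by (intro Liminf_mono always_eventually allI b)
  also have "\<dots> = ennreal K" by (rule Liminf_const) simp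
  finally show ?thesis .
qed

section \<open>The density of the orthogonality measure and the constants\<close>

context modulated_jacobi
begin

lemma zP_weyl: "weyl_den a b zeta (sk k) (of_real x) = zP k x"
  unfolding weyl_den_def zP_def zk_def orthP_of_real ..

text \<open>By \<open>rk_eq\<close> this density contains exactly the amplitude of \<open>zP\<close>
  whose limit is \<open>gp\<close>; this is the reason for taking \<open>zeta\<close> as the
  boundary value and the starts of the blocks as truncation points.\<close>

definition rk :: "nat \<Rightarrow> real \<Rightarrow> real" where "rk k x = Im (weyl_m a b zeta (sk k) (of_real x))"

lemma rk_eq: "rk k x = - Im zeta / (A k * (cmod (zP k x))\<^sup>2)"
  unfolding rk_def weyl_m_Im_real[where a=a and b=b, OF a_pos Im_zeta] zP_weyl A_def ..

lemma A_pos': "A k > 0" by (simp add: A_def a_pos)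

lemma rk_nonneg: "rk k x \<ge> 0"
  unfolding rk_eq using Im_zeta less_imp_le[OF A_pos'[of k]] by (intro divide_nonneg_nonneg mult_nonneg_nonneg) auto

lemma rk_limit:
  assumes "compact C"
  shows "uniform_limit C rk (\<lambda>x. - Im (tau x)) sequentially"
proof -
  obtain c where c: "c > 0" "\<And>x. x \<in> C \<Longrightarrow> c \<le> gp x" using gp_limit(2)[OF assms] by blast
  obtain B where B: "\<And>x. x \<in> C \<Longrightarrow> gp x \<le> B" using gp_limit(3)[OF assms] by blast
  have "uniform_limit C (\<lambda>k x. (- Im zeta) / (A k * (cmod (zP k x))\<^sup>2)) (\<lambda>x. (- Im zeta) / gp x) sequentially"
  proof (rule uniform_lim_divide)
    show "uniform_limit C (\<lambda>k x. A k * (cmod (zP k x))\<^sup>2) gp sequentially" by (rule gp_limit(1)[OF assms])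
    show "uniform_limit C (\<lambda>k x. - Im zeta) (\<lambda>x. - Im zeta) sequentially" by (rule uniform_limit_const)
    show "bounded ((\<lambda>x. - Im zeta) ` C)" by (rule bounded_subset[of "{- Im zeta}"]) auto
    show "c \<le> norm (gp x)" if "x \<in> C" for x using c(2)[OF that] by simp
  qed (use c in auto)
  then show ?thesis unfolding rk_eq[abs_def] Im_tau by simp
qed

lemma rk_poisson:
  assumes t: "t > 0"
  shows "integrable lborel (\<lambda>x. rk k x * (t / ((x - s)\<^sup>2 + t\<^sup>2)))"
    and "(\<integral>x. rk k x * (t / ((x - s)\<^sup>2 + t\<^sup>2)) \<partial>lborel) = pi * Im (weyl_m a b zeta (sk k) (Complex s t))"
proof -
  obtain B where B: "\<And>z. Im z \<ge> 0 \<Longrightarrow> cmod (weyl_m a b zeta (sk k) z) \<le> B" using weyl_m_regular(3)[where a=a and b=b, OF a_pos Im_zeta] by blast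
  define g where "g x = weyl_m a b zeta (sk k) (of_real x) * complex_of_real (t / ((x - s)\<^sup>2 + t\<^sup>2))" for x
  note h = halfplane_poisson[OF weyl_m_regular(1)[where a=a and b=b, OF a_pos Im_zeta] weyl_m_regular(2)[where a=a and b=b, OF a_pos Im_zeta] B, of "Complex s t"]
  have g: "integrable lborel g" "integral\<^sup>L lborel g = pi * weyl_m a b zeta (sk k) (Complex s t)"
    unfolding g_def[abs_def] using h t by (simp_all only: complex.sel)
  have e: "Im (g x) = rk k x * (t / ((x - s)\<^sup>2 + t\<^sup>2))" for x
    by (simp only: g_def rk_def complex.sel Im_complex_of_real Re_complex_of_real mult_zero_right add_0 times_complex.sel)
  show "integrable lborel (\<lambda>x. rk k x * (t / ((x - s)\<^sup>2 + t\<^sup>2)))" using integrable_Im[OF g(1)] unfolding e by simp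
  show "(\<integral>x. rk k x * (t / ((x - s)\<^sup>2 + t\<^sup>2)) \<partial>lborel) = pi * Im (weyl_m a b zeta (sk k) (Complex s t))"
    using integral_Im[OF g(1)] unfolding e g(2) by simp
qed

lemma continuous_Im_tau: "continuous_on UNIV (\<lambda>x. - Im (tau x))"
  unfolding Im_tau using less_imp_neq[OF gp_pos] by (intro continuous_intros continuous_gp) metis

lemma rk_measurable: "rk k \<in> borel_measurable borel"
proof (rule borel_measurable_continuous_onI)
  have "continuous_on UNIV (\<lambda>x. weyl_m a b zeta (sk k) (complex_of_real x))"
    by (rule continuous_on_compose2[OF weyl_m_regular(1)[where a=a and b=b, OF a_pos Im_zeta]]) (auto intro!: continuous_intros)
  then show "continuous_on UNIV (rk k)" unfolding rk_def[abs_def] by (intro continuous_intros)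
qed

lemma rk_mass: "(\<integral>\<^sup>+x. rk k x \<partial>lborel) \<le> ennreal pi"
proof (rule poisson_mass[OF rk_measurable rk_nonneg])
  fix t :: real assume t: "t > 0"
  show "integrable lborel (\<lambda>x. rk k x * (t / (x\<^sup>2 + t\<^sup>2)))" using rk_poisson(1)[OF t, of k 0] by simp
  have "(\<integral>x. rk k x * (t / (x\<^sup>2 + t\<^sup>2)) \<partial>lborel) = pi * Im (weyl_m a b zeta (sk k) (Complex 0 t))" using rk_poisson(2)[OF t, of k 0] by simp
  also have "\<dots> \<le> pi * (1 / t)"
  proof (intro mult_left_mono)
    have "Im (weyl_m a b zeta (sk k) (Complex 0 t)) \<le> cmod (weyl_m a b zeta (sk k) (Complex 0 t))" using abs_Im_le_cmod[of "weyl_m a b zeta (sk k) (Complex 0 t)"] by linarith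
    also have "\<dots> \<le> 1 / Im (Complex 0 t)" by (rule weyl_m_bounds(1)[OF a_pos Im_zeta]) (use t in simp)
    finally show "Im (weyl_m a b zeta (sk k) (Complex 0 t)) \<le> 1 / t" by simp
  qed simp
  finally show "(\<integral>x. rk k x * (t / (x\<^sup>2 + t\<^sup>2)) \<partial>lborel) \<le> pi / t" by simp
qed

text \<open>The Poisson integrals of \<open>rk k\<close> converge in two ways: by the locally
  uniform limit of the densities, and by \<open>weyl_limit\<close> along the subsequence
  \<open>sk\<close>. Comparing the limits identifies \<open>\<mu>\<close> through
  \<open>poisson_unique\<close>.\<close>

theorem orthogonality_density:
  assumes o: "orthonormalizing_measure a b \<mu>"
  shows "\<mu> = density lborel (\<lambda>x. ennreal (- Im (tau x) / pi))"
proof -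
  define r0 where "r0 = (\<lambda>x. - Im (tau x))"
  have r0m [measurable]: "r0 \<in> borel_measurable borel" unfolding r0_def by (rule borel_measurable_continuous_onI[OF continuous_Im_tau])
  have r0p: "r0 x \<ge> 0" for x using Im_tau_neg[of x] by (simp add: r0_def)
  have lim: "compact C \<Longrightarrow> uniform_limit C rk r0 sequentially" for C unfolding r0_def by (rule rk_limit)
  have pl1: "(\<integral>\<^sup>+x. ennreal (r0 x) \<partial>lborel) \<le> ennreal pi"
    by (rule poisson_limit(1)[OF rk_measurable r0m rk_nonneg r0p rk_mass lim])
  have pl2: "(\<lambda>k. \<integral>x. rk k x * (t / ((x - s)\<^sup>2 + t\<^sup>2)) \<partial>lborel) \<longlonglongrightarrow> (\<integral>x. r0 x * (t / ((x - s)\<^sup>2 + t\<^sup>2)) \<partial>lborel)" if "t > 0" for s t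
    by (rule poisson_limit(2)[OF rk_measurable r0m rk_nonneg r0p rk_mass lim that])
  define M2 where "M2 = density lborel (\<lambda>x. ennreal (r0 x / pi))"
  have N0: "0 < N" using N_eq by simp
  have skinf: "filterlim sk sequentially sequentially"
    by (intro filterlim_subseq) (simp add: strict_mono_Suc_iff sk_Suc N0)
  have "\<mu> = M2"
  proof (rule poisson_unique[OF orth_integrals(1)[OF o]])
    have "emeasure M2 (space M2) = (\<integral>\<^sup>+x. ennreal (r0 x / pi) \<partial>lborel)" by (simp add: M2_def emeasure_density)
    also have "\<dots> = (\<integral>\<^sup>+x. ennreal (r0 x) * ennreal (1 / pi) \<partial>lborel)"
      by (intro nn_integral_cong) (simp add: ennreal_mult[symmetric] r0p)
    also have "\<dots> = (\<integral>\<^sup>+x. ennreal (r0 x) \<partial>lborel) * ennreal (1 / pi)" by (rule nn_integral_multc) measurable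
    finally have eq: "emeasure M2 (space M2) = (\<integral>\<^sup>+x. ennreal (r0 x) \<partial>lborel) * ennreal (1 / pi)" .
    have "(\<integral>\<^sup>+x. ennreal (r0 x) \<partial>lborel) \<noteq> \<top>" using neq_top_trans[OF _ pl1] by simp
    then have "emeasure M2 (space M2) \<noteq> \<infinity>" unfolding eq by (simp add: ennreal_mult_eq_top_iff)
    then show "finite_measure M2" by (rule finite_measureI)
    show "sets M2 = sets borel" by (simp add: M2_def)
    fix s t :: real assume t: "t > 0"
    have "(\<lambda>k. pi * Im (weyl_m a b zeta (sk k) (Complex s t))) \<longlonglongrightarrow> pi * Im (stieltjes \<mu> (Complex s t))"
      by (intro tendsto_intros filterlim_compose[OF weyl_limit[OF a_pos Im_zeta carleman o] skinf]) (use t in simp)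
    then have "(\<lambda>k. \<integral>x. rk k x * (t / ((x - s)\<^sup>2 + t\<^sup>2)) \<partial>lborel) \<longlonglongrightarrow> pi * Im (stieltjes \<mu> (Complex s t))"
      unfolding rk_poisson(2)[OF t] .
    then have eq: "(\<integral>x. r0 x * (t / ((x - s)\<^sup>2 + t\<^sup>2)) \<partial>lborel) = pi * Im (stieltjes \<mu> (Complex s t))"
      by (rule LIMSEQ_unique[OF pl2[OF t, of s]])
    have "(\<integral>x. t / ((x - s)\<^sup>2 + t\<^sup>2) \<partial>\<mu>) = Im (stieltjes \<mu> (Complex s t))"
      using stieltjes_orth(3)[where a=a and b=b and \<mu>=\<mu> and z="Complex s t", OF a_pos o] t by simp
    also have "\<dots> = (\<integral>x. r0 x * (t / ((x - s)\<^sup>2 + t\<^sup>2)) \<partial>lborel) / pi" unfolding eq by simp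
    finally have e1: "(\<integral>x. t / ((x - s)\<^sup>2 + t\<^sup>2) \<partial>\<mu>) = (\<integral>x. r0 x * (t / ((x - s)\<^sup>2 + t\<^sup>2)) \<partial>lborel) / pi" .
    have e2: "(\<integral>x. t / ((x - s)\<^sup>2 + t\<^sup>2) \<partial>M2) = (\<integral>x. (r0 x / pi) *\<^sub>R (t / ((x - s)\<^sup>2 + t\<^sup>2)) \<partial>lborel)"
      unfolding M2_def
    proof (rule integral_density[where g="\<lambda>x. r0 x / pi" and f="\<lambda>x. t / ((x - s)\<^sup>2 + t\<^sup>2)" and M=lborel])
      show "AE x in lborel. 0 \<le> r0 x / pi" by (rule AE_I2) (use r0p in simp)
    qed measurable
    have e3: "(r0 x / pi) *\<^sub>R (t / ((x - s)\<^sup>2 + t\<^sup>2)) = r0 x * (t / ((x - s)\<^sup>2 + t\<^sup>2)) / pi" for x by simp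
    show "(\<integral>x. t / ((x - s)\<^sup>2 + t\<^sup>2) \<partial>\<mu>) = (\<integral>x. t / ((x - s)\<^sup>2 + t\<^sup>2) \<partial>M2)"
      unfolding e1 e2 e3 by (rule integral_divide_zero[symmetric])
  qed
  then show ?thesis by (simp add: M2_def r0_def)
qed

text \<open>The summand with index \<open>i\<close> equals \<open>q * (Im zeta)^2\<close> times the
  squared modulus of \<open>gam i\<close>, so \<open>Gam\<close> is the derivative of the trace at 0
  up to an explicit factor. The right-hand side is the modulus of \<open>Th'\<close> at 0, whence
  \<open>kap\<close> is \<open>pi\<close> times the equilibrium density at 0.\<close>

lemma kap_eq:
  fixes p q r s t :: real
  defines "p \<equiv> cl N" and "q \<equiv> dl N" and "r \<equiv> cl (Suc N)" and "s \<equiv> dl (Suc N)"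
  assumes t: "\<alpha> (-1) * t = (\<Sum>i<N. q * (cl (Suc i))\<^sup>2 + (s - p) * (cl (Suc i) * dl (Suc i)) - r * (dl (Suc i))\<^sup>2)"
  shows "real N * kap = \<bar>t\<bar> / sqrt (4 - (p + s)\<^sup>2)"
proof -
  define D where "D = 4 - (p + s)\<^sup>2"
  have D: "D > 0" using disc_pos by (simp add: D_def p_def s_def)
  have q: "q \<noteq> 0" using dl_nz by (simp add: q_def)
  have Iz: "Im zeta = - (sqrt D / (2 * \<bar>q\<bar>))" by (simp add: zeta_def D_def p_def q_def s_def)
  have Rz: "Re zeta = (s - p) / (2 * q)" by (simp add: zeta_def p_def q_def s_def)
  have nz: "(Re zeta)\<^sup>2 + (Im zeta)\<^sup>2 = - r / q" using norm_zeta by (simp add: cmod_power2 q_def r_def)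
  have g: "q * (Im zeta)\<^sup>2 * (cmod (gam i))\<^sup>2 = q * (cl (Suc i))\<^sup>2 + (s - p) * (cl (Suc i) * dl (Suc i)) - r * (dl (Suc i))\<^sup>2" for i
  proof -
    define c d where "c = cl (Suc i)" "d = dl (Suc i)"
    have "(Im zeta)\<^sup>2 * (cmod (gam i))\<^sup>2 = (Im zeta)\<^sup>2 * d\<^sup>2 + (c + d * Re zeta)\<^sup>2"
      using Im_zeta by (simp add: gam_def cmod_power2 power_divide c_d_def distrib_left)
    also have "\<dots> = ((Re zeta)\<^sup>2 + (Im zeta)\<^sup>2) * d\<^sup>2 + c\<^sup>2 + 2 * c * d * Re zeta" by (simp add: power2_eq_square algebra_simps)
    also have "\<dots> = - r / q * d\<^sup>2 + c\<^sup>2 + 2 * c * d * ((s - p) / (2 * q))" unfolding nz unfolding Rz ..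
    finally have e: "(Im zeta)\<^sup>2 * (cmod (gam i))\<^sup>2 = - r / q * d\<^sup>2 + c\<^sup>2 + 2 * c * d * ((s - p) / (2 * q))" .
    show ?thesis unfolding mult.assoc e using q by (simp add: c_d_def[symmetric] field_simps)
  qed
  have G: "q * (Im zeta)\<^sup>2 * Gam = \<alpha> (-1) * t" unfolding t Gam_def sum_distrib_left g ..
  have I2: "(Im zeta)\<^sup>2 = D / (4 * q\<^sup>2)" unfolding Iz using D by (simp add: power_divide power_mult_distrib)
  have al: "\<alpha> (-1) > 0" by simp
  have G': "Gam = 4 * q * \<alpha> (-1) * t / D"
    using G q D unfolding I2 by (simp add: field_simps power2_eq_square)
  have N0: "real N > 0" using N_eq by simp
  have "real N * kap = sqrt D / (2 * \<bar>q\<bar>) * Gam / (2 * \<alpha> (-1))" unfolding kap_def Iz using N0 by simp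
  also have "\<dots> = sqrt D / D * (q / \<bar>q\<bar> * t)" unfolding G' using al by (simp add: field_simps)
  also have "sqrt D / D = 1 / sqrt D" using D by (simp add: real_div_sqrt field_simps)
  finally have e: "real N * kap = (q / \<bar>q\<bar> * t) / sqrt D" by simp
  \<comment> \<open>The sign of \<open>q\<close> is unknown; positivity of \<open>kap\<close>
    permits the passage to absolute values.\<close>
  have "kap \<ge> 0" unfolding kap_def
    using less_imp_le[OF Im_zeta] less_imp_le[OF al] less_imp_le[OF Gam_pos] by (intro divide_nonneg_nonneg mult_nonneg_nonneg) auto
  then have "real N * kap \<ge> 0" by simp
  then have "real N * kap = \<bar>real N * kap\<bar>" by simp
  also have "\<dots> = \<bar>(q / \<bar>q\<bar> * t) / sqrt D\<bar>" unfolding e ..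
  also have "\<dots> = \<bar>t\<bar> / sqrt D" using q D by (simp add: abs_mult abs_divide)
  finally show ?thesis unfolding D_def .
qed

lemma density_value:
  assumes "orthonormalizing_measure a b \<mu>"
  shows "cont_density_on UNIV \<mu> x = - Im (tau x) / pi"
proof (rule cont_density_on_eq)
  have m: "(\<lambda>x. - Im (tau x)) \<in> borel_measurable borel" by (rule borel_measurable_continuous_onI[OF continuous_Im_tau])
  have "emeasure \<mu> A = (\<integral>\<^sup>+x. ennreal (- Im (tau x) / pi) * indicator A x \<partial>lborel)" if "A \<in> sets borel" for A
    unfolding orthogonality_density[OF assms]
    by (rule emeasure_density) (use that m in \<open>simp_all add: borel_measurable_divide\<close>)
  moreover have "continuous_on UNIV (\<lambda>x. - Im (tau x) / pi)"
    by (intro continuous_on_divide continuous_Im_tau continuous_on_const) simp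
  moreover have "- Im (tau x) / pi \<ge> 0" for x using Im_tau_neg[of x] by (intro divide_nonneg_nonneg) auto
  ultimately show "is_cont_density_on UNIV \<mu> (\<lambda>x. - Im (tau x) / pi)"
    unfolding is_cont_density_on_def by blast
qed auto

end

theorem theorem1p3:
  fixes N :: nat
    and a b :: "nat \<Rightarrow> real"
    and \<alpha> \<beta> :: "int \<Rightarrow> real"
    and \<mu> \<omega> :: "real measure"
    and \<mu>' \<omega>' :: "real \<Rightarrow> real"
    and F :: "real set"
    and \<rho> :: "nat \<Rightarrow> real"
  assumes "N \<ge> 1"
    and "\<And>n. a n > 0"
    and "periodically_modulated N \<alpha> \<beta> a b"
    and "\<And>i. i < N \<Longrightarrow> (\<lambda>k. a (k * N + i - 1) / a (k * N + i)) \<in> class_D1"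
    and "\<And>i. i < N \<Longrightarrow> (\<lambda>k. b (k * N + i) / a (k * N + i)) \<in> class_D1"
    and "\<And>i. i < N \<Longrightarrow> (\<lambda>k. 1 / a (k * N + i)) \<in> class_D1"
    and "\<not> summable (\<lambda>n. 1 / a n)"
    and "\<bar>trace (monodromy N \<alpha> \<beta> 0 0)\<bar> < 2"
    and "orthonormalizing_measure a b \<mu>"
    and "\<mu>' = cont_density_on UNIV \<mu>"
    and "F = {x. \<bar>trace (monodromy N \<alpha> \<beta> 0 x)\<bar> \<le> 2}"
    and "equilibrium_measure F \<omega>"
    and "\<omega>' = cont_density_on (interior F) \<omega>"
    and "\<And>n. \<rho> n = (\<Sum>j\<le>n. \<alpha> (int j) / a j)"
  shows "\<forall>C :: (real \<times> real \<times> real) set. compact C \<longrightarrow>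
    uniform_limit C
      (\<lambda>n (x, u, v). 1 / \<rho> n * CD_kernel a b n (x + u / \<rho> n) (x + v / \<rho> n))
      (\<lambda>(x, u, v). \<omega>' 0 / \<mu>' x * sinc ((u - v) * pi * \<omega>' 0))
      sequentially"
proof (intro allI impI)
  fix C :: "(real \<times> real \<times> real) set" assume C: "compact C"
  obtain M where M: "N = Suc M" using assms(1) by (cases N) auto
  have per: "periodic_jacobi N \<alpha>"
    using assms(1,3) by (auto simp: periodic_jacobi_def periodically_modulated_def periodic_seq_def)
  interpret P: periodic_jacobi N \<alpha> \<beta> by (rule per)
  have Tr: "P.Tr x = per_sol \<alpha> \<beta> 1 0 N x + per_sol \<alpha> \<beta> 0 1 (Suc N) x" for x
    unfolding P.Tr_def P.poly_TP per_gen_real ..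
  have T0: "\<bar>P.Tr 0\<bar> < 2" using assms(8) unfolding P.trace_monodromy .
  interpret J: modulated_jacobi M N a b \<alpha> \<beta>
    by unfold_locales (use M assms(2-7) T0[unfolded Tr] in auto)
  have F: "F = {x. \<bar>P.Tr x\<bar> \<le> 2}" unfolding assms(11) P.trace_monodromy ..
  have N0: "real N > 0" using M by simp
  have \<omega>0: "\<omega>' 0 = J.kap / pi"
  proof -
    have "\<omega>' 0 = \<bar>P.Th' 0\<bar> / (real N * pi)"
      unfolding assms(13) F by (rule P.equilibrium_density[OF assms(12)[unfolded F] T0])
    also have "\<bar>P.Th' 0\<bar> = \<bar>poly (pderiv P.TP) 0\<bar> / sqrt (4 - (P.Tr 0)\<^sup>2)"
      using P.sqrt_pos[of 0] T0 by (simp add: P.Th'_def P.Om_def abs_divide)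
    also have "\<dots> = real N * J.kap"
      unfolding Tr J.cl_def[symmetric] J.dl_def[symmetric]
      by (rule J.kap_eq[symmetric]) (use P.pderiv_TP[of "0::real"] in \<open>simp add: per_gen_real J.cl_def J.dl_def\<close>)
    finally show ?thesis using N0 by simp
  qed
  have \<mu>x: "\<mu>' x = - Im (J.tau x) / pi" for x unfolding assms(10) by (rule J.density_value[OF assms(9)])
  have rho: "\<rho> n = J.rhos (Suc n)" for n
    unfolding assms(14) J.rhos_def J.drho_def lessThan_Suc_atMost ..
  \<comment> \<open>\<open>tau_hh\<close> gives \<open>hh x\<close> as \<open>kap\<close> over
    \<open>- Im (tau x)\<close>; the factors \<open>pi\<close> of the two densities cancel in the
    quotient.\<close>
  have lim: "\<omega>' 0 / \<mu>' x * sinc ((u - v) * pi * \<omega>' 0) = J.hh x * sinc ((u - v) * J.kap)" for x u v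
  proof -
    have "J.hh x = J.kap / (- Im (J.tau x))"
      using J.tau_hh[of x] J.Im_tau_neg[of x] by (simp add: field_simps)
    then show ?thesis unfolding \<omega>0 \<mu>x by simp
  qed
  \<comment> \<open>The universality estimate is uniform over a compact set of points
    \<open>x\<close> and an interval of values \<open>u\<close>, \<open>v\<close>, so
    \<open>C\<close> is enclosed in the product of its first projection and a square.\<close>
  obtain B where B: "\<And>p. p \<in> C \<Longrightarrow> norm p \<le> B" using compact_imp_bounded[OF C] by (auto simp: bounded_iff)
  define V where "V = max B 0"
  have V: "\<bar>u\<bar> \<le> V" "\<bar>v\<bar> \<le> V" if "(x, u, v) \<in> C" for x u v
  proof -
    have "norm (u, v) \<le> norm (x, u, v)" "norm u \<le> norm (u, v)" "norm v \<le> norm (u, v)"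
      by (rule norm_snd_le norm_fst_le)+
    then show "\<bar>u\<bar> \<le> V" "\<bar>v\<bar> \<le> V" using B[OF that] unfolding V_def by auto
  qed
  have Cx: "compact (fst ` C)" by (intro compact_continuous_image C continuous_intros)
  show "uniform_limit C
      (\<lambda>n (x, u, v). 1 / \<rho> n * CD_kernel a b n (x + u / \<rho> n) (x + v / \<rho> n))
      (\<lambda>(x, u, v). \<omega>' 0 / \<mu>' x * sinc ((u - v) * pi * \<omega>' 0))
      sequentially"
  proof (rule uniform_limitI)
    fix e :: real assume e: "e > 0"
    have "V \<ge> 0" by (simp add: V_def)
    from J.universality[OF Cx this e]
    show "\<forall>\<^sub>F n in sequentially. \<forall>p\<in>C. dist
        ((\<lambda>(x, u, v). 1 / \<rho> n * CD_kernel a b n (x + u / \<rho> n) (x + v / \<rho> n)) p)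
        ((\<lambda>(x, u, v). \<omega>' 0 / \<mu>' x * sinc ((u - v) * pi * \<omega>' 0)) p) < e"
    proof eventually_elim
      case (elim n)
      show ?case
      proof (intro ballI)
        fix p assume p: "p \<in> C"
        obtain x u v where xuv: "p = (x, u, v)" by (cases p) auto
        have "x \<in> fst ` C" using p xuv by force
        then show "dist ((\<lambda>(x, u, v). 1 / \<rho> n * CD_kernel a b n (x + u / \<rho> n) (x + v / \<rho> n)) p)
            ((\<lambda>(x, u, v). \<omega>' 0 / \<mu>' x * sinc ((u - v) * pi * \<omega>' 0)) p) < e"
          using elim V[of x u v] p unfolding xuv prod.case lim rho dist_real_def by blast
      qed
    qed
  qed
qed

end
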